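(* Let $\preceq$ be a pair ordering on an arc diagram $\mathcal{Z}$, let $\mathcal{A}=\mathcal{A}(\mathcal{Z})$ be its strand algebra and $\mathcal{H}=H(\mathcal{A})$. Then there is an $A_\infty$ structure $X$ on $\mathcal{H}$, with operations $X_n:\mathcal{H}^{\otimes n}\to\mathcal{H}$, extending the DGA structure of $\mathcal{H}$ (i.e. $X_1=0$ and $X_2$ is multiplication), and a morphism of $A_\infty$ algebras $f:\mathcal{H}\to\mathcal{A}$, with maps $f_n:\mathcal{H}^{\otimes n}\to\mathcal{A}$, extending the cycle selection map $f_1=f^{\preceq}$ (where $\mathcal{A}$ is regarded as an $A_\infty$ algebra with trivial $n$-ary operations for $n\ge 3$), such that the following hold for every tensor product $M=M_1\otimes\cdots\otimes M_n$ of nonzero homology classes of diagrams: (1) if $M$ is not viable then $\overline{f}_n(M)=0$ and $X_n(M)=0$; and if $M$ has an idempotent mismatch then $f_n(M)=0$; (2) all $X_n$ and $f_n$ preserve H-data; $X_n$ has Maslov degree $n-2$ and $f_n$ has Maslov degree $n-1$; (3) for $n\ge2$, $f_n$ is balanced: if $(f_1X_n-U_n)(M)=0$ then $f_n(M)=0$; (4) for $n\ge 2$, whenever $M$ is viable with twisted H-data, $f_n(M)=A^*_{\preceq}\big((f_1X_n-U_n)(M)\big)$. Here $U_n:\mathcal{H}^{\otimes n}\to\mathcal{A}$ is $$U_n(a_1\otimes\cdots\otimes a_n)=\sum_{j=1}^{n-1}f_j(a_1\otimes\cdots\otimes a_j)\,f_{n-j}(a_{j+1}\otimes\cdots\otimes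 a_n)+\sum_{\substack{2\le j\le n-1\\ 0\le k\le n-j}}f_{n-j+1}\big(a_1\otimes\cdots\otimes a_k\otimes X_j(a_{k+1}\otimes\cdots\otimes a_{k+j})\otimes\cdots\otimes a_n\big),$$ and $X_n=[U_n]$ is the homology class of $U_n$.
   Context: All algebra is over $\mathbb{Z}_2$. An arc diagram $\mathcal{Z}=(\mathbf{Z},\mathbf{a},r)$ consists of oriented intervals $\mathbf{Z}=\{Z_1,\dots,Z_l\}$, distinct points $\mathbf{a}=(a_1,\dots,a_{2k})$ (places) in the interiors of the intervals, ordered along them, and a 2-to-1 map $r:\mathbf{a}\to\{1,\dots,k\}$ such that oriented surgery on $\mathbf{Z}$ at all $0$-spheres $r^{-1}(i)$ yields a 1-manifold with no circle components. The fibres $P=\{p,q\}$ of $r$ are the matched pairs, identified with $1,\dots,k$. Let $-\infty_i,+\infty_i$ be the start and end of $Z_i$ and $\mathbf{a}_{\pm\infty}=\mathbf{a}\cup\{\pm\infty_i\}$, partially ordered along the intervals; the places cut the intervals into steps. A strand diagram is a triple $(S,T,\phi)$ with $S,T\subseteq\mathbf{a}_{\pm\infty}$ and $\phi:S\to T$ a bijection with $\phi(x)\ge x$; it is drawn as strands in $[0,1]\times\mathbf{Z}$ from $\{0\}\times S$ to $\{1\}\times T$, meeting efficiently; crossings are inversions ($x<y$ with $\phi(x)>\phi(y)$), counted by $\mathrm{inv}$. The product of $(S,T,\phi)$ and $(U,V,\psi)$ is $(S,V,\psi\phi)$ if $T=U$ and $\mathrm{inv}(\psi\phi)=\mathrm{inv}(\phi)+\mathrm{inv}(\psi)$,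 and $0$ otherwise; $\partial$ is the sum of all resolutions of one crossing which lower the number of crossings by exactly $1$. $I(S)$ is the identity diagram on $S$. For a set $s$ of matched pairs let $I(s)=\sum_S I(S)$, over all $S\subseteq \mathbf{a}_{\pm\infty}$ consisting of exactly one place of each pair in $s$, no other places, and any subset of $\{\pm\infty_i\}$. For $\mu=(S,T,\phi)$ without horizontal strands (fixed points) let $a(\mu)=\sum_U(S\cup U,T\cup U,\phi_U)$ over $U\subseteq\mathbf{a}_{\pm\infty}\setminus(S\cup T)$, $\phi_U$ extending $\phi$ by the identity. A diagram from $s$ to $t$ is a nonzero element $I(s)a(\mu)I(t)$; it is drawn as one picture with dotted horizontal strands at both places $p,q$ of every matched pair carrying a horizontal strand. The (augmented) strand algebra $\mathcal{A}=\mathcal{A}(\mathcal{Z})$ is the DGA with basis the diagrams; $\mathcal{H}=H(\mathcal{A})$, a DGA with zero differential. H-data is a triple $(h,s,t)$ with $h\in H_1(\mathbf{Z},\mathbf{a}_{\pm\infty})$ and $s,t$ sets of matched pairs. A diagram from $s$ to $t$ has H-data $(h,s,t)$, $h=\sum_x[x,\phi(x)]$; $\mathcal{A}(h,s,t)$ is the span of diagrams with this H-data and $\mathcal{H}(h,s,t)$ its homology, so $\mathcal{A}=\bigoplus\mathcal{A}(h,s,t)$, $\mathcal{H}=\bigoplus\mathcal{H}(h,s,t)$. The Maslov grading is $\iota(D)=\mathrm{inv}(\mu)-m(h,S)$ for any term $\mu=(S,T,\phi)$ of $D$, where $m(h,S)$ is the sum over places $a\in S\cap\mathbf{a}$ of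 the average multiplicity of $h$ on the two steps at $a$ (and $m$ is extended linearly to $0$-chains, ignoring $\pm\infty_i$). $h$ (and any H-data or diagram with H-grading $h$) is viable if $h$ has multiplicity $0$ or $1$ on every step. In a viable diagram every crossing involves a horizontal strand, hence lies at a matched pair. A viable diagram is tight if it has no crossings and is nonzero in homology, twisted if it has no crossings and is zero in homology, crossed if it has crossings. Viable H-data is tight (resp. twisted) if some tight (resp. twisted) diagram has that H-data, and singular otherwise. Each $\mathcal{H}(h,s,t)$ is $0$ or $\mathbb{Z}_2$, nonzero exactly for tight $(h,s,t)$, with generator represented by any tight diagram with H-data $(h,s,t)$. A pair $P$ is 11 if $P\in s$ and $P\in t$; it is once occupied at $p$ by $h$ if $h$ covers both steps at $p$ and neither step at the twin $q$; doubly occupied if $h$ covers all four steps at $p,q$. $\mathcal{F}\subset\mathcal{A}$ is the two-sided ideal spanned by diagrams that are non-viable or have a crossing at some doubly occupied pair. $\overline{f}$ denotes the composition of a map $f$ into $\mathcal{A}$ with $\mathcal{A}\to\mathcal{A}/\mathcal{F}$. For classes $M_i$ with H-data $(h_i,s_i,t_i)$, $M=M_1\otimes\cdots\otimes M_n$ has an idempotent mismatch if some $t_i\neq s_{i+1}$; $M$ is viable if it has no mismatch and $\sum h_i$ is viable. Its H-data is $(\sum h_i,s_1,t_n)$ and its Maslov grading is $\sum\iota(M_i)+\sum_{j<k}m(h_k,\partial h_j)$. A map preserves H-data if it sends such $M$ into the $(\sum h_i,s_1,t_n)$ summand. A pair ordering $\preceq$ is a total order on the set of matched pairs together with a total order on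 the two places of each matched pair. $f^{\preceq}:\mathcal{H}\to\mathcal{A}$ is the linear map sending, for each tight $(h,s,t)$, the generator of $\mathcal{H}(h,s,t)$ to the unique tight diagram with H-data $(h,s,t)$ in which, at each 11 doubly occupied pair, strands begin and end at the $\preceq$-smaller place of the pair. The operator $A^*_{\preceq}$ on $\bigoplus_{(h,s,t)\text{ twisted}}\mathcal{A}(h,s,t)$ is defined on diagrams $D\in\mathcal{A}(h,s,t)$ as follows: let $P=\{p,q\}$ be the $\preceq$-smallest 11 once occupied pair, $p$ its occupied place (a twisted $(h,s,t)$ has such a pair). If $D$ has a crossing at $P$, $A^*_{\preceq}D=0$. Otherwise one strand of $D$ ends at $p$ and another begins at $p$; $A^*_{\preceq}D$ is obtained by joining these into a single strand running past $p$ and adding dotted horizontal strands at $p$ and $q$ (i.e. inserting a crossing at $p$). $A_\infty$ conventions: $\sum_{i+j+k=n}X_{i+1+k}(1^{\otimes i}\otimes X_j\otimes 1^{\otimes k})=0$ for all $n\ge 1$; $f$ is a morphism if $\sum_{i+j+k=n}f_{i+1+k}(1^{\otimes i}\otimes X_j\otimes1^{\otimes k})=\partial f_n+\sum_{i=1}^{n-1}f_i\cdot f_{n-i}$ for all $n\geq 1$. *)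

theory Defs
  imports Complex_Main "HOL-Library.Poly_Mapping" "HOL-Library.Z2" "HOL-Algebra.QuotRing"
begin

section \<open>Arc diagrams\<close>

text \<open>
  An arc diagram is recorded combinatorially. The list \<open>place_counts\<close> has one entry for each
  interval; \<open>(i, j)\<close> is the \<open>j\<close>-th point along the \<open>i\<close>-th interval, where \<open>j = 0\<close> is the start
  of the interval, \<open>j = place_counts ! i + 1\<close> is its end, and the points in between are the places.
  The step \<open>(i, j)\<close> runs from the point \<open>(i, j)\<close> to the point \<open>(i, j + 1)\<close>.
\<close>

type_synonym point = "nat \<times> nat"
type_synonym step = "nat \<times> nat"

record arc_data =
  place_counts :: "nat list"
  num_pairs :: nat
  pair_of :: "point \<Rightarrow> nat"

definition points :: "arc_data \<Rightarrow> point set" where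
  "points Z = {(i, j). i < length (place_counts Z) \<and> j \<le> place_counts Z ! i + 1}"

definition places :: "arc_data \<Rightarrow> point set" where
  "places Z = {(i, j). i < length (place_counts Z) \<and> 1 \<le> j \<and> j \<le> place_counts Z ! i}"

definition steps :: "arc_data \<Rightarrow> step set" where
  "steps Z = {(i, j). i < length (place_counts Z) \<and> j \<le> place_counts Z ! i}"

definition step_start :: "step \<Rightarrow> point" where
  "step_start \<sigma> = \<sigma>"

definition step_end :: "step \<Rightarrow> point" where
  "step_end \<sigma> = (fst \<sigma>, Suc (snd \<sigma>))"

definition step_before :: "point \<Rightarrow> step" where
  "step_before p = (fst p, snd p - 1)"

definition step_after :: "point \<Rightarrow> step" where
  "step_after p = p"

definition point_less :: "point \<Rightarrow> point \<Rightarrow> bool" where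
  "point_less x y \<longleftrightarrow> fst x = fst y \<and> snd x < snd y"

definition point_le :: "point \<Rightarrow> point \<Rightarrow> bool" where
  "point_le x y \<longleftrightarrow> fst x = fst y \<and> snd x \<le> snd y"

definition pairs :: "arc_data \<Rightarrow> nat set" where
  "pairs Z = {1..num_pairs Z}"

definition pair_places :: "arc_data \<Rightarrow> nat \<Rightarrow> point set" where
  "pair_places Z P = {p \<in> places Z. pair_of Z p = P}"

text \<open>
  Oriented surgery at all matched pairs reconnects the end of the step arriving at a place to the
  beginning of the step leaving its twin. The circle components of the surgered 1-manifold are
  the cycles of the resulting successor relation on steps.
\<close>

definition surgery_succ :: "arc_data \<Rightarrow> (step \<times> step) set" where
  "surgery_succ Z = {(\<sigma>, step_after q) | \<sigma> q. \<sigma> \<in> steps Z \<and> step_end \<sigma> \<in> places Z \<and>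
     q \<in> places Z \<and> q \<noteq> step_end \<sigma> \<and> pair_of Z q = pair_of Z (step_end \<sigma>)}"

definition arc_diagram :: "arc_data \<Rightarrow> bool" where
  "arc_diagram Z \<longleftrightarrow>
     (\<forall>p\<in>places Z. pair_of Z p \<in> pairs Z) \<and>
     (\<forall>P\<in>pairs Z. card (pair_places Z P) = 2) \<and>
     acyclic (surgery_succ Z)"

section \<open>Strand diagrams and the unrestricted algebra\<close>

text \<open>
  A strand diagram \<open>(S, T, \<phi>)\<close> is represented by the graph of \<open>\<phi>\<close>, that is, by its set of strands
  \<open>(x, \<phi> x)\<close>; thus \<open>S\<close> is its domain, \<open>T\<close> its range, and composition of relations is
  composition of bijections.
\<close>

type_synonym strand = "point \<times> point"
type_synonym strands = "strand set"

definition strand_diagram :: "arc_data \<Rightarrow> strands \<Rightarrow> bool" where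
  "strand_diagram Z \<phi> \<longleftrightarrow> \<phi> \<subseteq> points Z \<times> points Z \<and> single_valued \<phi> \<and> single_valued (\<phi>\<inverse>) \<and>
     (\<forall>(x, y)\<in>\<phi>. point_le x y)"

definition crossings :: "strands \<Rightarrow> (strand \<times> strand) set" where
  "crossings \<phi> = {(a, b). a \<in> \<phi> \<and> b \<in> \<phi> \<and> point_less (fst a) (fst b) \<and> point_less (snd b) (snd a)}"

definition inversions :: "strands \<Rightarrow> nat" where
  "inversions \<phi> = card (crossings \<phi>)"

definition resolve :: "strands \<Rightarrow> strand \<times> strand \<Rightarrow> strands" where
  "resolve \<phi> c = (case c of (a, b) \<Rightarrow> \<phi> - {a, b} \<union> {(fst a, snd b), (fst b, snd a)})"

text \<open>
  Chains are formal sums of strand diagrams with coefficients in the field \<open>bit\<close> of two elements.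
  Over this field a map is linear if and only if it is additive.
\<close>

type_synonym chain = "strands \<Rightarrow>\<^sub>0 bit"

definition basis_mult :: "strands \<Rightarrow> strands \<Rightarrow> chain" where
  "basis_mult \<phi> \<psi> =
     (if Range \<phi> = Domain \<psi> \<and> inversions (\<phi> O \<psi>) = inversions \<phi> + inversions \<psi>
      then Poly_Mapping.single (\<phi> O \<psi>) 1 else 0)"

definition chain_mult :: "chain \<Rightarrow> chain \<Rightarrow> chain" where
  "chain_mult x y = (\<Sum>\<phi>\<in>Poly_Mapping.keys x. \<Sum>\<psi>\<in>Poly_Mapping.keys y. basis_mult \<phi> \<psi>)"

definition basis_diff :: "strands \<Rightarrow> chain" where
  "basis_diff \<phi> =
     (\<Sum>c\<in>{c \<in> crossings \<phi>. inversions (resolve \<phi> c) + 1 = inversions \<phi>}.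
        Poly_Mapping.single (resolve \<phi> c) 1)"

definition diff :: "chain \<Rightarrow> chain" where
  "diff x = (\<Sum>\<phi>\<in>Poly_Mapping.keys x. basis_diff \<phi>)"

definition span2 :: "chain set \<Rightarrow> chain set" where
  "span2 B = {\<Sum>x\<in>T. x | T. finite T \<and> T \<subseteq> B}"

section \<open>The strand algebra and its homology\<close>

definition idem :: "arc_data \<Rightarrow> nat set \<Rightarrow> chain" where
  "idem Z s =
     (\<Sum>S\<in>{S. S \<subseteq> points Z \<and>
              (\<forall>P\<in>pairs Z. card (S \<inter> pair_places Z P) = (if P \<in> s then 1 else 0))}.
        Poly_Mapping.single (Id_on S) 1)"

definition add_horizontals :: "arc_data \<Rightarrow> strands \<Rightarrow> chain" where
  "add_horizontals Z \<mu> =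
     (\<Sum>U\<in>Pow (points Z - (Domain \<mu> \<union> Range \<mu>)). Poly_Mapping.single (\<mu> \<union> Id_on U) 1)"

text \<open>
  A diagram \<open>I(s) a(\<mu>) I(t)\<close> is represented by the triple \<open>(s, \<mu>, t)\<close>, which it determines;
  its value as an element of the algebra is \<open>chain_of\<close>.
\<close>

type_synonym diagram = "nat set \<times> strands \<times> nat set"

definition chain_of :: "arc_data \<Rightarrow> diagram \<Rightarrow> chain" where
  "chain_of Z D = (case D of (s, \<mu>, t) \<Rightarrow>
     chain_mult (chain_mult (idem Z s) (add_horizontals Z \<mu>)) (idem Z t))"

definition terms_of :: "arc_data \<Rightarrow> diagram \<Rightarrow> strands set" where
  "terms_of Z D = Poly_Mapping.keys (chain_of Z D)"

definition diagrams :: "arc_data \<Rightarrow> diagram set" where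
  "diagrams Z = {(s, \<mu>, t). s \<subseteq> pairs Z \<and> t \<subseteq> pairs Z \<and> strand_diagram Z \<mu> \<and>
     (\<forall>(x, y)\<in>\<mu>. x \<noteq> y) \<and> chain_of Z (s, \<mu>, t) \<noteq> 0}"

definition strand_algebra :: "arc_data \<Rightarrow> chain ring" where
  "strand_algebra Z =
     \<lparr>carrier = span2 (chain_of Z ` diagrams Z), mult = chain_mult,
      one = (\<Sum>s\<in>Pow (pairs Z). idem Z s), zero = 0, add = (+)\<rparr>"

definition cycles :: "arc_data \<Rightarrow> chain set" where
  "cycles Z = {x \<in> carrier (strand_algebra Z). diff x = 0}"

definition boundaries :: "arc_data \<Rightarrow> chain set" where
  "boundaries Z = diff ` carrier (strand_algebra Z)"

definition cycle_ring :: "arc_data \<Rightarrow> chain ring" where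
  "cycle_ring Z = (strand_algebra Z)\<lparr>carrier := cycles Z\<rparr>"

definition homology :: "arc_data \<Rightarrow> chain set ring" where
  "homology Z = cycle_ring Z Quot boundaries Z"

definition cls :: "arc_data \<Rightarrow> chain \<Rightarrow> chain set" where
  "cls Z x = boundaries Z +>\<^bsub>cycle_ring Z\<^esub> x"

section \<open>H-data, gradings, and types of diagrams\<close>

text \<open>
  The group \<open>H\<^sub>1(Z, a\<^sub>\<plusminus>\<^sub>\<infinity>)\<close> is free abelian on the steps, so a class is recorded by
  its multiplicity on each step; \<open>interval_class x y\<close> is the class \<open>[x, y]\<close>.
\<close>

type_synonym hclass = "step \<Rightarrow>\<^sub>0 int"
type_synonym hdata = "hclass \<times> nat set \<times> nat set"

definition interval_class :: "point \<Rightarrow> point \<Rightarrow> hclass" where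
  "interval_class x y = (\<Sum>j\<in>{snd x..<snd y}. Poly_Mapping.single (fst x, j) 1)"

definition hgrade :: "diagram \<Rightarrow> hclass" where
  "hgrade D = (case D of (s, \<mu>, t) \<Rightarrow> \<Sum>(x, y)\<in>\<mu>. interval_class x y)"

definition source :: "diagram \<Rightarrow> nat set" where
  "source D = fst D"

definition target :: "diagram \<Rightarrow> nat set" where
  "target D = snd (snd D)"

definition hdata_of :: "diagram \<Rightarrow> hdata" where
  "hdata_of D = (hgrade D, source D, target D)"

definition bdry :: "hclass \<Rightarrow> point \<Rightarrow>\<^sub>0 int" where
  "bdry h = (\<Sum>\<sigma>\<in>Poly_Mapping.keys h.
     Poly_Mapping.single (step_end \<sigma>) (Poly_Mapping.lookup h \<sigma>)
     - Poly_Mapping.single (step_start \<sigma>) (Poly_Mapping.lookup h \<sigma>))"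

definition avg_mult :: "hclass \<Rightarrow> point \<Rightarrow> rat" where
  "avg_mult h a =
     of_int (Poly_Mapping.lookup h (step_before a) + Poly_Mapping.lookup h (step_after a)) / 2"

text \<open>
  \<open>mlt Z h c\<close> is the pairing \<open>m(h, c)\<close> with a 0-chain \<open>c\<close>, which ignores the ends of the intervals.
\<close>

definition mlt :: "arc_data \<Rightarrow> hclass \<Rightarrow> (point \<Rightarrow>\<^sub>0 int) \<Rightarrow> rat" where
  "mlt Z h c = (\<Sum>a\<in>places Z. of_int (Poly_Mapping.lookup c a) * avg_mult h a)"

text \<open>The Maslov grading does not depend on the term chosen to compute it.\<close>

definition maslov :: "arc_data \<Rightarrow> diagram \<Rightarrow> rat" where
  "maslov Z D = (let \<nu> = (SOME \<nu>. \<nu> \<in> terms_of Z D) in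
     of_nat (inversions \<nu>) - mlt Z (hgrade D) (\<Sum>a\<in>Domain \<nu>. Poly_Mapping.single a 1))"

definition alg_hdata :: "arc_data \<Rightarrow> hdata \<Rightarrow> chain set" where
  "alg_hdata Z d = span2 (chain_of Z ` {D \<in> diagrams Z. hdata_of D = d})"

definition hom_hdata :: "arc_data \<Rightarrow> hdata \<Rightarrow> chain set set" where
  "hom_hdata Z d = cls Z ` (cycles Z \<inter> alg_hdata Z d)"

definition alg_maslov :: "arc_data \<Rightarrow> rat \<Rightarrow> chain set" where
  "alg_maslov Z g = span2 (chain_of Z ` {D \<in> diagrams Z. maslov Z D = g})"

definition hom_maslov :: "arc_data \<Rightarrow> rat \<Rightarrow> chain set set" where
  "hom_maslov Z g = cls Z ` (cycles Z \<inter> alg_maslov Z g)"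

definition viable_class :: "arc_data \<Rightarrow> hclass \<Rightarrow> bool" where
  "viable_class Z h \<longleftrightarrow> (\<forall>\<sigma>\<in>steps Z. Poly_Mapping.lookup h \<sigma> \<in> {0, 1})"

text \<open>
  The terms of a diagram run through the possible positions of its dotted strands, so a crossing
  is visible in the picture of the diagram if and only if it occurs in some term.
  \<open>crossing_at\<close> asks for a crossing with a horizontal strand at a place of the pair; in a viable
  diagram all crossings are of this kind.
\<close>

definition has_crossing :: "arc_data \<Rightarrow> diagram \<Rightarrow> bool" where
  "has_crossing Z D \<longleftrightarrow> (\<exists>\<nu>\<in>terms_of Z D. crossings \<nu> \<noteq> {})"

definition crossing_at :: "arc_data \<Rightarrow> diagram \<Rightarrow> nat \<Rightarrow> bool" where
  "crossing_at Z D P \<longleftrightarrow>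
     (\<exists>\<nu>\<in>terms_of Z D. \<exists>(a, b)\<in>crossings \<nu>. \<exists>p\<in>pair_places Z P. a = (p, p) \<or> b = (p, p))"

definition tight_diagram :: "arc_data \<Rightarrow> diagram \<Rightarrow> bool" where
  "tight_diagram Z D \<longleftrightarrow> D \<in> diagrams Z \<and> viable_class Z (hgrade D) \<and> \<not> has_crossing Z D \<and>
     cls Z (chain_of Z D) \<noteq> \<zero>\<^bsub>homology Z\<^esub>"

definition twisted_diagram :: "arc_data \<Rightarrow> diagram \<Rightarrow> bool" where
  "twisted_diagram Z D \<longleftrightarrow> D \<in> diagrams Z \<and> viable_class Z (hgrade D) \<and> \<not> has_crossing Z D \<and>
     cls Z (chain_of Z D) = \<zero>\<^bsub>homology Z\<^esub>"

definition tight_hdata :: "arc_data \<Rightarrow> hdata \<Rightarrow> bool" where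
  "tight_hdata Z d \<longleftrightarrow> (\<exists>D. tight_diagram Z D \<and> hdata_of D = d)"

definition twisted_hdata :: "arc_data \<Rightarrow> hdata \<Rightarrow> bool" where
  "twisted_hdata Z d \<longleftrightarrow> (\<exists>D. twisted_diagram Z D \<and> hdata_of D = d)"

definition covers :: "hclass \<Rightarrow> step \<Rightarrow> bool" where
  "covers h \<sigma> \<longleftrightarrow> Poly_Mapping.lookup h \<sigma> \<noteq> 0"

definition once_occupied_at :: "arc_data \<Rightarrow> hclass \<Rightarrow> nat \<Rightarrow> point \<Rightarrow> bool" where
  "once_occupied_at Z h P p \<longleftrightarrow> p \<in> pair_places Z P \<and>
     covers h (step_before p) \<and> covers h (step_after p) \<and>
     (\<forall>q\<in>pair_places Z P - {p}. \<not> covers h (step_before q) \<and> \<not> covers h (step_after q))"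

definition doubly_occupied :: "arc_data \<Rightarrow> hclass \<Rightarrow> nat \<Rightarrow> bool" where
  "doubly_occupied Z h P \<longleftrightarrow> P \<in> pairs Z \<and>
     (\<forall>p\<in>pair_places Z P. covers h (step_before p) \<and> covers h (step_after p))"

text \<open>
  The linear span of these diagrams is already a two-sided ideal; \<open>\<F>\<close> is this span.
\<close>

definition ideal_F :: "arc_data \<Rightarrow> chain set" where
  "ideal_F Z = span2 (chain_of Z ` {D \<in> diagrams Z. \<not> viable_class Z (hgrade D) \<or>
     (\<exists>P. doubly_occupied Z (hgrade D) P \<and> crossing_at Z D P)})"

section \<open>Pair orderings, cycle selection and the operator inserting crossings\<close>

record pair_order =
  pair_le :: "(nat \<times> nat) set"
  place_le :: "nat \<Rightarrow> (point \<times> point) set"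

definition pair_ordering :: "arc_data \<Rightarrow> pair_order \<Rightarrow> bool" where
  "pair_ordering Z ord \<longleftrightarrow> linear_order_on (pairs Z) (pair_le ord) \<and>
     (\<forall>P\<in>pairs Z. linear_order_on (pair_places Z P) (place_le ord P))"

definition smaller_place :: "arc_data \<Rightarrow> pair_order \<Rightarrow> nat \<Rightarrow> point \<Rightarrow> bool" where
  "smaller_place Z ord P p \<longleftrightarrow>
     p \<in> pair_places Z P \<and> (\<forall>q\<in>pair_places Z P. (p, q) \<in> place_le ord P)"

definition selected_diagram :: "arc_data \<Rightarrow> pair_order \<Rightarrow> hdata \<Rightarrow> diagram \<Rightarrow> bool" where
  "selected_diagram Z ord d D \<longleftrightarrow> tight_diagram Z D \<and> hdata_of D = d \<and>
     (\<forall>P p. P \<in> source D \<inter> target D \<and> doubly_occupied Z (hgrade D) P \<and> smaller_place Z ord P p \<longrightarrow>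
        p \<in> Domain (fst (snd D)) \<and> p \<in> Range (fst (snd D)))"

text \<open>
  \<open>cycle_selection Z ord g\<close> says that \<open>g\<close> is the linear map \<open>f\<^sup>\<preceq>\<close> on homology. The nonzero
  element of the summand of tight H-data \<open>d\<close> is its generator, and the selected diagram
  with H-data \<open>d\<close> is unique.
\<close>

definition cycle_selection :: "arc_data \<Rightarrow> pair_order \<Rightarrow> (chain set \<Rightarrow> chain) \<Rightarrow> bool" where
  "cycle_selection Z ord g \<longleftrightarrow>
     (\<forall>x\<in>carrier (homology Z). \<forall>y\<in>carrier (homology Z). g (x \<oplus>\<^bsub>homology Z\<^esub> y) = g x + g y) \<and>
     (\<forall>d. tight_hdata Z d \<longrightarrow> (\<forall>c\<in>hom_hdata Z d. c \<noteq> \<zero>\<^bsub>homology Z\<^esub> \<longrightarrow>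
        g c = chain_of Z (THE D. selected_diagram Z ord d D)))"

definition join_at :: "strands \<Rightarrow> point \<Rightarrow> strands" where
  "join_at \<mu> p = {(x, y) \<in> \<mu>. x \<noteq> p \<and> y \<noteq> p} \<union> {(x, y). (x, p) \<in> \<mu> \<and> (p, y) \<in> \<mu>}"

text \<open>
  Dotted strands are not part of \<open>\<mu>\<close> in \<open>(s, \<mu>, t)\<close>: once the two strands meeting at \<open>p\<close> are
  joined, the pair \<open>P\<close> (in both \<open>s\<close> and \<open>t\<close>) is no longer used by \<open>\<mu>\<close>, and \<open>chain_of\<close> puts
  dotted strands at it.
\<close>

definition A_star_diagram :: "arc_data \<Rightarrow> pair_order \<Rightarrow> diagram \<Rightarrow> chain" where
  "A_star_diagram Z ord D = (case D of (s, \<mu>, t) \<Rightarrow>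
     let C = {P \<in> s \<inter> t. \<exists>p. once_occupied_at Z (hgrade D) P p};
         P = (THE P. P \<in> C \<and> (\<forall>Q\<in>C. (P, Q) \<in> pair_le ord));
         p = (THE p. once_occupied_at Z (hgrade D) P p)
     in if crossing_at Z D P then 0 else chain_of Z (s, join_at \<mu> p, t))"

text \<open>
  Distinct diagrams have disjoint sets of terms, so the diagrams occurring in an element
  \<open>x\<close> of the algebra are those all of whose terms occur in \<open>x\<close>.
\<close>

definition A_star :: "arc_data \<Rightarrow> pair_order \<Rightarrow> chain \<Rightarrow> chain" where
  "A_star Z ord x =
     (\<Sum>D\<in>{D \<in> diagrams Z. twisted_hdata Z (hdata_of D) \<and> terms_of Z D \<subseteq> Poly_Mapping.keys x}.
        A_star_diagram Z ord D)"

section \<open>A-infinity structures and morphisms\<close>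

text \<open>
  A family of operations on tensor powers, one for each \<open>n \<ge> 1\<close>, is represented by one multiadditive
  function on lists, whose restriction to lists of length \<open>n\<close> is the \<open>n\<close>-ary operation.
\<close>

definition multilinear :: "('a, 'm) ring_scheme \<Rightarrow> ('b, 'k) ring_scheme \<Rightarrow> ('a list \<Rightarrow> 'b) \<Rightarrow> bool" where
  "multilinear R S F \<longleftrightarrow>
     (\<forall>xs. xs \<noteq> [] \<and> set xs \<subseteq> carrier R \<longrightarrow> F xs \<in> carrier S) \<and>
     (\<forall>xs ys x y. set xs \<subseteq> carrier R \<and> set ys \<subseteq> carrier R \<and> x \<in> carrier R \<and> y \<in> carrier R \<longrightarrow>
        F (xs @ [x \<oplus>\<^bsub>R\<^esub> y] @ ys) = F (xs @ [x] @ ys) \<oplus>\<^bsub>S\<^esub> F (xs @ [y] @ ys))"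

text \<open>\<open>apply_inner F X i j xs\<close> is \<open>F (1\<^sup>\<otimes>\<^sup>i \<otimes> X\<^sub>j \<otimes> 1\<^sup>\<otimes>\<^sup>k)\<close> evaluated at \<open>xs\<close>.\<close>

definition apply_inner :: "('a list \<Rightarrow> 'b) \<Rightarrow> ('a list \<Rightarrow> 'a) \<Rightarrow> nat \<Rightarrow> nat \<Rightarrow> 'a list \<Rightarrow> 'b" where
  "apply_inner F X i j xs = F (take i xs @ [X (take j (drop i xs))] @ drop (i + j) xs)"

definition ainf_structure :: "('a, 'm) ring_scheme \<Rightarrow> ('a list \<Rightarrow> 'a) \<Rightarrow> bool" where
  "ainf_structure R X \<longleftrightarrow> multilinear R R X \<and>
     (\<forall>xs. xs \<noteq> [] \<and> set xs \<subseteq> carrier R \<longrightarrow>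
        (\<Oplus>\<^bsub>R\<^esub>c\<in>{(i, j). 1 \<le> j \<and> i + j \<le> length xs}. apply_inner X X (fst c) (snd c) xs) = \<zero>\<^bsub>R\<^esub>)"

definition ainf_morphism ::
  "arc_data \<Rightarrow> (chain set list \<Rightarrow> chain set) \<Rightarrow> (chain set list \<Rightarrow> chain) \<Rightarrow> bool" where
  "ainf_morphism Z X f \<longleftrightarrow> multilinear (homology Z) (strand_algebra Z) f \<and>
     (\<forall>xs. xs \<noteq> [] \<and> set xs \<subseteq> carrier (homology Z) \<longrightarrow>
        (\<Sum>(i, j)\<in>{(i, j). 1 \<le> j \<and> i + j \<le> length xs}. apply_inner f X i j xs) =
        diff (f xs) + (\<Sum>i\<in>{1..<length xs}. chain_mult (f (take i xs)) (f (drop i xs))))"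

definition U_op :: "(chain set list \<Rightarrow> chain set) \<Rightarrow> (chain set list \<Rightarrow> chain) \<Rightarrow> chain set list \<Rightarrow> chain" where
  "U_op X f xs =
     (\<Sum>j\<in>{1..<length xs}. chain_mult (f (take j xs)) (f (drop j xs))) +
     (\<Sum>(j, k)\<in>{(j, k). 2 \<le> j \<and> j < length xs \<and> j + k \<le> length xs}. apply_inner f X k j xs)"

section \<open>Tensor products of homology classes of diagrams\<close>

text \<open>
  A tensor product of nonzero homology classes of diagrams is given by a list of representing
  diagrams; all the notions below only depend on the classes.
\<close>

definition represents_class :: "arc_data \<Rightarrow> diagram \<Rightarrow> bool" where
  "represents_class Z D \<longleftrightarrow> D \<in> diagrams Z \<and> diff (chain_of Z D) = 0 \<and>
     cls Z (chain_of Z D) \<noteq> \<zero>\<^bsub>homology Z\<^esub>"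

definition idem_mismatch :: "diagram list \<Rightarrow> bool" where
  "idem_mismatch Ds \<longleftrightarrow> (\<exists>i. Suc i < length Ds \<and> target (Ds ! i) \<noteq> source (Ds ! Suc i))"

definition tensor_hdata :: "diagram list \<Rightarrow> hdata" where
  "tensor_hdata Ds = (\<Sum>D\<leftarrow>Ds. hgrade D, source (hd Ds), target (last Ds))"

definition tensor_viable :: "arc_data \<Rightarrow> diagram list \<Rightarrow> bool" where
  "tensor_viable Z Ds \<longleftrightarrow> \<not> idem_mismatch Ds \<and> viable_class Z (\<Sum>D\<leftarrow>Ds. hgrade D)"

definition tensor_maslov :: "arc_data \<Rightarrow> diagram list \<Rightarrow> rat" where
  "tensor_maslov Z Ds = (\<Sum>D\<leftarrow>Ds. maslov Z D) +
     (\<Sum>(j, k)\<in>{(j, k). j < k \<and> k < length Ds}. mlt Z (hgrade (Ds ! k)) (bdry (hgrade (Ds ! j))))"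

end

(*
  The A-infinity structure is transferred along an explicit linear contraction of the strand
  algebra onto the span of the selected tight diagrams. The contraction preserves H-data, so it is
  built on each summand separately. On a non-viable summand two strands cover a common step; looking
  at the first such step, exchanging the ends of the two strands there contracts the summand. On a
  viable summand the differential breaks a strand at a crossing, and joining the strands at a fixed
  place q is a homotopy from the identity to an operation that moves a break from q to its twin. At a
  once occupied pair this operation is zero, which gives the operator A*; at doubly occupied pairs it
  is iterated until all breaks lie at the smaller places. With the resulting homotopy h and projection
  p put X_n = p U_n and f_n = h (f_1 X_n + U_n). The A-infinity relations follow from p being the
  identity on selected diagrams and from d U_n = f_1 (E_n), where E_n is the n-th structure relation:
  applying p gives E_n = 0. All clauses about gradings hold because h and p are homogeneous.
*)
theory Submission
  imports Defs "HOL-Combinatorics.Transposition"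
begin

text \<open>A diagram is a sum over the positions of its dotted strands, while products and
  differentials are computed term by term mod 2. So the algebra is treated as the set of chains that
  contain, with a term, every term with the same moving strands and idempotents; closure under both
  operations is a matter of parities, settled by bijections that move horizontal strands. The first
  doubly covered step is chosen because the moving strands before it on its interval are disjoint:
  one strand arrives, one starts there, and no resolution changes this. On a viable summand the
  moving strands are disjoint throughout, so a diagram is known from the ends of its strands, and
  joining at one place commutes with breaking at another unless the two are twins. That single
  failure is the operation moving a break. Tight and twisted are defined by homology and have to be
  recognised: the projection vanishes on a summand with a once occupied 11 pair and sends every
  other uncrossed viable diagram to a selected one, so these two cases are twisted and
  tight.\<close>

abbreviation "keys \<equiv> Poly_Mapping.keys"
abbreviation "single \<equiv> Poly_Mapping.single"
abbreviation "lookup \<equiv> Poly_Mapping.lookup"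

section \<open>Inversions\<close>

text \<open>With starts kept in a fixed set, exchanging the ends of two strands is composition with
  a transposition, so crossings can be counted as inversions of functions.\<close>

definition grf :: "'a set => ('a => 'b) => ('a \<times> 'b) set" where
 "grf S g = (\<lambda>x. (x, g x)) ` S"

lemma in_grf [simp]: "(x, y) \<in> grf S g \<longleftrightarrow> x \<in> S \<and> y = g x"
 by (auto simp: grf_def)

lemma Domain_grf [simp]: "Domain (grf S g) = S"
 and Range_grf [simp]: "Range (grf S g) = g ` S"
 by (auto simp: grf_def Domain_iff)

lemma grf_comp: "grf S g O grf (g ` S) k = grf S (k \<circ> g)"
 by (auto simp: grf_def)

lemma grf_eqI: "(\<And>x. x \<in> S ==> g x = k x) ==> grf S g = grf S k"
 by (auto simp: grf_def)

text \<open>Points are comparable only within an interval. \<open>part\<close> names the interval,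
  which lets all intervals be treated at once without a total order.\<close>

locale strand_order =
 fixes less :: "'a => 'a => bool" and part :: "'a => 'b"
 assumes less_irrefl [simp]: "\<not> less x x"
  and less_trans: "less x y ==> less y z ==> less x z"
  and less_part: "less x y ==> part x = part y"
  and comparable: "part x = part y ==> x \<noteq> y ==> less x y \<or> less y x"
begin

lemma less_asym: "less x y ==> \<not> less y x"
 using less_trans less_irrefl by blast

definition crs :: "'a set => ('a => 'a) => ('a \<times> 'a) set" where
 "crs S g = {(u, v). u \<in> S \<and> v \<in> S \<and> less u v \<and> less (g v) (g u)}"

definition interval_inj :: "'a set => ('a => 'a) => bool" where
 "interval_inj S g \<longleftrightarrow> finite S \<and> inj_on g S \<and> (\<forall>x\<in>S. part (g x) = part x)"

lemma finite_crs [simp]: "finite S ==> finite (crs S g)"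
 by (rule finite_subset [of _ "S \<times> S"]) (auto simp: crs_def)

lemma interval_inj_transpose:
 assumes "interval_inj S g" "u \<in> S" "v \<in> S" "part u = part v"
 shows "interval_inj S (g \<circ> transpose u v)"
proof -
 have "inj_on (g \<circ> transpose u v) S"
  using assms by (intro comp_inj_on) (auto simp: interval_inj_def transpose_image_eq)
 then show ?thesis
  using assms by (auto simp: interval_inj_def transpose_def)
qed

lemma interval_inj_comp:
 assumes "interval_inj S g" "interval_inj (g ` S) k"
 shows "interval_inj S (k \<circ> g)"
 using assms by (auto simp: interval_inj_def comp_inj_on)

text \<open>The map \<open>swap_crossing\<close> sends the crossings left after exchanging the ends of the strands at
 \<open>u\<close> and \<open>v\<close> injectively to the crossings before the exchange.\<close>

definition swap_crossing :: "'a => 'a => 'a \<times> 'a => 'a \<times> 'a" where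
 "swap_crossing u v = (\<lambda>(a, b). if less (transpose u v a) (transpose u v b)
  then (transpose u v a, transpose u v b) else (a, b))"

text \<open>A value of the map is either a pair itself or its transposed pair. If a transposed pair
  equalled a pair left alone, transposing the latter would return the former, which is in order, so
  it would not have been left alone.\<close>

lemma swap_crossing_inj: 
 "inj_on (swap_crossing u v) {(a, b). less a b}"
proof (rule inj_onI, clarify)
 fix a b c d
 assume h: "less a b" "less c d" "swap_crossing u v (a, b) = swap_crossing u v (c, d)"
 define t where "t = transpose u v"
 have "t (t x) = x" for x by (simp add: t_def)
 moreover have "(if less (t a) (t b) then (t a, t b) else (a, b)) = (if less (t c) (t d) then (t c, t d) else (c, d))"
  using h(3) unfolding swap_crossing_def t_def prod.case .
 ultimately show "a = c \<and> b = d"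
  using h(1,2) less_asym by (metis prod.inject)
qed

text \<open>The delicate crossings pair the strand at u or v with one starting in between.
  Transposing would reverse their order, so they are left alone; such a pair crosses before the
  exchange as well, because the strand at u ended higher and the one at v lower then.\<close>

lemma swap_crossing_in:
 assumes g: "interval_inj S g" and uv: "(u, v) \<in> crs S g"
  and ab: "(a, b) \<in> crs S (g \<circ> transpose u v)"
 shows "swap_crossing u v (a, b) \<in> crs S g - {(u, v)}"
proof -
 have uv': "u \<in> S" "v \<in> S" "less u v" "less (g v) (g u)"
  using uv by (auto simp: crs_def)
 have ab': "a \<in> S" "b \<in> S" "less a b" "less (g (transpose u v b)) (g (transpose u v a))"
  using ab by (auto simp: crs_def)
 have fab: "part a = part b" and fuv: "part u = part v" 
  using ab' uv' less_part by auto
 consider "a = u" "b = v" | "a = u" "b \<noteq> v" "b \<noteq> u" | "a = v" "b = u" | "a = v" "b \<noteq> u" "b \<noteq> v"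
  | "a \<noteq> u" "a \<noteq> v" "b = u" | "a \<noteq> u" "a \<noteq> v" "b = v" | "a \<noteq> u" "a \<noteq> v" "b \<noteq> u" "b \<noteq> v"
  using less_irrefl ab'(3) by metis
 then show ?thesis
 proof cases
  case 1
  then show ?thesis using ab' uv' by (auto simp: transpose_def dest: less_asym)
 next
  case 2
  then show ?thesis
   using ab' uv' comparable [of b v]
   by (auto simp: swap_crossing_def crs_def fab fuv transpose_def dest: less_asym less_trans)
 next
  case 3
  then show ?thesis using ab' uv' by (auto simp: transpose_def dest: less_asym)
 next
  case 4
  then show ?thesis using ab' uv'
   by (auto simp: swap_crossing_def crs_def transpose_def dest: less_asym less_trans)
 next
  case 5
  then show ?thesis using ab' uv'
   by (auto simp: swap_crossing_def crs_def transpose_def dest: less_asym less_trans)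
 next
  case 6
  then show ?thesis using ab' uv' comparable [of a u]
   by (auto simp: swap_crossing_def crs_def fab fuv transpose_def dest: less_asym less_trans)
 next
  case 7
  then show ?thesis using ab' uv'
   by (auto simp: swap_crossing_def crs_def transpose_def)
 qed
qed

lemma swap_crossing_image:
 assumes "interval_inj S g" and "(u, v) \<in> crs S g"
 shows "swap_crossing u v ` crs S (g \<circ> transpose u v) \<subseteq> crs S g - {(u, v)}"
proof (rule image_subsetI)
 fix c assume "c \<in> crs S (g \<circ> transpose u v)"
 then show "swap_crossing u v c \<in> crs S g - {(u, v)}"
  using swap_crossing_in [OF assms, of "fst c" "snd c"] by simp
qed

text \<open>The crossings after the exchange inject into the former crossings other than (u, v), and
  this one is lost.\<close>

lemma crs_transpose_less:
 assumes g: "interval_inj S g" and uv: "(u, v) \<in> crs S g"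
 shows "card (crs S (g \<circ> transpose u v)) < card (crs S g)"
proof -
 have fin: "finite S" using g by (simp add: interval_inj_def)
 have "card (crs S (g \<circ> transpose u v)) = card (swap_crossing u v ` crs S (g \<circ> transpose u v))"
  by (rule card_image [symmetric], rule inj_on_subset [OF swap_crossing_inj]) (auto simp: crs_def)
 also have "\<dots> \<le> card (crs S g - {(u, v)})"
  using swap_crossing_image [OF g uv] fin by (intro card_mono) simp_all
 also have "\<dots> < card (crs S g)"
  using uv fin by (intro psubset_card_mono) auto
 finally show ?thesis .
qed

definition blocked :: "'a set => ('a => 'a) => 'a => 'a => bool" where
 "blocked S g u v \<longleftrightarrow> (\<exists>w\<in>S. less u w \<and> less w v \<and> less (g v) (g w) \<and> less (g w) (g u))"

text \<open>The injection of crossings always misses (u, v), so the count drops by one exactly when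
  it reaches everything else. A strand nested between the two at both ends crosses both of them
  before and neither of them after the exchange, which costs two more crossings.\<close>

lemma crs_transpose_Suc:
 assumes g: "interval_inj S g" and uv: "(u, v) \<in> crs S g"
 shows "card (crs S (g \<circ> transpose u v)) + 1 = card (crs S g) \<longleftrightarrow> \<not> blocked S g u v"
proof -
 let ?g' = "g \<circ> transpose u v"
 have fin: "finite S" using g by (simp add: interval_inj_def)
 have uv': "u \<in> S" "v \<in> S" "less u v" "less (g v) (g u)"
  using uv by (auto simp: crs_def)
 have card: "card (crs S ?g') = card (swap_crossing u v ` crs S ?g')"
  by (rule card_image [symmetric], rule inj_on_subset [OF swap_crossing_inj]) (auto simp: crs_def)
 have sub: "swap_crossing u v ` crs S ?g' \<subseteq> crs S g - {(u, v)}"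
  by (rule swap_crossing_image [OF g uv])
 have full: "card (crs S g - {(u, v)}) + 1 = card (crs S g)"
  using uv fin by (metis finite_crs card_Suc_Diff1 Suc_eq_plus1)
 have "card (crs S ?g') + 1 = card (crs S g) \<longleftrightarrow> swap_crossing u v ` crs S ?g' = crs S g - {(u, v)}"
  using card_subset_eq [OF _ sub] fin full card by (metis add_right_cancel finite_Diff finite_crs)
 also have "\<dots> \<longleftrightarrow> \<not> blocked S g u v"
 proof
  assume eq: "swap_crossing u v ` crs S ?g' = crs S g - {(u, v)}"
  show "\<not> blocked S g u v"
  proof
   assume "blocked S g u v"
   then obtain w where w: "w \<in> S" "less u w" "less w v"
    "less (g v) (g w)" "less (g w) (g u)"
    by (auto simp: blocked_def)
   then have "(u, w) \<in> crs S g - {(u, v)}" by (auto simp: crs_def uv')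
   then obtain a b where ab: "(a, b) \<in> crs S ?g'" "swap_crossing u v (a, b) = (u, w)"
    using eq by (metis (no_types, lifting) imageE surj_pair)
   have wne: "w \<noteq> u" "w \<noteq> v" using w by auto
   have "(a, b) = (v, w) \<or> (a, b) = (u, w)"
    using ab(2) wne by (auto simp: swap_crossing_def transpose_def split: if_splits)
   then show False
    using ab w uv' wne by (auto simp: crs_def transpose_def dest: less_asym)
  qed
 next
  assume nb: "\<not> blocked S g u v"
  show "swap_crossing u v ` crs S ?g' = crs S g - {(u, v)}"
  proof (rule antisym [OF sub], rule subsetI)
   fix c assume "c \<in> crs S g - {(u, v)}"
   then obtain a b where c: "c = (a, b)" and ab: "a \<in> S" "b \<in> S" "less a b" 
    "less (g b) (g a)" "(a, b) \<noteq> (u, v)"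
    by (auto simp: crs_def)
   have f: "part (g x) = part x" if "x \<in> S" for x using g that by (auto simp: interval_inj_def)
   have i: "g x \<noteq> g y" if "x \<in> S" "y \<in> S" "x \<noteq> y" for x y using g that by (auto simp: interval_inj_def inj_on_def)
   let ?a = "transpose u v a" and ?b = "transpose u v b"
   show "c \<in> swap_crossing u v ` crs S ?g'"
   proof (cases "less ?a ?b")
    case True
    then have "(?a, ?b) \<in> crs S ?g'" 
     using ab uv' by (auto simp: crs_def) (auto simp: transpose_def)
    moreover have "swap_crossing u v (?a, ?b) = c"
     using ab c by (simp add: swap_crossing_def)
    ultimately show ?thesis by (metis imageI)
   next
    case False
    \<comment> \<open>Transposing spoils the order of a pair only if u is its lower or v its upper
      strand, with the other strand starting in between; these are the pairs that
      \<open>swap_crossing\<close> leaves alone.\<close>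
    have "a = u \<and> less b v \<and> b \<noteq> u \<or> b = v \<and> less u a \<and> a \<noteq> v"
    proof (cases "a = u")
     case True
     then have "b \<noteq> u" "b \<noteq> v" using ab by auto
     then show ?thesis
      using True False ab uv' comparable [of b v] less_part [of a b] less_part [of u v] by auto
    next
     case au: False
     show ?thesis
     proof (cases "b = v")
      case True
      then have "a \<noteq> v" using ab by auto
      then show ?thesis
       using True au False ab uv' comparable [of a u] less_part [of a b] less_part [of u v] by auto
     next
      case bv: False
      have "a \<noteq> v \<or> b \<noteq> u" using ab(3) uv'(3) less_asym by blast
      moreover have "a = v ==> less u b" "b = u ==> less a v"
       using ab(3) uv'(3) less_trans by blast+
      ultimately have "less ?a ?b"
       using au bv ab by (cases "a = v"; cases "b = u") auto
      then show ?thesis using False by contradiction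
     qed
    qed
    then have "(a, b) \<in> crs S ?g'"
    proof (elim disjE conjE)
     assume h: "a = u" "less b v" "b \<noteq> u"
     have "\<not> less (g v) (g b)" using nb h ab by (auto simp: blocked_def)
     then have "less (g b) (g v)"
      using comparable [of "g b" "g v"] i [of b v] f [of b] f [of v] h ab uv' less_part
      by metis
     then show ?thesis using h ab uv' by (auto simp: crs_def transpose_def)
    next
     assume h: "b = v" "less u a" "a \<noteq> v"
     have "\<not> less (g a) (g u)" using nb h ab by (auto simp: blocked_def)
     then have "less (g u) (g a)"
      using comparable [of "g u" "g a"] i [of u a] f [of u] f [of a] h ab uv' less_part
      by metis
     then show ?thesis using h ab uv' by (auto simp: crs_def transpose_def)
    qed
    moreover have "swap_crossing u v (a, b) = c"
     using False c by (simp add: swap_crossing_def)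
    ultimately show ?thesis by (metis imageI)
   qed
  qed
 qed
 finally show ?thesis .
qed

definition double_crs :: "'a set => ('a => 'a) => ('a => 'a) => ('a \<times> 'a) set" where
 "double_crs S g k = {(u, v) \<in> crs S g. (g v, g u) \<in> crs (g ` S) k}"

text \<open>Two strands cross in the composite if they cross in exactly one factor. A pair crossing
  in both counts once in each factor and not in the composite, hence the factor 2. In the proof
  \<open>?G\<close> and \<open>?K\<close> are the pairs crossing in g only and in k only,
  \<open>?D\<close> those crossing twice.\<close>

lemma card_crs_comp:
 assumes g: "interval_inj S g" and k: "interval_inj (g ` S) k"
 shows "card (crs S (k \<circ> g)) + 2 * card (double_crs S g k) = card (crs S g) + card (crs (g ` S) k)"
proof -
 have fin: "finite S" using g by (simp add: interval_inj_def)
 have f: "part (g x) = part x" "part (k (g x)) = part x" if "x \<in> S" for x 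
  using g k that by (auto simp: interval_inj_def)
 have i: "g x \<noteq> g y" "k (g x) \<noteq> k (g y)" if "x \<in> S" "y \<in> S" "x \<noteq> y" for x y
  using g k that unfolding interval_inj_def inj_on_def by blast+
 let ?D = "double_crs S g k"
 let ?K = "{(u, v). u \<in> S \<and> v \<in> S \<and> less u v \<and> less (g u) (g v) \<and> less (k (g v)) (k (g u))}"
 let ?G = "{(u, v) \<in> crs S g. less (k (g v)) (k (g u))}"
 have finD: "finite ?D"
  by (rule finite_subset [of _ "crs S g"]) (use fin in \<open>auto simp: double_crs_def\<close>)
 have finK: "finite ?K"
  by (rule finite_subset [of _ "S \<times> S"]) (use fin in auto)
 have finG: "finite ?G"
  by (rule finite_subset [of _ "crs S g"]) (use fin in auto)
 note fins = finD finK finG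
 have 1: "crs S g = ?G \<union> ?D" 
 proof (rule Set.set_eqI, unfold split_paired_all)
  fix u v
  show "(u, v) \<in> crs S g \<longleftrightarrow> (u, v) \<in> ?G \<union> ?D"
  proof (cases "(u, v) \<in> crs S g")
   case True
   then have h: "u \<in> S" "v \<in> S" "part u = part v" "u \<noteq> v" "less (g v) (g u)" 
    by (auto simp: crs_def dest: less_part)
   then have "less (k (g v)) (k (g u)) \<or> less (k (g u)) (k (g v))"
    by (intro comparable) (auto simp: f i dest: i(2))
   then show ?thesis using True h by (auto simp: double_crs_def) (auto simp: crs_def)
  qed (auto simp: double_crs_def)
 qed
 have d1: "?G \<inter> ?D = {}" 
  by (auto simp: double_crs_def crs_def dest: less_asym)
 have 2: "crs S (k \<circ> g) = ?G \<union> ?K"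
 proof (rule Set.set_eqI, unfold split_paired_all)
  fix u v
  show "(u, v) \<in> crs S (k \<circ> g) \<longleftrightarrow> (u, v) \<in> ?G \<union> ?K"
  proof (cases "(u, v) \<in> crs S (k \<circ> g)")
   case True
   then have h: "u \<in> S" "v \<in> S" "part u = part v" "u \<noteq> v"
    by (auto simp: crs_def dest: less_part)
   then have "less (g v) (g u) \<or> less (g u) (g v)"
    by (intro comparable) (auto simp: f i dest: i(1))
   then show ?thesis using True by (auto simp: crs_def)
  qed (auto simp: crs_def)
 qed
 have d2: "?G \<inter> ?K = {}" by (auto simp: crs_def dest: less_asym)
 let ?r = "\<lambda>(u, v). (g u, g v)" and ?s = "\<lambda>(u, v). (g v, g u)"
 have 3: "crs (g ` S) k = ?r ` ?K \<union> ?s ` ?D"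
 proof (rule Set.set_eqI, unfold split_paired_all)
  fix a b
  show "(a, b) \<in> crs (g ` S) k \<longleftrightarrow> (a, b) \<in> ?r ` ?K \<union> ?s ` ?D"
  proof (cases "(a, b) \<in> crs (g ` S) k")
   case True
   then obtain u v where h: "a = g u" "b = g v" "u \<in> S" "v \<in> S" "less (g u) (g v)"
    "less (k (g v)) (k (g u))"
    by (auto simp: crs_def)
   have "part u = part v" "u \<noteq> v" using h f[of u] f[of v] less_part [of "g u" "g v"] by auto
   from comparable [OF this] have "(u, v) \<in> ?K \<or> (v, u) \<in> ?D"
    using h True by (auto simp: double_crs_def crs_def)
   then show ?thesis using h True by force
  qed (auto simp: double_crs_def crs_def)
 qed
 have d3: "?r ` ?K \<inter> ?s ` ?D = {}"
 proof (rule ccontr)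
  assume "?r ` ?K \<inter> ?s ` ?D \<noteq> {}"
  then obtain c d where cd: "c \<in> ?K" "d \<in> ?D" "?r c = ?s d" by blast
  obtain u v u' v' where "c = (u, v)" "d = (u', v')" by (cases c, cases d)
  with cd have h: "(u, v) \<in> ?K" "(u', v') \<in> ?D" "g u = g v'" "g v = g u'" by auto
  then have "u = v'" "v = u'" using i(1) unfolding double_crs_def crs_def by blast+
  then show False using h by (auto simp: double_crs_def crs_def dest: less_asym)
 qed
 have r: "card (?r ` ?K) = card ?K"
  using i(1) by (intro card_image) (auto simp: inj_on_def)
 have s: "card (?s ` ?D) = card ?D"
  using i(1) by (intro card_image) (auto simp: inj_on_def double_crs_def crs_def)
 have "card (crs S g) = card ?G + card ?D"
  by (subst 1, subst card_Un_disjoint) (use fins d1 in auto)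
 moreover have "card (crs S (k \<circ> g)) = card ?G + card ?K"
  by (subst 2, subst card_Un_disjoint) (use fins d2 in auto)
 moreover have "card (crs (g ` S) k) = card ?K + card ?D"
  by (subst 3, subst card_Un_disjoint) (use fins d3 r s in auto)
 ultimately show ?thesis by simp
qed

lemma card_crs_comp_le:
 assumes "interval_inj S g" "interval_inj (g ` S) k"
 shows "card (crs S (k \<circ> g)) \<le> card (crs S g) + card (crs (g ` S) k)"
 using card_crs_comp [OF assms] by linarith

lemma card_crs_comp_eq:
 assumes "interval_inj S g" "interval_inj (g ` S) k"
 shows "card (crs S (k \<circ> g)) = card (crs S g) + card (crs (g ` S) k) \<longleftrightarrow> double_crs S g k = {}"
proof -
 have "finite (double_crs S g k)"
  using assms by (auto intro: finite_subset [of _ "crs S g"] simp: double_crs_def interval_inj_def)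
 then show ?thesis
  using card_crs_comp [OF assms] by auto
qed

end

global_interpretation points: strand_order point_less "fst :: point => nat"
 defines crs = points.crs and interval_inj = points.interval_inj and double_crs = points.double_crs
  and blocked = points.blocked
 by unfold_locales (auto simp: point_less_def prod_eq_iff)

lemma crossings_grf: "crossings (grf S g) = (\<lambda>(u, v). ((u, g u), (v, g v))) ` crs S g"
 by (auto simp: crossings_def points.crs_def grf_def image_iff)

lemma inversions_grf: "inversions (grf S g) = card (crs S g)"
 unfolding inversions_def crossings_grf
 by (rule card_image) (auto simp: inj_on_def)

lemma resolve_grf:
 assumes "u \<in> S" "v \<in> S" "u \<noteq> v" "inj_on g S"
 shows "resolve (grf S g) ((u, g u), (v, g v)) = grf S (g \<circ> transpose u v)"
 using assms by (auto simp: resolve_def transpose_def grf_def image_iff inj_on_def split: if_splits)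

section \<open>Chains of strand diagrams\<close>

text \<open>Additive extension from basis elements; with coefficients in \<open>bit\<close> a chain
  is its support. The target is an arbitrary commutative monoid, so additivity asks that doubled
  values vanish.\<close>

definition lin :: "('a => 'b::comm_monoid_add) => ('a \<Rightarrow>\<^sub>0 bit) => 'b" where
 "lin F x = (\<Sum>a\<in>keys x. F a)"

lemma chain_double [simp]: "x + x = (0 :: 'a \<Rightarrow>\<^sub>0 bit)"
 by (rule poly_mapping_eqI) (simp add: lookup_add)

lemma chain_uminus [simp]: "- x = (x :: 'a \<Rightarrow>\<^sub>0 bit)"
 by (metis chain_double add_eq_0_iff)

lemma chain_minus [simp]: "x - y = (x + y :: 'a \<Rightarrow>\<^sub>0 bit)"
 by (metis chain_uminus diff_conv_add_uminus)

lemma chain_double' [simp]: "x + (x + y) = (y :: 'a \<Rightarrow>\<^sub>0 bit)"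
 by (metis add.assoc add_0 chain_double)

lemma chain_add_eq_0: "x + y = 0 \<longleftrightarrow> x = (y :: 'a \<Rightarrow>\<^sub>0 bit)"
 by (metis chain_uminus add_eq_0_iff)

lemma bit_nonzero: "b \<noteq> (0::bit) \<longleftrightarrow> b = 1"
 by (cases b) auto

lemma lookup_bit: "lookup x a = (if a \<in> keys x then 1 else (0::bit))"
 by (auto simp: in_keys_iff bit_nonzero)

lemma keys_add_bit: "keys (x + y :: 'a \<Rightarrow>\<^sub>0 bit) =
  (keys x - keys y) \<union> (keys y - keys x)"
 by (rule Set.set_eqI) (simp add: in_keys_iff lookup_add, auto simp: lookup_bit)

lemma keys_single_bit [simp]: "keys (single a (1::bit)) = {a}"
 by simp

lemma lin_single [simp]: "lin F (single a 1) = F a"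
 by (simp add: lin_def)

lemma lin_zero [simp]: "lin F 0 = 0"
 by (simp add: lin_def)

lemma lin_add:
 assumes "\<And>a. F a + F a = 0"
 shows "lin F (x + y) = lin F x + lin F y"
proof -
 let ?X = "keys x" and ?Y = "keys y"
 have "sum F ?X + sum F ?Y = (sum F (?X - ?Y) + sum F (?X \<inter> ?Y)) + (sum F (?Y - ?X) + sum F (?X \<inter> ?Y))"
  by (subst (1 2) sum.union_disjoint [symmetric]) (auto intro!: arg_cong2 [of _ _ _ _ "(+)"] sum.cong)
 also have "\<dots> = sum F (?X - ?Y) + sum F (?Y - ?X) + sum (\<lambda>a. F a + F a) (?X \<inter> ?Y)"
  by (simp add: sum.distrib algebra_simps)
 also have "\<dots> = sum F (?X - ?Y) + sum F (?Y - ?X)"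
  by (simp add: assms)
 also have "\<dots> = sum F (keys (x + y))"
  unfolding keys_add_bit by (rule sum.union_disjoint [symmetric]) auto
 finally show ?thesis by (simp add: lin_def)
qed

lemma lin_sum:
 assumes "\<And>a. F a + F a = 0"
 shows "lin F (\<Sum>i\<in>I. x i) = (\<Sum>i\<in>I. lin F (x i))"
 by (induction I rule: infinite_finite_induct) (simp_all add: lin_add [OF assms])

lemma lin_lin:
 assumes "\<And>a. F a + F a = 0"
 shows "lin F (lin G x) = lin (\<lambda>a. lin F (G a)) x"
 unfolding lin_def [of G] lin_sum [OF assms] by (simp add: lin_def)

lemma lin_swap: "lin (\<lambda>a. lin (F a) y) x = lin (\<lambda>b. lin (\<lambda>a. F a b) x) y"
 unfolding lin_def by (rule sum.swap)

lemma lin_fun_add: "lin (\<lambda>a. F a + G a) x = lin F x + lin G x"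
 by (simp add: lin_def sum.distrib)

lemma lin_cong: "(\<And>a. a \<in> keys x ==> F a = G a) ==> lin F x = lin G x"
 by (simp add: lin_def)

lemma lin_id [simp]: "lin (\<lambda>a. single a 1) x = (x :: 'a \<Rightarrow>\<^sub>0 bit)"
proof (rule poly_mapping_eqI)
 fix k
 have "lookup (lin (\<lambda>a. single a 1) x) k =
   (\<Sum>a\<in>keys x. if a = k then 1 else (0::bit))"
  by (simp add: lin_def lookup_sum lookup_single when_def)
 then show "lookup (lin (\<lambda>a. single a 1) x) k = lookup x k"
  by (simp add: lookup_bit)
qed

lemma keys_lin: "keys (lin (F :: 'a => 'b \<Rightarrow>\<^sub>0 bit) x) \<subseteq> (\<Union>a\<in>keys x. keys (F a))"
 unfolding lin_def by (rule Poly_Mapping.keys_sum)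

lemma chain_mult_lin: "chain_mult x y = lin (\<lambda>phi. lin (basis_mult phi) y) x"
 by (simp add: chain_mult_def lin_def)

lemma diff_lin: "diff = lin basis_diff"
 by (rule ext) (simp add: diff_def lin_def)

lemma chain_mult_add_left: "chain_mult (x + y) z = chain_mult x z + chain_mult y z"
 by (simp add: chain_mult_lin lin_add)

lemma chain_mult_add_right: "chain_mult x (y + z) = chain_mult x y + chain_mult x z"
 by (simp add: chain_mult_lin lin_add lin_fun_add)

lemma chain_mult_zero [simp]: "chain_mult 0 x = 0" "chain_mult x 0 = 0"
 by (simp_all add: chain_mult_def)

lemma chain_mult_single [simp]:
 "chain_mult (single phi 1) (single psi 1) = basis_mult phi psi"
 by (simp add: chain_mult_def)

lemma chain_mult_sum_left: "chain_mult (\<Sum>i\<in>I. x i) z = (\<Sum>i\<in>I. chain_mult (x i) z)"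
 by (induction I rule: infinite_finite_induct) (simp_all add: chain_mult_add_left)

lemma chain_mult_sum_right: "chain_mult z (\<Sum>i\<in>I. x i) = (\<Sum>i\<in>I. chain_mult z (x i))"
 by (induction I rule: infinite_finite_induct) (simp_all add: chain_mult_add_right)

lemma diff_add: "diff (x + y) = diff x + diff y"
 by (simp add: diff_lin lin_add)

lemma diff_zero [simp]: "diff 0 = 0"
 by (simp add: diff_def)

lemma diff_single [simp]: "diff (single phi 1) = basis_diff phi"
 by (simp add: diff_lin)

lemma diff_sum: "diff (\<Sum>i\<in>I. x i) = (\<Sum>i\<in>I. diff (x i))"
 by (induction I rule: infinite_finite_induct) (simp_all add: diff_add)

lemma sum_filter: 
 assumes "finite A"
 shows "(\<Sum>x\<in>A. if P x then f x else 0) = (\<Sum>x\<in>{x \<in> A. P x}. f x)"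
 using sum.inter_filter [OF assms, of f P] by simp

lemma image_comp_transpose: "u \<in> S ==> v \<in> S ==> (g \<circ> transpose u v) ` S = g ` S"
 by (simp only: image_comp [symmetric] transpose_image_eq)

lemma transpose_comm_inj:
 assumes "inj_on g S" "u \<in> S" "v \<in> S" "x \<in> S"
 shows "transpose (g u) (g v) (g x) = g (transpose u v x)"
 using assms by (auto simp: transpose_def inj_on_def)

section \<open>The Leibniz rule for strand diagrams\<close>

context strand_order
begin

lemma crs_cong: "(\<And>x. x \<in> S ==> g x = k x) ==> crs S g = crs S k"
 by (auto simp: crs_def)

lemma interval_inj_cong: "(\<And>x. x \<in> S ==> g x = k x) ==> interval_inj S g = interval_inj S k"
 by (simp add: interval_inj_def cong: inj_on_cong)

text \<open>Each factor either keeps or reverses the order of two strands, so the composite reverses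
  it exactly when one factor does and the other does not. The disjunction covers both orders of the
  two strands in the middle.\<close>

lemma crs_comp_iff:
 assumes "interval_inj S g" "interval_inj (g ` S) k" "u \<in> S" "v \<in> S" "less u v"
 shows "(u, v) \<in> crs S (k \<circ> g) \<longleftrightarrow> ((u, v) \<in> crs S g) \<noteq> ((g u, g v) \<in> crs (g ` S) k \<or> (g v, g u) \<in> crs (g ` S) k)"
proof -
 have "part (g u) = part (g v)" "part (k (g u)) = part (k (g v))" "u \<noteq> v"
  using assms less_part [of u v] by (auto simp: interval_inj_def)
 moreover have "g u \<noteq> g v" "k (g u) \<noteq> k (g v)"
  using assms \<open>u \<noteq> v\<close> unfolding interval_inj_def inj_on_def by blast+
 ultimately have "less (g u) (g v) \<or> less (g v) (g u)"
  "less (k (g u)) (k (g v)) \<or> less (k (g v)) (k (g u))"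
  using comparable by blast+
 then show ?thesis
  using assms by (auto simp: crs_def dest: less_asym)
qed

definition fmult :: "'a set => ('a => 'a) => 'a set => ('a => 'a) => ('a \<times> 'a) set \<Rightarrow>\<^sub>0 bit" where
 "fmult S g T k =
  (if T = g ` S \<and> card (crs S (k \<circ> g)) = card (crs S g) + card (crs T k)
  then single (grf S (k \<circ> g)) 1 else 0)"

definition covers_of :: "'a set => ('a => 'a) => ('a \<times> 'a) set" where
 "covers_of S g = {(u, v) \<in> crs S g. card (crs S (g \<circ> transpose u v)) + 1 = card (crs S g)}"

text \<open>All three sums become sums over pairs u < v of the same term, the composite with the
  ends of u and v exchanged, under the same condition that its length is one less than the sum of
  the lengths of the factors. The remaining conditions, crossing in the composite, in g and in k,
  are related by exclusive or, which is addition mod 2; a pair crossing in both factors contributes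
  twice on the right and cancels.\<close>

lemma fleibniz:
 assumes i: "interval_inj S g" "interval_inj T k"
 shows "(if T = g ` S \<and> card (crs S (k \<circ> g)) = card (crs S g) + card (crs T k)
   then \<Sum>(u, v)\<in>covers_of S (k \<circ> g). single (grf S (k \<circ> g \<circ> transpose u v)) (1::bit) else 0) =
  (\<Sum>(u, v)\<in>covers_of S g. fmult S (g \<circ> transpose u v) T k) +
  (\<Sum>(u, v)\<in>covers_of T k. fmult S g T (k \<circ> transpose u v))" (is "?L = ?L1 + ?L2")
proof -
 have trS: "(g \<circ> transpose u v) ` S = g ` S" if "(u, v) \<in> crs S g" for u v
  using that image_comp_transpose [of u S v g] by (simp add: crs_def del: image_comp)
 show ?thesis
 proof (cases "T = g ` S")
  case False
  have "(\<Sum>(u, v)\<in>covers_of S g. fmult S (g \<circ> transpose u v) T k) = 0"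
   by (rule sum.neutral) (use False trS in \<open>auto simp: fmult_def covers_of_def simp del: image_comp\<close>)
  moreover have "(\<Sum>(u, v)\<in>covers_of T k. fmult S g T (k \<circ> transpose u v)) = 0"
   by (rule sum.neutral) (use False in \<open>auto simp: fmult_def\<close>)
  ultimately show ?thesis using False by simp
 next
  case T: True
  have finS: "finite S" and finT: "finite T" using i by (auto simp: interval_inj_def)
  have ig: "inj_on g S" using i by (simp add: interval_inj_def)
  have ik: "interval_inj (g ` S) k" using i T by simp
  let ?P = "{(u, v). u \<in> S \<and> v \<in> S \<and> less u v}"
  let ?Q = "{(a, b). a \<in> T \<and> b \<in> T \<and> less a b}"
  let ?N = "card (crs S g) + card (crs T k)"
  let ?chi = "\<lambda>(u, v). single (grf S (k \<circ> g \<circ> transpose u v)) (1::bit)"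
  let ?I = "\<lambda>(u, v). card (crs S (k \<circ> g \<circ> transpose u v))"
  \<comment> \<open>\<open>?s\<close> sends a pair of starts to the corresponding middle points in
    increasing order, since g may reverse them.\<close>
  let ?s = "\<lambda>(u, v). if less (g u) (g v) then (g u, g v) else (g v, g u)"
  have finP: "finite ?P" by (rule finite_subset [of _ "S \<times> S"]) (use finS in auto)
  have finQ: "finite ?Q" by (rule finite_subset [of _ "T \<times> T"]) (use finT in auto)
  have le: "card (crs S (k \<circ> g)) \<le> ?N"
   using card_crs_comp_le [OF i(1) ik] T by simp
  have ikg: "interval_inj S (k \<circ> g)" using interval_inj_comp [OF i(1) ik] .
  have A: "?L = (\<Sum>c\<in>?P. if c \<in> crs S (k \<circ> g) \<and> ?I c + 1 = ?N then ?chi c else 0)"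
  proof (cases "card (crs S (k \<circ> g)) = ?N")
   case True
   then have "?L = (\<Sum>(u, v)\<in>covers_of S (k \<circ> g). single (grf S (k \<circ> g \<circ> transpose u v)) 1)"
    using T by (simp del: image_comp)
   also have "\<dots> = (\<Sum>c\<in>{c \<in> ?P. c \<in> crs S (k \<circ> g) \<and> ?I c + 1 = ?N}. ?chi c)"
    by (rule sum.cong) (use True in \<open>auto simp: crs_def covers_of_def\<close>)
   finally show ?thesis unfolding sum_filter [OF finP] .
  next
   case False
   \<comment> \<open>If the product vanishes, the composite is already shorter than
     \<open>?N\<close>, and exchanging ends at one of its crossings shortens it further, so the
     length \<open>?N - 1\<close> is out of reach.\<close>
   have "\<not> (c \<in> crs S (k \<circ> g) \<and> ?I c + 1 = ?N)" if "c \<in> ?P" for c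
    using crs_transpose_less [OF ikg, of "fst c" "snd c"] le False
    by (cases c) (auto simp: comp_assoc)
   then have "(\<Sum>c\<in>?P. if c \<in> crs S (k \<circ> g) \<and> ?I c + 1 = ?N then ?chi c else 0) = 0"
    by (intro sum.neutral) auto
   then show ?thesis using False T by (simp del: image_comp)
  qed
  have B: "(\<Sum>(u, v)\<in>covers_of S g. fmult S (g \<circ> transpose u v) T k) =
    (\<Sum>c\<in>?P. if c \<in> crs S g \<and> ?I c + 1 = ?N then ?chi c else 0)"
  proof -
   \<comment> \<open>A resolution shortens g by at least one and length is subadditive under
     composition. Hence a composite of length \<open>?N - 1\<close> forces both a drop by exactly
     one and a nonzero product.\<close>
   have "fmult S (g \<circ> transpose u v) T k = 
     (if ?I (u, v) + 1 = ?N then ?chi (u, v) else 0)"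
    "?I (u, v) + 1 = ?N ==> card (crs S (g \<circ> transpose u v)) + 1 = card (crs S g)"
    if c: "(u, v) \<in> crs S g" and "card (crs S (g \<circ> transpose u v)) + 1 = card (crs S g) \<or> ?I (u, v) + 1 = ?N" for u v
   proof -
    have uv: "u \<in> S" "v \<in> S" "part u = part v" using c less_part by (auto simp: crs_def)
    have "interval_inj S (g \<circ> transpose u v)" 
     using interval_inj_transpose [OF i(1) uv] .
    moreover have "interval_inj ((g \<circ> transpose u v) ` S) k" using ik trS [OF c] by simp
    ultimately have "?I (u, v) \<le> card (crs S (g \<circ> transpose u v)) + card (crs T k)"
     using card_crs_comp_le [of S "g \<circ> transpose u v" k] trS [OF c] T by (simp add: comp_assoc)
    moreover have "card (crs S (g \<circ> transpose u v)) < card (crs S g)"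
     using crs_transpose_less [OF i(1) c] .
    moreover have "fmult S (g \<circ> transpose u v) T k =
      (if ?I (u, v) = card (crs S (g \<circ> transpose u v)) + card (crs T k) then ?chi (u, v) else 0)"
     using trS [OF c] T by (simp add: fmult_def comp_assoc del: image_comp)
    ultimately show "?I (u, v) + 1 = ?N ==> card (crs S (g \<circ> transpose u v)) + 1 = card (crs S g)"
     "fmult S (g \<circ> transpose u v) T k = (if ?I (u, v) + 1 = ?N then ?chi (u, v) else 0)"
     using that by auto
   qed
   note h = this
   have fin: "finite (covers_of S g)"
    by (rule finite_subset [of _ "crs S g"]) (use finS in \<open>auto simp: covers_of_def\<close>)
   have crsP: "c \<in> ?P" if "c \<in> crs S g" for c
    using that by (auto simp: crs_def)
   have "?L1 = (\<Sum>c\<in>covers_of S g. if ?I c + 1 = ?N then ?chi c else 0)"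
   proof (rule sum.cong [OF refl])
    fix c assume "c \<in> covers_of S g"
    then obtain u v where c: "c = (u, v)" "(u, v) \<in> crs S g" "card (crs S (g \<circ> transpose u v)) + 1 = card (crs S g)"
     by (auto simp: covers_of_def)
    show "(case c of (u, v) => fmult S (g \<circ> transpose u v) T k) = (if ?I c + 1 = ?N then ?chi c else 0)"
     unfolding c(1) prod.case using h(1) [OF c(2)] c(3) by simp
   qed
   also have "\<dots> = (\<Sum>c\<in>{c \<in> covers_of S g. ?I c + 1 = ?N}. ?chi c)"
    by (rule sum_filter [OF fin])
   also have "{c \<in> covers_of S g. ?I c + 1 = ?N} = {c \<in> ?P. c \<in> crs S g \<and> ?I c + 1 = ?N}"
   proof (rule Collect_cong)
    fix c show "(c \<in> covers_of S g \<and> ?I c + 1 = ?N) = (c \<in> ?P \<and> c \<in> crs S g \<and> ?I c + 1 = ?N)"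
     using h(2) [of "fst c" "snd c"] crsP [of c] by (cases c) (auto simp: covers_of_def)
   qed
   finally show ?thesis
    unfolding sum_filter [OF finP] .
  qed
  have bij: "bij_betw ?s ?P ?Q"
  proof (rule bij_betwI')
   fix c d assume "c \<in> ?P" "d \<in> ?P"
   then obtain u v u' v' where "c = (u, v)" "d = (u', v')" "u \<in> S" "v \<in> S" "u' \<in> S" "v' \<in> S" 
    "less u v" "less u' v'" by auto
   then show "(?s c = ?s d) = (c = d)"
    using inj_on_eq_iff [OF ig] by (auto dest: less_asym split: if_splits)
  next
   fix c assume "c \<in> ?P"
   then obtain u v where c: "c = (u, v)" "u \<in> S" "v \<in> S" "less u v" by auto
   then have "part (g u) = part (g v)" "u \<noteq> v" using i less_part [of u v] by (auto simp: interval_inj_def)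
   then have "less (g u) (g v) \<or> less (g v) (g u)"
    using comparable [of "g u" "g v"] ig c by (auto simp: inj_on_eq_iff)
   then show "?s c \<in> ?Q" using c T by auto
  next
   fix d assume "d \<in> ?Q"
   then obtain u v where d: "d = (g u, g v)" "u \<in> S" "v \<in> S" "less (g u) (g v)" using T by auto
   then have "part u = part v" "u \<noteq> v" using i less_part [of "g u" "g v"] by (auto simp: interval_inj_def)
   then have "less u v \<or> less v u" using comparable by blast
   then show "\<exists>c\<in>?P. d = ?s c"
   proof
    assume "less u v" then show ?thesis using d by (intro bexI [of _ "(u, v)"]) auto
   next
    assume "less v u" then show ?thesis using d less_asym by (intro bexI [of _ "(v, u)"]) auto
   qed
  qed
  have s: "\<And>c. c \<in> ?P ==> fmult S g T ((k \<circ> transpose (fst (?s c)) (snd (?s c)))) =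
    (if ?I c = card (crs S g) + card (crs T (k \<circ> transpose (fst (?s c)) (snd (?s c)))) then ?chi c else 0)"
   and sI: "\<And>c. c \<in> ?P ==> ?I c \<le> card (crs S g) + card (crs T (k \<circ> transpose (fst (?s c)) (snd (?s c))))"
  proof -
   fix c assume "c \<in> ?P"
   then obtain u v where c: "c = (u, v)" "u \<in> S" "v \<in> S" "less u v" by auto
   let ?t = "transpose (fst (?s c)) (snd (?s c))"
   have t: "?t = transpose (g u) (g v)" using c by (auto simp: transpose_commute)
   have eq: "(k \<circ> ?t \<circ> g) x = (k \<circ> g \<circ> transpose u v) x" if "x \<in> S" for x
    unfolding t using transpose_comm_inj [OF ig c(2,3) that] by simp
   have eq': "grf S (k \<circ> ?t \<circ> g) = grf S (k \<circ> g \<circ> transpose u v)"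
    "crs S (k \<circ> ?t \<circ> g) = crs S (k \<circ> g \<circ> transpose u v)"
    using eq by (auto intro!: grf_eqI crs_cong simp del: comp_apply)
   have "interval_inj (g ` S) (k \<circ> ?t)"
    unfolding t using c i(1) ik
    by (intro interval_inj_transpose) (auto simp: interval_inj_def dest: less_part)
   from card_crs_comp_le [OF i(1) this]
   show "?I c \<le> card (crs S g) + card (crs T (k \<circ> ?t))"
    using eq' c(1) T by simp
   show "fmult S g T ((k \<circ> ?t)) = (if ?I c = card (crs S g) + card (crs T (k \<circ> ?t)) then ?chi c else 0)"
    unfolding fmult_def using eq' c(1) T by simp
  qed
  have C: "(\<Sum>(u, v)\<in>covers_of T k. fmult S g T (k \<circ> transpose u v)) =
    (\<Sum>c\<in>?P. if ?s c \<in> crs T k \<and> ?I c + 1 = ?N then ?chi c else 0)"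
  proof -
   have "(\<Sum>(u, v)\<in>covers_of T k. fmult S g T (k \<circ> transpose u v)) =
    (\<Sum>d\<in>?Q. if d \<in> crs T k \<and> card (crs T (k \<circ> transpose (fst d) (snd d))) + 1 = card (crs T k) then
     fmult S g T ((k \<circ> transpose (fst d) (snd d))) else 0)"
    unfolding sum_filter [OF finQ] by (rule sum.cong) (auto simp: crs_def covers_of_def)
   also have "\<dots> = (\<Sum>c\<in>?P. if ?s c \<in> crs T k \<and> card (crs T (k \<circ> transpose (fst (?s c)) (snd (?s c)))) + 1 = card (crs T k) then
     fmult S g T ((k \<circ> transpose (fst (?s c)) (snd (?s c)))) else 0)"
    by (rule sum.reindex_bij_betw [OF bij, symmetric])
   also have "\<dots> = (\<Sum>c\<in>?P. if ?s c \<in> crs T k \<and> ?I c + 1 = ?N then ?chi c else 0)"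
   proof (rule sum.cong [OF refl])
    fix c assume c: "c \<in> ?P"
    show "(if ?s c \<in> crs T k \<and> card (crs T (k \<circ> transpose (fst (?s c)) (snd (?s c)))) + 1 = card (crs T k) then
     fmult S g T ((k \<circ> transpose (fst (?s c)) (snd (?s c)))) else 0) = 
     (if ?s c \<in> crs T k \<and> ?I c + 1 = ?N then ?chi c else 0)"
    proof (cases "?s c \<in> crs T k")
     case True
     have "card (crs T (k \<circ> transpose (fst (?s c)) (snd (?s c)))) < card (crs T k)"
      by (rule crs_transpose_less [OF i(2)]) (use True in simp)
     then show ?thesis
      using True s [OF c] sI [OF c] by (cases "?I c + 1 = ?N") (auto simp del: split_paired_All)
    qed simp
   qed
   finally show ?thesis .
  qed
  show ?thesis unfolding A B C sum.distrib [symmetric]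
  proof (rule sum.cong [OF refl])
   fix c assume "c \<in> ?P"
   then obtain u v where c: "c = (u, v)" "u \<in> S" "v \<in> S" "less u v" by auto
   have "c \<in> crs S (k \<circ> g) \<longleftrightarrow> (c \<in> crs S g) \<noteq> (?s c \<in> crs T k)"
    using crs_comp_iff [OF i(1) ik c(2-4)] c(1) T less_asym
    by (auto simp: crs_def)
   then show "(if c \<in> crs S (k \<circ> g) \<and> ?I c + 1 = ?N then ?chi c else 0) =
    (if c \<in> crs S g \<and> ?I c + 1 = ?N then ?chi c else 0) + (if ?s c \<in> crs T k \<and> ?I c + 1 = ?N then ?chi c else 0)"
    by (auto split: prod.splits)
  qed
 qed
qed

end

text \<open>Strands are not required to move upwards here, so that permutations are available.\<close>

definition matchings :: "strands set" where
 "matchings = {grf S g | S g. interval_inj S g}"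

lemma grf_matchings [intro]: "interval_inj S g ==> grf S g \<in> matchings"
 by (auto simp: matchings_def)

section \<open>Associativity, the Leibniz rule and the square of the differential on chains\<close>

lemma basis_mult_grf:
 "basis_mult (grf S g) (grf T k) =
  (if T = g ` S \<and> card (crs S (k \<circ> g)) = card (crs S g) + card (crs T k)
  then single (grf S (k \<circ> g)) 1 else 0)"
 by (auto simp: basis_mult_def grf_comp inversions_grf)

lemma basis_diff_grf:
 assumes "interval_inj S g"
 shows "basis_diff (grf S g) =
  (\<Sum>(u, v)\<in>{(u, v) \<in> crs S g. card (crs S (g \<circ> transpose u v)) + 1 = card (crs S g)}.
   single (grf S (g \<circ> transpose u v)) 1)"
proof -
 let ?j = "\<lambda>(u, v). ((u, g u), (v, g v))"
 let ?A = "{(u, v) \<in> crs S g. card (crs S (g \<circ> transpose u v)) + 1 = card (crs S g)}"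
 have res: "resolve (grf S g) (?j c) = grf S (g \<circ> transpose (fst c) (snd c))" if "c \<in> crs S g" for c
 proof -
  obtain u v where c: "c = (u, v)" by (cases c)
  then have "u \<in> S" "v \<in> S" "u \<noteq> v" "inj_on g S"
   using that assms by (auto simp: points.crs_def points.interval_inj_def simp del: split_paired_All)
  then show ?thesis unfolding c using resolve_grf by simp
 qed
 have "{c \<in> crossings (grf S g). inversions (resolve (grf S g) c) + 1 = inversions (grf S g)} =
   ?j ` {c \<in> crs S g. inversions (resolve (grf S g) (?j c)) + 1 = inversions (grf S g)}"
  unfolding crossings_grf by (rule Compr_image_eq)
 also have "{c \<in> crs S g. inversions (resolve (grf S g) (?j c)) + 1 = inversions (grf S g)} = ?A"
  using res by (auto simp: inversions_grf)
 finally have set: "{c \<in> crossings (grf S g). inversions (resolve (grf S g) c) + 1 = inversions (grf S g)} = ?j ` ?A" .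
 have inj: "inj_on ?j ?A" by (auto simp: inj_on_def)
 show ?thesis
  unfolding basis_diff_def set sum.reindex [OF inj]
  by (rule sum.cong) (use res in \<open>auto simp del: split_paired_All\<close>)
qed

text \<open>Length is subadditive under composition, so each bracketing is nonzero exactly when the
  length of the triple composite is the sum of the three lengths.\<close>

lemma basis_mult_assoc:
 assumes "phi \<in> matchings" "psi \<in> matchings" "\<rho> \<in> matchings"
 shows "lin (\<lambda>chi. basis_mult chi \<rho>) (basis_mult phi psi) = lin (basis_mult phi) (basis_mult psi \<rho>)"
proof -
 obtain S g T k R m where e: "phi = grf S g" "psi = grf T k" "\<rho> = grf R m"
  and i: "interval_inj S g" "interval_inj T k" "interval_inj R m"
  using assms by (auto simp: matchings_def)
 show ?thesis
 proof (cases "T = g ` S \<and> R = k ` T")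
  case True
  then have T: "T = g ` S" and R: "R = k ` g ` S" "R = (k \<circ> g) ` S" by (auto simp: image_comp)
  have "interval_inj (g ` S) k" "interval_inj (k ` g ` S) m" using i T R by auto
  note le = points.card_crs_comp_le
  have "card (crs S (k \<circ> g)) \<le> card (crs S g) + card (crs T k)"
   "card (crs T (m \<circ> k)) \<le> card (crs T k) + card (crs R m)"
   "card (crs S (m \<circ> (k \<circ> g))) \<le> card (crs S (k \<circ> g)) + card (crs R m)"
   "card (crs S ((m \<circ> k) \<circ> g)) \<le> card (crs S g) + card (crs T (m \<circ> k))"
   using i T R points.interval_inj_comp by (metis le)+
  then show ?thesis
   unfolding e by (auto simp: basis_mult_grf T R image_comp comp_assoc)
 next
  case False
  have "basis_mult (grf S g) (grf T l) = 0" if "T \<noteq> g ` S" for l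
   using that by (simp add: basis_mult_grf)
  moreover have "basis_mult (grf S (k \<circ> g)) (grf R m) = 0" if "R \<noteq> k ` T" "T = g ` S"
   using that by (simp add: basis_mult_grf image_comp)
  ultimately show ?thesis
   unfolding e basis_mult_grf [of S g T k] basis_mult_grf [of T k R m] using False by (cases "T = g ` S") auto
 qed
qed

definition mchains :: "chain set" where
 "mchains = {x. keys x \<subseteq> matchings}"

lemma mem_mchains: "x \<in> mchains ==> phi \<in> keys x ==> phi \<in> matchings"
 by (auto simp: mchains_def)

lemma chain_mult_assoc:
 assumes "x \<in> mchains" "y \<in> mchains" "z \<in> mchains"
 shows "chain_mult (chain_mult x y) z = chain_mult x (chain_mult y z)"
proof -
 have "chain_mult (chain_mult x y) z = lin (\<lambda>phi. lin (\<lambda>psi. lin (\<lambda>chi. lin (basis_mult chi) z) (basis_mult phi psi)) y) x"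
  by (simp add: chain_mult_lin lin_lin)
 also have "\<dots> = lin (\<lambda>phi. lin (\<lambda>psi. lin (\<lambda>\<rho>. lin (basis_mult phi) (basis_mult psi \<rho>)) z) y) x"
  using assms
  by (auto simp: lin_swap [of basis_mult z] mchains_def intro!: lin_cong basis_mult_assoc)
 also have "\<dots> = chain_mult x (chain_mult y z)"
  by (simp add: chain_mult_lin lin_lin)
 finally show ?thesis .
qed

lemma basis_diff_lin:
 "interval_inj S g ==> basis_diff (grf S g) =
  (\<Sum>(u, v)\<in>points.covers_of S g. single (grf S (g \<circ> transpose u v)) 1)"
 by (simp add: basis_diff_grf points.covers_of_def)

lemma basis_leibniz:
 assumes "phi \<in> matchings" "psi \<in> matchings"
 shows "diff (basis_mult phi psi) = lin (\<lambda>chi. basis_mult chi psi) (basis_diff phi) + lin (basis_mult phi) (basis_diff psi)"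
proof -
 obtain S g T k where e: "phi = grf S g" "psi = grf T k"
  and i: "interval_inj S g" "interval_inj T k"
  using assms by (auto simp: matchings_def)
 have f: "basis_mult (grf S a) (grf T b) = points.fmult S a T b" for a b
  by (simp only: basis_mult_grf points.fmult_def)
 have "interval_inj S (k \<circ> g)" if "T = g ` S"
  using points.interval_inj_comp i that by blast
 then have "diff (basis_mult phi psi) = (if T = g ` S \<and> card (crs S (k \<circ> g)) = card (crs S g) + card (crs T k)
   then \<Sum>(u, v)\<in>points.covers_of S (k \<circ> g). single (grf S (k \<circ> g \<circ> transpose u v)) (1::bit) else 0)"
  unfolding e basis_mult_grf by (simp add: basis_diff_lin)
 also have "\<dots> = lin (\<lambda>chi. basis_mult chi psi) (basis_diff phi) + lin (basis_mult phi) (basis_diff psi)"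
  unfolding points.fleibniz [OF i] e basis_diff_lin [OF i(1)] basis_diff_lin [OF i(2)]
  by (simp add: lin_sum f case_prod_unfold)
 finally show ?thesis .
qed

lemma leibniz:
 assumes "x \<in> mchains" "y \<in> mchains"
 shows "diff (chain_mult x y) = chain_mult (diff x) y + chain_mult x (diff y)"
proof -
 have "diff (chain_mult x y) = lin (\<lambda>phi. lin (\<lambda>psi. diff (basis_mult phi psi)) y) x"
  by (simp add: chain_mult_lin diff_lin lin_lin)
 also have "\<dots> = lin (\<lambda>phi. lin (\<lambda>psi. lin (\<lambda>chi. basis_mult chi psi) (basis_diff phi) + lin (basis_mult phi) (basis_diff psi)) y) x"
  using assms by (auto simp: mchains_def intro!: lin_cong basis_leibniz)
 also have "\<dots> = lin (\<lambda>phi. lin (\<lambda>chi. lin (basis_mult chi) y) (basis_diff phi)) x + lin (\<lambda>phi. lin (\<lambda>psi. lin (basis_mult phi) (basis_diff psi)) y) x"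
  by (simp add: lin_fun_add lin_swap [of basis_mult y])
 also have "\<dots> = chain_mult (diff x) y + chain_mult x (diff y)"
  by (simp add: chain_mult_lin diff_lin lin_lin)
 finally show ?thesis .
qed

lemma basis_diff_matchings: "phi \<in> matchings ==> basis_diff phi \<in> mchains"
proof -
 assume "phi \<in> matchings"
 then obtain S g where e: "phi = grf S g" "interval_inj S g" by (auto simp: matchings_def)
 have "grf S (g \<circ> transpose u v) \<in> matchings" if "(u, v) \<in> crs S g" for u v
  using that by (intro grf_matchings points.interval_inj_transpose [OF e(2)]) (auto simp: points.crs_def point_less_def)
 then show ?thesis
  unfolding e basis_diff_grf [OF e(2)] mchains_def
  by (auto dest!: subsetD [OF Poly_Mapping.keys_sum] split: prod.splits)
qed

lemma basis_mult_matchings: 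
 assumes "phi \<in> matchings" "psi \<in> matchings"
 shows "basis_mult phi psi \<in> mchains"
proof -
 obtain S g T k where e: "phi = grf S g" "psi = grf T k" 
  and i: "interval_inj S g" "interval_inj T k"
  using assms by (auto simp: matchings_def)
 have "grf S (k \<circ> g) \<in> matchings" if "T = g ` S"
  using points.interval_inj_comp i that by blast
 then show ?thesis unfolding e basis_mult_grf by (simp add: mchains_def)
qed

lemma mchains_lin:
 assumes "\<And>a. a \<in> keys x ==> F a \<in> mchains"
 shows "lin F x \<in> mchains"
 using assms keys_lin [of F x] unfolding mchains_def by blast

lemma diff_mchains: "x \<in> mchains ==> diff x \<in> mchains"
 unfolding diff_lin by (rule mchains_lin) (intro basis_diff_matchings mem_mchains)

lemma chain_mult_mchains: "x \<in> mchains ==> y \<in> mchains ==> chain_mult x y \<in> mchains"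
 unfolding chain_mult_lin 
 by (intro mchains_lin basis_mult_matchings; erule (1) mem_mchains)

text \<open>Among all crossings take one whose starts are closest. A strand starting in between
  would end below the end of u and cross u, or above it and cross v; either crossing would be
  closer.\<close>

lemma adjacent_crossing:
 assumes i: "interval_inj S g" and ne: "crs S g \<noteq> {}"
 shows "\<exists>u v. (u, v) \<in> crs S g \<and> (\<forall>w\<in>S. \<not> (point_less u w \<and> point_less w v))"
proof -
 obtain c where c: "c \<in> crs S g" and min: "\<And>d. d \<in> crs S g ==> snd (snd c) - snd (fst c) \<le> snd (snd d) - snd (fst d)"
 proof -
  obtain c0 where "c0 \<in> crs S g" using ne by (meson ex_in_conv)
  then show thesis
   using that ex_has_least_nat [of "\<lambda>c. c \<in> crs S g" c0 "\<lambda>c. snd (snd c) - snd (fst c)"] by (metis (no_types, lifting))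
 qed
 obtain u v where uv: "c = (u, v)" by (cases c)
 have False if w: "w \<in> S" "point_less u w" "point_less w v" for w
 proof -
  have h: "u \<in> S" "v \<in> S" "point_less (g v) (g u)" using c uv by (auto simp: points.crs_def)
  have "fst (g w) = fst (g u)" using i w h by (auto simp: points.interval_inj_def point_less_def)
  moreover have "g w \<noteq> g u" using i w h points.less_irrefl unfolding points.interval_inj_def inj_on_def by blast
  ultimately have "point_less (g w) (g u) \<or> point_less (g u) (g w)" using points.comparable by blast
  then have "(u, w) \<in> crs S g \<or> (w, v) \<in> crs S g"
   using h w points.less_trans [of "g v" "g u" "g w"] by (auto simp: points.crs_def simp del: split_paired_All)
  then show False using min [of "(u, w)"] min [of "(w, v)"] w uv by (auto simp: point_less_def)
 qed
 then show ?thesis using c uv by blast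
qed

text \<open>A permutation of positive length is a simple transposition times a shorter one, so the
 Leibniz rule reduces the claim to simple transpositions.\<close>

lemma diff_diff_basis: "phi \<in> matchings ==> diff (basis_diff phi) = 0"
proof -
 assume "phi \<in> matchings"
 then obtain S g where e: "phi = grf S g" "interval_inj S g" by (auto simp: matchings_def)
 have "interval_inj S g ==> diff (basis_diff (grf S g)) = 0"
 proof (induction "card (crs S g)" arbitrary: g rule: less_induct)
  case less
  note i = less.prems
  have fin: "finite S" using i by (simp add: points.interval_inj_def)
  show ?case
  proof (cases "crs S g = {}")
   case True
   then show ?thesis by (simp add: basis_diff_grf [OF i])
  next
   case False
   obtain u v where uv: "(u, v) \<in> crs S g" and adj: "\<And>w. w \<in> S ==> \<not> (point_less u w \<and> point_less w v)"
    using adjacent_crossing [OF i False] by blast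
   have h: "u \<in> S" "v \<in> S" "point_less u v" "fst u = fst v" using uv by (auto simp: points.crs_def point_less_def)
   let ?t = "transpose u v" and ?g = "g \<circ> transpose u v"
   have ids: "interval_inj S id" using fin by (simp add: points.interval_inj_def)
   have it: "interval_inj S ?t"
    using points.interval_inj_transpose [OF ids h(1,2,4)] by simp
   have ig: "interval_inj S ?g" using points.interval_inj_transpose [OF i h(1,2,4)] .
   have crsid: "crs S id = {}" by (auto simp: points.crs_def dest: points.less_asym)
   have uvt: "(u, v) \<in> crs S ?t" using h by (auto simp: points.crs_def)
   have tt: "?t \<circ> transpose u v = id" by (rule ext) simp
   have "card (crs S (?t \<circ> transpose u v)) + 1 = card (crs S ?t)"
    by (subst points.crs_transpose_Suc [OF it uvt]) (use adj in \<open>auto simp: points.blocked_def\<close>)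
   then have card1: "card (crs S ?t) = 1" by (simp add: tt crsid)
   then have crst: "crs S ?t = {(u, v)}"
    using uvt by (metis card_1_singletonE singletonD)
   have card2: "card (crs S ?g) + 1 = card (crs S g)"
    by (subst points.crs_transpose_Suc [OF i uv]) (use adj in \<open>auto simp: points.blocked_def\<close>)
   have im: "?t ` S = S" using h by simp
   have gt: "?g \<circ> ?t = g" by (rule ext) simp
   \<comment> \<open>The simple transposition has length one and the other factor has one crossing
     less than g, so lengths add and the product is not zero.\<close>
   have "basis_mult (grf S ?t) (grf S ?g) = single (grf S g) 1"
    unfolding basis_mult_grf gt using im card1 card2 by simp
   then have m: "single (grf S g) 1 = 
     chain_mult (single (grf S ?t) 1) (single (grf S ?g) 1)"
    by simp
   have M: "single (grf S ?t) 1 \<in> mchains" "single (grf S ?g) 1 \<in> mchains"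
    using it ig by (auto simp: mchains_def)
   have "{(a, b). (a, b) \<in> crs S ?t \<and> card (crs S (?t \<circ> transpose a b)) + 1 = card (crs S ?t)} = {(u, v)}"
    using card1 by (auto simp: crst tt crsid)
   then have "basis_diff (grf S ?t) = single (grf S id) 1"
    using basis_diff_grf [OF it] tt by simp
   then have 1: "diff (basis_diff (grf S ?t)) = 0"
    using basis_diff_grf [OF ids] by (simp add: crsid)
   have 2: "diff (basis_diff (grf S ?g)) = 0"
    using less.hyps [OF _ ig] card2 by simp
   \<comment> \<open>The mixed term, the product of the two first differentials, arises twice and
     cancels.\<close>
   have "diff (diff (single (grf S g) 1)) = 0"
    unfolding m using M 1 2 by (simp only: leibniz diff_mchains diff_add chain_mult_mchains)
     (simp add: add.assoc)
   then show ?thesis by simp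
  qed
 qed
 then show ?thesis using e by simp
qed

lemma diff_diff: "x \<in> mchains ==> diff (diff x) = 0"
proof -
 assume x: "x \<in> mchains"
 have "diff (diff x) = lin (\<lambda>phi. diff (basis_diff phi)) x"
  by (simp add: diff_lin lin_lin)
 also have "\<dots> = lin (\<lambda>_. 0) x"
  using x by (intro lin_cong) (auto simp: mchains_def diff_diff_basis)
 finally show ?thesis by (simp add: lin_def)
qed

section \<open>The strand algebra as a space of invariant chains\<close>

lemma finite_points [simp]: "finite (points Z)"
proof -
 have "points Z \<subseteq> (\<Union>i<length (place_counts Z). {i} \<times> {..place_counts Z ! i + 1})"
  by (auto simp: points_def)
 then show ?thesis by (rule finite_subset) auto
qed

lemma strand_diagramD:
 assumes "strand_diagram Z phi" "(x, y) \<in> phi"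
 shows "x \<in> points Z" "y \<in> points Z" "point_le x y"
 using assms by (auto simp: strand_diagram_def)

lemma strand_diagram_unique:
 assumes "strand_diagram Z phi" "(x, y) \<in> phi"
 shows "(x, z) \<in> phi \<longleftrightarrow> z = y" "(z, y) \<in> phi \<longleftrightarrow> z = x"
 using assms unfolding strand_diagram_def single_valued_def converse_iff by blast+

lemma strand_diagram_finite [simp]: "strand_diagram Z phi ==> finite phi"
 by (rule finite_subset [of _ "points Z \<times> points Z"]) (auto simp: strand_diagram_def)

lemma single_valued_grf:
 assumes "single_valued phi"
 obtains g where "phi = grf (Domain phi) g" "\<And>x y. (x, y) \<in> phi ==> y = g x"
proof -
 define g where "g x = (THE y. (x, y) \<in> phi)" for x
 have g: "y = g x" if "(x, y) \<in> phi" for x y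
  unfolding g_def using assms that by (intro the_equality [symmetric]) (auto dest: single_valuedD)
 have "c \<in> phi \<longleftrightarrow> c \<in> grf (Domain phi) g" for c
  using g by (cases c) (auto simp: Domain_iff)
 then show ?thesis using g that by blast
qed

lemma strand_diagram_matchings:
 assumes "strand_diagram Z phi"
 shows "phi \<in> matchings"
proof -
 have sv: "single_valued phi" "single_valued (phi\<inverse>)" using assms by (auto simp: strand_diagram_def)
 obtain g where g: "phi = grf (Domain phi) g" "\<And>x y. (x, y) \<in> phi ==> y = g x"
  using single_valued_grf [OF sv(1)] by blast
 have "finite (Domain phi)" using assms by (simp add: finite_Domain)
 moreover have "inj_on g (Domain phi)"
 proof (rule inj_onI)
  fix x y assume "x \<in> Domain phi" "y \<in> Domain phi" "g x = g y"
  then have "(x, g x) \<in> phi" "(y, g x) \<in> phi" using g(2) by (metis DomainE)+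
  then show "x = y" using sv(2) by (meson converseI single_valuedD)
 qed
 moreover have "fst (g x) = fst x" if x: "x \<in> Domain phi" for x
 proof -
  obtain y where "(x, y) \<in> phi" using x by blast
  then show ?thesis using g(2) strand_diagramD(3) [OF assms] by (metis point_le_def)
 qed
 ultimately show ?thesis
  using g(1) by (metis grf_matchings points.interval_inj_def)
qed

context strand_order
begin

lemma double_crs_empty_iff:
 "double_crs S g k = {} \<longleftrightarrow> \<not> (\<exists>a b c d e f. (a, c) \<in> grf S g \<and> (b, d) \<in> grf S g \<and>
  (c, e) \<in> grf (g ` S) k \<and> (d, f) \<in> grf (g ` S) k \<and> less a b \<and> less d c \<and> less e f)"
 unfolding double_crs_def crs_def in_grf by auto

lemma blocked_iff:
 "blocked S g u v \<longleftrightarrow> (\<exists>w\<in>grf S g. less u (fst w) \<and> less (fst w) v \<and> less (g v) (snd w) \<and> less (snd w) (g u))"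
 by (auto simp: blocked_def grf_def)

end

text \<open>\<open>double_crs\<close> for relations: products can then be examined on sets of
  strands without choosing functions.\<close>

definition dbl_cross :: "strands => strands => bool" where
 "dbl_cross phi psi \<longleftrightarrow> (\<exists>a b c d e f. (a, c) \<in> phi \<and> (b, d) \<in> phi \<and> (c, e) \<in> psi \<and> (d, f) \<in> psi \<and>
  point_less a b \<and> point_less d c \<and> point_less e f)"

lemma inversions_comp:
 assumes "phi \<in> matchings" "psi \<in> matchings" "Range phi = Domain psi"
 shows "inversions (phi O psi) = inversions phi + inversions psi \<longleftrightarrow> \<not> dbl_cross phi psi"
proof -
 obtain S g T k where e: "phi = grf S g" "psi = grf T k" 
  and i: "interval_inj S g" "interval_inj T k"
  using assms by (auto simp: matchings_def)
 have T: "T = g ` S" using assms(3) by (simp add: e)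
 have "inversions (phi O psi) = inversions phi + inversions psi \<longleftrightarrow> double_crs S g k = {}"
  using points.card_crs_comp_eq [OF i(1)] i(2) unfolding e T by (simp add: grf_comp inversions_grf)
 also have "\<dots> \<longleftrightarrow> \<not> dbl_cross phi psi"
  unfolding dbl_cross_def points.double_crs_empty_iff e T ..
 finally show ?thesis .
qed

text \<open>The unblocked crossings, for relations; by \<open>crs_transpose_Suc\<close> they are the
  ones that the differential resolves.\<close>

definition uncrossable :: "strands => (strand \<times> strand) set" where
 "uncrossable phi = {(a, b) \<in> crossings phi. \<not> (\<exists>w\<in>phi. point_less (fst a) (fst w) \<and> point_less (fst w) (fst b) \<and>
  point_less (snd b) (snd w) \<and> point_less (snd w) (snd a))}"

lemma basis_diff_uncrossable:
 assumes "phi \<in> matchings"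
 shows "basis_diff phi = (\<Sum>c\<in>uncrossable phi. single (resolve phi c) 1)"
proof -
 obtain S g where e: "phi = grf S g" and i: "interval_inj S g"
  using assms by (auto simp: matchings_def)
 have inj: "inj_on g S" using i by (simp add: points.interval_inj_def)
 have "inversions (resolve phi c) + 1 = inversions phi \<longleftrightarrow> c \<in> uncrossable phi" if c: "c \<in> crossings phi" for c
 proof -
  obtain u v where uv: "(u, v) \<in> crs S g" "c = ((u, g u), (v, g v))"
   using c unfolding e crossings_grf by (auto simp del: split_paired_All split_paired_Ex)
  have "u \<in> S" "v \<in> S" "u \<noteq> v" using uv(1) points.less_irrefl unfolding points.crs_def by blast+
  then have "resolve phi c = grf S (g \<circ> transpose u v)"
   unfolding e uv(2) using inj by (rule resolve_grf)
  then have "inversions (resolve phi c) + 1 = inversions phi \<longleftrightarrow> \<not> points.blocked S g u v"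
   using points.crs_transpose_Suc [OF i uv(1)] by (simp add: e inversions_grf)
  also have "\<dots> \<longleftrightarrow> c \<in> uncrossable phi"
   using c unfolding uncrossable_def points.blocked_iff uv(2) e by simp
  finally show ?thesis .
 qed
 then have "{c \<in> crossings phi. inversions (resolve phi c) + 1 = inversions phi} = uncrossable phi"
  unfolding uncrossable_def by blast
 then show ?thesis by (simp add: basis_diff_def)
qed

definition chain_sum :: "'a set => 'a \<Rightarrow>\<^sub>0 bit" where
 "chain_sum A = (\<Sum>a\<in>A. single a 1)"

lemma lookup_sum_single:
 assumes "finite I"
 shows "lookup (\<Sum>i\<in>I. single (f i) (1::bit)) a = of_nat (card {i \<in> I. f i = a})"
proof -
 have "lookup (\<Sum>i\<in>I. single (f i) (1::bit)) a = (\<Sum>i\<in>I. if f i = a then 1 else 0)"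
  by (simp add: lookup_sum lookup_single when_def)
 also have "\<dots> = of_nat (card {i \<in> I. f i = a})"
  unfolding sum_filter [OF assms] by simp
 finally show ?thesis .
qed

text \<open>A coefficient is the parity of a fibre, so a bijection of fibres suffices. The fibres
  compared later are the ways to obtain two terms of one diagram as a resolution or as a
  product.\<close>

lemma keys_sum_single_iff:
 assumes "finite I" "finite J" "bij_betw h {i \<in> I. f i = a} {j \<in> J. k j = b}"
 shows "a \<in> keys (\<Sum>i\<in>I. single (f i) (1::bit)) \<longleftrightarrow>
  b \<in> keys (\<Sum>j\<in>J. single (k j) (1::bit))"
 using bij_betw_same_card [OF assms(3)]
 unfolding in_keys_iff lookup_sum_single [OF assms(1)] lookup_sum_single [OF assms(2)] by simp

lemma keys_chain_sum [simp]: "finite A ==> keys (chain_sum A) = A"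
proof -
 assume A: "finite A"
 have "{i \<in> A. i = a} = (if a \<in> A then {a} else {})" for a by auto
 then have "lookup (chain_sum A) a = (if a \<in> A then 1 else 0)" for a
  unfolding chain_sum_def by (simp only: lookup_sum_single [OF A]) simp
 then show ?thesis by (auto simp: in_keys_iff split: if_splits)
qed

lemma chain_sum_keys [simp]: "chain_sum (keys x) = x"
 using lin_id [of x] unfolding chain_sum_def lin_def .

section \<open>Diagrams as classes of strand diagrams\<close>

definition core :: "strands => strands" where
 "core phi = {(x, y) \<in> phi. x \<noteq> y}"

definition horiz :: "strands => point set" where
 "horiz phi = {x. (x, x) \<in> phi}"

text \<open>The terms that can occur in diagrams: each pair is used at most once at the start and at
  most once at the end. The extremities of the intervals are unrestricted, as in the
  idempotents.\<close>

definition valid :: "arc_data => strands => bool" where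
 "valid Z phi \<longleftrightarrow> strand_diagram Z phi \<and> 
  (\<forall>P\<in>pairs Z. card (Domain phi \<inter> pair_places Z P) \<le> 1 \<and> card (Range phi \<inter> pair_places Z P) \<le> 1)"

definition occ :: "arc_data => point set => nat set" where
 "occ Z S = {P \<in> pairs Z. card (S \<inter> pair_places Z P) = 1}"

text \<open>The position of the horizontal strands is forgotten; what remains of them is that their
  pairs belong to both idempotents.\<close>

definition diagram_of :: "arc_data => strands => diagram" where
 "diagram_of Z phi = (occ Z (Domain phi), core phi, occ Z (Range phi))"

lemma core_horiz: "phi = core phi \<union> Id_on (horiz phi)"
 by (auto simp: core_def horiz_def)

lemma valid_strand_diagram [simp]: "valid Z phi ==> strand_diagram Z phi"
 by (simp add: valid_def)

lemma valid_matchings [simp]: "valid Z phi ==> phi \<in> matchings"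
 by (rule strand_diagram_matchings [of Z]) simp

lemma finite_valid [simp]: "finite {phi. valid Z phi}"
 by (rule finite_subset [of _ "Pow (points Z \<times> points Z)"]) (auto simp: valid_def strand_diagram_def)

lemma strand_diagram_core: "strand_diagram Z phi ==> strand_diagram Z (core phi)"
 by (auto simp: strand_diagram_def core_def single_valued_def)

lemma occ_subset: "occ Z S \<subseteq> pairs Z"
 by (auto simp: occ_def)

definition idem_sets :: "arc_data => nat set => point set set" where
 "idem_sets Z s = {S. S \<subseteq> points Z \<and>
  (\<forall>P\<in>pairs Z. card (S \<inter> pair_places Z P) = (if P \<in> s then 1 else 0))}"

lemma finite_idem_sets [simp]: "finite (idem_sets Z s)"
 by (rule finite_subset [of _ "Pow (points Z)"]) (auto simp: idem_sets_def)

lemma crossings_Id_on [simp]: "crossings (Id_on S) = {}"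
 by (auto simp: crossings_def Id_on_def dest: points.less_asym)

lemma inversions_Id_on [simp]: "inversions (Id_on S) = 0"
 by (simp add: inversions_def)

lemma Id_on_Domain_comp [simp]: "Id_on (Domain phi) O phi = phi" "phi O Id_on (Range phi) = phi"
 by auto

lemma basis_mult_Id_left: "basis_mult (Id_on S) phi = (if S = Domain phi then single phi 1 else 0)"
 by (auto simp: basis_mult_def Range_Id_on)

lemma basis_mult_Id_right: "basis_mult phi (Id_on S) = (if S = Range phi then single phi 1 else 0)"
 by (auto simp: basis_mult_def Domain_Id_on)

lemma idem_eq: "idem Z s = (\<Sum>S\<in>idem_sets Z s. single (Id_on S) 1)"
 by (simp add: idem_def idem_sets_def)

lemma idem_mult_single: "chain_mult (idem Z s) (single phi 1) =
  (if Domain phi \<in> idem_sets Z s then single phi 1 else 0)"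
 by (simp add: idem_eq chain_mult_sum_left basis_mult_Id_left sum.delta)

lemma single_mult_idem: "chain_mult (single phi 1) (idem Z s) =
  (if Range phi \<in> idem_sets Z s then single phi 1 else 0)"
 by (simp add: idem_eq chain_mult_sum_right basis_mult_Id_right sum.delta)

lemma idem_sets_occ:
 assumes "s \<subseteq> pairs Z"
 shows "S \<in> idem_sets Z s \<longleftrightarrow> S \<subseteq> points Z \<and> (\<forall>P\<in>pairs Z. card (S \<inter> pair_places Z P) \<le> 1) \<and> occ Z S = s"
proof -
 have fin: "finite (S \<inter> pair_places Z P)" if "S \<subseteq> points Z" for P
  using that by (meson finite_points finite_subset finite_Int)
 have "(\<forall>P\<in>pairs Z. card (S \<inter> pair_places Z P) = (if P \<in> s then 1 else 0)) \<longleftrightarrow>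
   (\<forall>P\<in>pairs Z. card (S \<inter> pair_places Z P) \<le> 1 \<and> (card (S \<inter> pair_places Z P) = 1 \<longleftrightarrow> P \<in> s))"
  by (intro ball_cong refl) (auto split: if_splits)
 also have "\<dots> \<longleftrightarrow> (\<forall>P\<in>pairs Z. card (S \<inter> pair_places Z P) \<le> 1) \<and> occ Z S = s"
  using assms unfolding occ_def by blast
 finally show ?thesis by (simp add: idem_sets_def)
qed

text \<open>Multiplying by \<open>I(s)\<close> and \<open>I(t)\<close> only filters the terms of
  \<open>a(\<mu>)\<close>: a term survives if its starts and ends use exactly the pairs of s and t.
  The set U of horizontal strands is recovered from a term, so no two terms coincide and nothing
  cancels.\<close>

lemma terms_of_explicit:
 assumes "s \<subseteq> pairs Z" "t \<subseteq> pairs Z" "strand_diagram Z \<mu>" "core \<mu> = \<mu>"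
 shows "chain_of Z (s, \<mu>, t) = chain_sum {phi. valid Z phi \<and> diagram_of Z phi = (s, \<mu>, t)}"
proof -
 let ?V = "Pow (points Z - (Domain \<mu> \<union> Range \<mu>))"
 let ?f = "\<lambda>U. \<mu> \<union> Id_on U"
 have fin: "finite ?V" by simp
 have "chain_of Z (s, \<mu>, t) = (\<Sum>U\<in>?V. if Range (?f U) \<in> idem_sets Z t \<and> Domain (?f U) \<in> idem_sets Z s 
   then single (?f U) 1 else 0)"
  unfolding chain_of_def prod.case add_horizontals_def chain_mult_sum_right chain_mult_sum_left idem_mult_single
  by (rule sum.cong) (auto simp: single_mult_idem)
 also have "\<dots> = (\<Sum>U\<in>{U \<in> ?V. Range (?f U) \<in> idem_sets Z t \<and> Domain (?f U) \<in> idem_sets Z s}. single (?f U) 1)"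
  by (rule sum_filter [OF fin])
 also have "\<dots> = (\<Sum>phi\<in>?f ` {U \<in> ?V. Range (?f U) \<in> idem_sets Z t \<and> Domain (?f U) \<in> idem_sets Z s}. single phi 1)"
 proof (subst sum.reindex)
  show "inj_on ?f {U \<in> ?V. Range (?f U) \<in> idem_sets Z t \<and> Domain (?f U) \<in> idem_sets Z s}"
  proof (rule inj_onI, intro equalityI subsetI)
   fix U U' x assume h: "U \<in> {U \<in> ?V. Range (?f U) \<in> idem_sets Z t \<and> Domain (?f U) \<in> idem_sets Z s}"
    "U' \<in> {U \<in> ?V. Range (?f U) \<in> idem_sets Z t \<and> Domain (?f U) \<in> idem_sets Z s}" "?f U = ?f U'"
   { assume "x \<in> U"
    then have "(x, x) \<in> ?f U'" "x \<notin> Domain \<mu>" using h by blast+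
    then show "x \<in> U'" by blast }
   { assume "x \<in> U'"
    then have "(x, x) \<in> ?f U" "x \<notin> Domain \<mu>" using h by blast+
    then show "x \<in> U" by blast }
  qed
 qed simp
 also have "?f ` {U \<in> ?V. Range (?f U) \<in> idem_sets Z t \<and> Domain (?f U) \<in> idem_sets Z s} =
   {phi. valid Z phi \<and> diagram_of Z phi = (s, \<mu>, t)}" (is "?L = ?R")
 proof (intro equalityI subsetI)
  fix phi assume "phi \<in> ?L"
  then obtain U where U0: "phi = ?f U" "U \<in> {U \<in> ?V. Range (?f U) \<in> idem_sets Z t \<and> Domain (?f U) \<in> idem_sets Z s}"
   by (rule imageE)
  then have U: "U \<subseteq> points Z" "U \<inter> Domain \<mu> = {}" "U \<inter> Range \<mu> = {}" "phi = ?f U"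
   "Range (?f U) \<in> idem_sets Z t" "Domain (?f U) \<in> idem_sets Z s"
   unfolding mem_Collect_eq by (simp_all, blast+)
  have sd: "strand_diagram Z phi"
   unfolding strand_diagram_def
  proof (intro conjI)
   have \<mu>: "\<mu> \<subseteq> points Z \<times> points Z" "single_valued \<mu>" "single_valued (\<mu>\<inverse>)" "\<forall>(x, y)\<in>\<mu>. point_le x y"
    using assms(3) by (simp_all add: strand_diagram_def)
   show "phi \<subseteq> points Z \<times> points Z" using U(1,4) \<mu>(1) by blast
   show "single_valued phi" using U(2,4) \<mu>(2) unfolding single_valued_def by blast
   show "single_valued (phi\<inverse>)" using U(3,4) \<mu>(3) unfolding single_valued_def by blast
   have "point_le x x" for x by (simp add: point_le_def)
   then show "\<forall>(x, y)\<in>phi. point_le x y" using U(4) \<mu>(4) by blast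
  qed
  have "core phi = core \<mu>" using U(4) by (auto simp: core_def)
  then show "phi \<in> ?R"
   using U(4-6) sd assms idem_sets_occ [OF assms(1), of "Domain (?f U)"] idem_sets_occ [OF assms(2), of "Range (?f U)"]
   unfolding valid_def diagram_of_def by simp
 next
  fix phi assume "phi \<in> ?R"
  then have h: "valid Z phi" "occ Z (Domain phi) = s" "core phi = \<mu>" "occ Z (Range phi) = t" 
   by (auto simp: diagram_of_def)
  then have sd: "strand_diagram Z phi" by simp
  have e: "phi = ?f (horiz phi)" using core_horiz [of phi] h by simp
  have "x \<notin> Domain \<mu>" "x \<notin> Range \<mu>" "x \<in> points Z" if x: "x \<in> horiz phi" for x
   using x strand_diagramD(1) [OF sd] strand_diagram_unique [OF sd]
   unfolding h(3) [symmetric] horiz_def core_def by blast+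
  then have "horiz phi \<in> ?V" by blast
  moreover have "Domain phi \<subseteq> points Z" "Range phi \<subseteq> points Z"
   using strand_diagramD(1,2) [OF sd] by blast+
  ultimately have "horiz phi \<in> {U \<in> ?V. Range (?f U) \<in> idem_sets Z t \<and> Domain (?f U) \<in> idem_sets Z s}"
   unfolding mem_Collect_eq e [symmetric]
   using h by (simp add: idem_sets_occ [OF assms(1)] idem_sets_occ [OF assms(2)] valid_def)
  then show "phi \<in> ?L" using e by blast
 qed
 finally show ?thesis by (simp add: chain_sum_def)
qed

lemma core_core [simp]: "core (core phi) = core phi"
 by (auto simp: core_def)

lemma diagrams_eq: "diagrams Z = diagram_of Z ` {phi. valid Z phi}"
proof (intro equalityI subsetI)
 fix D assume D: "D \<in> diagrams Z"
 obtain s \<mu> t where e: "D = (s, \<mu>, t)" by (cases D)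
 then have h: "s \<subseteq> pairs Z" "t \<subseteq> pairs Z" "strand_diagram Z \<mu>" "\<forall>(x, y)\<in>\<mu>. x \<noteq> y" "chain_of Z (s, \<mu>, t) \<noteq> 0"
  using D by (auto simp: diagrams_def)
 have "core \<mu> = \<mu>" using h(4) unfolding core_def by blast
 then have "{phi. valid Z phi \<and> diagram_of Z phi = (s, \<mu>, t)} \<noteq> {}"
  using terms_of_explicit [OF h(1-3)] h(5) by (metis chain_sum_def sum.empty)
 then obtain phi where "valid Z phi" "diagram_of Z phi = (s, \<mu>, t)" by auto
 then show "D \<in> diagram_of Z ` {phi. valid Z phi}" using e by (metis imageI mem_Collect_eq)
next
 fix D assume "D \<in> diagram_of Z ` {phi. valid Z phi}"
 then obtain phi where phi: "valid Z phi" "D = diagram_of Z phi" by blast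
 have sd: "strand_diagram Z (core phi)" using phi strand_diagram_core by simp
 have "chain_of Z D = chain_sum {psi. valid Z psi \<and> diagram_of Z psi = D}"
  unfolding phi(2) diagram_of_def
  using terms_of_explicit [OF occ_subset occ_subset sd core_core] unfolding diagram_of_def .
 moreover have "finite {psi. valid Z psi \<and> diagram_of Z psi = D}"
  by (rule finite_subset [OF _ finite_valid [of Z]]) auto
 ultimately have "phi \<in> keys (chain_of Z D)" using phi by simp
 then have "chain_of Z D \<noteq> 0" by auto
 then show "D \<in> diagrams Z"
  using sd phi(2) occ_subset unfolding diagrams_def diagram_of_def core_def by blast
qed

lemma finite_terms [simp]: "finite {phi. valid Z phi \<and> Q phi}"
 by (rule finite_subset [OF _ finite_valid [of Z]]) auto

lemma chain_of_diagram: 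
 assumes "D \<in> diagrams Z"
 shows "chain_of Z D = chain_sum {phi. valid Z phi \<and> diagram_of Z phi = D}"
proof -
 obtain phi where phi: "valid Z phi" "D = diagram_of Z phi" using assms by (auto simp: diagrams_eq)
 have sd: "strand_diagram Z (core phi)" using phi strand_diagram_core by simp
 show ?thesis
  unfolding phi(2) diagram_of_def
  using terms_of_explicit [OF occ_subset occ_subset sd core_core] unfolding diagram_of_def .
qed

lemma terms_of_diagram: "D \<in> diagrams Z ==> terms_of Z D = {phi. valid Z phi \<and> diagram_of Z phi = D}"
 by (simp add: terms_of_def chain_of_diagram)

lemma finite_diagrams [simp]: "finite (diagrams Z)"
 by (simp add: diagrams_eq)

lemma diagram_of_diagrams [simp]: "valid Z phi ==> diagram_of Z phi \<in> diagrams Z"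
 by (simp add: diagrams_eq)

text \<open>Membership form of the span of the diagrams satisfying Q. Distinct diagrams have no
  common terms, so a chain of valid terms lies in a span exactly when it contains each diagram
  completely or not at all.\<close>

definition invariant_chains :: "arc_data => (diagram => bool) => chain set" where
 "invariant_chains Z Q = {x. (\<forall>phi\<in>keys x. valid Z phi \<and> Q (diagram_of Z phi)) \<and>
  (\<forall>phi psi. valid Z phi --> valid Z psi --> diagram_of Z phi = diagram_of Z psi -->
    phi \<in> keys x --> psi \<in> keys x)}"

lemma invariant_chainsD:
 assumes "x \<in> invariant_chains Z Q" "phi \<in> keys x"
 shows "valid Z phi" "Q (diagram_of Z phi)"
 using assms unfolding invariant_chains_def by blast+

lemma invariant_chains_closed:
 assumes "x \<in> invariant_chains Z Q" "phi \<in> keys x" "valid Z psi" "diagram_of Z psi = diagram_of Z phi"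
 shows "psi \<in> keys x"
proof -
 have "\<forall>phi psi. valid Z phi --> valid Z psi --> diagram_of Z phi = diagram_of Z psi -->
    phi \<in> keys x --> psi \<in> keys x"
  using assms(1) unfolding invariant_chains_def mem_Collect_eq by (rule conjunct2)
 from this [rule_format, OF invariant_chainsD(1) [OF assms(1,2)] assms(3) assms(4) [symmetric] assms(2)]
 show ?thesis .
qed

lemma invariant_chainsI:
 assumes "\<And>phi. phi \<in> keys x ==> valid Z phi" "\<And>phi. phi \<in> keys x ==> Q (diagram_of Z phi)"
  and "\<And>phi psi. valid Z phi ==> valid Z psi ==> diagram_of Z psi = diagram_of Z phi ==>
    phi \<in> keys x ==> psi \<in> keys x"
 shows "x \<in> invariant_chains Z Q"
 unfolding invariant_chains_def mem_Collect_eq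
proof (intro conjI ballI allI impI)
 fix phi psi assume h: "valid Z phi" "valid Z psi" "diagram_of Z phi = diagram_of Z psi" "phi \<in> keys x"
 show "psi \<in> keys x" by (rule assms(3) [OF h(1,2) h(3) [symmetric] h(4)])
qed (use assms(1,2) in blast)+

lemma invariant_chains_add: 
 assumes x: "x \<in> invariant_chains Z Q" and y: "y \<in> invariant_chains Z Q"
 shows "x + y \<in> invariant_chains Z Q"
proof (rule invariant_chainsI)
 fix phi assume "phi \<in> keys (x + y)"
 then have "phi \<in> keys x \<or> phi \<in> keys y" unfolding keys_add_bit by blast
 then show "valid Z phi" "Q (diagram_of Z phi)" using invariant_chainsD [OF x] invariant_chainsD [OF y] by blast+
next
 fix phi psi assume h: "valid Z phi" "valid Z psi" "diagram_of Z psi = diagram_of Z phi" "phi \<in> keys (x + y)"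
 have "phi \<in> keys z \<longleftrightarrow> psi \<in> keys z" if "z \<in> invariant_chains Z Q" for z
  using invariant_chains_closed [OF that _ h(2,3)] invariant_chains_closed [OF that _ h(1) h(3) [symmetric]] by blast
 from this [OF x] this [OF y] show "psi \<in> keys (x + y)"
  using h(4) by (simp add: keys_add_bit)
qed

lemma invariant_chains_zero [simp]: "0 \<in> invariant_chains Z Q"
 by (simp add: invariant_chains_def)

lemma invariant_chains_sum:
 "(\<And>i. i \<in> I ==> x i \<in> invariant_chains Z Q) ==> (\<Sum>i\<in>I. x i) \<in> invariant_chains Z Q"
 by (induction I rule: infinite_finite_induct) 
  (simp_all add: invariant_chains_add)

text \<open>The coordinates of x in the basis of diagrams: coefficients are bits, so they amount to
  a finite set of diagrams.\<close>

definition supp :: "arc_data => chain => diagram set" where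
 "supp Z x = {D \<in> diagrams Z. terms_of Z D \<subseteq> keys x}"

lemma invariant_supp:
 assumes "x \<in> invariant_chains Z Q"
 shows "supp Z x = diagram_of Z ` keys x"
proof (intro equalityI subsetI)
 fix D assume D: "D \<in> supp Z x"
 then obtain phi where "valid Z phi" "D = diagram_of Z phi"
  unfolding supp_def diagrams_eq by blast
 then have "phi \<in> terms_of Z D" by (simp add: terms_of_diagram)
 then have "phi \<in> keys x" using subsetD [OF conjunct2 [OF D [unfolded supp_def mem_Collect_eq]]] by blast
 then show "D \<in> diagram_of Z ` keys x" 
  using \<open>D = diagram_of Z phi\<close> by (rule rev_image_eqI)
next
 fix D assume "D \<in> diagram_of Z ` keys x"
 then obtain phi where phi: "phi \<in> keys x" "D = diagram_of Z phi" by blast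
 then have v: "valid Z phi" using invariant_chainsD [OF assms] by blast
 have "terms_of Z D \<subseteq> keys x"
  using invariant_chains_closed [OF assms phi(1)] v unfolding phi(2) by (simp add: terms_of_diagram subset_eq)
 then show "D \<in> supp Z x" using phi v by (simp add: supp_def)
qed

lemma invariant_expand:
 assumes "x \<in> invariant_chains Z Q"
 shows "x = (\<Sum>D\<in>supp Z x. chain_of Z D)"
proof -
 have v: "valid Z phi" if "phi \<in> keys x" for phi using invariant_chainsD(1) [OF assms that] .
 have "x = (\<Sum>phi\<in>keys x. single phi 1)"
  using chain_sum_keys [of x] by (simp add: chain_sum_def)
 also have "\<dots> = (\<Sum>D\<in>diagram_of Z ` keys x. \<Sum>phi\<in>{phi \<in> keys x. diagram_of Z phi = D}. single phi 1)"
  by (rule sum.group [symmetric]) auto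
 also have "\<dots> = (\<Sum>D\<in>supp Z x. chain_of Z D)"
  unfolding invariant_supp [OF assms]
 proof (rule sum.cong [OF refl])
  fix D assume "D \<in> diagram_of Z ` keys x"
  then obtain psi where psi: "psi \<in> keys x" "D = diagram_of Z psi" by blast
  have "{phi \<in> keys x. diagram_of Z phi = D} = {phi. valid Z phi \<and> diagram_of Z phi = D}"
   using invariant_chains_closed [OF assms psi(1)] v unfolding psi(2) by blast
  then show "(\<Sum>phi\<in>{phi \<in> keys x. diagram_of Z phi = D}. single phi 1) = chain_of Z D"
   using v psi by (simp add: chain_of_diagram chain_sum_def)
 qed
 finally show ?thesis .
qed

lemma chain_of_invariant: "D \<in> diagrams Z ==> Q D ==> chain_of Z D \<in> invariant_chains Z Q"
 by (rule invariant_chainsI) (simp_all add: chain_of_diagram)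

lemma chain_of_inj: "inj_on (chain_of Z) (diagrams Z)"
proof (rule inj_onI)
 fix D E assume h: "D \<in> diagrams Z" "E \<in> diagrams Z" "chain_of Z D = chain_of Z E"
 obtain phi where "valid Z phi" "D = diagram_of Z phi" using h(1) by (auto simp: diagrams_eq)
 then have "phi \<in> terms_of Z D" by (simp add: terms_of_diagram)
 then have "phi \<in> terms_of Z E" using h(3) by (simp add: terms_of_def)
 then show "D = E" using \<open>D = _\<close> h(2) by (simp add: terms_of_diagram)
qed

lemma span2_invariant: "span2 (chain_of Z ` {D \<in> diagrams Z. Q D}) = invariant_chains Z Q"
proof (intro equalityI subsetI)
 fix x assume "x \<in> span2 (chain_of Z ` {D \<in> diagrams Z. Q D})"
 then obtain T where T: "T \<subseteq> chain_of Z ` {D \<in> diagrams Z. Q D}" "x = (\<Sum>y\<in>T. y)"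
  unfolding span2_def by blast
 show "x \<in> invariant_chains Z Q"
  unfolding T(2)
 proof (rule invariant_chains_sum)
  fix y assume "y \<in> T"
  then obtain D where "y = chain_of Z D" "D \<in> diagrams Z" "Q D" using T(1) by blast
  then show "y \<in> invariant_chains Z Q" using chain_of_invariant by blast
 qed
next
 fix x assume x: "x \<in> invariant_chains Z Q"
 have sub: "supp Z x \<subseteq> {D \<in> diagrams Z. Q D}"
  using invariant_chainsD [OF x] diagram_of_diagrams unfolding invariant_supp [OF x] by blast
 have "x = (\<Sum>y\<in>chain_of Z ` supp Z x. y)"
  using invariant_expand [OF x] sub inj_on_subset [OF chain_of_inj [of Z], of "supp Z x"]
  by (simp add: sum.reindex supp_def)
 moreover have "finite (chain_of Z ` supp Z x)" by (simp add: supp_def)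
 ultimately show "x \<in> span2 (chain_of Z ` {D \<in> diagrams Z. Q D})"
  using sub unfolding span2_def by blast
qed

abbreviation alg :: "arc_data => chain set" where
 "alg Z \<equiv> invariant_chains Z (\<lambda>_. True)"

lemma carrier_strand_algebra [simp]: "carrier (strand_algebra Z) = alg Z"
 using span2_invariant [of Z "\<lambda>_. True"] by (simp add: strand_algebra_def)

lemma invariant_chains_alg: "x \<in> invariant_chains Z Q \<longleftrightarrow> x \<in> alg Z \<and> (\<forall>phi\<in>keys x. Q (diagram_of Z phi))"
proof (intro iffI conjI ballI; (elim conjE)?)
 assume x: "x \<in> invariant_chains Z Q"
 show "x \<in> alg Z"
  using invariant_chainsD [OF x] invariant_chains_closed [OF x] by (intro invariant_chainsI) blast+
 fix phi assume "phi \<in> keys x"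
 then show "Q (diagram_of Z phi)" using invariant_chainsD [OF x] by blast
next
 assume x: "x \<in> alg Z" and "\<forall>phi\<in>keys x. Q (diagram_of Z phi)"
 then show "x \<in> invariant_chains Z Q"
  using invariant_chainsD [OF x] invariant_chains_closed [OF x] by (intro invariant_chainsI) blast+
qed

lemma alg_valid: "x \<in> alg Z ==> phi \<in> keys x ==> valid Z phi"
 by (rule invariant_chainsD(1))

lemma alg_mchains: "x \<in> alg Z ==> x \<in> mchains"
 unfolding mchains_def using alg_valid valid_matchings by blast

section \<open>The strand algebra and its homology ring\<close>

lemma matchings_single_valued: "phi \<in> matchings ==> single_valued phi"
 and matchings_single_valued_converse: "phi \<in> matchings ==> single_valued (phi\<inverse>)"
 unfolding matchings_def points.interval_inj_def single_valued_def inj_on_def mem_Collect_eq converse_iff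
 by (metis in_grf)+

lemma resolve_matchings:
 assumes "phi \<in> matchings" "c \<in> crossings phi"
 shows "resolve phi c \<in> matchings" "Domain (resolve phi c) = Domain phi" "Range (resolve phi c) = Range phi"
proof -
 obtain S g where e: "phi = grf S g" and i: "interval_inj S g"
  using assms by (auto simp: matchings_def)
 have inj: "inj_on g S" using i by (simp add: points.interval_inj_def)
 obtain u v where uv: "(u, v) \<in> crs S g" "c = ((u, g u), (v, g v))"
  using assms(2) unfolding e crossings_grf by (auto simp del: split_paired_All split_paired_Ex)
 have h: "u \<in> S" "v \<in> S" "point_less u v" using uv(1) unfolding points.crs_def by blast+
 then have r: "resolve phi c = grf S (g \<circ> transpose u v)"
  unfolding e uv(2) using inj by (intro resolve_grf) auto
 show "resolve phi c \<in> matchings"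
  unfolding r using h points.interval_inj_transpose [OF i h(1,2)] by (auto simp: point_less_def)
 show "Domain (resolve phi c) = Domain phi" unfolding r by (simp add: e)
 show "Range (resolve phi c) = Range phi"
  using image_comp_transpose [OF h(1,2), of g] unfolding r by (simp add: e del: image_comp)
qed

text \<open>Strands do not descend, so the ends of two crossing strands satisfy a < b \<le> y < x.
  In particular both strands produced by the resolution move strictly upwards.\<close>

lemma crossing_cases:
 assumes "strand_diagram Z phi" "c \<in> crossings phi"
 obtains a b x y where "c = ((a, x), (b, y))" "(a, x) \<in> phi" "(b, y) \<in> phi" "point_less a b" "point_less y x"
  "point_le b y" "point_less a y" "point_less b x"
proof -
 obtain a b x y where c: "c = ((a, x), (b, y))" by (metis surj_pair)
 then have h: "(a, x) \<in> phi" "(b, y) \<in> phi" "point_less a b" "point_less y x"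
  using assms(2) unfolding crossings_def by simp_all
 have "point_le b y" using strand_diagramD(3) [OF assms(1) h(2)] .
 then have "point_less a y" "point_less b x" using h(3,4) by (auto simp: point_less_def point_le_def)
 then show ?thesis using that c h \<open>point_le b y\<close> by blast
qed

lemma valid_resolve:
 assumes "valid Z phi" "c \<in> crossings phi"
 shows "valid Z (resolve phi c)"
proof -
 have sd: "strand_diagram Z phi" and m: "phi \<in> matchings" using assms(1) by auto
 note r = resolve_matchings [OF m assms(2)]
 obtain a b x y where c: "c = ((a, x), (b, y))" "(a, x) \<in> phi" "(b, y) \<in> phi"
  "point_less a y" "point_less b x"
  using crossing_cases [OF sd assms(2)] by metis
 have le: "point_le a y" "point_le b x" using c(4,5) by (auto simp: point_less_def point_le_def)
 have res: "resolve phi c = phi - {(a, x), (b, y)} \<union> {(a, y), (b, x)}" by (simp add: resolve_def c(1))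
 have "strand_diagram Z (resolve phi c)"
  unfolding strand_diagram_def
 proof (intro conjI)
  show "single_valued (resolve phi c)" "single_valued ((resolve phi c)\<inverse>)"
   using r(1) matchings_single_valued matchings_single_valued_converse by blast+
  show "resolve phi c \<subseteq> points Z \<times> points Z"
  proof -
   have "phi \<subseteq> points Z \<times> points Z" using sd by (simp add: strand_diagram_def)
   then show ?thesis using strand_diagramD(1,2) [OF sd c(2)] strand_diagramD(1,2) [OF sd c(3)] unfolding res by blast
  qed
  show "\<forall>(x, y)\<in>resolve phi c. point_le x y"
  proof -
   have "\<forall>(x, y)\<in>phi. point_le x y" using sd by (simp add: strand_diagram_def)
   then show ?thesis using le unfolding res by blast
  qed
 qed
 then show ?thesis using assms(1) r(2,3) by (simp add: valid_def)
qed

lemma valid_comp: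
 assumes "valid Z phi" "valid Z psi" "Range phi = Domain psi"
 shows "valid Z (phi O psi)" "Domain (phi O psi) = Domain phi" "Range (phi O psi) = Range psi"
proof -
 show D: "Domain (phi O psi) = Domain phi" "Range (phi O psi) = Range psi" using assms(3) by blast+
 have sd: "strand_diagram Z phi" "strand_diagram Z psi" using assms by auto
 have le: "point_le x y ==> point_le y z ==> point_le x z" for x y z by (simp add: point_le_def)
 have "strand_diagram Z (phi O psi)"
  unfolding strand_diagram_def
 proof (intro conjI)
  show "phi O psi \<subseteq> points Z \<times> points Z"
   using strand_diagramD(1) [OF sd(1)] strand_diagramD(2) [OF sd(2)] by blast
  show "single_valued (phi O psi)" "single_valued ((phi O psi)\<inverse>)"
   using sd unfolding strand_diagram_def converse_relcomp by (simp_all add: single_valued_relcomp)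
  show "\<forall>(x, y)\<in>phi O psi. point_le x y"
   using strand_diagramD(3) [OF sd(1)] strand_diagramD(3) [OF sd(2)] le by blast
 qed
 then show "valid Z (phi O psi)" using assms D unfolding valid_def by simp
qed

text \<open>Replacing the horizontal strands at \<open>H\<close> by horizontal strands at \<open>H'\<close> relates the terms
 of one diagram.\<close>

definition move_horiz :: "point set => point set => strands => strands" where
 "move_horiz H H' phi = (phi - Id_on H) \<union> Id_on H'"

text \<open>Nothing is asked at the extremities of the intervals, where \<open>I(s)\<close> admits
  every subset and two terms of a diagram may differ at will.\<close>

definition twin_sets :: "arc_data => point set => point set => bool" where
 "twin_sets Z H H' \<longleftrightarrow> H' \<subseteq> points Z \<and> (\<forall>P\<in>pairs Z. H \<inter> pair_places Z P = {} \<and> H' \<inter> pair_places Z P = {} \<or>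
  (\<exists>q z. H \<inter> pair_places Z P = {q} \<and> H' \<inter> pair_places Z P = {z}))"

lemma twin_sets_cases:
 assumes "twin_sets Z H H'" "P \<in> pairs Z"
 obtains "H \<inter> pair_places Z P = {}" "H' \<inter> pair_places Z P = {}"
  | q z where "H \<inter> pair_places Z P = {q}" "H' \<inter> pair_places Z P = {z}"
proof -
 have "H \<inter> pair_places Z P = {} \<and> H' \<inter> pair_places Z P = {} \<or>
  (\<exists>q z. H \<inter> pair_places Z P = {q} \<and> H' \<inter> pair_places Z P = {z})"
  using assms unfolding twin_sets_def by simp
 then show ?thesis
  by (elim disjE exE conjE) (rule that; assumption)+
qed

lemma card_le_1_eq: "finite A ==> card A \<le> 1 ==> a \<in> A ==> A = {a}"
 by (metis card_le_Suc0_iff_eq One_nat_def insertI1 subsetI subset_antisym singletonD insert_absorb insert_subset empty_iff)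

lemma move_horiz_valid:
 assumes v: "valid Z phi" and H: "Id_on H \<subseteq> phi" and tw: "twin_sets Z H H'"
  and new: "\<And>z. z \<in> H' ==> z \<notin> H ==> z \<notin> Domain phi \<and> z \<notin> Range phi"
 shows "valid Z (move_horiz H H' phi)" "diagram_of Z (move_horiz H H' phi) = diagram_of Z phi"
  "move_horiz H' H (move_horiz H H' phi) = phi"
proof -
 have sd: "strand_diagram Z phi" using v by simp
 note u = strand_diagram_unique [OF sd]
 let ?psi = "move_horiz H H' phi"
 have Hm: "z \<in> H ==> (z, z) \<in> phi" for z using H by blast
 have n: "a \<in> H \<longleftrightarrow> b \<in> H" if "(a, b) \<in> phi" for a b
  using u(1) [OF Hm [of a], of b] u(2) [OF Hm [of b], of a] that by blast
 have m: "(a, b) \<in> ?psi \<longleftrightarrow> a = b \<and> a \<in> H' \<or> (a, b) \<in> phi \<and> a \<notin> H" for a b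
  unfolding move_horiz_def using n [of a b] u(1) [OF Hm [of a], of b] by blast
 have D: "Domain ?psi = (Domain phi - H) \<union> H'"
  by (rule Set.set_eqI) (unfold Domain_iff m Un_iff Diff_iff, blast)
 have D': "Range ?psi = (Range phi - H) \<union> H'"
  by (rule Set.set_eqI) (unfold Range_iff m Un_iff Diff_iff, use n in blast)
 note D = D D'
 have fin: "finite (Domain phi \<inter> P)" "finite (Range phi \<inter> P)" for P
  using sd by (simp_all add: finite_Domain finite_Range)
 have card: "card ((A - H \<union> H') \<inter> pair_places Z P) = card (A \<inter> pair_places Z P)"
  if "P \<in> pairs Z" "H \<subseteq> A" "finite (A \<inter> pair_places Z P)" "card (A \<inter> pair_places Z P) \<le> 1" for P A
 proof -
  let ?P = "pair_places Z P"
  from tw that(1) show ?thesis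
  proof (cases rule: twin_sets_cases)
   case 1
   then have "(A - H \<union> H') \<inter> ?P = A \<inter> ?P" by blast
   then show ?thesis by simp
  next
   case (2 q z)
   then have "q \<in> A \<inter> ?P" using that(2) by blast
   then have A: "A \<inter> ?P = {q}" by (rule card_le_1_eq [OF that(3,4)])
   have "(A - H \<union> H') \<inter> ?P = (A \<inter> ?P - H \<inter> ?P) \<union> (H' \<inter> ?P)" by blast
   then have "(A - H \<union> H') \<inter> ?P = {z}" unfolding A 2 by simp
   then show ?thesis using A by simp
  qed
 qed
 have HD: "H \<subseteq> Domain phi" "H \<subseteq> Range phi" using H by blast+
 have cD: "card (Domain ?psi \<inter> pair_places Z P) = card (Domain phi \<inter> pair_places Z P)"
  "card (Range ?psi \<inter> pair_places Z P) = card (Range phi \<inter> pair_places Z P)" if "P \<in> pairs Z" for P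
  unfolding D using card [OF that HD(1) fin(1)] card [OF that HD(2) fin(2)] v that by (auto simp: valid_def)
 have sd': "strand_diagram Z ?psi"
  unfolding strand_diagram_def
 proof (intro conjI)
  have le: "point_le x x" for x by (simp add: point_le_def)
  have "H' \<subseteq> points Z" "phi \<subseteq> points Z \<times> points Z"
   using tw sd by (simp_all add: twin_sets_def strand_diagram_def)
  then show "?psi \<subseteq> points Z \<times> points Z" unfolding move_horiz_def by blast
  have nn: "a \<notin> H' \<and> b \<notin> H'" if "(a, b) \<in> phi" "a \<notin> H" for a b
   using new [of a] new [of b] n [OF that(1)] that by blast
  show "single_valued ?psi"
  proof (rule single_valuedI)
   fix x y z assume h: "(x, y) \<in> ?psi" "(x, z) \<in> ?psi"
   then show "y = z" unfolding m using nn [of x y] nn [of x z] u(1) [of x y z] by blast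
  qed
  show "single_valued (?psi\<inverse>)"
  proof (rule single_valuedI)
   fix x y z assume "(x, y) \<in> ?psi\<inverse>" "(x, z) \<in> ?psi\<inverse>"
   then show "y = z" unfolding m converse_iff using nn [of y x] nn [of z x] u(2) [of y x z] by blast
  qed
  have "\<forall>(x, y)\<in>phi. point_le x y" using sd by (simp add: strand_diagram_def)
  then show "\<forall>(x, y)\<in>?psi. point_le x y"
   using le unfolding move_horiz_def by blast
 qed
 show "valid Z ?psi" using sd' cD v unfolding valid_def by simp
 have "core ?psi = core phi" unfolding core_def move_horiz_def by blast
 then show "diagram_of Z ?psi = diagram_of Z phi"
  using cD by (simp add: diagram_of_def occ_def cong: conj_cong)
 have "(a, b) \<in> move_horiz H' H ?psi \<longleftrightarrow> (a, b) \<in> phi" for a b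
  unfolding move_horiz_def [of H' H] using m [of a b] n [of a b] Hm [of a] u(1) [OF Hm [of a], of b] new [of a] by blast
 then show "move_horiz H' H ?psi = phi" by (meson subrelI subset_antisym)
qed

text \<open>Terms of one diagram share their moving strands and the pairs used at the start. A pair
  has at most one start, so a horizontal strand at a pair in one term has exactly one counterpart in
  the other.\<close>

lemma same_diagram_horiz:
 assumes v: "valid Z chi" "valid Z chi'" and eq: "diagram_of Z chi' = diagram_of Z chi"
 shows "twin_sets Z (horiz chi) (horiz chi')" "move_horiz (horiz chi) (horiz chi') chi = chi'"
  "\<And>z. z \<in> horiz chi' ==> z \<notin> horiz chi ==> z \<notin> Domain chi \<and> z \<notin> Range chi"
proof -
 have sd: "strand_diagram Z chi" "strand_diagram Z chi'" using v by auto
 note u = strand_diagram_unique [OF sd(1)] and u' = strand_diagram_unique [OF sd(2)]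
 have core: "core chi' = core chi" and occD: "occ Z (Domain chi') = occ Z (Domain chi)"
  using eq by (auto simp: diagram_of_def)
 have c: "(x, y) \<in> chi' \<longleftrightarrow> (x, y) \<in> chi" if "x \<noteq> y" for x y
  using core that unfolding core_def by blast
 show new: "z \<notin> Domain chi \<and> z \<notin> Range chi" if "z \<in> horiz chi'" "z \<notin> horiz chi" for z
 proof -
  have "(z, z) \<in> chi'" "(z, z) \<notin> chi" using that by (simp_all add: horiz_def)
  then have "(z, y) \<notin> chi" "(y, z) \<notin> chi" for y
   using c [of z y] c [of y z] u'(1) [of z z y] u'(2) [of z z y] by blast+
  then show ?thesis by blast
 qed
 have new': "z \<notin> Domain chi'" if "z \<in> horiz chi" "z \<notin> horiz chi'" for z
 proof -
  have "(z, z) \<in> chi" "(z, z) \<notin> chi'" using that by (simp_all add: horiz_def)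
  then have "(z, y) \<notin> chi'" for y
   using c [of z y] u(1) [of z z y] by blast
  then show ?thesis by blast
 qed
 have "move_horiz (horiz chi) (horiz chi') chi = core chi \<union> Id_on (horiz chi')"
  unfolding move_horiz_def core_def horiz_def by blast
 then show "move_horiz (horiz chi) (horiz chi') chi = chi'"
  using core core_horiz [of chi'] by simp
 show "twin_sets Z (horiz chi) (horiz chi')"
  unfolding twin_sets_def
 proof (intro conjI ballI)
  show "horiz chi' \<subseteq> points Z" using strand_diagramD(1) [OF sd(2)] by (auto simp: horiz_def)
  fix P assume P: "P \<in> pairs Z"
  let ?P = "pair_places Z P"
  have fin: "finite (Domain chi \<inter> ?P)" "finite (Domain chi' \<inter> ?P)"
   using sd by (simp_all add: finite_Domain)
  have le: "card (Domain chi \<inter> ?P) \<le> 1" "card (Domain chi' \<inter> ?P) \<le> 1" using v P by (auto simp: valid_def)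
  have iff: "card (Domain chi \<inter> ?P) = 1 \<longleftrightarrow> card (Domain chi' \<inter> ?P) = 1" using occD P by (auto simp: occ_def)
  have hD: "horiz chi \<subseteq> Domain chi" "horiz chi' \<subseteq> Domain chi'" by (auto simp: horiz_def)
  have one: "\<exists>z. B \<inter> ?P = {z}" if h: "q \<in> A" "q \<in> ?P" "A \<subseteq> D" "finite (D \<inter> ?P)" "card (D \<inter> ?P) \<le> 1"
   "B \<subseteq> D'" "finite (D' \<inter> ?P)" "card (D \<inter> ?P) = 1 \<longleftrightarrow> card (D' \<inter> ?P) = 1"
   "\<And>z. z \<in> D' ==> z \<in> B \<or> z \<in> D \<and> z \<notin> A" for q A B D D' 
  proof -
   have "q \<in> D \<inter> ?P" using h(1-3) by blast
   then have D: "D \<inter> ?P = {q}" using card_le_1_eq [OF h(4,5)] by blast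
   then have "card (D' \<inter> ?P) = 1" using h(8) by simp
   then obtain z where z: "D' \<inter> ?P = {z}" by (rule card_1_singletonE)
   have "z \<in> D'" "z \<in> ?P" using z by (metis IntD1 IntD2 singletonI)+
   then have "z \<in> D ==> z = q" using D by (metis IntI singletonD)
   then have "z \<in> B" using h(9) [OF \<open>z \<in> D'\<close>] h(1) by blast
   then show ?thesis using z h(6) by blast
  qed
  have s: "z \<in> horiz chi \<or> z \<in> Domain chi' \<and> z \<notin> horiz chi'" if hz: "z \<in> Domain chi" for z
  proof (cases "z \<in> horiz chi")
   case False
   then obtain y where "(z, y) \<in> chi" "z \<noteq> y" using hz unfolding horiz_def by blast
   then have "(z, y) \<in> chi'" "(z, z) \<notin> chi'" using c u' by blast+
   then show ?thesis by (auto simp: horiz_def)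
  qed simp
  have s': "z \<in> horiz chi' \<or> z \<in> Domain chi \<and> z \<notin> horiz chi" if hz: "z \<in> Domain chi'" for z
  proof (cases "z \<in> horiz chi'")
   case False
   then obtain y where "(z, y) \<in> chi'" "z \<noteq> y" using hz unfolding horiz_def by blast
   then have "(z, y) \<in> chi" "(z, z) \<notin> chi" using c u by blast+
   then show ?thesis by (auto simp: horiz_def)
  qed simp
  show "horiz chi \<inter> ?P = {} \<and> horiz chi' \<inter> ?P = {} \<or> (\<exists>q z. horiz chi \<inter> ?P = {q} \<and> horiz chi' \<inter> ?P = {z})"
  proof (cases "horiz chi \<inter> ?P = {}")
   case True
   have "horiz chi' \<inter> ?P = {}"
   proof (rule ccontr)
    assume "horiz chi' \<inter> ?P \<noteq> {}"
    then obtain q where "q \<in> horiz chi'" "q \<in> ?P" by blast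
    then have "\<exists>z. horiz chi \<inter> ?P = {z}"
     using one [of q "horiz chi'" "Domain chi'" "horiz chi" "Domain chi"] fin le iff hD s by blast
    then show False using True by blast
   qed
   then show ?thesis using True by blast
  next
   case False
   then obtain q where q: "q \<in> horiz chi" "q \<in> ?P" by blast
   then have "horiz chi \<inter> ?P = {q}"
    using card_le_1_eq [OF fin(1) le(1), of q] hD(1) by blast
   moreover have "\<exists>z. horiz chi' \<inter> ?P = {z}"
    using one [of q "horiz chi" "Domain chi" "horiz chi'" "Domain chi'"] q fin le iff hD s' by blast
   ultimately show ?thesis by blast
  qed
 qed
qed

text \<open>Both strands produced by a resolution move strictly upwards, so the horizontal strands
  of the result were already present and untouched by c. They can be moved before resolving. A
  strand blocking a crossing is never horizontal, so the move creates no obstruction to resolving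
  c.\<close>

lemma move_horiz_resolve:
 assumes phi: "valid Z phi" and c: "c \<in> uncrossable phi" and chi: "resolve phi c = chi"
  and chi': "valid Z chi'" "diagram_of Z chi' = diagram_of Z chi"
 defines "psi \<equiv> move_horiz (horiz chi) (horiz chi') phi"
 shows "valid Z psi" "diagram_of Z psi = diagram_of Z phi" "move_horiz (horiz chi') (horiz chi) psi = phi"
  "c \<in> uncrossable psi" "resolve psi c = chi'"
proof -
 have sd: "strand_diagram Z phi" using phi by simp
 have cc: "c \<in> crossings phi" using c by (auto simp: uncrossable_def)
 have vchi: "valid Z chi" using valid_resolve [OF phi cc] chi by simp
 note tw = same_diagram_horiz [OF vchi chi']
 have DR: "Domain chi = Domain phi" "Range chi = Range phi" using resolve_matchings [OF _ cc] phi chi by auto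
 obtain a b x y where ab: "c = ((a, x), (b, y))" "(a, x) \<in> phi" "(b, y) \<in> phi" "point_less a b" "point_less y x"
  "point_le b y" "point_less a y" "point_less b x"
  using crossing_cases [OF sd cc] by metis
 have res: "resolve \<rho> c = \<rho> - {(a, x), (b, y)} \<union> {(a, y), (b, x)}" for \<rho> by (simp add: resolve_def ab(1))
 have ne: "a \<noteq> y" "b \<noteq> x" using ab(7,8) by auto
 have Id: "Id_on (horiz chi) \<subseteq> phi - {(a, x), (b, y)}"
 proof
  fix d assume "d \<in> Id_on (horiz chi)"
  then obtain z where "d = (z, z)" "(z, z) \<in> chi" by (auto simp: horiz_def)
  then show "d \<in> phi - {(a, x), (b, y)}" using ne unfolding chi [symmetric] res by blast
 qed
 have new: "z \<notin> Domain phi \<and> z \<notin> Range phi" if "z \<in> horiz chi'" "z \<notin> horiz chi" for z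
  using tw(3) [OF that] DR by simp
 have Id': "Id_on (horiz chi) \<subseteq> phi" using Id by blast
 show V: "valid Z psi" "diagram_of Z psi = diagram_of Z phi" "move_horiz (horiz chi') (horiz chi) psi = phi"
  unfolding psi_def using move_horiz_valid [OF phi Id' tw(1) new] by blast+
 have d: "(a, x) \<notin> Id_on (horiz chi')" "(b, y) \<notin> Id_on (horiz chi')" "(a, x) \<notin> Id_on (horiz chi)" "(b, y) \<notin> Id_on (horiz chi)"
  using new Id ab(2,3) by blast+
 have "resolve psi c = move_horiz (horiz chi) (horiz chi') (resolve phi c)"
  unfolding res psi_def move_horiz_def using d ne by blast
 then show "resolve psi c = chi'" using tw(2) chi by simp
 have mem: "(a, x) \<in> psi" "(b, y) \<in> psi" using ab(2,3) d unfolding psi_def move_horiz_def by blast+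
 show "c \<in> uncrossable psi"
  unfolding uncrossable_def ab(1) mem_Collect_eq prod.case
 proof (intro conjI notI)
  show "((a, x), (b, y)) \<in> crossings psi" using mem ab(4,5) by (simp add: crossings_def)
  assume "\<exists>w\<in>psi. point_less (fst (a, x)) (fst w) \<and> point_less (fst w) (fst (b, y)) \<and> point_less (snd (b, y)) (snd w) \<and>
   point_less (snd w) (snd (a, x))"
  then obtain p r where w: "(p, r) \<in> psi" "point_less a p" "point_less p b" "point_less y r" "point_less r x" by auto
  then have "p \<noteq> r" using ab(6) by (auto simp: point_less_def point_le_def)
  then have "(p, r) \<in> phi" using w(1) unfolding psi_def move_horiz_def by blast
  then show False using c w(2-5) unfolding uncrossable_def ab(1) by fastforce
 qed
qed

section \<open>Closure of the algebra under the differential\<close>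

lemma diff_pairs: 
 assumes "x \<in> mchains"
 shows "diff x = (\<Sum>i\<in>Sigma (keys x) uncrossable. single (resolve (fst i) (snd i)) 1)"
proof -
 have fin: "finite (uncrossable phi)" if "phi \<in> keys x" for phi
 proof -
  have "phi \<in> matchings" using assms that by (rule mem_mchains)
  then have "finite phi" by (auto simp: matchings_def grf_def points.interval_inj_def)
  then have "finite (phi \<times> phi)" by simp
  moreover have "uncrossable phi \<subseteq> phi \<times> phi" unfolding uncrossable_def crossings_def by blast
  ultimately show ?thesis by (rule rev_finite_subset)
 qed
 have "diff x = (\<Sum>phi\<in>keys x. \<Sum>c\<in>uncrossable phi. single (resolve phi c) 1)"
  unfolding diff_def by (rule sum.cong [OF refl]) (rule basis_diff_uncrossable, rule mem_mchains [OF assms])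
 also have "\<dots> = (\<Sum>i\<in>Sigma (keys x) uncrossable. single (resolve (fst i) (snd i)) 1)"
  by (subst sum.Sigma) (use fin in \<open>auto simp: case_prod_unfold\<close>)
 finally show ?thesis .
qed

lemma finite_uncrossable: "x \<in> mchains ==> finite (Sigma (keys x) uncrossable)"
proof (rule finite_SigmaI)
 fix phi assume x: "x \<in> mchains" "phi \<in> keys x"
 have "phi \<in> matchings" using x by (rule mem_mchains)
 then have "finite phi" by (auto simp: matchings_def grf_def points.interval_inj_def)
 then have "finite (phi \<times> phi)" by simp
 moreover have "uncrossable phi \<subseteq> phi \<times> phi" unfolding uncrossable_def crossings_def by blast
 ultimately show "finite (uncrossable phi)" by (rule rev_finite_subset)
qed simp

lemma keys_diff:
 assumes "x \<in> mchains" "chi \<in> keys (diff x)"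
 obtains phi c where "phi \<in> keys x" "c \<in> uncrossable phi" "resolve phi c = chi"
proof -
 have "chi \<in> (\<Union>i\<in>Sigma (keys x) uncrossable. keys (single (resolve (fst i) (snd i)) (1::bit)))"
  using assms(2) unfolding diff_pairs [OF assms(1)] by (rule subsetD [OF Poly_Mapping.keys_sum])
 then show ?thesis using that by auto
qed

text \<open>Moving horizontal strands is a bijection between the resolutions that produce one term
  of a diagram and those that produce another, so both terms have the same coefficient.\<close>

lemma diff_alg:
 assumes x: "x \<in> alg Z"
 shows "diff x \<in> alg Z"
proof (rule invariant_chainsI)
 fix phi assume "phi \<in> keys (diff x)"
 then obtain psi c where h: "psi \<in> keys x" "c \<in> uncrossable psi" "resolve psi c = phi"
  using keys_diff [OF alg_mchains [OF x]] by blast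
 then have "c \<in> crossings psi" by (auto simp: uncrossable_def)
 then show "valid Z phi" using valid_resolve [OF alg_valid [OF x h(1)], of c] h(3) by simp
next
 fix chi chi' assume v: "valid Z chi" "valid Z chi'" and eq: "diagram_of Z chi' = diagram_of Z chi"
  and k: "chi \<in> keys (diff x)"
 let ?S = "Sigma (keys x) uncrossable"
 let ?T = "\<lambda>chi. {i \<in> ?S. resolve (fst i) (snd i) = chi}"
 let ?m = "\<lambda>chi chi'. map_prod (move_horiz (horiz chi) (horiz chi')) (id :: strand \<times> strand => _)"
 have step: "?m chi chi' i \<in> ?T chi' \<and> ?m chi' chi (?m chi chi' i) = i"
  if "valid Z chi'" "diagram_of Z chi' = diagram_of Z chi" "i \<in> ?T chi" for chi chi' i
 proof -
  obtain phi c where i: "i = (phi, c)" by (cases i)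
  have h: "phi \<in> keys x" "c \<in> uncrossable phi" "resolve phi c = chi" using that(3) i by auto
  have v: "valid Z phi" by (rule alg_valid [OF x h(1)])
  note m = move_horiz_resolve [OF v h(2,3) that(1,2)]
  show ?thesis
   using m invariant_chains_closed [OF x h(1) m(1,2)] i by simp
 qed
 have "bij_betw (?m chi chi') (?T chi) (?T chi')"
 proof (rule bij_betw_byWitness [where f' = "?m chi' chi"]; intro ballI image_subsetI)
  fix i assume "i \<in> ?T chi"
  from step [OF v(2) eq this] show "?m chi' chi (?m chi chi' i) = i" "?m chi chi' i \<in> ?T chi'" by (rule conjunct2, rule conjunct1)
 next
  fix i assume "i \<in> ?T chi'"
  from step [OF v(1) eq [symmetric] this] show "?m chi chi' (?m chi' chi i) = i" "?m chi' chi i \<in> ?T chi" by (rule conjunct2, rule conjunct1)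
 qed
 from keys_sum_single_iff [OF finite_uncrossable finite_uncrossable this] k
 show "chi' \<in> keys (diff x)"
  using alg_mchains [OF x] unfolding diff_pairs [OF alg_mchains [OF x]] by blast
qed simp

section \<open>Closure of the algebra under products\<close>

definition composable :: "strands set => strands set => (strands \<times> strands) set" where
 "composable A B = {(phi, psi). phi \<in> A \<and> psi \<in> B \<and> Range phi = Domain psi \<and> \<not> dbl_cross phi psi}"

lemma chain_mult_pairs:
 assumes "x \<in> mchains" "y \<in> mchains"
 shows "chain_mult x y = (\<Sum>i\<in>composable (keys x) (keys y). single (fst i O snd i) 1)"
proof -
 let ?I = "keys x \<times> keys y"
 have "chain_mult x y = (\<Sum>i\<in>?I. basis_mult (fst i) (snd i))"
  by (simp add: chain_mult_def sum.cartesian_product case_prod_unfold)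
 also have "\<dots> = (\<Sum>i\<in>?I. if Range (fst i) = Domain (snd i) \<and> \<not> dbl_cross (fst i) (snd i)
   then single (fst i O snd i) 1 else 0)"
 proof (rule sum.cong [OF refl])
  fix i assume "i \<in> ?I"
  then have "fst i \<in> matchings" "snd i \<in> matchings" using assms mem_mchains by auto
  then show "basis_mult (fst i) (snd i) = (if Range (fst i) = Domain (snd i) \<and> \<not> dbl_cross (fst i) (snd i)
   then single (fst i O snd i) 1 else 0)"
   using inversions_comp [of "fst i" "snd i"] by (cases "Range (fst i) = Domain (snd i)") (simp_all add: basis_mult_def)
 qed
 also have "\<dots> = (\<Sum>i\<in>{i \<in> ?I. Range (fst i) = Domain (snd i) \<and> \<not> dbl_cross (fst i) (snd i)}. single (fst i O snd i) 1)"
  by (rule sum_filter) simp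
 also have "{i \<in> ?I. Range (fst i) = Domain (snd i) \<and> \<not> dbl_cross (fst i) (snd i)} =
   composable (keys x) (keys y)"
  by (rule Set.set_eqI) (simp add: composable_def case_prod_unfold mem_Times_iff)
 finally show ?thesis .
qed

lemma finite_composable: "finite A ==> finite B ==> finite (composable A B)"
 by (rule finite_subset [of _ "A \<times> B"]) (auto simp: composable_def)

lemma keys_chain_mult:
 assumes "x \<in> mchains" "y \<in> mchains" "chi \<in> keys (chain_mult x y)"
 obtains phi psi where "phi \<in> keys x" "psi \<in> keys y" "Range phi = Domain psi" "\<not> dbl_cross phi psi"
  "phi O psi = chi"
proof -
 have "chi \<in> (\<Union>i\<in>composable (keys x) (keys y). keys (single (fst i O snd i) (1::bit)))"
  using assms(3) unfolding chain_mult_pairs [OF assms(1,2)] by (rule subsetD [OF Poly_Mapping.keys_sum])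
 then show ?thesis using that by (auto simp: composable_def)
qed

text \<open>Strands do not descend, so a horizontal strand of the composite is horizontal in both
  factors and can be moved in both at once.\<close>

lemma move_horiz_comp:
 assumes Z: "arc_diagram Z" and v: "valid Z phi" "valid Z psi" and R: "Range phi = Domain psi" and nd: "\<not> dbl_cross phi psi"
  and chi: "phi O psi = chi" and chi': "valid Z chi'" "diagram_of Z chi' = diagram_of Z chi"
 defines "phi' \<equiv> move_horiz (horiz chi) (horiz chi') phi" and "psi' \<equiv> move_horiz (horiz chi) (horiz chi') psi"
 shows "valid Z phi'" "diagram_of Z phi' = diagram_of Z phi" "move_horiz (horiz chi') (horiz chi) phi' = phi"
  "valid Z psi'" "diagram_of Z psi' = diagram_of Z psi" "move_horiz (horiz chi') (horiz chi) psi' = psi"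
  "Range phi' = Domain psi'" "\<not> dbl_cross phi' psi'" "phi' O psi' = chi'"
proof -
 let ?H = "horiz chi" and ?H' = "horiz chi'"
 have sd: "strand_diagram Z phi" "strand_diagram Z psi" using v by auto
 note u1 = strand_diagram_unique [OF sd(1)] and u2 = strand_diagram_unique [OF sd(2)]
 note c = valid_comp [OF v R, unfolded chi]
 note tw = same_diagram_horiz [OF c(1) chi']
 have Hm: "(z, z) \<in> phi \<and> (z, z) \<in> psi" if "z \<in> ?H" for z
 proof -
  have "(z, z) \<in> phi O psi" using that unfolding chi horiz_def by simp
  then obtain m where m: "(z, m) \<in> phi" "(m, z) \<in> psi" by blast
  then have "point_le z m" "point_le m z" using strand_diagramD(3) sd by blast+
  then have "m = z" by (simp add: point_le_def prod_eq_iff)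
  then show ?thesis using m by simp
 qed
 then have Id: "Id_on ?H \<subseteq> phi" "Id_on ?H \<subseteq> psi" by blast+
 have new: "z \<notin> Domain phi \<and> z \<notin> Range phi \<and> z \<notin> Domain psi \<and> z \<notin> Range psi" if z: "z \<in> ?H'" "z \<notin> ?H" for z
 proof -
  have n: "z \<notin> Domain phi" "z \<notin> Range psi" using tw(3) [OF z] c by auto
  have "(z, z) \<in> chi'" using z(1) by (simp add: horiz_def)
  from strand_diagramD(1) [OF valid_strand_diagram [OF chi'(1)] this] have zp: "z \<in> points Z" .
  \<comment> \<open>z is free at the start and at the end of the composite, so the middle is the
    only danger. If z is a place, its pair is taken in the middle by q. If z is an extremity of an
    interval, the strand arriving at z or the one leaving it is horizontal, which would make z a
    start or an end of the composite.\<close>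
  have "z \<notin> Range phi"
  proof
   assume zR: "z \<in> Range phi"
   show False
   proof (cases "z \<in> places Z")
    case True
    let ?P = "pair_of Z z"
    have P: "?P \<in> pairs Z" "z \<in> pair_places Z ?P"
     using Z True unfolding arc_diagram_def by (blast, simp add: pair_places_def)
    obtain q where q: "?H \<inter> pair_places Z ?P = {q}"
     using tw(1) P(1) by (cases rule: twin_sets_cases) (use z(1) P(2) in blast)+
    then have "q \<in> Range phi \<inter> pair_places Z ?P" using Hm by blast
    moreover have "finite (Range phi \<inter> pair_places Z ?P)"
     using finite_Range [OF strand_diagram_finite [OF sd(1)]] by simp
    moreover have "card (Range phi \<inter> pair_places Z ?P) \<le> 1"
     using v(1) P(1) unfolding valid_def by blast
    ultimately have "Range phi \<inter> pair_places Z ?P = {q}" by (intro card_le_1_eq)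
    then have "z = q" using zR P(2) by (metis IntI singletonD)
    moreover have "q \<in> ?H" using q by (metis IntD1 singletonI)
    ultimately show False using z(2) by simp
   next
    case False
    obtain w where w: "(w, z) \<in> phi" using zR by blast
    obtain w' where w': "(z, w') \<in> psi" using zR R by blast
    have "point_le w z" "point_le z w'" "w \<in> points Z" "w' \<in> points Z"
     using w w' strand_diagramD [OF sd(1)] strand_diagramD [OF sd(2)] by blast+
    then have "w = z \<or> w' = z"
     using False zp by (cases z; cases w; cases w') (auto simp: point_le_def points_def places_def)
    then show False using w w' n by blast
   qed
  qed
  then show ?thesis using n R by blast
 qed
 have new1: "z \<notin> Domain phi \<and> z \<notin> Range phi" if "z \<in> ?H'" "z \<notin> ?H" for z using new [OF that] by blast
 have new2: "z \<notin> Domain psi \<and> z \<notin> Range psi" if "z \<in> ?H'" "z \<notin> ?H" for z using new [OF that] by blast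
 show V1: "valid Z phi'" "diagram_of Z phi' = diagram_of Z phi" "move_horiz (horiz chi') (horiz chi) phi' = phi"
  unfolding phi'_def using move_horiz_valid [OF v(1) Id(1) tw(1) new1] by blast+
 show V2: "valid Z psi'" "diagram_of Z psi' = diagram_of Z psi" "move_horiz (horiz chi') (horiz chi) psi' = psi"
  unfolding psi'_def using move_horiz_valid [OF v(2) Id(2) tw(1) new2] by blast+
 have n1: "a \<in> ?H \<longleftrightarrow> b \<in> ?H" if "(a, b) \<in> phi" for a b
  using u1(1) [of a a b] u1(2) [of b b a] Hm [of a] Hm [of b] that by blast
 have n2: "a \<in> ?H \<longleftrightarrow> b \<in> ?H" if "(a, b) \<in> psi" for a b
  using u2(1) [of a a b] u2(2) [of b b a] Hm [of a] Hm [of b] that by blast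
 have m1: "(a, b) \<in> phi' \<longleftrightarrow> a = b \<and> a \<in> ?H' \<or> (a, b) \<in> phi \<and> a \<notin> ?H' \<and> b \<notin> ?H' \<and> a \<notin> ?H \<and> b \<notin> ?H" for a b
  unfolding phi'_def move_horiz_def
  using n1 [of a b] u1(1) [of a a b] Hm [of a] new [of a] new [of b] by blast
 have m2: "(a, b) \<in> psi' \<longleftrightarrow> a = b \<and> a \<in> ?H' \<or> (a, b) \<in> psi \<and> a \<notin> ?H' \<and> b \<notin> ?H' \<and> a \<notin> ?H \<and> b \<notin> ?H" for a b
  unfolding psi'_def move_horiz_def
  using n2 [of a b] u2(1) [of a a b] Hm [of a] new [of a] new [of b] by blast
 have m3: "(a, b) \<in> chi' \<longleftrightarrow> a = b \<and> a \<in> ?H' \<or> (a, b) \<in> chi \<and> a \<notin> ?H' \<and> b \<notin> ?H' \<and> a \<notin> ?H \<and> b \<notin> ?H" for a b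
 proof -
  have "(a, b) \<in> move_horiz ?H ?H' chi \<longleftrightarrow> a = b \<and> a \<in> ?H' \<or> (a, b) \<in> chi \<and> \<not> (a = b \<and> a \<in> ?H)"
   unfolding move_horiz_def by blast
  then have "(a, b) \<in> chi' \<longleftrightarrow> a = b \<and> a \<in> ?H' \<or> (a, b) \<in> chi \<and> \<not> (a = b \<and> a \<in> ?H)"
   unfolding tw(2) .
  moreover have "(a \<in> ?H --> b = a) \<and> (b \<in> ?H --> b = a)" if "(a, b) \<in> chi"
   using strand_diagram_unique(1) [OF valid_strand_diagram [OF c(1)] that, of a]
    strand_diagram_unique(2) [OF valid_strand_diagram [OF c(1)] that, of b]
   by (simp add: horiz_def)
  moreover have "(a \<in> ?H' --> a \<in> ?H) \<and> (b \<in> ?H' --> b \<in> ?H)" if "(a, b) \<in> chi"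
   using tw(3) [of a] tw(3) [of b] that by blast
  ultimately show ?thesis by blast
 qed
 have R1: "(\<exists>a. (a, b) \<in> phi') \<longleftrightarrow> b \<in> ?H' \<or> b \<in> Range phi \<and> b \<notin> ?H" for b
 proof -
  have "a \<notin> ?H' \<and> a \<notin> ?H" if "(a, b) \<in> phi" "b \<notin> ?H" for a
   using n1 [OF that(1)] that new [of a] by blast
  then show ?thesis unfolding m1 Range_iff by blast
 qed
 have R2: "(\<exists>a. (b, a) \<in> psi') \<longleftrightarrow> b \<in> ?H' \<or> b \<in> Domain psi \<and> b \<notin> ?H" for b
 proof -
  have "a \<notin> ?H' \<and> a \<notin> ?H" if "(b, a) \<in> psi" "b \<notin> ?H" for a
   using n2 [OF that(1)] that new [of a] by blast
  then show ?thesis unfolding m2 Domain_iff by blast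
 qed
 show "Range phi' = Domain psi'" 
 proof (rule Set.set_eqI)
  fix b
  have "b \<in> Range phi' \<longleftrightarrow> b \<in> ?H' \<or> b \<in> Range phi \<and> b \<notin> ?H" unfolding R1 [symmetric] by blast
  moreover have "b \<in> Domain psi' \<longleftrightarrow> b \<in> ?H' \<or> b \<in> Domain psi \<and> b \<notin> ?H" unfolding R2 [symmetric] by blast
  ultimately show "b \<in> Range phi' \<longleftrightarrow> b \<in> Domain psi'" by (simp only: R)
 qed
 have m4: "b \<notin> ?H \<and> b \<notin> ?H'" if "(a, b) \<in> phi" "(b, d) \<in> psi" "a \<notin> ?H" "a \<notin> ?H'" for a b d
  using that n1 [OF that(1)] new [of b] by blast
 have m5: "(a, d) \<in> phi' O psi' \<longleftrightarrow> (a, d) \<in> chi'" for a d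
 proof -
  have "(a, d) \<in> phi' O psi' \<longleftrightarrow> (\<exists>b. (a, b) \<in> phi' \<and> (b, d) \<in> psi')" by blast
  also have "\<dots> \<longleftrightarrow> a = d \<and> a \<in> ?H' \<or> (\<exists>b. (a, b) \<in> phi \<and> (b, d) \<in> psi) \<and> a \<notin> ?H' \<and> d \<notin> ?H' \<and> a \<notin> ?H \<and> d \<notin> ?H"
   unfolding m1 m2 using m4 by blast
  also have "\<dots> \<longleftrightarrow> (a, d) \<in> chi'" unfolding m3 using chi by blast
  finally show ?thesis .
 qed
 show "phi' O psi' = chi'" using m5 by (meson subrelI subset_antisym)
 show "\<not> dbl_cross phi' psi'"
 proof
  assume "dbl_cross phi' psi'"
  then obtain a b c d e f where h: "(a, c) \<in> phi'" "(b, d) \<in> phi'" "(c, e) \<in> psi'" "(d, f) \<in> psi'"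
  "point_less a b" "point_less d c" "point_less e f" unfolding dbl_cross_def by blast
  have le: "point_le a c" "point_le b d" "point_le c e" "point_le d f"
   using h(1-4) strand_diagramD(3) valid_strand_diagram V1(1) V2(1) by blast+
  \<comment> \<open>Neither of two strands that cross twice is horizontal through both factors, so
    both were there before the move.\<close>
  have 1: "\<not> (a = c \<and> c = e)" "\<not> (b = d \<and> d = f)"
   using le h(5-7) by (auto simp: point_le_def point_less_def)
  have "(a, c) \<in> phi" "(c, e) \<in> psi" using h(1,3) 1(1) unfolding m1 m2 by blast+
  moreover have "(b, d) \<in> phi" "(d, f) \<in> psi" using h(2,4) 1(2) unfolding m1 m2 by blast+
  ultimately show False using nd h(5-7) unfolding dbl_cross_def by blast
 qed
qed

lemma chain_mult_alg:
 assumes Z: "arc_diagram Z" and x: "x \<in> alg Z" and y: "y \<in> alg Z"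
 shows "chain_mult x y \<in> alg Z"
proof (rule invariant_chainsI)
 fix chi assume "chi \<in> keys (chain_mult x y)"
 then obtain phi psi where h: "phi \<in> keys x" "psi \<in> keys y" "Range phi = Domain psi" "phi O psi = chi"
  using keys_chain_mult [OF alg_mchains [OF x] alg_mchains [OF y]] by metis
 then show "valid Z chi" using valid_comp(1) [OF alg_valid [OF x h(1)] alg_valid [OF y h(2)] h(3)] by simp
next
 fix chi chi' assume v: "valid Z chi" "valid Z chi'" and eq: "diagram_of Z chi' = diagram_of Z chi"
  and k: "chi \<in> keys (chain_mult x y)"
 let ?S = "composable (keys x) (keys y)"
 let ?T = "\<lambda>chi. {i \<in> ?S. fst i O snd i = chi}"
 let ?m = "\<lambda>chi chi'. map_prod (move_horiz (horiz chi) (horiz chi')) (move_horiz (horiz chi) (horiz chi'))"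
 have step: "?m chi chi' i \<in> ?T chi' \<and> ?m chi' chi (?m chi chi' i) = i"
  if "valid Z chi'" "diagram_of Z chi' = diagram_of Z chi" "i \<in> ?T chi" for chi chi' i
 proof -
  obtain phi psi where i: "i = (phi, psi)" by (cases i)
  have h: "phi \<in> keys x" "psi \<in> keys y" "Range phi = Domain psi" "\<not> dbl_cross phi psi" "phi O psi = chi"
   using that(3) i by (auto simp: composable_def)
  note m = move_horiz_comp [OF Z alg_valid [OF x h(1)] alg_valid [OF y h(2)] h(3-5) that(1,2)]
  show ?thesis
   using m invariant_chains_closed [OF x h(1) m(1,2)] invariant_chains_closed [OF y h(2) m(4,5)] i
   by (simp add: composable_def)
 qed
 have "bij_betw (?m chi chi') (?T chi) (?T chi')"
 proof (rule bij_betw_byWitness [where f' = "?m chi' chi"]; intro ballI image_subsetI)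
  fix i assume "i \<in> ?T chi"
  from step [OF v(2) eq this] show "?m chi' chi (?m chi chi' i) = i" "?m chi chi' i \<in> ?T chi'" by (rule conjunct2, rule conjunct1)
 next
  fix i assume "i \<in> ?T chi'"
  from step [OF v(1) eq [symmetric] this] show "?m chi chi' (?m chi' chi i) = i" "?m chi' chi i \<in> ?T chi" by (rule conjunct2, rule conjunct1)
 qed
 from keys_sum_single_iff [OF finite_composable finite_composable this] k
 show "chi' \<in> keys (chain_mult x y)"
  unfolding chain_mult_pairs [OF alg_mchains [OF x] alg_mchains [OF y]] by simp
qed simp

section \<open>The homology ring\<close>

lemma alg_add: "x \<in> alg Z ==> y \<in> alg Z ==> x + y \<in> alg Z"
 by (rule invariant_chains_add)

lemma alg_diff_diff: "x \<in> alg Z ==> diff (diff x) = 0"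
 by (rule diff_diff [OF alg_mchains])

lemma alg_leibniz:
 "x \<in> alg Z ==> y \<in> alg Z ==> diff (chain_mult x y) = chain_mult (diff x) y + chain_mult x (diff y)"
 by (rule leibniz [OF alg_mchains alg_mchains])

lemma alg_mult_assoc:
 "x \<in> alg Z ==> y \<in> alg Z ==> z \<in> alg Z ==> chain_mult (chain_mult x y) z = chain_mult x (chain_mult y z)"
 by (rule chain_mult_assoc [OF alg_mchains alg_mchains alg_mchains])

lemma strand_algebra_simps [simp]:
 "mult (strand_algebra Z) = chain_mult" "zero (strand_algebra Z) = 0" "add (strand_algebra Z) = (+)"
 "one (strand_algebra Z) = (\<Sum>s\<in>Pow (pairs Z). idem Z s)"
 by (simp_all add: strand_algebra_def)

lemma finite_pairs [simp]: "finite (pairs Z)"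
 by (simp add: pairs_def)

lemma idem_chain_sum: "idem Z s = chain_sum (Id_on ` idem_sets Z s)"
proof -
 have "inj_on Id_on (idem_sets Z s)" by (rule inj_onI) (metis Domain_Id_on)
 then show ?thesis unfolding idem_eq chain_sum_def by (simp add: sum.reindex)
qed

lemma idem_alg:
 assumes "s \<subseteq> pairs Z"
 shows "idem Z s \<in> alg Z"
proof -
 have sd: "strand_diagram Z {}" by (simp add: strand_diagram_def)
 have core: "core {} = {}" by (simp add: core_def)
 have eq: "Id_on ` idem_sets Z s = {phi. valid Z phi \<and> diagram_of Z phi = (s, {}, s)}"
 proof (intro equalityI subsetI)
  fix phi assume "phi \<in> Id_on ` idem_sets Z s"
  then obtain S where S: "phi = Id_on S" "S \<in> idem_sets Z s" by blast
  have h: "S \<subseteq> points Z" "\<forall>P\<in>pairs Z. card (S \<inter> pair_places Z P) \<le> 1" "occ Z S = s"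
   using S(2) unfolding idem_sets_occ [OF assms] by simp_all
  have "strand_diagram Z phi"
   unfolding strand_diagram_def S(1) single_valued_def point_le_def
   using h(1) by blast
  moreover have "core phi = {}" unfolding S(1) core_def by blast
  moreover have "Domain phi = S" "Range phi = S" by (simp_all add: S(1) Domain_Id_on Range_Id_on)
  ultimately show "phi \<in> {phi. valid Z phi \<and> diagram_of Z phi = (s, {}, s)}"
   using h unfolding valid_def diagram_of_def by simp
 next
  fix phi assume "phi \<in> {phi. valid Z phi \<and> diagram_of Z phi = (s, {}, s)}"
  then have h: "valid Z phi" "core phi = {}" "occ Z (Domain phi) = s" by (simp_all add: diagram_of_def)
  have e: "phi = Id_on (horiz phi)" using core_horiz [of phi] h(2) by simp
  then have D: "Domain phi = horiz phi" by (metis Domain_Id_on)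
  have "phi \<subseteq> points Z \<times> points Z" using h(1) by (simp add: valid_def strand_diagram_def)
  then have "horiz phi \<subseteq> points Z" unfolding horiz_def by blast
  then have "horiz phi \<in> idem_sets Z s"
   unfolding idem_sets_occ [OF assms] using h D by (simp add: valid_def)
  then show "phi \<in> Id_on ` idem_sets Z s" using e by (rule rev_image_eqI)
 qed
 show ?thesis
  unfolding idem_chain_sum eq by (rule invariant_chainsI) simp_all
qed

lemma one_alg: "(\<Sum>s\<in>Pow (pairs Z). idem Z s) \<in> alg Z"
 by (rule invariant_chains_sum) (simp add: idem_alg)

text \<open>A term is fixed by the one idempotent whose set consists of the pairs used at its start
  and is killed by all others.\<close>

lemma idem_sum_left:
 assumes "x \<in> alg Z"
 shows "chain_mult (\<Sum>s\<in>Pow (pairs Z). idem Z s) x = x"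
proof -
 let ?one = "\<Sum>s\<in>Pow (pairs Z). idem Z s"
 have s: "chain_mult ?one (single phi 1) = single phi 1" if "phi \<in> keys x" for phi
 proof -
  have v: "valid Z phi" by (rule alg_valid [OF assms that])
  then have sub: "Domain phi \<subseteq> points Z" unfolding valid_def strand_diagram_def by blast
  have "(Domain phi \<in> idem_sets Z s) = (s = occ Z (Domain phi))" if "s \<in> Pow (pairs Z)" for s
   using idem_sets_occ [of s Z "Domain phi"] v sub that by (auto simp: valid_def)
  then have "chain_mult ?one (single phi 1) = (\<Sum>s\<in>Pow (pairs Z). if s = occ Z (Domain phi) then single phi 1 else 0)"
   unfolding chain_mult_sum_left idem_mult_single by (intro sum.cong) auto
  then show ?thesis using occ_subset [of Z "Domain phi"] by (simp add: sum.delta)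
 qed
 have "chain_mult ?one x = chain_mult ?one (\<Sum>phi\<in>keys x. single phi 1)"
  using chain_sum_keys [of x] by (simp add: chain_sum_def)
 also have "\<dots> = (\<Sum>phi\<in>keys x. single phi 1)"
  unfolding chain_mult_sum_right by (rule sum.cong [OF refl s])
 also have "\<dots> = x" using chain_sum_keys [of x] by (simp add: chain_sum_def)
 finally show ?thesis .
qed

lemma idem_sum_right:
 assumes "x \<in> alg Z"
 shows "chain_mult x (\<Sum>s\<in>Pow (pairs Z). idem Z s) = x"
proof -
 let ?one = "\<Sum>s\<in>Pow (pairs Z). idem Z s"
 have s: "chain_mult (single phi 1) ?one = single phi 1" if "phi \<in> keys x" for phi
 proof -
  have v: "valid Z phi" by (rule alg_valid [OF assms that])
  then have sub: "Range phi \<subseteq> points Z" unfolding valid_def strand_diagram_def by blast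
  have "(Range phi \<in> idem_sets Z s) = (s = occ Z (Range phi))" if "s \<in> Pow (pairs Z)" for s
   using idem_sets_occ [of s Z "Range phi"] v sub that by (auto simp: valid_def)
  then have "chain_mult (single phi 1) ?one = (\<Sum>s\<in>Pow (pairs Z). if s = occ Z (Range phi) then single phi 1 else 0)"
   unfolding chain_mult_sum_right single_mult_idem by (intro sum.cong) auto
  then show ?thesis using occ_subset [of Z "Range phi"] by (simp add: sum.delta)
 qed
 have "chain_mult x ?one = chain_mult (\<Sum>phi\<in>keys x. single phi 1) ?one"
  using chain_sum_keys [of x] by (simp add: chain_sum_def)
 also have "\<dots> = (\<Sum>phi\<in>keys x. single phi 1)"
  unfolding chain_mult_sum_left by (rule sum.cong [OF refl s])
 also have "\<dots> = x" using chain_sum_keys [of x] by (simp add: chain_sum_def)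
 finally show ?thesis .
qed

lemma basis_diff_Id_on [simp]: "basis_diff (Id_on S) = 0"
 by (simp add: basis_diff_def)

lemma diff_idem [simp]: "diff (idem Z s) = 0"
 unfolding idem_eq diff_sum by simp

lemma cycles_eq: "cycles Z = {x \<in> alg Z. diff x = 0}"
 by (simp add: cycles_def)

lemma boundaries_eq: "boundaries Z = diff ` alg Z"
 by (simp add: boundaries_def)

lemma boundaries_cycles: "boundaries Z \<subseteq> cycles Z"
 unfolding boundaries_eq cycles_eq by (auto simp: diff_alg alg_diff_diff)

lemma cycles_add: "x \<in> cycles Z ==> y \<in> cycles Z ==> x + y \<in> cycles Z"
 by (simp add: cycles_eq diff_add alg_add)

lemma cycles_alg: "x \<in> cycles Z ==> x \<in> alg Z"
 by (simp add: cycles_eq)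

lemma cycles_zero [simp]: "0 \<in> cycles Z"
 by (simp add: cycles_eq)

lemma boundaries_zero [simp]: "0 \<in> boundaries Z"
 unfolding boundaries_eq by (rule image_eqI [of _ _ 0]) simp_all

lemma boundaries_add: "x \<in> boundaries Z ==> y \<in> boundaries Z ==> x + y \<in> boundaries Z"
proof -
 assume "x \<in> boundaries Z" "y \<in> boundaries Z"
 then obtain a b where "a \<in> alg Z" "b \<in> alg Z" "x = diff a" "y = diff b" unfolding boundaries_eq by blast
 then show "x + y \<in> boundaries Z"
  unfolding boundaries_eq by (intro image_eqI [of _ _ "a + b"]) (simp_all add: diff_add alg_add)
qed

lemma cycles_sum: "(\<And>i. i \<in> I ==> x i \<in> cycles Z) ==> (\<Sum>i\<in>I. x i) \<in> cycles Z"
 by (induction I rule: infinite_finite_induct) (simp_all add: cycles_add)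

context
 fixes Z :: arc_data
 assumes Z: "arc_diagram Z"
begin

lemma ring_cycle_ring: "ring (cycle_ring Z)"
proof (rule ringI)
 show "abelian_group (cycle_ring Z)"
 proof (rule abelian_groupI)
  fix x assume "x \<in> carrier (cycle_ring Z)"
  then show "\<exists>y\<in>carrier (cycle_ring Z). y \<oplus>\<^bsub>cycle_ring Z\<^esub> x = \<zero>\<^bsub>cycle_ring Z\<^esub>"
   by (intro bexI [of _ x]) (simp_all add: cycle_ring_def)
 qed (simp_all add: cycle_ring_def cycles_add ac_simps)
 show "monoid (cycle_ring Z)"
  by (rule monoidI)
   (auto simp: cycle_ring_def cycles_eq chain_mult_alg [OF Z] alg_leibniz one_alg diff_sum alg_mult_assoc
    idem_sum_left idem_sum_right)
qed (simp_all add: cycle_ring_def chain_mult_add_left chain_mult_add_right)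

lemma ideal_boundaries: "ideal (boundaries Z) (cycle_ring Z)"
proof (rule idealI [OF ring_cycle_ring])
 show "subgroup (boundaries Z) (add_monoid (cycle_ring Z))"
 proof (rule group.subgroupI)
  show "Group.group (add_monoid (cycle_ring Z))"
   by (rule abelian_group.a_group [OF ring.is_abelian_group [OF ring_cycle_ring]])
  show "boundaries Z \<subseteq> carrier (add_monoid (cycle_ring Z))"
   using boundaries_cycles by (simp add: cycle_ring_def)
  show "boundaries Z \<noteq> {}" using boundaries_zero by blast
  fix a b assume a: "a \<in> boundaries Z" and b: "b \<in> boundaries Z"
  show "a \<otimes>\<^bsub>add_monoid (cycle_ring Z)\<^esub> b \<in> boundaries Z"
   using a b by (simp add: cycle_ring_def boundaries_add)
  have "a \<in> cycles Z" using a boundaries_cycles by blast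
  then have "inv\<^bsub>add_monoid (cycle_ring Z)\<^esub> a = a"
   using abelian_group.a_group [OF ring.is_abelian_group [OF ring_cycle_ring]]
   by (intro group.inv_equality) (auto simp: cycle_ring_def)
  then show "inv\<^bsub>add_monoid (cycle_ring Z)\<^esub> a \<in> boundaries Z" using a by simp
 qed
next
 fix a x assume "a \<in> boundaries Z" and x: "x \<in> carrier (cycle_ring Z)"
 then obtain b where b: "a = diff b" "b \<in> alg Z" by (auto simp: boundaries_eq)
 have x: "x \<in> alg Z" "diff x = 0" using x by (auto simp: cycle_ring_def cycles_eq)
 have "x \<otimes>\<^bsub>cycle_ring Z\<^esub> a = diff (chain_mult x b)" "a \<otimes>\<^bsub>cycle_ring Z\<^esub> x = diff (chain_mult b x)"
  using alg_leibniz [OF x(1) b(2)] alg_leibniz [OF b(2) x(1)] x(2) by (simp_all add: cycle_ring_def b(1))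
 then show "x \<otimes>\<^bsub>cycle_ring Z\<^esub> a \<in> boundaries Z" "a \<otimes>\<^bsub>cycle_ring Z\<^esub> x \<in> boundaries Z"
  using chain_mult_alg [OF Z] x(1) b(2) by (auto simp: boundaries_eq)
qed

lemma ring_homology: "ring (homology Z)"
 unfolding homology_def by (rule ideal.quotient_is_ring [OF ideal_boundaries])

lemma cls_ring_hom: "cls Z \<in> ring_hom (cycle_ring Z) (homology Z)"
proof -
 have "cls Z = (+>\<^bsub>cycle_ring Z\<^esub>) (boundaries Z)" by (rule ext) (simp add: cls_def)
 then show ?thesis unfolding homology_def using ideal.rcos_ring_hom [OF ideal_boundaries] by simp
qed

lemma carrier_homology: "carrier (homology Z) = cls Z ` cycles Z"
 unfolding homology_def FactRing_def cls_def A_RCOSETS_def' by (auto simp: cycle_ring_def)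

lemma cls_closed: "x \<in> cycles Z ==> cls Z x \<in> carrier (homology Z)"
 unfolding carrier_homology by (rule imageI)

lemma cls_add: "x \<in> cycles Z ==> y \<in> cycles Z ==> cls Z (x + y) = cls Z x \<oplus>\<^bsub>homology Z\<^esub> cls Z y"
 using ring_hom_add [OF cls_ring_hom, of x y] by (simp add: cycle_ring_def)

lemma cls_mult: "x \<in> cycles Z ==> y \<in> cycles Z ==> cls Z (chain_mult x y) = cls Z x \<otimes>\<^bsub>homology Z\<^esub> cls Z y"
 using ring_hom_mult [OF cls_ring_hom, of x y] by (simp add: cycle_ring_def)

lemma cls_def': "cls Z x = (\<lambda>b. b + x) ` boundaries Z"
 unfolding cls_def a_r_coset_def r_coset_def by (auto simp: cycle_ring_def)

lemma zero_homology: "\<zero>\<^bsub>homology Z\<^esub> = boundaries Z"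
 by (simp add: homology_def FactRing_def)

lemma cls_eq_iff: "x \<in> cycles Z ==> y \<in> cycles Z ==> cls Z x = cls Z y \<longleftrightarrow> x + y \<in> boundaries Z"
proof
 assume "cls Z x = cls Z y"
 then have "0 + x \<in> cls Z y" unfolding cls_def' using boundaries_zero by (metis imageI)
 then obtain b where "b \<in> boundaries Z" "x = b + y" by (auto simp: cls_def')
 then show "x + y \<in> boundaries Z" by (simp add: add.assoc)
next
 assume h: "x + y \<in> boundaries Z"
 have sub: "cls Z u \<subseteq> cls Z v" if "u + v \<in> boundaries Z" for u v
 proof
  fix w assume "w \<in> cls Z u"
  then obtain b where b: "b \<in> boundaries Z" "w = b + u" by (auto simp: cls_def')
  have "w = (b + (u + v)) + v" by (simp add: b add.assoc)
  then show "w \<in> cls Z v" unfolding cls_def' using boundaries_add [OF b(1) that] by (rule image_eqI)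
 qed
 have "y + x \<in> boundaries Z" using h by (simp add: add.commute)
 then show "cls Z x = cls Z y" using sub [OF h] sub [of y x] by blast
qed

lemma cls_zero: "cls Z 0 = \<zero>\<^bsub>homology Z\<^esub>"
 by (simp add: cls_def' zero_homology)

lemma cls_eq_zero: "x \<in> cycles Z ==> cls Z x = \<zero>\<^bsub>homology Z\<^esub> \<longleftrightarrow> x \<in> boundaries Z"
 using cls_eq_iff [of x 0] by (simp add: cls_zero)

lemma cls_sum: 
 assumes "finite I" "\<And>i. i \<in> I ==> x i \<in> cycles Z"
 shows "cls Z (\<Sum>i\<in>I. x i) = (\<Oplus>\<^bsub>homology Z\<^esub>i\<in>I. cls Z (x i))"
 using assms
proof (induction I)
 case empty
 interpret ring "homology Z" by (rule ring_homology)
 show ?case by (simp add: cls_zero)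
next
 case (insert j I)
 interpret ring "homology Z" by (rule ring_homology)
 have "(\<Sum>i\<in>I. x i) \<in> cycles Z"
  using insert.prems by (intro cycles_sum) simp
 then have "cls Z (x j + (\<Sum>i\<in>I. x i)) = cls Z (x j) \<oplus>\<^bsub>homology Z\<^esub> cls Z (\<Sum>i\<in>I. x i)"
  using insert.prems by (intro cls_add) auto
 moreover have "(\<lambda>i. cls Z (x i)) \<in> I \<rightarrow> carrier (homology Z)" "cls Z (x j) \<in> carrier (homology Z)"
  using insert.prems cls_closed by auto
 ultimately show ?case using insert by simp
qed

end

section \<open>Gradings\<close>

definition hgr :: "strands => hclass" where
 "hgr phi = (\<Sum>c\<in>phi. interval_class (fst c) (snd c))"

text \<open>A strand that does not descend covers \<sigma> exactly when it starts in this set and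
  ends outside.\<close>

definition below :: "step => point set" where
 "below \<sigma> = {p. fst p = fst \<sigma> \<and> snd p \<le> snd \<sigma>}"

lemma interval_class_self [simp]: "interval_class x x = 0"
 by (simp add: interval_class_def)

lemma lookup_interval_class:
 "lookup (interval_class x y) \<sigma> = (if fst \<sigma> = fst x \<and> snd x \<le> snd \<sigma> \<and> snd \<sigma> < snd y then 1 else 0)"
proof -
 have "lookup (interval_class x y) \<sigma> = (\<Sum>j\<in>{snd x..<snd y}. if j = snd \<sigma> then (if fst x = fst \<sigma> then 1 else 0) else 0)"
  unfolding interval_class_def lookup_sum by (rule sum.cong) (auto simp: lookup_single when_def prod_eq_iff)
 then show ?thesis by (auto simp: sum.delta)
qed

lemma lookup_interval_class_le:
 assumes "point_le x y"
 shows "lookup (interval_class x y) \<sigma> = of_bool (x \<in> below \<sigma>) - of_bool (y \<in> below \<sigma>)"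
 using assms by (auto simp: lookup_interval_class below_def point_le_def)

lemma lookup_hgr:
 "lookup (hgr phi) \<sigma> = (\<Sum>c\<in>phi. of_bool (fst \<sigma> = fst (fst c) \<and> snd (fst c) \<le> snd \<sigma> \<and> snd \<sigma> < snd (snd c)))"
 unfolding hgr_def lookup_sum lookup_interval_class by (rule sum.cong) simp_all

lemma sum_of_bool_card: "finite A ==> (\<Sum>a\<in>A. of_bool (P a)) = int (card {a \<in> A. P a})"
 unfolding of_bool_def by (simp add: sum_filter del: sum.inter_filter)

lemma inj_on_strands:
 assumes "strand_diagram Z phi"
 shows "inj_on fst phi" "inj_on snd phi"
proof -
 have u: "(fst a = fst b --> snd a = snd b) \<and> (snd a = snd b --> fst a = fst b)" if "a \<in> phi" "b \<in> phi" for a b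
 proof (intro conjI impI)
  have a: "(fst a, snd a) \<in> phi" and b: "(fst b, snd b) \<in> phi" using that by simp_all
  show "snd a = snd b" if "fst a = fst b"
   using strand_diagram_unique(1) [OF assms a, of "snd b"] b that by simp
  show "fst a = fst b" if "snd a = snd b"
   using strand_diagram_unique(2) [OF assms a, of "fst b"] b that by simp
 qed
 show "inj_on fst phi"
 proof (rule inj_onI)
  fix a b assume "a \<in> phi" "b \<in> phi" "fst a = fst b"
  with u [of a b] show "a = b" by (intro prod_eqI) simp_all
 qed
 show "inj_on snd phi"
 proof (rule inj_onI)
  fix a b assume "a \<in> phi" "b \<in> phi" "snd a = snd b"
  with u [of a b] show "a = b" by (intro prod_eqI) simp_all
 qed
qed

lemma sum_strands:
 assumes "strand_diagram Z phi"
 shows "(\<Sum>c\<in>phi. f (fst c)) = (\<Sum>x\<in>Domain phi. f x)" "(\<Sum>c\<in>phi. f (snd c)) = (\<Sum>x\<in>Range phi. f x)"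
proof -
 have "Domain phi = fst ` phi" "Range phi = snd ` phi" by (simp_all only: fst_eq_Domain snd_eq_Range)
 then show "(\<Sum>c\<in>phi. f (fst c)) = (\<Sum>x\<in>Domain phi. f x)" "(\<Sum>c\<in>phi. f (snd c)) = (\<Sum>x\<in>Range phi. f x)"
  using inj_on_strands [OF assms] by (simp_all add: sum.reindex)
qed

text \<open>Counting starts minus ends up to a step shows that the class depends only on the sets of
  starts and ends. Hence resolutions preserve it and composition adds it.\<close>

lemma lookup_hgr_endpoints:
 assumes "strand_diagram Z phi"
 shows "lookup (hgr phi) \<sigma> = (\<Sum>x\<in>Domain phi. of_bool (x \<in> below \<sigma>)) - (\<Sum>y\<in>Range phi. of_bool (y \<in> below \<sigma>))"
proof -
 have "point_le (fst c) (snd c)" if "c \<in> phi" for c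
  using strand_diagramD(3) [OF assms, of "fst c" "snd c"] that by simp
 then have "lookup (hgr phi) \<sigma> = (\<Sum>c\<in>phi. of_bool (fst c \<in> below \<sigma>) - of_bool (snd c \<in> below \<sigma>))"
  unfolding hgr_def lookup_sum by (intro sum.cong refl lookup_interval_class_le)
 also have "\<dots> = (\<Sum>c\<in>phi. of_bool (fst c \<in> below \<sigma>)) - (\<Sum>c\<in>phi. of_bool (snd c \<in> below \<sigma>))"
  by (rule sum_subtractf)
 finally show ?thesis
  using sum_strands [OF assms, of "\<lambda>x. of_bool (x \<in> below \<sigma>) :: int"] by simp
qed

lemma hgr_eqI:
 assumes "strand_diagram Z phi" "strand_diagram Z psi" "Domain phi = Domain psi" "Range phi = Range psi"
 shows "hgr phi = hgr psi"
 by (rule poly_mapping_eqI) (simp add: lookup_hgr_endpoints [OF assms(1)] lookup_hgr_endpoints [OF assms(2)] assms(3,4))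

lemma hgr_comp:
 assumes "valid Z phi" "valid Z psi" "Range phi = Domain psi"
 shows "hgr (phi O psi) = hgr phi + hgr psi"
proof (rule poly_mapping_eqI)
 fix \<sigma>
 note c = valid_comp [OF assms]
 show "lookup (hgr (phi O psi)) \<sigma> = lookup (hgr phi + hgr psi) \<sigma>"
  unfolding lookup_add lookup_hgr_endpoints [OF valid_strand_diagram [OF c(1)]] c(2,3)
   lookup_hgr_endpoints [OF valid_strand_diagram [OF assms(1)]]
   lookup_hgr_endpoints [OF valid_strand_diagram [OF assms(2)]] assms(3) by simp
qed

text \<open>The case distinction is there because \<open>step_before\<close> of the start of an
  interval is, by truncated subtraction, the step after it.\<close>

lemma lookup_bdry: "lookup (bdry h) p =
 (if snd p = 0 then 0 else lookup h (step_before p)) - lookup h (step_after p)"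
proof -
 let ?l = "lookup h" and ?K = "keys h"
 have "lookup (bdry h) p = (\<Sum>\<sigma>\<in>?K. (if step_end \<sigma> = p then ?l \<sigma> else 0)) - (\<Sum>\<sigma>\<in>?K. if \<sigma> = p then ?l \<sigma> else 0)"
  unfolding bdry_def lookup_sum lookup_minus sum_subtractf
  by (simp add: lookup_single when_def step_start_def)
 also have "(\<Sum>\<sigma>\<in>?K. if \<sigma> = p then ?l \<sigma> else 0) = ?l (step_after p)"
  by (simp add: sum.delta step_after_def in_keys_iff)
 also have "(\<Sum>\<sigma>\<in>?K. (if step_end \<sigma> = p then ?l \<sigma> else 0)) = (\<Sum>\<sigma>\<in>?K. if \<sigma> = step_before p then (if snd p = 0 then 0 else ?l \<sigma>) else 0)"
  by (rule sum.cong) (auto simp: step_end_def step_before_def prod_eq_iff)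
 also have "\<dots> = (if snd p = 0 then 0 else ?l (step_before p))"
  by (simp add: sum.delta in_keys_iff)
 finally show ?thesis .
qed

text \<open>From the step before p to the step after it the count of starts and ends changes only at
  p itself. So the class determines the points that are a start or an end but not both; it does not
  see whether a point is both or neither.\<close>

lemma lookup_bdry_hgr:
 assumes "strand_diagram Z phi"
 shows "lookup (bdry (hgr phi)) p = of_bool (p \<in> Range phi) - of_bool (p \<in> Domain phi)"
proof -
 let ?b = "\<lambda>S \<sigma>. (\<Sum>x\<in>S. of_bool (x \<in> below \<sigma>)) :: int"
 have fin: "finite (Domain phi)" "finite (Range phi)"
  using strand_diagram_finite [OF assms] by (simp_all add: finite_Domain finite_Range)
 have S: "?b S (step_after p) = (if snd p = 0 then 0 else ?b S (step_before p)) + of_bool (p \<in> S)" if "finite S" for S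
 proof -
  have "of_bool (x \<in> below (step_after p)) = (if snd p = 0 then 0 else of_bool (x \<in> below (step_before p))) + (of_bool (x = p) :: int)" for x
   by (cases x; cases p) (auto simp: below_def step_after_def step_before_def)
  then have "?b S (step_after p) = (if snd p = 0 then 0 else ?b S (step_before p)) + (\<Sum>x\<in>S. of_bool (x = p))"
   by (simp add: sum.distrib)
  also have "(\<Sum>x\<in>S. of_bool (x = p)) = (of_bool (p \<in> S) :: int)"
   using that by (simp add: of_bool_def sum.delta)
  finally show ?thesis .
 qed
 show ?thesis
  unfolding lookup_bdry lookup_hgr_endpoints [OF assms] S [OF fin(1)] S [OF fin(2)] by simp
qed

definition mset_mult :: "arc_data => hclass => point set => rat" where
 "mset_mult Z h S = (\<Sum>a\<in>places Z. of_bool (a \<in> S) * avg_mult h a)"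

lemma finite_places [simp]: "finite (places Z)"
 by (rule finite_subset [OF _ finite_points [of Z]]) (auto simp: places_def points_def)

lemma mlt_set: "finite S ==> mlt Z h (\<Sum>a\<in>S. single a 1) = mset_mult Z h S"
 unfolding mlt_def mset_mult_def
 by (rule sum.cong) (simp_all add: lookup_sum lookup_single when_def of_bool_def sum.delta')

lemma mlt_bdry:
 assumes "strand_diagram Z phi"
 shows "mlt Z h (bdry (hgr phi)) = mset_mult Z h (Range phi) - mset_mult Z h (Domain phi)"
 unfolding mlt_def mset_mult_def lookup_bdry_hgr [OF assms] sum_subtractf [symmetric]
 by (rule sum.cong) (simp_all add: left_diff_distrib)

lemma avg_mult_add: "avg_mult (h + k) a = avg_mult h a + avg_mult k a"
 by (simp add: avg_mult_def lookup_add add_divide_distrib)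

lemma mset_mult_add: "mset_mult Z (h + k) S = mset_mult Z h S + mset_mult Z k S"
 by (simp add: mset_mult_def avg_mult_add ring_distribs sum.distrib)

text \<open>The Maslov grading computed from one term; \<open>iota_core\<close> shows that the terms
  of a diagram agree on it.\<close>

definition iota :: "arc_data => strands => rat" where
 "iota Z phi = of_nat (inversions phi) - mset_mult Z (hgr phi) (Domain phi)"

lemma hgr_core:
 assumes "strand_diagram Z phi"
 shows "hgr (core phi) = hgr phi"
 unfolding hgr_def
 by (rule sum.mono_neutral_left) (use strand_diagram_finite [OF assms] in \<open>auto simp: core_def\<close>)

lemma hgrade_diagram_of: "valid Z phi ==> hgrade (diagram_of Z phi) = hgr phi"
 using hgr_core [of Z phi] by (simp add: hgrade_def diagram_of_def hgr_def case_prod_unfold)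

text \<open>A horizontal strand at a place p crosses exactly the moving strands running past p. No
  moving strand begins or ends at p, so their number is the multiplicity on both adjacent steps,
  which is the average subtracted for p. Nothing runs past the extremities of an interval, so
  horizontal strands contribute zero in total.\<close>

lemma iota_core:
 assumes v: "valid Z phi"
 shows "iota Z phi = iota Z (core phi)"
proof -
 have sd: "strand_diagram Z phi" using v by simp
 have fin: "finite phi" by (rule strand_diagram_finite [OF sd])
 let ?H = "horiz phi"
 let ?over = "\<lambda>p. {c \<in> core phi. point_less (fst c) p \<and> point_less p (snd c)}"
 have finc: "finite (core phi)" using fin by (rule finite_subset [rotated]) (auto simp: core_def)
 have HD: "?H \<subseteq> Domain phi" by (auto simp: horiz_def)
 have finH: "finite ?H" using HD fin by (meson finite_Domain finite_subset)
 let ?hc = "(\<lambda>(p, c). (c, (p, p))) ` Sigma ?H ?over"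
 have cr: "crossings phi = crossings (core phi) \<union> ?hc"
 proof (intro equalityI subsetI)
  fix d assume d: "d \<in> crossings phi"
  obtain a b x y where h: "d = ((a, x), (b, y))" "(a, x) \<in> phi" "(b, y) \<in> phi" "point_less a b" "point_less y x"
   "point_less a y"
   using crossing_cases [OF sd d] by metis
  have "a \<noteq> x" using h(5,6) by (auto simp: point_less_def)
  then have ax: "(a, x) \<in> core phi" using h(2) by (simp add: core_def)
  show "d \<in> crossings (core phi) \<union> ?hc"
  proof (cases "b = y")
   case True
   then have "(b, (a, x)) \<in> Sigma ?H ?over" using h ax by (simp add: horiz_def)
   then show ?thesis using h(1) True by force
  next
   case False
   then show ?thesis using h ax by (simp add: core_def crossings_def)
  qed
 next
  fix d assume "d \<in> crossings (core phi) \<union> ?hc"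
  then show "d \<in> crossings phi" by (auto simp: crossings_def core_def horiz_def)
 qed
 have disj: "crossings (core phi) \<inter> ?hc = {}" by (auto simp: crossings_def core_def)
 have "crossings (core phi) \<subseteq> core phi \<times> core phi" by (auto simp: crossings_def)
 then have fin1: "finite (crossings (core phi))" by (rule finite_subset) (simp add: finc)
 have fin2: "finite (Sigma ?H ?over)" using finH finc by simp
 have "inversions phi = inversions (core phi) + card ?hc"
  unfolding inversions_def cr by (rule card_Un_disjoint) (use fin1 fin2 disj in auto)
 also have "card ?hc = card (Sigma ?H ?over)" by (rule card_image) (auto simp: inj_on_def)
 also have "\<dots> = (\<Sum>p\<in>?H. card (?over p))" using finH finc by simp
 finally have inv: "inversions phi = inversions (core phi) + (\<Sum>p\<in>?H. card (?over p))" .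
 have Dom1: "Domain phi = Domain (core phi) \<union> ?H"
  using core_horiz [of phi] by (metis Domain_Un_eq Domain_Id_on)
 have Dom2: "Domain (core phi) \<inter> ?H = {}"
  using strand_diagram_unique(1) [OF sd] unfolding core_def horiz_def by blast
 have Dom3: "Range (core phi) \<inter> ?H = {}"
  using strand_diagram_unique(2) [OF sd] unfolding core_def horiz_def by blast
 note Dom = Dom1 Dom2 Dom3
 have nends: "fst c \<noteq> p \<and> snd c \<noteq> p" if "c \<in> core phi" "p \<in> ?H" for c p
  using Dom(2,3) that by (metis DomainI RangeI disjoint_iff prod.collapse)
 have nend: "(fst (fst c) = fst p --> snd (fst c) \<noteq> snd p) \<and> (fst (snd c) = fst p --> snd (snd c) \<noteq> snd p)"
  if "c \<in> core phi" "p \<in> ?H" for c p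
  using nends [OF that] by (metis prod_eqI)
 have avg: "avg_mult (hgr phi) p = of_nat (card (?over p))" if p: "p \<in> ?H" "p \<in> places Z" for p
 proof -
  have s: "snd p \<noteq> 0" using p(2) by (auto simp: places_def)
  have "lookup (hgr (core phi)) (step_before p) = int (card (?over p))"
   unfolding lookup_hgr sum_of_bool_card [OF finc]
  proof (rule arg_cong [of _ _ int], rule arg_cong [of _ _ card], rule Collect_cong, rule conj_cong, rule refl)
   fix c assume c: "c \<in> core phi"
   have "(fst c, snd c) \<in> phi" using c by (simp add: core_def case_prod_unfold)
   from strand_diagramD(3) [OF sd this]
   show "(fst (step_before p) = fst (fst c) \<and> snd (fst c) \<le> snd (step_before p) \<and> snd (step_before p) < snd (snd c)) =
     (point_less (fst c) p \<and> point_less p (snd c))"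
    using nend [OF c p(1)] s
    by (cases "fst (fst c) = fst p") (auto simp: step_before_def point_less_def point_le_def)
  qed
  moreover have "lookup (hgr (core phi)) (step_after p) = int (card (?over p))"
   unfolding lookup_hgr sum_of_bool_card [OF finc]
  proof (rule arg_cong [of _ _ int], rule arg_cong [of _ _ card], rule Collect_cong, rule conj_cong, rule refl)
   fix c assume c: "c \<in> core phi"
   have "(fst c, snd c) \<in> phi" using c by (simp add: core_def case_prod_unfold)
   from strand_diagramD(3) [OF sd this]
   show "(fst (step_after p) = fst (fst c) \<and> snd (fst c) \<le> snd (step_after p) \<and> snd (step_after p) < snd (snd c)) =
     (point_less (fst c) p \<and> point_less p (snd c))"
    using nend [OF c p(1)] s
    by (cases "fst (fst c) = fst p") (auto simp: step_after_def point_less_def point_le_def)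
  qed
  ultimately show ?thesis unfolding avg_mult_def hgr_core [OF sd] by simp
 qed
 have noplace: "card (?over p) = 0" if "p \<in> ?H" "p \<notin> places Z" for p
 proof -
  have pp: "p \<in> points Z" using that(1) strand_diagramD(1) [OF sd] by (auto simp: horiz_def)
  have "?over p = {}"
  proof (rule ccontr)
   assume "?over p \<noteq> {}"
   then obtain c where c: "c \<in> core phi" "point_less (fst c) p" "point_less p (snd c)" by blast
   have "(fst c, snd c) \<in> phi" using c(1) by (simp add: core_def case_prod_unfold)
   then have "snd c \<in> points Z" using strand_diagramD(2) [OF sd] by blast
   then show False using c(2,3) that(2) pp
    by (cases p; cases "fst c"; cases "snd c") (auto simp: point_less_def points_def places_def)
  qed
  then show ?thesis by (simp only: card.empty)
 qed
 have "mset_mult Z (hgr phi) (Domain phi) = mset_mult Z (hgr phi) (Domain (core phi)) + mset_mult Z (hgr phi) ?H"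
  unfolding mset_mult_def sum.distrib [symmetric]
 proof (rule sum.cong [OF refl])
  fix a
  show "of_bool (a \<in> Domain phi) * avg_mult (hgr phi) a =
    of_bool (a \<in> Domain (core phi)) * avg_mult (hgr phi) a + of_bool (a \<in> ?H) * avg_mult (hgr phi) a"
  proof -
   have "a \<in> Domain phi \<longleftrightarrow> a \<in> Domain (core phi) \<or> a \<in> ?H" using Dom(1) by (metis Un_iff)
   moreover have "\<not> (a \<in> Domain (core phi) \<and> a \<in> ?H)" using Dom(2) by (metis IntI emptyE)
   ultimately show ?thesis by (cases "a \<in> ?H") simp_all
  qed
 qed
 also have "mset_mult Z (hgr phi) ?H = (\<Sum>p\<in>?H. of_nat (card (?over p)))"
 proof -
  have "mset_mult Z (hgr phi) ?H = (\<Sum>p\<in>places Z. if p \<in> ?H then avg_mult (hgr phi) p else 0)"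
   unfolding mset_mult_def by (rule sum.cong) simp_all
  also have "\<dots> = (\<Sum>p\<in>places Z \<inter> ?H. avg_mult (hgr phi) p)"
   by (rule sum.inter_restrict [symmetric]) simp
  also have "\<dots> = (\<Sum>p\<in>places Z \<inter> ?H. of_nat (card (?over p)))"
   by (rule sum.cong) (use avg in simp_all)
  also have "\<dots> = (\<Sum>p\<in>?H. of_nat (card (?over p)))"
  proof (rule sum.mono_neutral_left [OF finH], blast, rule ballI)
   fix p assume "p \<in> ?H - places Z \<inter> ?H"
   then have "card (?over p) = 0" by (intro noplace) blast+
   then show "rat_of_nat (card (?over p)) = 0" by (simp only: of_nat_0)
  qed
  finally show ?thesis .
 qed
 finally show ?thesis by (simp add: iota_def inv hgr_core [OF sd])
qed

lemma maslov_diagram_of: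
 assumes "valid Z phi"
 shows "maslov Z (diagram_of Z phi) = iota Z phi"
proof -
 let ?D = "diagram_of Z phi"
 define \<nu> where "\<nu> = (SOME \<nu>. \<nu> \<in> terms_of Z ?D)"
 have "phi \<in> terms_of Z ?D" using assms by (simp add: terms_of_diagram)
 then have "\<nu> \<in> terms_of Z ?D" unfolding \<nu>_def by (rule someI)
 then have \<nu>: "valid Z \<nu>" "diagram_of Z \<nu> = ?D" using assms by (simp_all add: terms_of_diagram)
 have "core \<nu> = core phi" using \<nu>(2) by (simp add: diagram_of_def)
 then have "iota Z \<nu> = iota Z phi" using iota_core [OF \<nu>(1)] iota_core [OF assms] by simp
 moreover have "finite (Domain \<nu>)" by (rule finite_Domain [OF strand_diagram_finite [OF valid_strand_diagram [OF \<nu>(1)]]])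
 moreover have "hgrade ?D = hgr \<nu>" using hgrade_diagram_of [OF \<nu>(1)] \<nu>(2) by simp
 ultimately have "maslov Z ?D = iota Z \<nu>"
  unfolding maslov_def \<nu>_def [symmetric] Let_def by (simp only: mlt_set iota_def)
 then show ?thesis using \<open>iota Z \<nu> = iota Z phi\<close> by simp
qed

lemma hdata_diagram_of: "valid Z phi ==> hdata_of (diagram_of Z phi) = (hgr phi, occ Z (Domain phi), occ Z (Range phi))"
 using hgrade_diagram_of [of Z phi] by (simp add: hdata_of_def source_def target_def diagram_of_def)

definition alg_gr :: "arc_data => hdata => rat => chain set" where
 "alg_gr Z d g = invariant_chains Z (\<lambda>D. hdata_of D = d \<and> maslov Z D = g)"

lemma alg_hdata_eq: "alg_hdata Z d = invariant_chains Z (\<lambda>D. hdata_of D = d)"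
 and alg_maslov_eq: "alg_maslov Z g = invariant_chains Z (\<lambda>D. maslov Z D = g)"
 and ideal_F_eq: "ideal_F Z = invariant_chains Z (\<lambda>D. \<not> viable_class Z (hgrade D) \<or>
  (\<exists>P. doubly_occupied Z (hgrade D) P \<and> crossing_at Z D P))"
 unfolding alg_hdata_def alg_maslov_def ideal_F_def by (rule span2_invariant)+

lemma alg_gr_iff: "x \<in> alg_gr Z (h, s, t) g \<longleftrightarrow> x \<in> alg Z \<and> 
  (\<forall>phi\<in>keys x. hgr phi = h \<and> occ Z (Domain phi) = s \<and> occ Z (Range phi) = t \<and> iota Z phi = g)"
proof -
 have "(hdata_of (diagram_of Z phi) = (h, s, t) \<and> maslov Z (diagram_of Z phi) = g) =
   (hgr phi = h \<and> occ Z (Domain phi) = s \<and> occ Z (Range phi) = t \<and> iota Z phi = g)" if "valid Z phi" for phi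
  using that by (auto simp: hdata_diagram_of maslov_diagram_of)
 then show ?thesis
  unfolding alg_gr_def invariant_chains_alg [of x Z "\<lambda>D. hdata_of D = (h, s, t) \<and> maslov Z D = g"]
  using alg_valid by blast
qed

lemma alg_gr_alg: "x \<in> alg_gr Z d g ==> x \<in> alg Z"
 by (cases d) (simp add: alg_gr_iff)

lemma alg_gr_zero [simp]: "0 \<in> alg_gr Z d g"
 by (simp add: alg_gr_def)

lemma alg_gr_add: "x \<in> alg_gr Z d g ==> y \<in> alg_gr Z d g ==> x + y \<in> alg_gr Z d g"
 unfolding alg_gr_def by (rule invariant_chains_add)

lemma alg_gr_hdata: "x \<in> alg_gr Z d g ==> x \<in> alg_hdata Z d"
 and alg_gr_maslov: "x \<in> alg_gr Z d g ==> x \<in> alg_maslov Z g"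
proof -
 assume "x \<in> alg_gr Z d g"
 then have "x \<in> alg Z" "\<forall>phi\<in>keys x. hdata_of (diagram_of Z phi) = d \<and> maslov Z (diagram_of Z phi) = g"
  using invariant_chains_alg [of x Z "\<lambda>D. hdata_of D = d \<and> maslov Z D = g"] unfolding alg_gr_def by blast+
 then show "x \<in> alg_hdata Z d" "x \<in> alg_maslov Z g"
  using invariant_chains_alg [of x Z "\<lambda>D. hdata_of D = d"] invariant_chains_alg [of x Z "\<lambda>D. maslov Z D = g"]
  unfolding alg_hdata_eq alg_maslov_eq by blast+
qed

lemma inversions_uncrossable:
 assumes "phi \<in> matchings" "c \<in> uncrossable phi"
 shows "inversions (resolve phi c) + 1 = inversions phi"
proof -
 obtain S g where e: "phi = grf S g" and i: "interval_inj S g"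
  using assms by (auto simp: matchings_def)
 have inj: "inj_on g S" using i by (simp add: points.interval_inj_def)
 have cc: "c \<in> crossings phi" using assms(2) unfolding uncrossable_def by blast
 obtain u v where uv: "(u, v) \<in> crs S g" "c = ((u, g u), (v, g v))"
  using cc unfolding e crossings_grf by (auto simp del: split_paired_All split_paired_Ex)
 have "u \<in> S" "v \<in> S" "u \<noteq> v" using uv(1) points.less_irrefl unfolding points.crs_def by blast+
 then have r: "resolve phi c = grf S (g \<circ> transpose u v)"
  unfolding e uv(2) using inj by (rule resolve_grf)
 have "\<not> points.blocked S g u v"
  using assms(2) unfolding uncrossable_def points.blocked_iff uv(2) e by simp
 then show ?thesis using points.crs_transpose_Suc [OF i uv(1)] unfolding r by (simp add: e inversions_grf)
qed

lemma resolve_graded: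
 assumes "valid Z phi" "c \<in> uncrossable phi"
 shows "hgr (resolve phi c) = hgr phi" "iota Z (resolve phi c) = iota Z phi - 1"
proof -
 have cc: "c \<in> crossings phi" using assms(2) unfolding uncrossable_def by blast
 note r = resolve_matchings [OF valid_matchings [OF assms(1)] cc]
 show h: "hgr (resolve phi c) = hgr phi"
  by (rule hgr_eqI [of Z]) (use assms(1) valid_resolve [OF assms(1) cc] r in auto)
 have "rat_of_nat (inversions phi) = of_nat (inversions (resolve phi c)) + 1"
  using inversions_uncrossable [OF valid_matchings [OF assms(1)] assms(2)] by (metis of_nat_1 of_nat_add)
 then show "iota Z (resolve phi c) = iota Z phi - 1" by (simp add: iota_def h r)
qed

lemma diff_graded:
 assumes x: "x \<in> alg_gr Z d g"
 shows "diff x \<in> alg_gr Z d (g - 1)"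
proof -
 obtain h s t where d: "d = (h, s, t)" by (cases d)
 have xa: "x \<in> alg Z" by (rule alg_gr_alg [OF x])
 show ?thesis
  unfolding d alg_gr_iff
 proof (intro conjI ballI)
  show "diff x \<in> alg Z" by (rule diff_alg [OF xa])
  fix phi assume "phi \<in> keys (diff x)"
  then obtain psi c where p: "psi \<in> keys x" "c \<in> uncrossable psi" "resolve psi c = phi"
   using keys_diff [OF alg_mchains [OF xa]] by blast
  have v: "valid Z psi" by (rule alg_valid [OF xa p(1)])
  have cc: "c \<in> crossings psi" using p(2) unfolding uncrossable_def by blast
  have g: "hgr psi = h" "occ Z (Domain psi) = s" "occ Z (Range psi) = t" "iota Z psi = g"
   using x p(1) unfolding d alg_gr_iff by blast+
  note r = resolve_matchings [OF valid_matchings [OF v] cc] resolve_graded [OF v p(2)]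
  show "hgr phi = h" "occ Z (Domain phi) = s" "occ Z (Range phi) = t" "iota Z phi = g - 1"
   using r g p(3) by simp_all
 qed
qed

text \<open>In the product the class h' is subtracted at the starts of the first factor, in the
  second factor alone at its own starts, which are the ends of the first. The difference between
  these ends and starts is the boundary of h, which gives the correction term.\<close>

lemma mult_graded:
 assumes Z: "arc_diagram Z" and x: "x \<in> alg_gr Z (h, s, t) g" and y: "y \<in> alg_gr Z (h', t, u) g'"
 shows "chain_mult x y \<in> alg_gr Z (h + h', s, u) (g + g' + mlt Z h' (bdry h))"
 unfolding alg_gr_iff
proof (intro conjI ballI)
 have xa: "x \<in> alg Z" "y \<in> alg Z" using x y alg_gr_alg by blast+
 show "chain_mult x y \<in> alg Z" by (rule chain_mult_alg [OF Z xa])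
 fix chi assume "chi \<in> keys (chain_mult x y)"
 then obtain phi psi where p: "phi \<in> keys x" "psi \<in> keys y" "Range phi = Domain psi"
  "\<not> dbl_cross phi psi" "phi O psi = chi"
  by (rule keys_chain_mult [OF alg_mchains [OF xa(1)] alg_mchains [OF xa(2)]])
 have v: "valid Z phi" "valid Z psi" using alg_valid xa p by blast+
 have g: "hgr phi = h" "occ Z (Domain phi) = s" "iota Z phi = g" "hgr psi = h'" "occ Z (Range psi) = u" "iota Z psi = g'"
  using x y p(1,2) unfolding alg_gr_iff by blast+
 note c = valid_comp [OF v p(3), unfolded p(5)]
 have hc: "hgr chi = hgr phi + hgr psi" using hgr_comp [OF v p(3)] p(5) by simp
 have "inversions chi = inversions phi + inversions psi"
  using inversions_comp [OF valid_matchings [OF v(1)] valid_matchings [OF v(2)] p(3)] p(4,5) by simp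
 then have "iota Z chi = iota Z phi + iota Z psi + mlt Z (hgr psi) (bdry (hgr phi))"
  unfolding mlt_bdry [OF valid_strand_diagram [OF v(1)]] iota_def hc c(2) mset_mult_add p(3) by simp
 then show "iota Z chi = g + g' + mlt Z h' (bdry h)" using g by simp
 show "hgr chi = h + h'" "occ Z (Domain chi) = s" "occ Z (Range chi) = u" using hc c g by simp_all
qed

lemma mult_mismatch:
 assumes x: "x \<in> alg_gr Z (h, s, t) g" and y: "y \<in> alg_gr Z (h', t', u) g'" and "t \<noteq> t'"
 shows "chain_mult x y = 0"
proof (rule ccontr)
 assume "chain_mult x y \<noteq> 0"
 then obtain chi where chi: "chi \<in> keys (chain_mult x y)" by (metis keys_eq_empty ex_in_conv)
 have xa: "x \<in> alg Z" "y \<in> alg Z" using x y alg_gr_alg by blast+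
 obtain phi psi where p: "phi \<in> keys x" "psi \<in> keys y" "Range phi = Domain psi"
  "\<not> dbl_cross phi psi" "phi O psi = chi"
  by (rule keys_chain_mult [OF alg_mchains [OF xa(1)] alg_mchains [OF xa(2)] chi])
 have "occ Z (Range phi) = t" "occ Z (Domain psi) = t'" using x y p unfolding alg_gr_iff by blast+
 then show False using p(3) assms(3) by simp
qed

section \<open>Contracting the non-viable part\<close>

lemma chain_cancel: "y + (x + y) = (x :: 'a \<Rightarrow>\<^sub>0 bit)"
 by (subst add.left_commute) simp

context strand_order
begin

text \<open>The situation at the first step covered twice, which begins at c: a strand from x runs
  past c and another starts at c. The conditions on the other strands express disjointness before c
  and that strands do not descend.\<close>

definition pass :: "'a set => ('a => 'a) => 'a => 'a => bool" where
 "pass S g c x \<longleftrightarrow> x \<in> S \<and> c \<in> S \<and> less x c \<and> less c (g x) \<and> less c (g c) \<and>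
  (\<forall>z\<in>S. less z x --> \<not> less x (g z)) \<and> (\<forall>z\<in>S. less x z --> less z c --> g z = z) \<and>
  (\<forall>z\<in>S. g z = z \<or> less z (g z))"

text \<open>An earlier strand reaching past c would run past x, and a strand starting between x and
  c is horizontal.\<close>

lemma pass_unique: "pass S g c x ==> z \<in> S ==> less z c ==> less c (g z) ==> z = x"
 unfolding pass_def by (metis less_trans less_asym comparable less_part)

text \<open>Inverse to resolving the crossing of the strands at x and c; it is zero if they already
  cross.\<close>

definition pass_swap :: "'a set => ('a => 'a) => 'a => ('a \<times> 'a) set \<Rightarrow>\<^sub>0 bit" where
 "pass_swap S g c = (if \<exists>x. pass S g c x \<and> less (g x) (g c)
  then single (grf S (g \<circ> transpose (THE x. pass S g c x) c)) 1 else 0)"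

lemma pass_inj: "pass S g c x ==> pass S g c y ==> y = x"
 using pass_unique [of S g c x y] unfolding pass_def by blast

lemma pass_swap_eq:
 assumes "pass S g c x"
 shows "pass_swap S g c = (if less (g x) (g c) then single (grf S (g \<circ> transpose x c)) 1 else 0)"
proof -
 have "(THE x. pass S g c x) = x" using assms pass_inj by (intro the_equality) blast+
 moreover have "(\<exists>x. pass S g c x \<and> less (g x) (g c)) \<longleftrightarrow> less (g x) (g c)" using assms pass_inj by blast
 ultimately show ?thesis by (simp add: pass_swap_def)
qed

lemma covers_of_iff:
 assumes "interval_inj S g"
 shows "(u, v) \<in> covers_of S g \<longleftrightarrow> u \<in> S \<and> v \<in> S \<and> less u v \<and> less (g v) (g u) \<and> \<not> blocked S g u v"
 using crs_transpose_Suc [OF assms, of u v] by (auto simp: covers_of_def crs_def)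

lemma finite_covers_of: "finite S ==> finite (covers_of S g)"
 by (rule finite_subset [of _ "crs S g"]) (auto simp: covers_of_def)

lemma pass_cong:
 assumes "\<And>z. z \<in> S ==> g z = k z"
 shows "pass S g c x \<longleftrightarrow> pass S k c x"
 by (simp add: pass_def assms cong: ball_cong conj_cong)

lemma pass_swap_cong:
 assumes "\<And>z. z \<in> S ==> g z = k z" "pass S g c x"
 shows "pass_swap S g c = pass_swap S k c"
proof -
 have S: "x \<in> S" "c \<in> S" using assms(2) by (simp_all add: pass_def)
 then have "grf S (g \<circ> transpose x c) = grf S (k \<circ> transpose x c)"
  using assms(1) by (intro grf_eqI) (auto simp: transpose_def)
 then show ?thesis
  using pass_swap_eq [OF assms(2)] pass_swap_eq [of S k c x] pass_cong [OF assms(1)] assms S by simp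
qed

text \<open>A blocking strand would start between x and c, hence be horizontal and end before c,
  while it has to end beyond a point that lies past c.\<close>

lemma pass_swap_cover:
 assumes i: "interval_inj S g" and p: "pass S g c x" and N: "less (g x) (g c)"
 shows "(x, c) \<in> covers_of S (g \<circ> transpose x c)"
proof -
 have h: "x \<in> S" "c \<in> S" "less x c" "less c (g x)"
  and hor: "\<And>z. z \<in> S ==> less x z ==> less z c ==> g z = z"
  using p unfolding pass_def by blast+
 have pxc: "part x = part c" using h(3) less_part by blast
 let ?g1 = "g \<circ> transpose x c"
 have g1: "?g1 x = g c" "?g1 c = g x" "\<And>z. z \<noteq> x ==> z \<noteq> c ==> ?g1 z = g z" by auto
 have "\<not> blocked S ?g1 x c"
 proof
  assume "blocked S ?g1 x c"
  then obtain w where w: "w \<in> S" "less x w" "less w c" "less (?g1 c) (?g1 w)" unfolding blocked_def by blast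
  then have "w \<noteq> x" "w \<noteq> c" by auto
  then have "less (g x) w" using w g1 hor [OF w(1-3)] by metis
  then show False using h(4) w(3) less_trans less_asym by metis
 qed
 then show ?thesis unfolding covers_of_iff [OF interval_inj_transpose [OF i h(1,2) pxc]] using h N g1 by simp
qed

text \<open>This is the identity h d + d h = 1. If the strands at x and c cross, h vanishes, and
  only the resolution of this crossing contributes to h d, because h restores it. Otherwise
  resolving the inserted crossing returns the diagram, and the other resolutions of the swapped
  diagram match the nonzero swaps of resolutions of the original one, so they cancel in
  pairs.\<close>

lemma pass_homotopy:
 assumes i: "interval_inj S g" and p: "pass S g c x"
  and res: "\<And>u v. (u, v) \<in> covers_of S g ==> \<exists>x'. pass S (g \<circ> transpose u v) c x'"
 shows "(\<Sum>(u, v)\<in>covers_of S g. pass_swap S (g \<circ> transpose u v) c) +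
  (if less (g x) (g c) then \<Sum>(u, v)\<in>covers_of S (g \<circ> transpose x c). single (grf S (g \<circ> transpose x c \<circ> transpose u v)) 1
  else 0) = single (grf S g) 1"
proof -
 have fin: "finite S" using i by (simp add: interval_inj_def)
 have h: "x \<in> S" "c \<in> S" "less x c" "less c (g x)" "less c (g c)"
  and below: "\<And>z. z \<in> S ==> less z x ==> \<not> less x (g z)"
  and hor: "\<And>z. z \<in> S ==> less x z ==> less z c ==> g z = z"
  and up: "\<And>z. z \<in> S ==> g z = z \<or> less z (g z)"
  using p unfolding pass_def by blast+
 have xc: "x \<noteq> c" using h(3) by auto
 have part: "part (g x) = part (g c)" using h(3-5) less_part by metis
 have gne: "g x \<noteq> g c" using i h(1,2) xc unfolding interval_inj_def inj_on_def by blast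
 have ginj: "g u = g v \<longleftrightarrow> u = v" if "u \<in> S" "v \<in> S" for u v
  using i that unfolding interval_inj_def inj_on_def by blast
 have only: "z = x" if "z \<in> S" "less z c" "less c (g z)" for z
  using pass_unique [OF p that] .
 \<comment> \<open>Apart from x, no strand that starts before c ends beyond \<open>g x\<close> or
   \<open>g c\<close>. So x and c can be the later strand of a crossing only in (x, c).\<close>
 have no_into: "\<not> (u \<in> S \<and> u \<noteq> x \<and> less u c \<and> less y (g u))" if "y = g x \<or> y = g c" for u y
  using only [of u] that h(4,5) less_trans by blast
 have above: "less c (g v)" if "v \<in> S" "less c v" for v
  using up [OF that(1)] that(2) less_trans by metis
 \<comment> \<open>A resolution may change which strand runs past c, but by uniqueness any strand
   found to do so is the one used by \<open>pass_swap\<close>.\<close>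
 have psv: "pass_swap S (g \<circ> transpose u v) c =
   (if less (g (transpose u v x')) (g (transpose u v c)) then single (grf S (g \<circ> transpose u v \<circ> transpose x' c)) 1 else 0)"
  if hh: "(u, v) \<in> covers_of S g" "x' \<in> S" "less x' c" "less c (g (transpose u v x'))" for u v x'
 proof -
  obtain y where y: "pass S (g \<circ> transpose u v) c y" using res [OF hh(1)] by blast
  have "x' = y" using pass_unique [OF y hh(2,3)] hh(4) by simp
  then show ?thesis using pass_swap_eq [OF y] by simp
 qed
 note cov = covers_of_iff [OF i]
 have vne: "v \<noteq> x" if "(u, v) \<in> covers_of S g" for u v
  using that no_into [of "g x" u] h(3) less_trans less_irrefl unfolding cov by metis
 have vnc: "u = x" if "(u, v) \<in> covers_of S g" "v = c" for u v
  using that no_into [of "g c" u] unfolding cov by blast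
 show ?thesis
 proof (cases "less (g x) (g c)")
  case False
  then have gcx: "less (g c) (g x)" using comparable [OF part gne] by blast
  have xcov: "(x, c) \<in> covers_of S g"
   unfolding cov blocked_def using h gcx hor less_trans less_asym less_irrefl by metis
  have zero: "pass_swap S (g \<circ> transpose u v) c = 0" if uv: "(u, v) \<in> covers_of S g" "(u, v) \<noteq> (x, c)" for u v
  proof -
   have uv': "u \<in> S" "v \<in> S" "less u v" "less (g v) (g u)" "\<not> blocked S g u v" "u \<noteq> v" using uv(1) unfolding cov by auto
   have "v \<noteq> x" "v \<noteq> c" using vne vnc uv by blast+
   consider "u = x" "less v c" | "u = x" "less c v" | "u = c" | "u \<noteq> x" "u \<noteq> c"
    using comparable [of v c] less_part [OF uv'(3)] less_part [OF h(3)] \<open>v \<noteq> c\<close> by metis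
   then show ?thesis
   proof cases
    \<comment> \<open>Here v carries a horizontal strand. After the resolution the strand from v is
      the one that runs past c.\<close>
    case 1
    then have "\<not> less (g x) (g c)" using gcx less_asym by blast
    then show ?thesis
     using psv [OF uv(1) uv'(2)] 1 h(4) \<open>v \<noteq> c\<close> xc by simp
   next
    case 2
    have "\<not> less (g v) (g c)"
     using uv'(5) 2 gcx h(2,3) unfolding blocked_def by blast
    then show ?thesis
     using psv [OF uv(1) h(1,3)] 2 above [OF uv'(2)] \<open>v \<noteq> c\<close> xc by simp
   next
    case 3
    then have "\<not> less (g x) (g v)" using uv'(4) gcx less_trans less_asym by metis
    then show ?thesis
     using psv [OF uv(1) h(1,3)] 3 h(4) \<open>v \<noteq> x\<close> \<open>v \<noteq> c\<close> xc by simp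
   next
    case 4
    then have "transpose u v x = x" "transpose u v c = c" using \<open>v \<noteq> x\<close> \<open>v \<noteq> c\<close> by auto
    then show ?thesis
     using psv [OF uv(1) h(1,3)] h(4) gcx less_asym by simp
   qed
  qed
  have one: "pass_swap S (g \<circ> transpose x c) c = single (grf S g) 1"
  proof -
   have "g \<circ> transpose x c \<circ> transpose x c = g" by (rule ext) simp
   then show ?thesis using psv [OF xcov h(1,3)] h(5) gcx by simp
  qed
  have "(\<Sum>(u, v)\<in>covers_of S g. pass_swap S (g \<circ> transpose u v) c) =
    (\<Sum>(u, v)\<in>{(x, c)}. pass_swap S (g \<circ> transpose u v) c)"
   by (rule sum.mono_neutral_right) (use xcov zero finite_covers_of [OF fin] in auto)
  then show ?thesis using False one by simp
 next
  case N: True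
  let ?g1 = "g \<circ> transpose x c"
  have pxc: "part x = part c" using h(3) less_part by blast
  have i1: "interval_inj S ?g1" using interval_inj_transpose [OF i h(1,2) pxc] .
  note cov1 = covers_of_iff [OF i1]
  have g1x: "?g1 x = g c" "?g1 c = g x" by auto
  have g1o: "?g1 z = g z" if "z \<noteq> x" "z \<noteq> c" for z using that by simp
  \<comment> \<open>If \<open>g v\<close> lies below \<open>g x\<close>, resolving (c, v) makes the
    strands at x and c cross, so the swap vanishes; such pairs are left out.\<close>
  let ?A = "{(u, v) \<in> covers_of S g. u = c --> less (g x) (g v)}"
  let ?B = "covers_of S ?g1 - {(x, c)}"
  \<comment> \<open>The swap gives the end of the strand at c to the strand at x and conversely. A
    crossing with a strand that starts beyond c therefore changes its partner between x and c, while
    x keeps its crossings with horizontal strands before c.\<close>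
  let ?f = "\<lambda>(u, v). (if u = c then x else if u = x \<and> less c v then c else u, v)"
  let ?s = "\<lambda>(u, v). single (grf S (?g1 \<circ> transpose u v)) (1::bit)"
  have vnc': "v \<noteq> c" if "(u, v) \<in> covers_of S g" for u v
   using vnc [OF that] that N less_asym unfolding cov by blast
  have B1: "v \<noteq> x \<and> v \<noteq> c" if "(u, v) \<in> ?B" for u v
  proof -
   have uv: "u \<in> S" "v \<in> S" "less u v" "less (?g1 v) (?g1 u)" "(u, v) \<noteq> (x, c)" using that unfolding Diff_iff cov1 by auto
   show ?thesis
   proof (intro conjI notI)
    assume "v = x"
    then have "u \<noteq> x" "u \<noteq> c" "less u c" using uv(3) h(3) less_trans less_asym less_irrefl by metis+
    then show False using no_into [of "g c" u] uv(1,4) \<open>v = x\<close> g1x g1o [of u] by simp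
   next
    assume "v = c"
    then have "u \<noteq> x" "u \<noteq> c" "less u c" using uv(3,5) by auto
    then show False using no_into [of "g x" u] uv(1,4) \<open>v = c\<close> g1x g1o [of u] by simp
   qed
  qed
  have hor_cov: "(x, v) \<in> covers_of S g \<and> (x, v) \<in> covers_of S ?g1" if "v \<in> S" "less x v" "less v c" for v
  proof -
   have gv: "g v = v" by (rule hor [OF that])
   have w: "g w = w" "w \<noteq> x" "w \<noteq> c" if "w \<in> S" "less x w" "less w v" for w
    using hor [OF that(1,2)] that \<open>less v c\<close> less_trans less_irrefl less_asym by metis+
   have "v \<noteq> x" "v \<noteq> c" using that by auto
   moreover have "less v (g x)" "less v (g c)" using that(3) h(4,5) less_trans by blast+
   moreover have "\<not> blocked S g x v" unfolding blocked_def using w gv less_asym by metis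
   moreover have "\<not> blocked S ?g1 x v"
    unfolding blocked_def using w gv less_asym g1o \<open>v \<noteq> x\<close> \<open>v \<noteq> c\<close> by metis
   ultimately show ?thesis unfolding cov cov1 using that h gv g1x g1o by auto
  qed
  have xv: "(x, v) \<in> covers_of S g \<longleftrightarrow> (c, v) \<in> covers_of S ?g1" if v: "v \<in> S" "less c v" for v
  proof -
   have ne: "v \<noteq> x" "v \<noteq> c" using v h(3) less_asym by auto
   have lt: "less x v" using h(3) v(2) less_trans by blast
   \<comment> \<open>A strand that starts between x and c is horizontal and ends before c, too low
     to block a crossing whose lower end lies beyond c.\<close>
   have w0: "\<not> less (g v) (g w)" if "w \<in> S" "less x w" "less w v" "\<not> less c w" "w \<noteq> c" for w
   proof -
    have "part w = part c" using less_part that(2) pxc by metis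
    then have "less w c" using comparable [of w c] that by blast
    then have "g w = w" by (rule hor [OF that(1,2)])
    then show ?thesis using \<open>less w c\<close> above [OF v] less_trans less_asym by metis
   qed
   have "blocked S g x v \<longleftrightarrow> blocked S ?g1 c v"
   proof
    assume "blocked S g x v"
    then obtain w where w: "w \<in> S" "less x w" "less w v" "less (g v) (g w)" "less (g w) (g x)" unfolding blocked_def by blast
    then have "w \<noteq> c" using N less_asym by blast
    then have "less c w" using w0 w by blast
    then have "w \<noteq> x" using h(3) less_asym by blast
    then show "blocked S ?g1 c v" unfolding blocked_def using w \<open>less c w\<close> \<open>w \<noteq> c\<close> g1o g1x ne by metis
   next
    assume "blocked S ?g1 c v"
    then obtain w where w: "w \<in> S" "less c w" "less w v" "less (?g1 v) (?g1 w)" "less (?g1 w) (?g1 c)" unfolding blocked_def by blast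
    then have "w \<noteq> c" "w \<noteq> x" "less x w" using h(3) less_asym less_trans less_irrefl by metis+
    then show "blocked S g x v" unfolding blocked_def using w g1o g1x ne by metis
   qed
   then show ?thesis unfolding cov cov1 using v lt h ne g1o [OF ne] g1x by simp
  qed
  \<comment> \<open>In the swapped diagram the strand at c ends at \<open>g x\<close>, so it blocks
    (x, v) exactly when v ends below \<open>g x\<close>.\<close>
  have cv: "(c, v) \<in> covers_of S g \<and> less (g x) (g v) \<longleftrightarrow> (x, v) \<in> covers_of S ?g1" if v: "v \<in> S" "less c v" for v
  proof -
   have ne: "v \<noteq> x" "v \<noteq> c" using v h(3) less_asym by auto
   have lt: "less x v" using h(3) v(2) less_trans by blast
   have w0: "\<not> less (g v) (g w)" if "w \<in> S" "less x w" "less w v" "\<not> less c w" "w \<noteq> c" for w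
   proof -
    have "part w = part c" using less_part that(2) pxc by metis
    then have "less w c" using comparable [of w c] that by blast
    then have "g w = w" by (rule hor [OF that(1,2)])
    then show ?thesis using \<open>less w c\<close> above [OF v] less_trans less_asym by metis
   qed
   have dich: "less (g x) (g v) \<longleftrightarrow> \<not> less (g v) (g x)"
   proof -
    have "g x \<noteq> g v" using ginj [OF h(1) v(1)] ne by auto
    moreover have "part (g x) = part (g v)" using above [OF v] h(4) less_part by metis
    ultimately show ?thesis using comparable less_asym by blast
   qed
   have "blocked S ?g1 x v \<longleftrightarrow> blocked S g c v \<or> less (g v) (g x)"
   proof
    assume "blocked S ?g1 x v"
    then obtain w where w: "w \<in> S" "less x w" "less w v" "less (?g1 v) (?g1 w)" "less (?g1 w) (?g1 x)" unfolding blocked_def by blast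
    show "blocked S g c v \<or> less (g v) (g x)"
    proof (cases "w = c")
     case True
     then show ?thesis using w(4) g1x g1o [OF ne] by simp
    next
     case False
     then have "w \<noteq> x" using w(2) by auto
     then have w': "less (g v) (g w)" "less (g w) (g c)" using w(4,5) g1x g1o [OF ne] g1o [of w] False by simp_all
     then have "less c w" using w0 w False by blast
     then show ?thesis using w w' unfolding blocked_def by blast
    qed
   next
    assume "blocked S g c v \<or> less (g v) (g x)"
    then show "blocked S ?g1 x v"
    proof
     assume "blocked S g c v"
     then obtain w where w: "w \<in> S" "less c w" "less w v" "less (g v) (g w)" "less (g w) (g c)" unfolding blocked_def by blast
     then have "w \<noteq> c" "w \<noteq> x" "less x w" using h(3) less_asym less_trans less_irrefl by metis+
     then show ?thesis unfolding blocked_def using w g1o g1x ne by metis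
    next
     assume "less (g v) (g x)"
     then show ?thesis unfolding blocked_def using h(2,3) v(2) N g1x g1o [OF ne] by metis
    qed
   qed
   then show ?thesis unfolding cov cov1 using v lt h ne g1o [OF ne] g1x dich by auto
  qed
  have uv: "(u, v) \<in> covers_of S g \<longleftrightarrow> (u, v) \<in> covers_of S ?g1" if ne: "u \<noteq> x" "u \<noteq> c" "v \<noteq> x" "v \<noteq> c" for u v
  proof (cases "u \<in> S \<and> v \<in> S \<and> less u v \<and> less (g v) (g u)")
   case True
   have nx: "\<not> (less u x \<and> less y (g u))" "\<not> (less u c \<and> less y (g u))" if "y = g x \<or> y = g c" for y
    using no_into [OF that, of u] True ne(1) h(3) less_trans by blast+
   have "blocked S g u v \<longleftrightarrow> blocked S ?g1 u v"
    unfolding blocked_def g1o [OF ne(1,2)] g1o [OF ne(3,4)]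
   proof (rule bex_cong [OF refl])
    fix w assume "w \<in> S"
    show "(less u w \<and> less w v \<and> less (g v) (g w) \<and> less (g w) (g u)) =
      (less u w \<and> less w v \<and> less (g v) (?g1 w) \<and> less (?g1 w) (g u))"
     using nx [of "g x"] nx [of "g c"] g1x g1o [of w] by (cases "w = x"; cases "w = c") auto
   qed
   then show ?thesis unfolding cov cov1 g1o [OF ne(1,2)] g1o [OF ne(3,4)] by blast
  next
   case False
   then show ?thesis unfolding cov cov1 g1o [OF ne(1,2)] g1o [OF ne(3,4)] by blast
  qed
  have cmp: "less v c \<or> less c v" if "less x v" "v \<noteq> c" for v
   using comparable [of v c] less_part [OF that(1)] pxc that(2) by metis
  have lt: "less u v \<and> u \<in> S \<and> v \<in> S" if "(u, v) \<in> covers_of S g \<or> (u, v) \<in> covers_of S ?g1" for u v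
   using that unfolding cov cov1 by blast
  have bij: "bij_betw ?f ?A ?B"
  proof (rule bij_betw_byWitness [where f' = ?f]; intro ballI image_subsetI)
   fix a assume a: "a \<in> ?A"
   obtain u v where auv: "a = (u, v)" by (cases a)
   have uvA: "(u, v) \<in> covers_of S g" "u = c ==> less (g x) (g v)" using a auv by auto
   have ne: "v \<noteq> x" "v \<noteq> c" using vne vnc' uvA(1) by blast+
   have l: "less u v" "u \<in> S" "v \<in> S" using lt uvA(1) by blast+
   show "?f (?f a) = a" using auv l(1) ne h(3) less_asym xc by auto
   consider "u = x" "less v c" | "u = x" "less c v" | "u = c" | "u \<noteq> x" "u \<noteq> c"
    using cmp ne(2) l(1) by metis
   then show "?f a \<in> ?B"
   proof cases
    case 1
    then show ?thesis using hor_cov [OF l(3)] l ne auv xc less_asym by auto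
   next
    case 2
    then show ?thesis using xv [OF l(3)] uvA(1) auv xc by auto
   next
    case 3
    then show ?thesis using cv [OF l(3)] uvA l ne auv by auto
   next
    case 4
    then show ?thesis using uv [OF 4 ne] uvA(1) auv by auto
   qed
  next
   fix a assume a: "a \<in> ?B"
   obtain u v where auv: "a = (u, v)" by (cases a)
   have uvB: "(u, v) \<in> covers_of S ?g1" "(u, v) \<in> ?B" using a auv by auto
   have ne: "v \<noteq> x" "v \<noteq> c" using B1 uvB(2) by blast+
   have l: "less u v" "u \<in> S" "v \<in> S" using lt uvB(1) by blast+
   show "?f (?f a) = a" using auv l(1) ne h(3) less_asym xc by auto
   consider "u = x" "less v c" | "u = x" "less c v" | "u = c" | "u \<noteq> x" "u \<noteq> c"
    using cmp ne(2) l(1) by metis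
   then show "?f a \<in> ?A"
   proof cases
    case 1
    then show ?thesis using hor_cov [OF l(3)] l ne auv xc less_asym by auto
   next
    case 2
    then show ?thesis using cv [OF l(3)] uvB(1) auv xc by auto
   next
    case 3
    then show ?thesis using xv [OF l(3)] uvB l ne auv xc by auto
   next
    case 4
    then show ?thesis using uv [OF 4 ne] uvB(1) auv by auto
   qed
  qed
  have val: "pass_swap S (g \<circ> transpose u v) c = (if u = c --> less (g x) (g v) then ?s (?f (u, v)) else 0)"
   if uvc: "(u, v) \<in> covers_of S g" for u v
  proof -
   have ne: "v \<noteq> x" "v \<noteq> c" using vne vnc' uvc by blast+
   have l: "less u v" "u \<in> S" "v \<in> S" "less (g v) (g u)" using lt uvc unfolding cov by blast+
   consider "u = x" "less v c" | "u = x" "less c v" | "u = c" | "u \<noteq> x" "u \<noteq> c"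
    using cmp ne(2) l(1) by metis
   then show ?thesis
   proof cases
    case 1
    have e: "g \<circ> transpose x v \<circ> transpose v c = ?g1 \<circ> transpose x v"
     by (rule ext) (use ne xc in \<open>simp add: transpose_def\<close>)
    show ?thesis
     using psv [OF uvc l(3)] 1 h(4) ne xc N less_asym e by simp
   next
    case 2
    have e: "g \<circ> transpose x v \<circ> transpose x c = ?g1 \<circ> transpose c v"
     by (rule ext) (use ne xc in \<open>simp add: transpose_def\<close>)
    have "less (g v) (g c)" using l(4) 2(1) N less_trans by blast
    then show ?thesis
     using psv [OF uvc h(1,3)] 2 above [OF l(3)] ne xc e by simp
   next
    case 3
    have e: "g \<circ> transpose c v \<circ> transpose x c = ?g1 \<circ> transpose x v"
     by (rule ext) (use ne xc in \<open>simp add: transpose_def\<close>)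
    show ?thesis
     using psv [OF uvc h(1,3)] 3 h(4) ne xc e by simp
   next
    case 4
    have e: "g \<circ> transpose u v \<circ> transpose x c = ?g1 \<circ> transpose u v"
     by (rule ext) (use 4 ne xc in \<open>simp add: transpose_def\<close>)
    have "transpose u v x = x" "transpose u v c = c" using 4 ne by auto
    then show ?thesis
     using psv [OF uvc h(1,3)] 4 h(4) N e by simp
   qed
  qed
  have "(\<Sum>(u, v)\<in>covers_of S g. pass_swap S (g \<circ> transpose u v) c) =
    (\<Sum>a\<in>covers_of S g. if fst a = c --> less (g x) (g (snd a)) then ?s (?f a) else 0)"
  proof (rule sum.cong [OF refl])
   fix a assume "a \<in> covers_of S g"
   then show "(case a of (u, v) => pass_swap S (g \<circ> transpose u v) c) =
     (if fst a = c --> less (g x) (g (snd a)) then ?s (?f a) else 0)"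
    using val [of "fst a" "snd a"] by (cases a) simp
  qed
  also have "\<dots> = (\<Sum>a\<in>{a \<in> covers_of S g. fst a = c --> less (g x) (g (snd a))}. ?s (?f a))"
   by (rule sum_filter [OF finite_covers_of [OF fin]])
  also have "{a \<in> covers_of S g. fst a = c --> less (g x) (g (snd a))} = ?A" by auto
  also have "(\<Sum>a\<in>?A. ?s (?f a)) = (\<Sum>b\<in>?B. ?s b)"
   by (rule sum.reindex_bij_betw [OF bij])
  finally have 1: "(\<Sum>(u, v)\<in>covers_of S g. pass_swap S (g \<circ> transpose u v) c) = (\<Sum>b\<in>?B. ?s b)" .
  have xcov: "(x, c) \<in> covers_of S ?g1" by (rule pass_swap_cover [OF i p N])
  have tt: "?g1 \<circ> transpose x c = g" by (rule ext) simp
  have "(\<Sum>b\<in>covers_of S ?g1. ?s b) = ?s (x, c) + (\<Sum>b\<in>?B. ?s b)"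
   by (rule sum.remove [OF finite_covers_of [OF fin] xcov])
  then have 2: "(\<Sum>b\<in>covers_of S ?g1. ?s b) = single (grf S g) 1 + (\<Sum>b\<in>?B. ?s b)"
   by (simp add: tt)
  have "(\<Sum>b\<in>?B. ?s b) + (\<Sum>b\<in>covers_of S ?g1. ?s b) = single (grf S g) 1"
   unfolding 2 by (rule chain_cancel)
  then show ?thesis unfolding 1 using N by simp
 qed
qed

end

section \<open>Swapping at the first doubly covered step\<close>

definition fun_of :: "strands => point => point" where
 "fun_of phi x = (THE y. (x, y) \<in> phi)"

lemma matchings_fun_of:
 assumes "phi \<in> matchings"
 shows "phi = grf (Domain phi) (fun_of phi)" "interval_inj (Domain phi) (fun_of phi)"
proof -
 obtain S g where e: "phi = grf S g" and i: "interval_inj S g"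
  using assms by (auto simp: matchings_def)
 have f: "fun_of phi x = g x" if "x \<in> S" for x using that by (simp add: fun_of_def e)
 have D: "Domain phi = S" by (simp add: e)
 have "grf S (fun_of phi) = grf S g" by (rule grf_eqI [OF f])
 then show "phi = grf (Domain phi) (fun_of phi)" unfolding D by (rule trans [OF e sym])
 show "interval_inj (Domain phi) (fun_of phi)"
  unfolding D by (rule iffD2 [OF points.interval_inj_cong [OF f] i])
qed

lemma fun_of_grf: "x \<in> S ==> fun_of (grf S g) x = g x"
 by (simp add: fun_of_def)

lemma fun_of_mem: "phi \<in> matchings ==> (x, y) \<in> phi \<longleftrightarrow> x \<in> Domain phi \<and> y = fun_of phi x"
 using matchings_fun_of(1) [of phi] in_grf by metis

definition covering :: "strands => step => strands" where
 "covering phi \<sigma> = {c \<in> phi. fst \<sigma> = fst (fst c) \<and> snd (fst c) \<le> snd \<sigma> \<and> snd \<sigma> < snd (snd c)}"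

lemma lookup_hgr_card: "finite phi ==> lookup (hgr phi) \<sigma> = int (card (covering phi \<sigma>))"
 unfolding lookup_hgr covering_def by (rule sum_of_bool_card)

lemma covering_unique:
 assumes "finite phi" "lookup (hgr phi) \<sigma> \<le> 1" "a \<in> covering phi \<sigma>" "b \<in> covering phi \<sigma>"
 shows "a = b"
proof -
 have "finite (covering phi \<sigma>)" by (rule finite_subset [OF _ assms(1)]) (auto simp: covering_def)
 moreover have "card (covering phi \<sigma>) \<le> 1" using assms(1,2) by (simp add: lookup_hgr_card)
 ultimately have "covering phi \<sigma> = {a}" using assms(3) by (rule card_le_1_eq)
 then show ?thesis using assms(4) by simp
qed

text \<open>A condition on the class alone, so one step serves all diagrams of a summand and
  survives resolutions and swaps.\<close>

definition first_double :: "hclass => step => bool" where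
 "first_double h \<sigma> \<longleftrightarrow> 2 \<le> lookup h \<sigma> \<and> (\<forall>j<snd \<sigma>. lookup h (fst \<sigma>, j) \<le> 1)"

lemma first_double_exists:
 assumes "valid Z phi" "\<not> viable_class Z (hgr phi)"
 shows "\<exists>\<sigma>. first_double (hgr phi) \<sigma>"
proof -
 have fin: "finite phi" by (rule strand_diagram_finite [OF valid_strand_diagram [OF assms(1)]])
 obtain \<sigma> where \<sigma>: "lookup (hgr phi) \<sigma> \<notin> {0, 1}" using assms(2) unfolding viable_class_def by blast
 then have "2 \<le> lookup (hgr phi) (fst \<sigma>, snd \<sigma>)" by (simp add: lookup_hgr_card [OF fin])
 then have ex: "\<exists>j. 2 \<le> lookup (hgr phi) (fst \<sigma>, j)" by blast
 define j where "j = (LEAST j. 2 \<le> lookup (hgr phi) (fst \<sigma>, j))"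
 have "2 \<le> lookup (hgr phi) (fst \<sigma>, j)" unfolding j_def by (rule LeastI_ex [OF ex])
 moreover have "\<not> 2 \<le> lookup (hgr phi) (fst \<sigma>, k)" if "k < j" for k
  using that unfolding j_def by (rule not_less_Least)
 ultimately have "2 \<le> lookup (hgr phi) (fst \<sigma>, j)" "\<forall>k<j. \<not> 2 \<le> lookup (hgr phi) (fst \<sigma>, k)" by blast+
 then have "first_double (hgr phi) (fst \<sigma>, j)" by (auto simp: first_double_def)
 then show ?thesis by blast
qed

text \<open>If no strand covering \<sigma> started there, two would cover the step before, which is
  covered at most once; and only one strand can start there. A strand overlapping the arriving one
  before \<sigma> would likewise cover an earlier step twice.\<close>

lemma first_double_pass:
 assumes v: "valid Z phi" and \<sigma>: "first_double (hgr phi) \<sigma>"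
 shows "\<exists>x. points.pass (Domain phi) (fun_of phi) \<sigma> x"
proof -
 have sd: "strand_diagram Z phi" and m: "phi \<in> matchings" using v by auto
 have fin: "finite phi" by (rule strand_diagram_finite [OF sd])
 let ?M = "covering phi \<sigma>" and ?g = "fun_of phi"
 have le1: "lookup (hgr phi) (fst \<sigma>, j) \<le> 1" if "j < snd \<sigma>" for j using \<sigma> that by (simp add: first_double_def)
 have same: "a = b" if "a \<in> phi" "b \<in> phi" "fst (fst a) = fst \<sigma>" "fst (fst b) = fst \<sigma>" "j < snd \<sigma>"
  "snd (fst a) \<le> j" "j < snd (snd a)" "snd (fst b) \<le> j" "j < snd (snd b)" for a b j
 proof (rule covering_unique [OF fin le1 [OF that(5)]])
  show "a \<in> covering phi (fst \<sigma>, j)" unfolding covering_def using that(1,3,6,7) by simp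
  show "b \<in> covering phi (fst \<sigma>, j)" unfolding covering_def using that(2,4,8,9) by simp
 qed
 have st: "(z, ?g z) \<in> phi" "?g z = z \<or> point_less z (?g z)" if "z \<in> Domain phi" for z
 proof -
  show "(z, ?g z) \<in> phi" using that fun_of_mem [OF m] by blast
  then have "point_le z (?g z)" by (rule strand_diagramD(3) [OF sd])
  then show "?g z = z \<or> point_less z (?g z)" by (auto simp: point_le_def point_less_def prod_eq_iff)
 qed
 have finM: "finite ?M" by (rule finite_subset [OF _ fin]) (auto simp: covering_def)
 have "2 \<le> card ?M" using \<sigma> by (simp add: first_double_def lookup_hgr_card [OF fin])
 then obtain a b where ab: "a \<in> ?M" "b \<in> ?M" "a \<noteq> b"
  by (metis One_nat_def Suc_1 card_le_Suc0_iff_eq finM not_less_eq_eq)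
 have abm: "a \<in> phi" "fst (fst a) = fst \<sigma>" "snd (fst a) \<le> snd \<sigma>" "snd \<sigma> < snd (snd a)"
  "b \<in> phi" "fst (fst b) = fst \<sigma>" "snd (fst b) \<le> snd \<sigma>" "snd \<sigma> < snd (snd b)"
  using ab(1,2) unfolding covering_def by auto
 have "snd (fst a) = snd \<sigma> \<or> snd (fst b) = snd \<sigma>"
 proof (rule ccontr)
  assume "\<not> (snd (fst a) = snd \<sigma> \<or> snd (fst b) = snd \<sigma>)"
  then have "a = b" using abm by (intro same [of a b "snd \<sigma> - 1"]) auto
  then show False using ab(3) by simp
 qed
 moreover have "\<not> (snd (fst a) = snd \<sigma> \<and> snd (fst b) = snd \<sigma>)"
 proof
  assume "snd (fst a) = snd \<sigma> \<and> snd (fst b) = snd \<sigma>"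
  then have "fst a = fst b" using abm by (simp add: prod_eq_iff)
  then show False using inj_on_strands(1) [OF sd] abm(1,5) ab(3) by (meson inj_onD)
 qed
 ultimately obtain d e where de: "d \<in> phi" "e \<in> phi" "fst d = \<sigma>" "snd \<sigma> < snd (snd d)"
  "fst (fst e) = fst \<sigma>" "snd (fst e) < snd \<sigma>" "snd \<sigma> < snd (snd e)"
  using abm by (metis le_neq_implies_less prod_eqI)
 let ?x = "fst e"
 have gd: "?g \<sigma> = snd d" "\<sigma> \<in> Domain phi" "?g ?x = snd e" "?x \<in> Domain phi"
 proof -
  have "(\<sigma>, snd d) \<in> phi" using de(1,3) by (metis prod.collapse)
  then show "?g \<sigma> = snd d" "\<sigma> \<in> Domain phi" unfolding fun_of_mem [OF m] by simp_all
  have "(?x, snd e) \<in> phi" using de(2) by simp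
  then show "?g ?x = snd e" "?x \<in> Domain phi" unfolding fun_of_mem [OF m] by simp_all
 qed
 have part: "fst (snd d) = fst \<sigma>" "fst (snd e) = fst \<sigma>"
 proof -
  have "(\<sigma>, snd d) \<in> phi" using de(1,3) by (metis prod.collapse)
  from strand_diagramD(3) [OF sd this] show "fst (snd d) = fst \<sigma>" by (simp add: point_le_def)
  have "(?x, snd e) \<in> phi" using de(2) by simp
  from strand_diagramD(3) [OF sd this] show "fst (snd e) = fst \<sigma>" using de(5) by (simp add: point_le_def)
 qed
 have eq: "z = ?x" if "z \<in> Domain phi" "fst z = fst \<sigma>" "j < snd \<sigma>" "snd z \<le> j" "j < snd (?g z)" "snd ?x \<le> j" for z j
 proof -
  have "(z, ?g z) = e"
   by (rule same [of _ _ j]) (use st(1) [OF that(1)] de that in simp_all)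
  then show ?thesis by (metis fst_conv)
 qed
 have "points.pass (Domain phi) ?g \<sigma> ?x"
  unfolding points.pass_def
 proof (intro conjI ballI impI)
  show "?x \<in> Domain phi" "\<sigma> \<in> Domain phi" using gd by blast+
  show "point_less ?x \<sigma>" "point_less \<sigma> (?g ?x)" "point_less \<sigma> (?g \<sigma>)"
   using de gd part by (simp_all add: point_less_def)
  fix z assume z: "z \<in> Domain phi"
  show "\<not> point_less ?x (?g z)" if "point_less z ?x"
   using eq [OF z, of "snd ?x"] that de(5,6) by (auto simp: point_less_def)
  show "?g z = z" if "point_less ?x z" "point_less z \<sigma>"
   using eq [OF z, of "snd z"] that de(5,6) st(2) [OF z] by (auto simp: point_less_def)
  show "?g z = z \<or> point_less z (?g z)" by (rule st(2) [OF z])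
 qed
 then show ?thesis by blast
qed

lemma covers_of_resolve:
 assumes i: "interval_inj S k" and uv: "(u, v) \<in> points.covers_of S k"
 shows "((u, k u), (v, k v)) \<in> uncrossable (grf S k)" "resolve (grf S k) ((u, k u), (v, k v)) = grf S (k \<circ> transpose u v)"
proof -
 have h: "u \<in> S" "v \<in> S" "point_less u v" "point_less (k v) (k u)" "\<not> points.blocked S k u v"
  using uv unfolding points.covers_of_iff [OF i] by blast+
 then show "((u, k u), (v, k v)) \<in> uncrossable (grf S k)"
  unfolding uncrossable_def points.blocked_iff crossings_def by simp
 have "inj_on k S" "u \<noteq> v" using i h(3) by (auto simp: points.interval_inj_def)
 then show "resolve (grf S k) ((u, k u), (v, k v)) = grf S (k \<circ> transpose u v)"
  using h(1,2) by (intro resolve_grf)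
qed

text \<open>A step and its starting point are the same pair of numbers, so \<sigma> also denotes the
  point at which the second strand starts.\<close>

definition swap_op :: "step => strands => chain" where
 "swap_op \<sigma> phi = points.pass_swap (Domain phi) (fun_of phi) \<sigma>"

lemma swap_op_homotopy:
 assumes v: "valid Z phi" and \<sigma>: "first_double (hgr phi) \<sigma>"
 shows "lin (swap_op \<sigma>) (basis_diff phi) + diff (swap_op \<sigma> phi) = single phi 1"
proof -
 have m: "phi \<in> matchings" using v by simp
 define S g where "S = Domain phi" and "g = fun_of phi"
 have e: "phi = grf S g" and i: "interval_inj S g" using matchings_fun_of [OF m] by (simp_all add: S_def g_def)
 obtain x where p: "points.pass S g \<sigma> x" using first_double_pass [OF v \<sigma>] unfolding S_def g_def by blast
 have xc1: "x \<in> S" "\<sigma> \<in> S" "point_less x \<sigma>" using p unfolding points.pass_def by blast+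
 then have xc: "x \<in> S" "\<sigma> \<in> S" "fst x = fst \<sigma>" by (simp_all add: point_less_def)
 have res: "\<exists>y. points.pass S (g \<circ> transpose u w) \<sigma> y \<and> swap_op \<sigma> (grf S (g \<circ> transpose u w)) = points.pass_swap S (g \<circ> transpose u w) \<sigma>"
  if uw: "(u, w) \<in> points.covers_of S g" for u w
 proof -
  note c = covers_of_resolve [OF i uw]
  let ?psi = "grf S (g \<circ> transpose u w)"
  have cc1: "((u, g u), (w, g w)) \<in> uncrossable phi" using c(1) unfolding e .
  then have cc2: "((u, g u), (w, g w)) \<in> crossings phi" unfolding uncrossable_def by blast
  note cc = cc1 cc2
  have "valid Z ?psi" using valid_resolve [OF v cc(2)] c(2) by (simp add: e)
  moreover have "first_double (hgr ?psi) \<sigma>" using resolve_graded(1) [OF v cc(1)] c(2) \<sigma> by (simp add: e)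
  ultimately obtain y where y: "points.pass (Domain ?psi) (fun_of ?psi) \<sigma> y" using first_double_pass by blast
  have f: "fun_of ?psi z = (g \<circ> transpose u w) z" if "z \<in> S" for z by (rule fun_of_grf [OF that])
  have y': "points.pass S (fun_of ?psi) \<sigma> y" using y by simp
  then have "points.pass S (g \<circ> transpose u w) \<sigma> y"
   using points.pass_cong [of S "fun_of ?psi" "g \<circ> transpose u w"] f by blast
  moreover have "swap_op \<sigma> ?psi = points.pass_swap S (g \<circ> transpose u w) \<sigma>"
   unfolding swap_op_def Domain_grf by (rule points.pass_swap_cong [OF f y'])
  ultimately show ?thesis by blast
 qed
 have "lin (swap_op \<sigma>) (basis_diff phi) = (\<Sum>(u, w)\<in>points.covers_of S g. points.pass_swap S (g \<circ> transpose u w) \<sigma>)"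
  unfolding e basis_diff_lin [OF i]
  by (simp add: lin_sum case_prod_unfold) (rule sum.cong [OF refl], use res in auto)
 moreover have "diff (swap_op \<sigma> phi) = (if point_less (g x) (g \<sigma>) then 
   \<Sum>(u, w)\<in>points.covers_of S (g \<circ> transpose x \<sigma>). single (grf S (g \<circ> transpose x \<sigma> \<circ> transpose u w)) 1 else 0)"
  unfolding swap_op_def S_def [symmetric] g_def [symmetric] points.pass_swap_eq [OF p]
  by (simp add: basis_diff_lin [OF points.interval_inj_transpose [OF i xc]])
 ultimately show ?thesis
  using points.pass_homotopy [OF i p] res by (simp add: e)
qed

text \<open>The swapped diagram resolves to phi, so its gradings can be read off from those of
  phi.\<close>

lemma swap_op_cases:
 assumes v: "valid Z phi" and \<sigma>: "first_double (hgr phi) \<sigma>" and ne: "swap_op \<sigma> phi \<noteq> 0"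
 obtains chi x where "swap_op \<sigma> phi = single chi 1" "valid Z chi" "Domain chi = Domain phi" "Range chi = Range phi"
  "points.pass (Domain chi) (fun_of chi) \<sigma> x"
  "((x, fun_of chi x), (\<sigma>, fun_of chi \<sigma>)) \<in> uncrossable chi"
  "resolve chi ((x, fun_of chi x), (\<sigma>, fun_of chi \<sigma>)) = phi"
proof -
 have m: "phi \<in> matchings" and sd: "strand_diagram Z phi" using v by auto
 define S g where "S = Domain phi" and "g = fun_of phi"
 have e: "phi = grf S g" and i: "interval_inj S g" using matchings_fun_of [OF m] by (simp_all add: S_def g_def)
 obtain x where p: "points.pass S g \<sigma> x" using first_double_pass [OF v \<sigma>] unfolding S_def g_def by blast
 have xc1: "x \<in> S" "\<sigma> \<in> S" "point_less x \<sigma>" "point_less \<sigma> (g x)" "point_less \<sigma> (g \<sigma>)"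
  using p unfolding points.pass_def by blast+
 then have "fst x = fst \<sigma>" by (simp add: point_less_def)
 note xc = xc1(1,2) this xc1(3-5)
 let ?k = "g \<circ> transpose x \<sigma>"
 let ?chi = "grf S ?k"
 have ps: "swap_op \<sigma> phi = (if point_less (g x) (g \<sigma>) then single ?chi 1 else 0)"
  unfolding swap_op_def S_def [symmetric] g_def [symmetric] by (rule points.pass_swap_eq [OF p])
 then have N: "point_less (g x) (g \<sigma>)" using ne by (auto split: if_splits)
 have ik: "interval_inj S ?k" by (rule points.interval_inj_transpose [OF i xc(1-3)])
 have cov: "(x, \<sigma>) \<in> points.covers_of S ?k" by (rule points.pass_swap_cover [OF i p N])
 note c = covers_of_resolve [OF ik cov]
 have tt: "?k \<circ> transpose x \<sigma> = g" by (rule ext) simp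
 have im: "?k ` S = g ` S" by (rule image_comp_transpose [OF xc(1,2)])
 have D: "Domain ?chi = Domain phi" "Range ?chi = Range phi" using im unfolding e by (simp_all del: image_comp)
 have f: "fun_of ?chi z = ?k z" if "z \<in> S" for z by (rule fun_of_grf [OF that])
 have sub: "phi \<subseteq> points Z \<times> points Z" using sd by (simp add: strand_diagram_def)
 have sdk: "strand_diagram Z ?chi"
  unfolding strand_diagram_def
 proof (intro conjI)
  have "Domain phi \<subseteq> points Z" "Range phi \<subseteq> points Z" using sub by blast+
  then have DR: "Domain ?chi \<subseteq> points Z" "Range ?chi \<subseteq> points Z" unfolding D by blast+
  show "?chi \<subseteq> points Z \<times> points Z"
  proof (rule subrelI)
   fix a b assume "(a, b) \<in> ?chi"
   then have "a \<in> Domain ?chi" "b \<in> Range ?chi" by (rule DomainI, rule RangeI)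
   then show "(a, b) \<in> points Z \<times> points Z" using DR by blast
  qed
  show "single_valued ?chi" "single_valued (?chi\<inverse>)"
   using ik matchings_single_valued matchings_single_valued_converse by blast+
  have le: "point_le z (?k z)" if "z \<in> S" for z
  proof -
   have gz: "point_le z (g z)" using strand_diagramD(3) [OF sd] that unfolding e by simp
   consider "z = x" | "z = \<sigma>" | "z \<noteq> x" "z \<noteq> \<sigma>" by blast
   then show ?thesis using gz xc(4-6) by cases (auto simp: point_le_def point_less_def)
  qed
  show "\<forall>(a, b)\<in>?chi. point_le a b" using le by (simp add: grf_def)
 qed
 have vk: "valid Z ?chi" using v sdk D unfolding valid_def by simp
 have fx: "fun_of ?chi x = ?k x" "fun_of ?chi \<sigma> = ?k \<sigma>" using f xc(1,2) by blast+
 have r: "resolve ?chi ((x, ?k x), (\<sigma>, ?k \<sigma>)) = phi" using c(2) unfolding tt e .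
 have "hgr phi = hgr ?chi" using resolve_graded(1) [OF vk c(1)] r by simp
 then have "first_double (hgr ?chi) \<sigma>" using \<sigma> by simp
 then obtain y where y: "points.pass (Domain ?chi) (fun_of ?chi) \<sigma> y" using first_double_pass [OF vk] by blast
 have "x = y" by (rule points.pass_unique [OF y]) (use xc fx in simp_all)
 then have "points.pass (Domain ?chi) (fun_of ?chi) \<sigma> x" using y by simp
 then show thesis using that [of ?chi x] ps N vk D c(1) r unfolding fx by simp
qed

text \<open>A crossing of two moving strands belongs to the common core and is present in every
  term.\<close>

lemma resolve_same_diagram:
 assumes v: "valid Z chi" "valid Z chi'" and eq: "diagram_of Z chi' = diagram_of Z chi"
  and c: "c \<in> crossings chi" and nh: "fst (fst c) \<noteq> snd (fst c)" "fst (snd c) \<noteq> snd (snd c)"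
 shows "c \<in> crossings chi'" "valid Z (resolve chi' c)" "diagram_of Z (resolve chi' c) = diagram_of Z (resolve chi c)"
proof -
 obtain a b x y where ab: "c = ((a, x), (b, y))" "(a, x) \<in> chi" "(b, y) \<in> chi" "point_less a b" "point_less y x"
  "point_le b y" "point_less a y" "point_less b x"
  using crossing_cases [OF valid_strand_diagram [OF v(1)] c] by metis
 have core: "core chi' = core chi" using eq by (simp add: diagram_of_def)
 have ne: "a \<noteq> x" "b \<noteq> y" "a \<noteq> y" "b \<noteq> x" using nh ab by auto
 have "(a, x) \<in> core chi'" "(b, y) \<in> core chi'" unfolding core using ab(2,3) ne by (simp_all add: core_def)
 then have mem: "(a, x) \<in> chi'" "(b, y) \<in> chi'" by (simp_all add: core_def)
 show c': "c \<in> crossings chi'" using mem ab(4,5) by (simp add: crossings_def ab(1))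
 show "valid Z (resolve chi' c)" by (rule valid_resolve [OF v(2) c'])
 have cr: "core (resolve \<rho> c) = core \<rho> - {(a, x), (b, y)} \<union> {(a, y), (b, x)}" for \<rho>
  unfolding resolve_def ab(1) core_def using ne(3,4) by auto
 show "diagram_of Z (resolve chi' c) = diagram_of Z (resolve chi c)"
  unfolding diagram_of_def cr core
  using resolve_matchings(2,3) [OF valid_matchings [OF v(1)] c] resolve_matchings(2,3) [OF valid_matchings [OF v(2)] c'] eq
  by (simp add: diagram_of_def)
qed

text \<open>A swapped term determines the term it came from by resolving, so no two contributions
  cancel. The exchanged strands both move, so in any other term of the same diagram the same
  crossing can be resolved, and swapping back shows that this term occurs too.\<close>

lemma swap_op_graded:
 assumes x: "x \<in> alg_gr Z (h, s, t) g" and \<sigma>: "first_double h \<sigma>"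
 shows "lin (swap_op \<sigma>) x \<in> alg_gr Z (h, s, t) (g + 1)"
proof -
 have xa: "x \<in> alg Z" by (rule alg_gr_alg [OF x])
 have xg0: "valid Z phi" "hgr phi = h" "occ Z (Domain phi) = s" "occ Z (Range phi) = t" "iota Z phi = g"
  if "phi \<in> keys x" for phi
  using x that alg_valid [OF xa that] unfolding alg_gr_iff by blast+
 have xg1: "first_double (hgr phi) \<sigma>" if "phi \<in> keys x" for phi
  using xg0(2) [OF that] \<sigma> by simp
 note xg = xg0 xg1
 let ?c = "\<lambda>chi y. ((y, fun_of chi y), (\<sigma>, fun_of chi \<sigma>))"
 have src: "\<exists>phi\<in>keys x. \<exists>y. swap_op \<sigma> phi = single chi 1 \<and> valid Z chi \<and>
   Domain chi = Domain phi \<and> Range chi = Range phi \<and> points.pass (Domain chi) (fun_of chi) \<sigma> y \<and>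
   ?c chi y \<in> uncrossable chi \<and> resolve chi (?c chi y) = phi" if k: "chi \<in> keys (lin (swap_op \<sigma>) x)" for chi
 proof -
  obtain phi where phi: "phi \<in> keys x" "chi \<in> keys (swap_op \<sigma> phi)"
   using subsetD [OF keys_lin k] by blast
  then have ne: "swap_op \<sigma> phi \<noteq> 0" by auto
  obtain chi' y' where c: "swap_op \<sigma> phi = single chi' 1" "valid Z chi'" "Domain chi' = Domain phi" "Range chi' = Range phi"
   "points.pass (Domain chi') (fun_of chi') \<sigma> y'" "?c chi' y' \<in> uncrossable chi'" "resolve chi' (?c chi' y') = phi"
   by (rule swap_op_cases [OF xg(1,6) [OF phi(1)] ne])
  have "chi' = chi" using phi(2) c(1) by simp
  then show ?thesis using phi(1) c by blast
 qed
 have inj: "phi = resolve chi (?c chi y)"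
  if phi: "phi \<in> keys x" "swap_op \<sigma> phi = single chi 1" and y: "points.pass (Domain chi) (fun_of chi) \<sigma> y" for phi chi y
 proof -
  have ne: "swap_op \<sigma> phi \<noteq> 0" using phi(2) by (metis keys_single_bit keys_zero insert_not_empty)
  obtain chi' y' where c: "swap_op \<sigma> phi = single chi' 1" "valid Z chi'" "Domain chi' = Domain phi" "Range chi' = Range phi"
   "points.pass (Domain chi') (fun_of chi') \<sigma> y'" "?c chi' y' \<in> uncrossable chi'" "resolve chi' (?c chi' y') = phi"
   by (rule swap_op_cases [OF xg(1,6) [OF phi(1)] ne])
  have "keys (single chi' (1::bit)) = keys (single chi (1::bit))"
   using c(1) phi(2) by simp
  then have "chi' = chi" by simp
  moreover have "y' = y" using points.pass_inj [OF y] c(5) unfolding \<open>chi' = chi\<close> by blast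
  ultimately show ?thesis using c(7) by simp
 qed
 have key: "chi \<in> keys (lin (swap_op \<sigma>) x)" if phi: "phi \<in> keys x" "swap_op \<sigma> phi = single chi 1" for phi chi
 proof -
  have ne: "swap_op \<sigma> phi \<noteq> 0" using phi(2) by (metis keys_single_bit keys_zero insert_not_empty)
  obtain chi' y' where c: "swap_op \<sigma> phi = single chi' 1" "valid Z chi'" "Domain chi' = Domain phi" "Range chi' = Range phi"
   "points.pass (Domain chi') (fun_of chi') \<sigma> y'" "?c chi' y' \<in> uncrossable chi'" "resolve chi' (?c chi' y') = phi"
   by (rule swap_op_cases [OF xg(1,6) [OF phi(1)] ne])
  have "keys (single chi' (1::bit)) = keys (single chi (1::bit))"
   using c(1) phi(2) by simp
  then have y: "points.pass (Domain chi) (fun_of chi) \<sigma> y'" using c(5) by simp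
  have "lookup (swap_op \<sigma> psi) chi = (if psi = phi then 1 else 0)" if psi: "psi \<in> keys x" for psi
  proof (cases "psi = phi")
   case False
   have "chi \<notin> keys (swap_op \<sigma> psi)"
   proof
    assume k: "chi \<in> keys (swap_op \<sigma> psi)"
    then have "swap_op \<sigma> psi \<noteq> 0" by auto
    obtain chi'' where "swap_op \<sigma> psi = single chi'' 1"
     by (rule swap_op_cases [OF xg(1,6) [OF psi] \<open>swap_op \<sigma> psi \<noteq> 0\<close>])
    then have "swap_op \<sigma> psi = single chi 1" using k by simp
    then show False using inj [OF psi _ y] inj [OF phi y] False by simp
   qed
   then show ?thesis using False by (simp add: in_keys_iff)
  qed (simp add: phi(2))
  then have "lookup (lin (swap_op \<sigma>) x) chi = (\<Sum>psi\<in>keys x. if psi = phi then 1 else 0)"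
   unfolding lin_def lookup_sum by (intro sum.cong) simp_all
  also have "\<dots> = 1" using phi(1) by (simp add: sum.delta)
  finally show ?thesis by (simp add: in_keys_iff)
 qed
 show ?thesis
  unfolding alg_gr_iff
 proof (intro conjI ballI)
  fix chi assume "chi \<in> keys (lin (swap_op \<sigma>) x)"
  from src [OF this] obtain phi y where phi: "phi \<in> keys x" "valid Z chi" "Domain chi = Domain phi" "Range chi = Range phi"
   "?c chi y \<in> uncrossable chi" "resolve chi (?c chi y) = phi" by blast
  show "hgr chi = h" "occ Z (Domain chi) = s" "occ Z (Range chi) = t" "iota Z chi = g + 1"
   using xg [OF phi(1)] phi(3,4) resolve_graded [OF phi(2,5)] phi(6) by simp_all
 next
  show "lin (swap_op \<sigma>) x \<in> alg Z"
  proof (rule invariant_chainsI)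
   fix chi assume "chi \<in> keys (lin (swap_op \<sigma>) x)"
   from src [OF this] show "valid Z chi" by blast
  next
   fix chi chi' assume v: "valid Z chi" "valid Z chi'" and eq: "diagram_of Z chi' = diagram_of Z chi"
    and k: "chi \<in> keys (lin (swap_op \<sigma>) x)"
   from src [OF k] obtain phi y where phi: "phi \<in> keys x" "Domain chi = Domain phi" "Range chi = Range phi"
    "points.pass (Domain chi) (fun_of chi) \<sigma> y" "?c chi y \<in> uncrossable chi" "resolve chi (?c chi y) = phi" by blast
   have cc: "?c chi y \<in> crossings chi" using phi(5) by (simp add: uncrossable_def)
   have m': "chi' \<in> matchings" and m: "chi \<in> matchings" using v by auto
   have ys: "point_less y \<sigma>" "point_less \<sigma> (fun_of chi y)" "point_less \<sigma> (fun_of chi \<sigma>)" "point_less (fun_of chi \<sigma>) (fun_of chi y)"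
    using phi(4) cc by (simp_all add: points.pass_def crossings_def)
   have nh: "fst (fst (?c chi y)) \<noteq> snd (fst (?c chi y))" "fst (snd (?c chi y)) \<noteq> snd (snd (?c chi y))"
    using ys by (auto simp: point_less_def)
   note r = resolve_same_diagram [OF v eq cc nh]
   let ?phi' = "resolve chi' (?c chi y)"
   have k': "?phi' \<in> keys x"
    by (rule invariant_chains_closed [OF xa phi(1) r(2)]) (use r(3) phi(6) in simp)
   have mem: "(y, fun_of chi y) \<in> chi'" "(\<sigma>, fun_of chi \<sigma>) \<in> chi'" using r(1) by (simp_all add: crossings_def)
   then have f: "fun_of chi' y = fun_of chi y" "fun_of chi' \<sigma> = fun_of chi \<sigma>" "y \<in> Domain chi'" "\<sigma> \<in> Domain chi'"
    using fun_of_mem [OF m'] by metis+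
   define S k where "S = Domain chi'" and "k = fun_of chi'"
   have e: "chi' = grf S k" and i: "interval_inj S k" using matchings_fun_of [OF m'] by (simp_all add: S_def k_def)
   have yS: "y \<in> S" "\<sigma> \<in> S" "y \<noteq> \<sigma>" using f ys(1) by (auto simp: S_def)
   have "?phi' = resolve chi' ((y, k y), (\<sigma>, k \<sigma>))" by (simp add: k_def f(1,2))
   also have "\<dots> = resolve (grf S k) ((y, k y), (\<sigma>, k \<sigma>))"
    by (rule arg_cong [of _ _ "\<lambda>r. resolve r ((y, k y), (\<sigma>, k \<sigma>))", OF e])
   finally have "?phi' = resolve (grf S k) ((y, k y), (\<sigma>, k \<sigma>))" .
   then have phi': "?phi' = grf S (k \<circ> transpose y \<sigma>)"
    using resolve_grf [OF yS] i by (simp add: points.interval_inj_def)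
   let ?l = "k \<circ> transpose y \<sigma>"
   obtain z where z: "points.pass S (fun_of ?phi') \<sigma> z"
    using first_double_pass [OF xg(1,6) [OF k']] unfolding phi' by auto
   have fl: "fun_of ?phi' w = ?l w" if "w \<in> S" for w unfolding phi' by (rule fun_of_grf [OF that])
   have z': "points.pass S ?l \<sigma> z" by (rule iffD1 [OF points.pass_cong [OF fl] z])
   have l: "?l y = fun_of chi \<sigma>" "?l \<sigma> = fun_of chi y" unfolding k_def by (simp_all add: f(1,2))
   have "point_less \<sigma> (?l y)" unfolding l by (rule ys(3))
   then have "y = z" by (rule points.pass_unique [OF z' yS(1) ys(1)])
   then have py: "points.pass S ?l \<sigma> y" using z' by simp
   have DS: "Domain ?phi' = S" unfolding phi' by simp
   have "swap_op \<sigma> ?phi' = points.pass_swap S ?l \<sigma>"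
    unfolding swap_op_def DS by (rule points.pass_swap_cong [OF fl z])
   also have "\<dots> = single (grf S (?l \<circ> transpose y \<sigma>)) 1"
    unfolding points.pass_swap_eq [OF py] l using ys(4) by simp
   also have "?l \<circ> transpose y \<sigma> = k" by (rule ext) simp
   finally have "swap_op \<sigma> ?phi' = single chi' 1" using e by simp
   then show "chi' \<in> keys (lin (swap_op \<sigma>) x)" by (rule key [OF k'])
  qed simp
 qed
qed

lemma swap_chain_homotopy:
 assumes x: "x \<in> alg_gr Z (h, s, t) g" and \<sigma>: "first_double h \<sigma>"
 shows "diff (lin (swap_op \<sigma>) x) + lin (swap_op \<sigma>) (diff x) = x"
proof -
 have xa: "x \<in> alg Z" by (rule alg_gr_alg [OF x])
 have "diff (lin (swap_op \<sigma>) x) + lin (swap_op \<sigma>) (diff x) =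
   lin (\<lambda>phi. lin (swap_op \<sigma>) (basis_diff phi) + diff (swap_op \<sigma> phi)) x"
  by (simp add: diff_lin lin_lin lin_fun_add add.commute)
 also have "\<dots> = lin (\<lambda>phi. single phi 1) x"
 proof (rule lin_cong)
  fix phi assume "phi \<in> keys x"
  then have "valid Z phi" "hgr phi = h" using x alg_valid [OF xa] unfolding alg_gr_iff by blast+
  then have "valid Z phi" "first_double (hgr phi) \<sigma>" using \<sigma> by simp_all
  then show "lin (swap_op \<sigma>) (basis_diff phi) + diff (swap_op \<sigma> phi) = single phi 1"
   by (rule swap_op_homotopy)
 qed
 finally show ?thesis by simp
qed

section \<open>Viable diagrams\<close>

text \<open>Extension from the basis of diagrams, whereas \<open>lin\<close> extends from single
  strand diagrams.\<close>

definition lext :: "arc_data => (diagram => chain) => chain => chain" where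
 "lext Z G x = (\<Sum>D\<in>supp Z x. G D)"

lemma finite_supp [simp]: "finite (supp Z x)"
 by (simp add: supp_def)

lemma supp_mem:
 assumes "x \<in> alg Z" "valid Z phi"
 shows "diagram_of Z phi \<in> supp Z x \<longleftrightarrow> phi \<in> keys x"
proof
 assume "diagram_of Z phi \<in> supp Z x"
 then have "terms_of Z (diagram_of Z phi) \<subseteq> keys x" by (simp add: supp_def)
 moreover have "phi \<in> terms_of Z (diagram_of Z phi)" using assms(2) by (simp add: terms_of_diagram)
 ultimately show "phi \<in> keys x" by blast
next
 assume "phi \<in> keys x"
 then show "diagram_of Z phi \<in> supp Z x" unfolding invariant_supp [OF assms(1)] by (rule imageI)
qed

lemma supp_add:
 assumes "x \<in> alg Z" "y \<in> alg Z"
 shows "supp Z (x + y) = (supp Z x - supp Z y) \<union> (supp Z y - supp Z x)"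
proof (rule Set.set_eqI)
 fix D
 show "D \<in> supp Z (x + y) \<longleftrightarrow> D \<in> (supp Z x - supp Z y) \<union> (supp Z y - supp Z x)"
 proof (cases "D \<in> diagrams Z")
  case True
  then obtain phi where phi: "valid Z phi" "D = diagram_of Z phi" unfolding diagrams_eq by blast
  show ?thesis
   unfolding phi(2) Un_iff Diff_iff supp_mem [OF assms(1) phi(1)] supp_mem [OF assms(2) phi(1)]
    supp_mem [OF alg_add [OF assms] phi(1)] keys_add_bit ..
 qed (simp add: supp_def)
qed

lemma lext_add:
 assumes "x \<in> alg Z" "y \<in> alg Z"
 shows "lext Z G (x + y) = lext Z G x + lext Z G y"
proof -
 let ?X = "supp Z x" and ?Y = "supp Z y"
 have "sum G ?X + sum G ?Y = (sum G (?X - ?Y) + sum G (?X \<inter> ?Y)) + (sum G (?Y - ?X) + sum G (?X \<inter> ?Y))"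
  using sum.Int_Diff [of ?X G ?Y] sum.Int_Diff [of ?Y G ?X] by (simp add: ac_simps Int_commute)
 also have "\<dots> = (sum G (?X - ?Y) + sum G (?Y - ?X)) + (sum G (?X \<inter> ?Y) + sum G (?X \<inter> ?Y))"
  by (simp only: ac_simps)
 also have "\<dots> = sum G (?X - ?Y) + sum G (?Y - ?X)" by simp
 also have "\<dots> = sum G (supp Z (x + y))"
  unfolding supp_add [OF assms] by (rule sum.union_disjoint [symmetric]) auto
 finally show ?thesis by (simp add: lext_def)
qed

lemma lext_zero [simp]: "lext Z G 0 = 0"
 using lext_add [of 0 Z 0 G] by simp

lemma lext_sum: "(\<And>i. i \<in> I ==> x i \<in> alg Z) ==> lext Z G (\<Sum>i\<in>I. x i) = (\<Sum>i\<in>I. lext Z G (x i))"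
 by (induction I rule: infinite_finite_induct) (simp_all add: lext_add invariant_chains_sum)

lemma chain_of_alg [simp]: "D \<in> diagrams Z ==> chain_of Z D \<in> alg Z"
 by (rule chain_of_invariant) simp_all

lemma keys_chain_of [simp]: "D \<in> diagrams Z ==> keys (chain_of Z D) = {phi. valid Z phi \<and> diagram_of Z phi = D}"
 by (simp add: chain_of_diagram)

lemma supp_chain_of: "D \<in> diagrams Z ==> supp Z (chain_of Z D) = {D}"
proof -
 assume D: "D \<in> diagrams Z"
 then obtain phi where "valid Z phi" "diagram_of Z phi = D" unfolding diagrams_eq by blast
 then have "diagram_of Z ` {phi. valid Z phi \<and> diagram_of Z phi = D} = {D}" by blast
 then show ?thesis unfolding invariant_supp [OF chain_of_alg [OF D]] keys_chain_of [OF D] .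
qed

lemma lext_chain_of [simp]: "D \<in> diagrams Z ==> lext Z G (chain_of Z D) = G D"
 by (simp add: lext_def supp_chain_of)

lemma alg_expand: "x \<in> alg Z ==> x = (\<Sum>D\<in>supp Z x. chain_of Z D)"
 by (rule invariant_expand)

lemma supp_diagrams: "D \<in> supp Z x ==> D \<in> diagrams Z"
 by (simp add: supp_def)

lemma chain_of_gr: "D \<in> diagrams Z ==> chain_of Z D \<in> alg_gr Z (hdata_of D) (maslov Z D)"
 unfolding alg_gr_def by (rule chain_of_invariant) simp_all

lemma supp_gr:
 assumes "x \<in> alg_gr Z d g" "D \<in> supp Z x"
 shows "hdata_of D = d" "maslov Z D = g"
proof -
 have x: "x \<in> invariant_chains Z (\<lambda>D. hdata_of D = d \<and> maslov Z D = g)" using assms(1) by (simp add: alg_gr_def)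
 from assms(2) obtain phi where "phi \<in> keys x" "D = diagram_of Z phi" unfolding invariant_supp [OF x] by blast
 then show "hdata_of D = d" "maslov Z D = g" using invariant_chainsD(2) [OF x] by blast+
qed

lemma alg_gr_sum: "(\<And>i. i \<in> I ==> x i \<in> alg_gr Z d g) ==> (\<Sum>i\<in>I. x i) \<in> alg_gr Z d g"
 unfolding alg_gr_def by (rule invariant_chains_sum)

lemma lext_gr:
 assumes "x \<in> alg_gr Z d g" "\<And>D. D \<in> diagrams Z ==> hdata_of D = d ==> maslov Z D = g ==> G D \<in> alg_gr Z e k"
 shows "lext Z G x \<in> alg_gr Z e k"
 unfolding lext_def
 by (rule alg_gr_sum, rule assms(2)) (use supp_gr [OF assms(1)] supp_diagrams in blast)+

text \<open>Moving strands are disjoint; the mixture of weak and strict inequalities allows a strand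
  to start where another ends.\<close>

definition slim :: "strands => bool" where
 "slim \<mu> \<longleftrightarrow> (\<forall>a x. (a, x) \<in> \<mu> --> point_less a x) \<and>
  (\<forall>a x b y. (a, x) \<in> \<mu> --> (b, y) \<in> \<mu> --> point_le a b --> point_less b x --> a = b \<and> x = y)"

lemma slim_less: "slim \<mu> ==> (a, x) \<in> \<mu> ==> point_less a x"
 and slim_eq: "slim \<mu> ==> (a, x) \<in> \<mu> ==> (b, y) \<in> \<mu> ==> point_le a b ==> point_less b x ==> a = b \<and> x = y"
 unfolding slim_def by blast+

lemma point_le_iff: "point_le x y \<longleftrightarrow> x = y \<or> point_less x y"
 by (auto simp: point_le_def point_less_def prod_eq_iff)

lemma slim_over:
 assumes "slim \<mu>" "(a, x) \<in> \<mu>" "(b, y) \<in> \<mu>" "point_le a p" "point_less p x" "point_le b p" "point_less p y"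
 shows "a = b \<and> x = y"
proof -
 have "point_le a b \<and> point_less b x \<or> point_le b a \<and> point_less a y"
  using assms(4-7) by (auto simp: point_le_def point_less_def)
 then show ?thesis using slim_eq [OF assms(1,2,3)] slim_eq [OF assms(1,3,2)] by blast
qed

text \<open>No end lies strictly inside a strand, because the strand ending there would overlap it.
  So every start is joined to the nearest end after it, and the sets of starts and ends fix the
  strands.\<close>

lemma slim_determined:
 assumes s: "slim \<mu>" "slim \<nu>" and D: "Domain \<mu> = Domain \<nu>" and R: "Range \<mu> = Range \<nu>"
 shows "\<mu> = \<nu>"
proof -
 have le: "(a, x) \<in> \<nu>" if sl: "slim \<mu>" "slim \<nu>" and D: "Domain \<mu> = Domain \<nu>" and R: "Range \<mu> = Range \<nu>" and ax: "(a, x) \<in> \<mu>" for \<mu> \<nu> a x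
 proof -
  have nl: False if m: "slim \<kappa>" "(a, u) \<in> \<kappa>" "(b, v) \<in> \<kappa>" "point_less v u" "point_less a v" for \<kappa> u v b
  proof -
   have bv: "point_less b v" by (rule slim_less [OF m(1,3)])
   have "point_le a b \<or> point_less b a" using bv m(5) by (auto simp: point_le_def point_less_def)
   then have "u = v"
   proof
    assume "point_le a b"
    then show "u = v" using slim_eq [OF m(1,2,3)] points.less_trans [OF bv m(4)] by blast
   next
    assume "point_less b a"
    then have "point_le b a" by (simp add: point_le_iff)
    then show "u = v" using slim_eq [OF m(1,3,2)] m(5) by blast
   qed
   then show False using m(4) by simp
  qed
  have "a \<in> Domain \<nu>" using ax D by blast
  then obtain y where ay: "(a, y) \<in> \<nu>" by blast
  have l: "point_less a x" "point_less a y" using slim_less sl ax ay by blast+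
  have "x \<in> Range \<nu>" "y \<in> Range \<mu>" using ax ay R by blast+
  then obtain b c where bc: "(b, x) \<in> \<nu>" "(c, y) \<in> \<mu>" by blast
  have "\<not> point_less y x" using nl [OF sl(1) ax bc(2) _ l(2)] by blast
  moreover have "\<not> point_less x y" using nl [OF sl(2) ay bc(1) _ l(1)] by blast
  moreover have "fst x = fst y" using l by (simp add: point_less_def)
  ultimately have "x = y" using points.comparable by blast
  then show ?thesis using ay by simp
 qed
 show ?thesis
  using le [OF s D R] le [OF s(2,1) D [symmetric] R [symmetric]] by (meson subrelI subset_antisym)
qed

text \<open>Two overlapping strands would both cover the step beginning at the later of their
  starts.\<close>

lemma viable_slim:
 assumes v: "valid Z phi" and vi: "viable_class Z (hgr phi)"
 shows "slim (core phi)"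
proof -
 have sd: "strand_diagram Z (core phi)" by (rule strand_diagram_core) (use v in simp)
 have h: "hgr (core phi) = hgr phi" by (rule hgr_core [of Z]) (use v in simp)
 have fin: "finite (core phi)" by (rule strand_diagram_finite [OF sd])
 have less: "point_less a x" if "(a, x) \<in> core phi" for a x
  using strand_diagramD(3) [OF sd that] that by (auto simp: point_le_iff core_def)
 have "a = b \<and> x = y" if ab: "(a, x) \<in> core phi" "(b, y) \<in> core phi" "point_le a b" "point_less b x" for a x b y
 proof -
  have "x \<in> points Z" by (rule strand_diagramD(2) [OF sd ab(1)])
  then have "b \<in> steps Z" using ab(4) by (auto simp: points_def steps_def point_less_def)
  then have "lookup (hgr (core phi)) b \<le> 1" using vi unfolding h viable_class_def by fastforce
  moreover have "(a, x) \<in> covering (core phi) b" "(b, y) \<in> covering (core phi) b"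
   using ab less [OF ab(2)] by (auto simp: covering_def point_le_def point_less_def)
  ultimately show ?thesis using covering_unique [OF fin] by blast
 qed
 then show ?thesis unfolding slim_def using less by blast
qed

abbreviation strands_of :: "diagram => strands" where
 "strands_of D \<equiv> fst (snd D)"

definition all_horiz :: "arc_data => diagram => nat => bool" where
 "all_horiz Z D P \<longleftrightarrow> P \<in> source D \<inter> target D \<and>
  (\<forall>r\<in>pair_places Z P. r \<notin> Domain (strands_of D) \<and> r \<notin> Range (strands_of D))"

definition over :: "diagram => point => bool" where
 "over D p \<longleftrightarrow> (\<exists>a x. (a, x) \<in> strands_of D \<and> point_less a p \<and> point_less p x)"

text \<open>What the picture shows at a crossing: the pair of p is dotted and a moving strand runs
  past p. \<open>crossing_at_iff\<close> relates this to crossings of terms.\<close>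

definition crossed_place :: "arc_data => diagram => point => bool" where
 "crossed_place Z D p \<longleftrightarrow> p \<in> places Z \<and> all_horiz Z D (pair_of Z p) \<and> over D p"

definition broken :: "diagram => point => bool" where
 "broken D p \<longleftrightarrow> p \<in> Domain (strands_of D) \<and> p \<in> Range (strands_of D)"

text \<open>The union over all strands past p avoids choosing one; in a viable diagram there is at
  most one.\<close>

definition break_at :: "diagram => point => diagram" where
 "break_at D p = (source D, {c \<in> strands_of D. \<not> (point_less (fst c) p \<and> point_less p (snd c))} \<union>
  (\<Union>c\<in>{c \<in> strands_of D. point_less (fst c) p \<and> point_less p (snd c)}. {(fst c, p), (p, snd c)}), target D)"

definition join_diagram :: "diagram => point => diagram" where
 "join_diagram D p = (source D, join_at (strands_of D) p, target D)"

lemma diagram_of_simps [simp]: "source (diagram_of Z phi) = occ Z (Domain phi)" "target (diagram_of Z phi) = occ Z (Range phi)"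
 "strands_of (diagram_of Z phi) = core phi"
 by (simp_all add: diagram_of_def source_def target_def)

lemma between_place:
 assumes "a \<in> points Z" "x \<in> points Z" "point_less a p" "point_less p x"
 shows "p \<in> places Z"
 using assms by (auto simp: points_def places_def point_less_def)

lemma core_iff: "(x, y) \<in> core phi \<longleftrightarrow> (x, y) \<in> phi \<and> x \<noteq> y"
 by (simp add: core_def)

lemma places_points: "places Z \<subseteq> points Z"
 by (auto simp: places_def points_def)

section \<open>Breaking and joining strands of viable diagrams\<close>

locale arc =
 fixes Z :: arc_data
 assumes Z: "arc_diagram Z"
begin

lemma pair_of_pairs: "p \<in> places Z ==> pair_of Z p \<in> pairs Z \<and> p \<in> pair_places Z (pair_of Z p)"
 using Z by (simp add: arc_diagram_def pair_places_def)

lemma pair_places_iff: "p \<in> pair_places Z P \<longleftrightarrow> p \<in> places Z \<and> pair_of Z p = P"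
 by (simp add: pair_places_def)

lemma horiz_all_horiz:
 assumes v: "valid Z phi" and r: "(r, r) \<in> phi" "r \<in> places Z"
 shows "all_horiz Z (diagram_of Z phi) (pair_of Z r)"
proof -
 let ?P = "pair_of Z r"
 have sd: "strand_diagram Z phi" using v by simp
 have P: "?P \<in> pairs Z" "r \<in> pair_places Z ?P" using pair_of_pairs [OF r(2)] by auto
 have fin: "finite (Domain phi \<inter> pair_places Z ?P)" "finite (Range phi \<inter> pair_places Z ?P)"
  using finite_Domain [OF strand_diagram_finite [OF sd]] finite_Range [OF strand_diagram_finite [OF sd]] by simp_all
 have le: "card (Domain phi \<inter> pair_places Z ?P) \<le> 1" "card (Range phi \<inter> pair_places Z ?P) \<le> 1"
  using v P(1) unfolding valid_def by blast+
 have rm: "r \<in> Domain phi \<inter> pair_places Z ?P" "r \<in> Range phi \<inter> pair_places Z ?P" using r(1) P(2) by blast+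
 have one: "Domain phi \<inter> pair_places Z ?P = {r}" "Range phi \<inter> pair_places Z ?P = {r}"
  using card_le_1_eq [OF fin(1) le(1) rm(1)] card_le_1_eq [OF fin(2) le(2) rm(2)] by blast+
 have "q \<notin> Domain (core phi) \<and> q \<notin> Range (core phi)" if q: "q \<in> pair_places Z ?P" for q
 proof -
  have "q = r" if "q \<in> Domain phi \<or> q \<in> Range phi" using one q that by (metis IntI singletonD)
  moreover have "r \<notin> Domain (core phi)" "r \<notin> Range (core phi)"
   using strand_diagram_unique [OF sd r(1)] unfolding Domain_iff Range_iff core_iff by metis+
  moreover have "Domain (core phi) \<subseteq> Domain phi" "Range (core phi) \<subseteq> Range phi" unfolding core_def by blast+
  ultimately show ?thesis by blast
 qed
 then show ?thesis using one P unfolding all_horiz_def by (simp add: occ_def)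
qed

text \<open>The dotted strand may be drawn at either place of its pair, and moving it to the other
  place gives another term of the same diagram.\<close>

lemma all_horiz_horiz:
 assumes v: "valid Z phi" and h: "all_horiz Z (diagram_of Z phi) P" and P: "P \<in> pairs Z" and r: "r \<in> pair_places Z P"
 shows "\<exists>psi. valid Z psi \<and> diagram_of Z psi = diagram_of Z phi \<and> (r, r) \<in> psi"
proof -
 have sd: "strand_diagram Z phi" using v by simp
 have c: "card (Domain phi \<inter> pair_places Z P) = 1" "card (Range phi \<inter> pair_places Z P) = 1"
  using h unfolding all_horiz_def by (simp_all add: occ_def)
 obtain q where q: "Domain phi \<inter> pair_places Z P = {q}" using c(1) by (rule card_1_singletonE)
 obtain q' where q': "Range phi \<inter> pair_places Z P = {q'}" using c(2) by (rule card_1_singletonE)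
 have qm: "q \<in> Domain phi" "q \<in> pair_places Z P" using q by (metis IntD1 IntD2 singletonI)+
 have "q \<notin> Domain (core phi)" using h qm(2) unfolding all_horiz_def by simp
 then have qq: "(q, q) \<in> phi" using qm(1) unfolding core_def by blast
 then have "q \<in> Range phi \<inter> pair_places Z P" using qm(2) by blast
 then have "q' = q" using q' by simp
 show ?thesis
 proof (cases "r = q")
  case True
  then show ?thesis using v qq by blast
 next
  case False
  have rn: "r \<notin> Domain phi" "r \<notin> Range phi"
   using q q' r False \<open>q' = q\<close> by (metis IntI singletonD)+
  have tw: "twin_sets Z {q} {r}"
   unfolding twin_sets_def
  proof (intro conjI ballI)
   show "{r} \<subseteq> points Z" using r places_points by (simp add: pair_places_def) blast
   fix Q assume "Q \<in> pairs Z"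
   show "{q} \<inter> pair_places Z Q = {} \<and> {r} \<inter> pair_places Z Q = {} \<or>
     (\<exists>q' z. {q} \<inter> pair_places Z Q = {q'} \<and> {r} \<inter> pair_places Z Q = {z})"
    using r qm(2) by (cases "Q = P") (simp_all add: pair_places_iff)
  qed
  have "Id_on {q} \<subseteq> phi" using qq by blast
  from move_horiz_valid [OF v this tw] rn
  have "valid Z (move_horiz {q} {r} phi)" "diagram_of Z (move_horiz {q} {r} phi) = diagram_of Z phi" by blast+
  moreover have "(r, r) \<in> move_horiz {q} {r} phi" unfolding move_horiz_def by blast
  ultimately show ?thesis by blast
 qed
qed

lemma swap_ends_valid:
 assumes v: "valid Z chi" and m: "(a, y) \<in> chi" "(b, x) \<in> chi" "a \<noteq> b" and le: "point_le a x" "point_le b y"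
 shows "valid Z (resolve chi ((a, y), (b, x)))" "Domain (resolve chi ((a, y), (b, x))) = Domain chi"
  "Range (resolve chi ((a, y), (b, x))) = Range chi" "hgr (resolve chi ((a, y), (b, x))) = hgr chi"
proof -
 have sd: "strand_diagram Z chi" and ma: "chi \<in> matchings" using v by auto
 define S k where "S = Domain chi" and "k = fun_of chi"
 have e: "chi = grf S k" and i: "interval_inj S k" using matchings_fun_of [OF ma] by (simp_all add: S_def k_def)
 have ab: "a \<in> S" "b \<in> S" "y = k a" "x = k b" using m(1,2) unfolding e by simp_all
 have "fst a = fst b" using le(1) strand_diagramD(3) [OF sd m(2)] by (simp add: point_le_def)
 have r: "resolve chi ((a, y), (b, x)) = grf S (k \<circ> transpose a b)"
  unfolding e ab(3,4) using ab(1,2) m(3) i by (intro resolve_grf) (simp_all add: points.interval_inj_def)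
 have ik: "interval_inj S (k \<circ> transpose a b)" by (rule points.interval_inj_transpose [OF i ab(1,2) \<open>fst a = fst b\<close>])
 have im: "(k \<circ> transpose a b) ` S = k ` S" by (rule image_comp_transpose [OF ab(1,2)])
 show D: "Domain (resolve chi ((a, y), (b, x))) = Domain chi" "Range (resolve chi ((a, y), (b, x))) = Range chi"
  unfolding r unfolding e using im by (simp_all del: image_comp)
 have res: "resolve chi ((a, y), (b, x)) = chi - {(a, y), (b, x)} \<union> {(a, x), (b, y)}" by (simp add: resolve_def)
 have sd': "strand_diagram Z (resolve chi ((a, y), (b, x)))"
  unfolding strand_diagram_def
 proof (intro conjI)
  show "single_valued (resolve chi ((a, y), (b, x)))" "single_valued ((resolve chi ((a, y), (b, x)))\<inverse>)"
   unfolding r using ik matchings_single_valued matchings_single_valued_converse by blast+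
  have "chi \<subseteq> points Z \<times> points Z" using sd by (simp add: strand_diagram_def)
  then show "resolve chi ((a, y), (b, x)) \<subseteq> points Z \<times> points Z" unfolding res using m by blast
  show "\<forall>(x, y)\<in>resolve chi ((a, y), (b, x)). point_le x y"
  proof (rule ballI)
   fix c assume "c \<in> resolve chi ((a, y), (b, x))"
   then have "c \<in> chi \<or> c = (a, x) \<or> c = (b, y)" unfolding res by blast
   then show "case c of (x, y) => point_le x y"
    using le strand_diagramD(3) [OF sd, of "fst c" "snd c"] by (cases c) auto
  qed
 qed
 show "valid Z (resolve chi ((a, y), (b, x)))" using v sd' D unfolding valid_def by simp
 show "hgr (resolve chi ((a, y), (b, x))) = hgr chi" by (rule hgr_eqI [OF sd' sd D])
qed

lemma break_at_strands:
 assumes "slim (strands_of D)" "(a, x) \<in> strands_of D" "point_less a p" "point_less p x"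
 shows "break_at D p = (source D, strands_of D - {(a, x)} \<union> {(a, p), (p, x)}, target D)"
proof -
 have u: "c = (a, x)" if "c \<in> strands_of D" "point_less (fst c) p" "point_less p (snd c)" for c
 proof -
  have "(fst c, snd c) \<in> strands_of D" using that(1) by simp
  then have "fst c = a \<and> snd c = x"
   using slim_over [OF assms(1) _ assms(2), of "fst c" "snd c" p] that assms(3,4) by (auto simp: point_le_iff)
  then show ?thesis by (simp add: prod_eq_iff)
 qed
 have M: "c \<in> strands_of D \<and> point_less (fst c) p \<and> point_less p (snd c) \<longleftrightarrow> c = (a, x)" for c
  using u assms(2-4) by (metis fst_conv snd_conv)
 have "{c \<in> strands_of D. point_less (fst c) p \<and> point_less p (snd c)} = {(a, x)}" using M by blast
 moreover have "{c \<in> strands_of D. \<not> (point_less (fst c) p \<and> point_less p (snd c))} = strands_of D - {(a, x)}"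
  using M by blast
 ultimately show ?thesis by (simp add: break_at_def)
qed

lemma break_resolve:
 assumes v: "valid Z phi" and vi: "viable_class Z (hgr phi)" and m: "(a, x) \<in> core phi" "(p, p) \<in> phi" "point_less a p" "point_less p x"
 shows "((a, x), (p, p)) \<in> uncrossable phi" "diagram_of Z (resolve phi ((a, x), (p, p))) = break_at (diagram_of Z phi) p"
  "crossed_place Z (diagram_of Z phi) p"
proof -
 have sd: "strand_diagram Z phi" using v by simp
 have sl: "slim (core phi)" by (rule viable_slim [OF v vi])
 have ax: "(a, x) \<in> phi" "a \<noteq> x" using m(1) by (auto simp: core_def)
 have cr: "((a, x), (p, p)) \<in> crossings phi" using ax m by (simp add: crossings_def)
 have "False" if w: "(u, w) \<in> phi" "point_less a u" "point_less u p" "point_less p w" "point_less w x" for u w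
 proof -
  have "u \<noteq> w" using w(3,4) by (auto simp: point_less_def)
  then have "(u, w) \<in> core phi" using w(1) by (simp add: core_def)
  moreover have "point_le a u" "point_less u x" using w m(4) by (auto simp: point_le_def point_less_def)
  ultimately have "a = u" by (rule slim_eq [OF sl m(1), THEN conjunct1])
  then show False using w(2) by simp
 qed
 then show "((a, x), (p, p)) \<in> uncrossable phi" using cr unfolding uncrossable_def by fastforce
 have pp: "p \<in> places Z"
  using strand_diagramD [OF sd ax(1)] m(3,4) by (intro between_place [of a Z x]) auto
 then have "all_horiz Z (diagram_of Z phi) (pair_of Z p)" using horiz_all_horiz [OF v m(2)] by blast
 then show "crossed_place Z (diagram_of Z phi) p"
  using pp m unfolding crossed_place_def over_def diagram_of_simps by blast
 note r = resolve_matchings(2,3) [OF valid_matchings [OF v] cr]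
 have "core (resolve phi ((a, x), (p, p))) = core phi - {(a, x)} \<union> {(a, p), (p, x)}"
  unfolding resolve_def core_def using m(3,4) by auto
 then show "diagram_of Z (resolve phi ((a, x), (p, p))) = break_at (diagram_of Z phi) p"
  using break_at_strands [of "diagram_of Z phi" a x p] sl m r by (simp add: diagram_of_def source_def target_def)
qed

text \<open>Two crossing strands overlap, which two moving strands of a viable diagram never do, so
  the strand that starts later is horizontal.\<close>

lemma crossings_viable:
 assumes v: "valid Z phi" and vi: "viable_class Z (hgr phi)" and c: "c \<in> crossings phi"
 obtains a x p where "c = ((a, x), (p, p))" "(a, x) \<in> core phi" "(p, p) \<in> phi" "point_less a p" "point_less p x"
proof -
 have sl: "slim (core phi)" by (rule viable_slim [OF v vi])
 obtain a b x y where ab: "c = ((a, x), (b, y))" "(a, x) \<in> phi" "(b, y) \<in> phi" "point_less a b" "point_less y x"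
  "point_le b y" "point_less a y" "point_less b x"
  using crossing_cases [OF valid_strand_diagram [OF v] c] by metis
 have ax: "(a, x) \<in> core phi" using ab(2,4,8) by (auto simp: core_def point_less_def)
 have "b = y"
 proof (rule ccontr)
  assume "b \<noteq> y"
  then have "(b, y) \<in> core phi" using ab(3) by (simp add: core_def)
  then have "x = y" using slim_eq [OF sl ax] ab(4,8) by (auto simp: point_le_iff)
  then show False using ab(5) by simp
 qed
 then show thesis using that ab ax by blast
qed

lemma break_term:
 assumes D: "D \<in> diagrams Z" and vi: "viable_class Z (hgrade D)" and c: "crossed_place Z D p"
 obtains phi a x where "valid Z phi" "diagram_of Z phi = D" "viable_class Z (hgr phi)" "(a, x) \<in> core phi" "(p, p) \<in> phi"
  "point_less a p" "point_less p x"
proof -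
 obtain psi where psi: "valid Z psi" "D = diagram_of Z psi" using D unfolding diagrams_eq by blast
 have p: "p \<in> places Z" "all_horiz Z D (pair_of Z p)" "over D p" using c by (auto simp: crossed_place_def)
 obtain phi where phi: "valid Z phi" "diagram_of Z phi = D" "(p, p) \<in> phi"
  using all_horiz_horiz [OF psi(1) p(2) [unfolded psi(2)]] pair_of_pairs [OF p(1)] unfolding psi(2) by blast
 obtain a x where "(a, x) \<in> core phi" "point_less a p" "point_less p x"
  using p(3) phi(2) unfolding over_def by auto
 moreover have "viable_class Z (hgr phi)" using vi hgrade_diagram_of [OF phi(1)] phi(2) by simp
 ultimately show thesis using that phi by blast
qed

lemma break_at_diagram:
 assumes D: "D \<in> diagrams Z" and vi: "viable_class Z (hgrade D)" and c: "crossed_place Z D p"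
 shows "break_at D p \<in> diagrams Z" "hdata_of (break_at D p) = hdata_of D" "maslov Z (break_at D p) = maslov Z D - 1"
  "Domain (strands_of (break_at D p)) = insert p (Domain (strands_of D))"
  "Range (strands_of (break_at D p)) = insert p (Range (strands_of D))"
  "\<And>r. r \<noteq> p ==> over (break_at D p) r \<longleftrightarrow> over D r"
  "source (break_at D p) = source D" "target (break_at D p) = target D"
proof -
 obtain phi a x where phi: "valid Z phi" "diagram_of Z phi = D" "viable_class Z (hgr phi)" "(a, x) \<in> core phi" "(p, p) \<in> phi"
  "point_less a p" "point_less p x" by (rule break_term [OF D vi c])
 note b = break_resolve [OF phi(1,3-7)]
 let ?chi = "resolve phi ((a, x), (p, p))"
 have cr: "((a, x), (p, p)) \<in> crossings phi" using b(1) unfolding uncrossable_def by blast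
 have v: "valid Z ?chi" by (rule valid_resolve [OF phi(1) cr])
 have e: "diagram_of Z ?chi = break_at D p" using b(2) phi(2) by simp
 show "break_at D p \<in> diagrams Z" using diagram_of_diagrams [OF v] e by simp
 show "source (break_at D p) = source D" "target (break_at D p) = target D"
  by (simp_all add: break_at_def source_def target_def)
 note r = resolve_matchings(2,3) [OF valid_matchings [OF phi(1)] cr]
 show "hdata_of (break_at D p) = hdata_of D"
  using hdata_diagram_of [OF v] hdata_diagram_of [OF phi(1)] resolve_graded(1) [OF phi(1) b(1)] r e phi(2) by simp
 show "maslov Z (break_at D p) = maslov Z D - 1"
  using maslov_diagram_of [OF v] maslov_diagram_of [OF phi(1)] resolve_graded(2) [OF phi(1) b(1)] e phi(2) by simp
 have mu: "strands_of D = core phi" using phi(2) by auto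
 have sl: "slim (strands_of D)" unfolding mu by (rule viable_slim [OF phi(1,3)])
 have bs: "strands_of (break_at D p) = strands_of D - {(a, x)} \<union> {(a, p), (p, x)}"
  using break_at_strands [OF sl] phi(4,6,7) mu by simp
 have ax: "(a, x) \<in> strands_of D" using phi(4) mu by simp
 show "Domain (strands_of (break_at D p)) = insert p (Domain (strands_of D))" unfolding bs using ax by blast
 show "Range (strands_of (break_at D p)) = insert p (Range (strands_of D))" unfolding bs using ax by blast
 fix r assume rp: "r \<noteq> p"
 have s: "point_less a r \<and> point_less r p \<or> point_less p r \<and> point_less r x \<longleftrightarrow> point_less a r \<and> point_less r x"
 proof -
  have "point_less r p \<or> point_less p r" if "point_less a r"
   using points.comparable [of r p] that phi(6) rp by (auto simp: point_less_def)
  then show ?thesis using phi(6,7) points.less_trans by blast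
 qed
 show "over (break_at D p) r \<longleftrightarrow> over D r"
 proof
  assume "over (break_at D p) r"
  then obtain b y where "(b, y) \<in> strands_of D - {(a, x)} \<union> {(a, p), (p, x)}" "point_less b r" "point_less r y"
   unfolding over_def bs by blast
  then show "over D r" using ax s unfolding over_def by blast
 next
  assume "over D r"
  then obtain b y where oy: "(b, y) \<in> strands_of D" "point_less b r" "point_less r y" unfolding over_def by blast
  show "over (break_at D p) r"
  proof (cases "(b, y) = (a, x)")
   case True
   then show ?thesis using oy s unfolding over_def bs by blast
  next
   case False
   then show ?thesis using oy unfolding over_def bs by blast
  qed
 qed
qed

text \<open>After the break the pair of p is no longer dotted, so both its places are lost as
  crossings; which other places are run past does not change.\<close>

lemma crossed_place_break:
 assumes D: "D \<in> diagrams Z" "viable_class Z (hgrade D)" "crossed_place Z D p"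
 shows "crossed_place Z (break_at D p) r \<longleftrightarrow> crossed_place Z D r \<and> pair_of Z r \<noteq> pair_of Z p"
proof -
 note b = break_at_diagram [OF D]
 have p: "p \<in> places Z" using D(3) by (simp add: crossed_place_def)
 have "all_horiz Z (break_at D p) P \<longleftrightarrow> all_horiz Z D P \<and> P \<noteq> pair_of Z p" for P
  unfolding all_horiz_def b(4,5,7,8) using p by (auto simp: pair_places_iff)
 then show ?thesis
  unfolding crossed_place_def using b(6) [of r] by (cases "r = p") auto
qed

text \<open>Replacing a -> p -> x by a -> x and a horizontal strand at p reverses a resolution,
  which makes joining inverse to breaking.\<close>

lemma join_term:
 assumes v: "valid Z chi" and viC: "viable_class Z (hgr chi)" and br: "broken (diagram_of Z chi) p"
 obtains phi a x where "valid Z phi" "viable_class Z (hgr phi)" "(a, x) \<in> core phi" "(p, p) \<in> phi" "point_less a p"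
  "point_less p x" "resolve phi ((a, x), (p, p)) = chi" "diagram_of Z phi = join_diagram (diagram_of Z chi) p"
proof -
 have sl: "slim (core chi)" by (rule viable_slim [OF v viC])
 obtain a x where ax: "(a, p) \<in> core chi" "(p, x) \<in> core chi" using br unfolding broken_def diagram_of_simps by blast
 have l: "point_less a p" "point_less p x" using slim_less [OF sl] ax by blast+
 have m: "(a, p) \<in> chi" "(p, x) \<in> chi" using ax by (simp_all add: core_def)
 have ne: "a \<noteq> p" "p \<noteq> x" "a \<noteq> x" "point_le a x" "point_le p p" using l by (auto simp: point_le_def point_less_def)
 note r = swap_ends_valid [OF v m ne(1,4,5)]
 let ?phi = "resolve chi ((a, p), (p, x))"
 have res: "?phi = chi - {(a, p), (p, x)} \<union> {(a, x), (p, p)}" by (simp add: resolve_def)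
 have sd: "strand_diagram Z chi" using v by simp
 note u1 = strand_diagram_unique [OF sd m(1)] and u2 = strand_diagram_unique [OF sd m(2)]
 have core: "core ?phi = core chi - {(a, p), (p, x)} \<union> {(a, x)}"
  unfolding res core_def using ne(3) by auto
 have "join_at (core chi) p = core chi - {(a, p), (p, x)} \<union> {(a, x)}"
 proof (rule Set.set_eqI)
  fix c
  obtain u w :: point where c: "c = (u, w)" by (cases c)
  have "(u, w) \<in> core chi ==> w = p \<longleftrightarrow> u = a" "(u, w) \<in> core chi ==> u = p \<longleftrightarrow> w = x"
   using u1 u2 unfolding core_def by blast+
  moreover have "(u, p) \<in> core chi \<longleftrightarrow> u = a" "(p, w) \<in> core chi \<longleftrightarrow> w = x"
   using u1 u2 ax unfolding core_def by blast+
  ultimately show "c \<in> join_at (core chi) p \<longleftrightarrow> c \<in> core chi - {(a, p), (p, x)} \<union> {(a, x)}"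
   unfolding join_at_def c using ax ne by (simp add: prod_eq_iff [where 'a = point and 'b = point]) metis
 qed
 then have e: "diagram_of Z ?phi = join_diagram (diagram_of Z chi) p"
  by (simp add: diagram_of_def join_diagram_def source_def target_def r(2,3) core)
 have vip: "viable_class Z (hgr ?phi)" using viC r(4) by simp
 have mp: "(a, x) \<in> core ?phi" unfolding core by simp
 have pp: "(p, p) \<in> ?phi" unfolding res by simp
 have ax': "(a, x) \<notin> chi" "(p, p) \<notin> chi" using u1 u2 ne by blast+
 have *: "(X - {c, d} \<union> {c', d'}) - {c', d'} \<union> {c, d} = X" if "c \<in> X" "d \<in> X" "c' \<notin> X" "d' \<notin> X" for X :: strands and c d c' d'
  using that by blast
 have rb: "resolve ?phi ((a, x), (p, p)) = chi"
  unfolding resolve_def [of ?phi] prod.case fst_conv snd_conv unfolding res by (rule * [OF m ax'])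
 show thesis by (rule that [OF r(1) vip mp pp l rb e])
qed

lemma join_diagram_props:
 assumes D: "D \<in> diagrams Z" and vi: "viable_class Z (hgrade D)" and br: "broken D p"
 shows "join_diagram D p \<in> diagrams Z" "crossed_place Z (join_diagram D p) p" "break_at (join_diagram D p) p = D"
  "hdata_of (join_diagram D p) = hdata_of D" "maslov Z (join_diagram D p) = maslov Z D + 1"
  "Domain (strands_of (join_diagram D p)) = Domain (strands_of D) - {p}"
  "Range (strands_of (join_diagram D p)) = Range (strands_of D) - {p}"
proof -
 obtain chi where chi: "valid Z chi" "D = diagram_of Z chi" using D unfolding diagrams_eq by blast
 have viC: "viable_class Z (hgr chi)" using vi hgrade_diagram_of [OF chi(1)] chi(2) by simp
 obtain phi a x where phi: "valid Z phi" "viable_class Z (hgr phi)" "(a, x) \<in> core phi" "(p, p) \<in> phi" "point_less a p"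
  "point_less p x" "resolve phi ((a, x), (p, p)) = chi" "diagram_of Z phi = join_diagram D p"
  unfolding chi(2) by (rule join_term [OF chi(1) viC br [unfolded chi(2)]])
 note b = break_resolve [OF phi(1-6)]
 show J: "join_diagram D p \<in> diagrams Z" using diagram_of_diagrams [OF phi(1)] phi(8) by simp
 show cp: "crossed_place Z (join_diagram D p) p" using b(3) phi(8) by simp
 show bj: "break_at (join_diagram D p) p = D" using b(2) phi(7,8) chi(2) by simp
 have viJ: "viable_class Z (hgrade (join_diagram D p))" using hgrade_diagram_of [OF phi(1)] phi(2,8) by simp
 note bb = break_at_diagram [OF J viJ cp, unfolded bj]
 show "hdata_of (join_diagram D p) = hdata_of D" using bb(2) by simp
 show "maslov Z (join_diagram D p) = maslov Z D + 1" using bb(3) by simp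
 have nJ: "p \<notin> Domain (strands_of (join_diagram D p))" "p \<notin> Range (strands_of (join_diagram D p))"
  using cp pair_of_pairs unfolding crossed_place_def all_horiz_def by blast+
 show "Domain (strands_of (join_diagram D p)) = Domain (strands_of D) - {p}" unfolding bb(4) using nJ(1) by blast
 show "Range (strands_of (join_diagram D p)) = Range (strands_of D) - {p}" unfolding bb(5) using nJ(2) by blast
qed

lemma hgrade_hdata: "hdata_of D = hdata_of E ==> hgrade D = hgrade E \<and> source D = source E \<and> target D = target E"
 by (simp add: hdata_of_def)

lemma diagram_slim:
 assumes "D \<in> diagrams Z" "viable_class Z (hgrade D)"
 shows "slim (strands_of D)"
proof -
 obtain phi where phi: "valid Z phi" "D = diagram_of Z phi" using assms(1) unfolding diagrams_eq by blast
 have "viable_class Z (hgr phi)" using assms(2) hgrade_diagram_of [OF phi(1)] phi(2) by simp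
 then show ?thesis using viable_slim [OF phi(1)] phi(2) by simp
qed

text \<open>With this, identities between iterated breaks and joins reduce to identities between
  finite sets of ends.\<close>

lemma viable_diagram_eqI:
 assumes "D \<in> diagrams Z" "E \<in> diagrams Z" "viable_class Z (hgrade D)" "hdata_of D = hdata_of E"
  "Domain (strands_of D) = Domain (strands_of E)" "Range (strands_of D) = Range (strands_of E)"
 shows "D = E"
proof -
 have h: "hgrade D = hgrade E" "source D = source E" "target D = target E" using hgrade_hdata [OF assms(4)] by auto
 have "slim (strands_of D)" "slim (strands_of E)" using diagram_slim assms(1-3) h(1) by auto
 then have "strands_of D = strands_of E" using slim_determined assms(5,6) by blast
 then show ?thesis using h(2,3) by (simp add: source_def target_def prod_eq_iff)
qed

end

section \<open>Homotopies on the summands of the algebra\<close>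

definition homotopy_on :: "arc_data => hdata => (diagram => chain) => (diagram => chain) => bool" where
 "homotopy_on Z d k q \<longleftrightarrow> (\<forall>D\<in>diagrams Z. hdata_of D = d -->
  k D \<in> alg_gr Z d (maslov Z D + 1) \<and> q D \<in> alg_gr Z d (maslov Z D) \<and>
  diff (k D) + lext Z k (diff (chain_of Z D)) = chain_of Z D + q D)"

lemma homotopy_onD:
 assumes "homotopy_on Z d k q" "D \<in> diagrams Z" "hdata_of D = d"
 shows "k D \<in> alg_gr Z d (maslov Z D + 1)" "q D \<in> alg_gr Z d (maslov Z D)"
  "diff (k D) + lext Z k (diff (chain_of Z D)) = chain_of Z D + q D"
 using assms unfolding homotopy_on_def by blast+

lemma homotopy_expand:
 assumes xa: "x \<in> alg Z" and h: "\<And>D. D \<in> supp Z x ==> diff (k D) + lext Z k (diff (chain_of Z D)) = chain_of Z D + q D"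
 shows "diff (lext Z k x) + lext Z k (diff x) = x + lext Z q x"
proof -
 have e: "x = (\<Sum>D\<in>supp Z x. chain_of Z D)" by (rule alg_expand [OF xa])
 have "diff x = diff (\<Sum>D\<in>supp Z x. chain_of Z D)" by (rule arg_cong [OF e])
 then have d: "diff x = (\<Sum>D\<in>supp Z x. diff (chain_of Z D))" by (simp only: diff_sum)
 have "diff (lext Z k x) + lext Z k (diff x) =
   (\<Sum>D\<in>supp Z x. diff (k D)) + (\<Sum>D\<in>supp Z x. lext Z k (diff (chain_of Z D)))"
  unfolding d by (subst lext_sum) (auto simp: lext_def [of Z k x] diff_sum intro: diff_alg chain_of_alg supp_diagrams)
 also have "\<dots> = (\<Sum>D\<in>supp Z x. diff (k D) + lext Z k (diff (chain_of Z D)))" by (rule sum.distrib [symmetric])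
 also have "\<dots> = (\<Sum>D\<in>supp Z x. chain_of Z D + q D)"
  by (rule sum.cong [OF refl], rule h)
 also have "\<dots> = x + lext Z q x"
  unfolding sum.distrib lext_def e [symmetric] ..
 finally show ?thesis .
qed

lemma homotopy_on_chain:
 assumes h: "homotopy_on Z d k q" and x: "x \<in> alg_gr Z d g"
 shows "lext Z k x \<in> alg_gr Z d (g + 1)" "lext Z q x \<in> alg_gr Z d g"
  "diff (lext Z k x) + lext Z k (diff x) = x + lext Z q x"
proof -
 have k: "k D \<in> alg_gr Z d (g + 1)" and q: "q D \<in> alg_gr Z d g" if "D \<in> diagrams Z" "hdata_of D = d" "maslov Z D = g" for D
  using homotopy_onD(1,2) [OF h that(1,2)] that(3) by simp_all
 show "lext Z k x \<in> alg_gr Z d (g + 1)" by (rule lext_gr [OF x k])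
 show "lext Z q x \<in> alg_gr Z d g" by (rule lext_gr [OF x q])
 show "diff (lext Z k x) + lext Z k (diff x) = x + lext Z q x"
  by (rule homotopy_expand [OF alg_gr_alg [OF x]], rule homotopy_onD(3) [OF h]) (use supp_diagrams supp_gr(1) [OF x] in blast)+
qed

text \<open>The second homotopy is applied to what the first one leaves. The computation needs q1 to
  commute with \<open>diff\<close>, which follows from the first homotopy identity itself: apply
  \<open>diff\<close> to it at D and compare with the identity at the differential of D.\<close>

lemma homotopy_on_compose:
 assumes h1: "homotopy_on Z d k1 q1" and h2: "homotopy_on Z d k2 q2"
 shows "homotopy_on Z d (\<lambda>D. k1 D + lext Z k2 (q1 D)) (\<lambda>D. lext Z q2 (q1 D))"
 unfolding homotopy_on_def
proof (intro ballI impI conjI)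
 fix D assume D: "D \<in> diagrams Z" "hdata_of D = d"
 let ?g = "maslov Z D" and ?x = "chain_of Z D"
 have x: "?x \<in> alg_gr Z d ?g" using chain_of_gr [OF D(1)] D(2) by simp
 have dx: "diff ?x \<in> alg_gr Z d (?g - 1)" by (rule diff_graded [OF x])
 have xa: "?x \<in> alg Z" "diff ?x \<in> alg Z" using alg_gr_alg x dx by blast+
 note H1 = homotopy_onD [OF h1 D]
 note c2 = homotopy_on_chain [OF h2 H1(2)]
 show "lext Z q2 (q1 D) \<in> alg_gr Z d ?g" by (rule c2(2))
 show "k1 D + lext Z k2 (q1 D) \<in> alg_gr Z d (?g + 1)" by (rule alg_gr_add [OF H1(1) c2(1)])
 have "diff (lext Z k1 (diff ?x)) + lext Z k1 (diff (diff ?x)) = diff ?x + lext Z q1 (diff ?x)"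
  by (rule homotopy_on_chain(3) [OF h1 dx])
 then have 1: "diff (lext Z k1 (diff ?x)) = diff ?x + lext Z q1 (diff ?x)" by (simp add: alg_diff_diff [OF xa(1)])
 have "diff (diff (k1 D) + lext Z k1 (diff ?x)) = diff (?x + q1 D)" using H1(3) by simp
 then have 2: "lext Z q1 (diff ?x) = diff (q1 D)"
  unfolding diff_add 1 by (simp add: alg_diff_diff [OF alg_gr_alg [OF H1(1)]])
 have split: "lext Z (\<lambda>D. k1 D + lext Z k2 (q1 D)) (diff ?x) = lext Z k1 (diff ?x) + lext Z k2 (lext Z q1 (diff ?x))"
 proof -
  have "lext Z k2 (lext Z q1 (diff ?x)) = (\<Sum>E\<in>supp Z (diff ?x). lext Z k2 (q1 E))"
   unfolding lext_def [of Z q1]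
  proof (rule lext_sum)
   fix E assume E: "E \<in> supp Z (diff ?x)"
   have "hdata_of E = d" by (rule supp_gr(1) [OF dx E])
   then show "q1 E \<in> alg Z" using homotopy_onD(2) [OF h1 supp_diagrams [OF E]] alg_gr_alg by blast
  qed
  then show ?thesis unfolding lext_def [of Z k1] lext_def [of Z "\<lambda>D. k1 D + lext Z k2 (q1 D)"] by (simp add: sum.distrib)
 qed
 have "diff (k1 D + lext Z k2 (q1 D)) + lext Z (\<lambda>D. k1 D + lext Z k2 (q1 D)) (diff ?x) =
  (diff (k1 D) + lext Z k1 (diff ?x)) + (diff (lext Z k2 (q1 D)) + lext Z k2 (diff (q1 D)))"
  unfolding split 2 diff_add by (simp only: ac_simps)
 also have "\<dots> = ?x + q1 D + (q1 D + lext Z q2 (q1 D))" using H1(3) c2(3) by simp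
 also have "\<dots> = ?x + lext Z q2 (q1 D)" by (simp add: add.assoc chain_cancel)
 finally show "diff (k1 D + lext Z k2 (q1 D)) + lext Z (\<lambda>D. k1 D + lext Z k2 (q1 D)) (diff ?x) = ?x + lext Z q2 (q1 D)" .
qed

context arc
begin

text \<open>A diagram in the summand shows that multiplicities are not negative, so non-viability
  yields a doubly covered step. An empty summand leaves nothing to contract.\<close>

lemma nonviable_homotopy:
 assumes "\<not> viable_class Z h"
 shows "\<exists>k. homotopy_on Z (h, s, t) k (\<lambda>D. 0)"
proof (cases "\<exists>D\<in>diagrams Z. hdata_of D = (h, s, t)")
 case True
 then obtain phi where phi: "valid Z phi" "hgr phi = h" unfolding diagrams_eq by (auto simp: hdata_diagram_of)
 obtain \<sigma> where \<sigma>: "first_double h \<sigma>" using first_double_exists [OF phi(1)] phi(2) assms by blast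
 let ?k = "\<lambda>D. lin (swap_op \<sigma>) (chain_of Z D)"
 have le: "lext Z ?k x = lin (swap_op \<sigma>) x" if "x \<in> alg Z" for x
 proof -
  have e: "x = (\<Sum>D\<in>supp Z x. chain_of Z D)" by (rule alg_expand [OF that])
  have "lin (swap_op \<sigma>) x = lin (swap_op \<sigma>) (\<Sum>D\<in>supp Z x. chain_of Z D)" by (rule arg_cong [OF e])
  then show ?thesis unfolding lext_def by (simp add: lin_sum)
 qed
 have "homotopy_on Z (h, s, t) ?k (\<lambda>D. 0)"
  unfolding homotopy_on_def
 proof (intro ballI impI conjI)
  fix D assume D: "D \<in> diagrams Z" "hdata_of D = (h, s, t)"
  have x: "chain_of Z D \<in> alg_gr Z (h, s, t) (maslov Z D)" using chain_of_gr [OF D(1)] D(2) by simp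
  show "?k D \<in> alg_gr Z (h, s, t) (maslov Z D + 1)" by (rule swap_op_graded [OF x \<sigma>])
  show "diff (?k D) + lext Z ?k (diff (chain_of Z D)) = chain_of Z D + 0"
   using swap_chain_homotopy [OF x \<sigma>] by (simp add: le diff_alg D(1))
 qed simp
 then show ?thesis by blast
next
 case False
 then show ?thesis unfolding homotopy_on_def by blast
qed

section \<open>The differential and the joining homotopy on viable summands\<close>

lemma finite_crossed: "finite {p. crossed_place Z D p \<and> R p}"
 by (rule finite_subset [OF _ finite_places]) (auto simp: crossed_place_def)

lemma swap_back: "c \<in> X ==> d \<in> X ==> c' \<notin> X ==> d' \<notin> X ==> (X - {c, d} \<union> {c', d'}) - {c', d'} \<union> {c, d} = X"
 by blast

lemma crossing_decompose:
 assumes D: "D \<in> diagrams Z" and vi: "viable_class Z (hgrade D)"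
  and i: "i \<in> Sigma {phi. valid Z phi \<and> diagram_of Z phi = D} crossings"
 obtains phi a x p where "i = (phi, ((a, x), (p, p)))" "valid Z phi" "diagram_of Z phi = D" "viable_class Z (hgr phi)"
  "(a, x) \<in> core phi" "(p, p) \<in> phi" "point_less a p" "point_less p x"
proof -
 obtain phi c where i': "i = (phi, c)" "valid Z phi" "diagram_of Z phi = D" "c \<in> crossings phi" using i by blast
 have v: "viable_class Z (hgr phi)" using vi hgrade_diagram_of [OF i'(2)] i'(3) by simp
 obtain a x p where "c = ((a, x), (p, p))" "(a, x) \<in> core phi" "(p, p) \<in> phi" "point_less a p" "point_less p x"
  by (rule crossings_viable [OF i'(2) v i'(4)])
 then show thesis using that [of phi a x p] i' v by simp
qed

text \<open>Recording the place of the crossing together with the resolved term is a bijection from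
  the resolutions of terms of D onto pairs of a crossed place p and a term of the diagram broken at
  p; its inverse joins at p.\<close>

lemma diff_viable:
 assumes D: "D \<in> diagrams Z" and vi: "viable_class Z (hgrade D)"
 shows "diff (chain_of Z D) = (\<Sum>p\<in>{p. crossed_place Z D p}. chain_of Z (break_at D p))"
proof -
 let ?K = "\<lambda>E. {phi. valid Z phi \<and> diagram_of Z phi = E}" and ?C = "{p. crossed_place Z D p}"
 let ?I = "Sigma (?K D) uncrossable" and ?J = "Sigma ?C (\<lambda>p. ?K (break_at D p))"
 let ?g = "\<lambda>i. (snd (snd (snd i)), resolve (fst i) (snd i))"
 have dec: thesis if i: "i \<in> ?I" and th: "\<And>phi a x p. i = (phi, ((a, x), (p, p))) ==> valid Z phi ==> diagram_of Z phi = D ==>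
   viable_class Z (hgr phi) ==> (a, x) \<in> core phi ==> (p, p) \<in> phi ==> point_less a p ==> point_less p x ==> thesis" for i thesis
 proof -
  have "i \<in> Sigma (?K D) crossings" using i unfolding uncrossable_def by blast
  then obtain phi a x p where "i = (phi, ((a, x), (p, p)))" "valid Z phi" "diagram_of Z phi = D" "viable_class Z (hgr phi)"
   "(a, x) \<in> core phi" "(p, p) \<in> phi" "point_less a p" "point_less p x" by (rule crossing_decompose [OF D vi])
  then show thesis by (rule th)
 qed
 have inj: "inj_on ?g ?I"
 proof (rule inj_onI)
  fix i j assume ij: "i \<in> ?I" "j \<in> ?I" "?g i = ?g j"
  obtain phi a x p where i: "i = (phi, ((a, x), (p, p)))" "valid Z phi" "diagram_of Z phi = D" "viable_class Z (hgr phi)"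
   "(a, x) \<in> core phi" "(p, p) \<in> phi" "point_less a p" "point_less p x" by (rule dec [OF ij(1)])
  obtain phi' a' x' p' where j: "j = (phi', ((a', x'), (p', p')))" "valid Z phi'" "diagram_of Z phi' = D" "viable_class Z (hgr phi')"
   "(a', x') \<in> core phi'" "(p', p') \<in> phi'" "point_less a' p'" "point_less p' x'" by (rule dec [OF ij(2)])
  have pp: "p' = p" using ij(3) unfolding i(1) j(1) by simp
  have re: "resolve phi ((a, x), (p, p)) = resolve phi' ((a', x'), (p, p))"
   using ij(3) unfolding i(1) j(1) pp by simp
  let ?chi = "resolve phi ((a, x), (p, p))"
  have cr: "((a, x), (p, p)) \<in> crossings phi" using i by (simp add: crossings_def core_def)
  have sd: "strand_diagram Z ?chi" using valid_resolve [OF i(2) cr] by simp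
  have m: "(a, p) \<in> ?chi" "(p, x) \<in> ?chi" by (simp_all add: resolve_def)
  have m': "(a', p) \<in> ?chi" "(p, x') \<in> ?chi" unfolding re by (simp_all add: resolve_def)
  have ax: "a' = a" "x' = x" using strand_diagram_unique [OF sd m(1)] strand_diagram_unique [OF sd m(2)] m' by simp_all
  have b: "psi = resolve psi ((a, x), (p, p)) - {(a, p), (p, x)} \<union> {(a, x), (p, p)}"
   if psi: "valid Z psi" "(a, x) \<in> core psi" "(p, p) \<in> psi" for psi
  proof -
   have n: "(a, p) \<notin> psi" "(p, x) \<notin> psi" using strand_diagram_unique [OF valid_strand_diagram [OF psi(1)] psi(3)] i(7,8) by auto
   have "(a, x) \<in> psi" using psi(2) by (simp add: core_def)
   from swap_back [OF this psi(3) n] show ?thesis by (simp add: resolve_def)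
  qed
  have "phi = phi'" using b [OF i(2,5,6)] b [OF j(2) j(5,6) [unfolded ax pp]] re unfolding ax by simp
  then show "i = j" using i(1) j(1) ax pp by simp
 qed
 have img: "?g ` ?I = ?J"
 proof
  show "?g ` ?I \<subseteq> ?J"
  proof (rule image_subsetI)
   fix i assume "i \<in> ?I"
   then obtain phi a x p where i: "i = (phi, ((a, x), (p, p)))" "valid Z phi" "diagram_of Z phi = D" "viable_class Z (hgr phi)"
    "(a, x) \<in> core phi" "(p, p) \<in> phi" "point_less a p" "point_less p x" by (rule dec)
   have cr: "((a, x), (p, p)) \<in> crossings phi" using i by (simp add: crossings_def core_def)
   show "?g i \<in> ?J"
    using break_resolve [OF i(2,4-8)] valid_resolve [OF i(2) cr] i(3) unfolding i(1) by simp
  qed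
  show "?J \<subseteq> ?g ` ?I"
  proof
   fix j assume "j \<in> ?J"
   then obtain p chi where j: "j = (p, chi)" "crossed_place Z D p" "valid Z chi" "diagram_of Z chi = break_at D p" by blast
   note b = break_at_diagram [OF D vi j(2)]
   have h: "hgrade (break_at D p) = hgrade D" using hgrade_hdata [OF b(2)] by simp
   have viC: "viable_class Z (hgr chi)" using vi hgrade_diagram_of [OF j(3)] j(4) h by simp
   have br: "broken (diagram_of Z chi) p" unfolding j(4) broken_def b(4,5) by blast
   obtain phi a x where phi: "valid Z phi" "viable_class Z (hgr phi)" "(a, x) \<in> core phi" "(p, p) \<in> phi" "point_less a p"
    "point_less p x" "resolve phi ((a, x), (p, p)) = chi" "diagram_of Z phi = join_diagram (diagram_of Z chi) p"
    by (rule join_term [OF j(3) viC br])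
   have vb: "viable_class Z (hgrade (break_at D p))" using vi h by simp
   note jp = join_diagram_props [OF b(1) vb br [unfolded j(4)]]
   have n: "p \<notin> Domain (strands_of D)" "p \<notin> Range (strands_of D)"
    using j(2) pair_of_pairs unfolding crossed_place_def all_horiz_def by blast+
   have "join_diagram (break_at D p) p = D"
   proof (rule viable_diagram_eqI [OF jp(1) D])
    show "viable_class Z (hgrade (join_diagram (break_at D p) p))"
     using hgrade_hdata [OF jp(4)] vb by simp
    show "hdata_of (join_diagram (break_at D p) p) = hdata_of D" using jp(4) b(2) by simp
    show "Domain (strands_of (join_diagram (break_at D p) p)) = Domain (strands_of D)" unfolding jp(6) b(4) using n(1) by blast
    show "Range (strands_of (join_diagram (break_at D p) p)) = Range (strands_of D)" unfolding jp(7) b(5) using n(2) by blast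
   qed
   then have d: "diagram_of Z phi = D" using phi(8) j(4) by simp
   have "(phi, ((a, x), (p, p))) \<in> ?I" using phi(1) d break_resolve(1) [OF phi(1-6)] by blast
   moreover have "?g (phi, ((a, x), (p, p))) = j" using phi(7) j(1) by simp
   ultimately show "j \<in> ?g ` ?I" by (metis (no_types, lifting) image_eqI)
  qed
 qed
 have "diff (chain_of Z D) = (\<Sum>i\<in>?I. single (resolve (fst i) (snd i)) 1)"
  using diff_pairs [OF alg_mchains [OF chain_of_alg [OF D]]] D by simp
 also have "\<dots> = (\<Sum>j\<in>?J. single (snd j) 1)"
  unfolding img [symmetric] sum.reindex [OF inj] by simp
 also have "\<dots> = (\<Sum>p\<in>?C. \<Sum>chi\<in>?K (break_at D p). single chi 1)"
 proof -
  have "finite ?C" using finite_crossed [of D "\<lambda>_. True"] by simp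
  moreover have "\<forall>p\<in>?C. finite (?K (break_at D p))"
  proof
   fix p assume "p \<in> ?C"
   then have "break_at D p \<in> diagrams Z" using break_at_diagram(1) [OF D vi] by blast
   then show "finite (?K (break_at D p))" using keys_chain_of [of "break_at D p" Z] finite_keys [of "chain_of Z (break_at D p)"] by simp
  qed
  ultimately show ?thesis using sum.Sigma [of ?C "\<lambda>p. ?K (break_at D p)" "\<lambda>p chi. single chi (1::bit)"]
   by (simp add: case_prod_unfold)
 qed
 also have "\<dots> = (\<Sum>p\<in>?C. chain_of Z (break_at D p))"
 proof (rule sum.cong [OF refl])
  fix p assume "p \<in> ?C"
  then have "break_at D p \<in> diagrams Z" using break_at_diagram(1) [OF D vi] by blast
  then show "(\<Sum>chi\<in>?K (break_at D p). single chi 1) = chain_of Z (break_at D p)"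
   by (simp add: chain_of_diagram chain_sum_def)
 qed
 finally show ?thesis .
qed

definition join_op :: "point => diagram => chain" where
 "join_op q D = (if broken D q then chain_of Z (join_diagram D q) else 0)"

text \<open>The defect of k = \<open>join_op q\<close> as a contraction, that is 1 + d k + k d. The
  sum has at most one term, a break at the twin of q.\<close>

definition move_break :: "point => diagram => chain" where
 "move_break q D = (if broken D q
  then \<Sum>r\<in>{r. crossed_place Z (join_diagram D q) r \<and> (pair_of Z r = pair_of Z q \<and> r \<noteq> q)}. chain_of Z (break_at (join_diagram D q) r)
  else if crossed_place Z D q then 0 else chain_of Z D)"

lemma broken_not_crossed: "broken D q ==> all_horiz Z D P ==> q \<notin> pair_places Z P"
 unfolding broken_def all_horiz_def by blast

lemma crossed_join:
 assumes D: "D \<in> diagrams Z" and vi: "viable_class Z (hgrade D)" and br: "broken D q"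
 shows "crossed_place Z D r \<longleftrightarrow> crossed_place Z (join_diagram D q) r \<and> pair_of Z r \<noteq> pair_of Z q"
proof -
 note j = join_diagram_props [OF D vi br]
 have "viable_class Z (hgrade (join_diagram D q))" using hgrade_hdata [OF j(4)] vi by simp
 from crossed_place_break [OF j(1) this j(2), of r] show ?thesis unfolding j(3) .
qed

lemma join_break:
 assumes D: "D \<in> diagrams Z" and vi: "viable_class Z (hgrade D)" and br: "broken D q" and c: "crossed_place Z D r"
 shows "join_diagram (break_at D r) q = break_at (join_diagram D q) r"
proof -
 note j = join_diagram_props [OF D vi br]
 have vj: "viable_class Z (hgrade (join_diagram D q))" using hgrade_hdata [OF j(4)] vi by simp
 have cj: "crossed_place Z (join_diagram D q) r" "pair_of Z r \<noteq> pair_of Z q" using c crossed_join [OF D vi br] by blast+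
 note bj = break_at_diagram [OF j(1) vj cj(1)]
 note b = break_at_diagram [OF D vi c]
 have vb: "viable_class Z (hgrade (break_at D r))" using hgrade_hdata [OF b(2)] vi by simp
 have "broken (break_at D r) q" using br unfolding broken_def b(4,5) by blast
 note jb = join_diagram_props [OF b(1) vb this]
 have rq: "r \<noteq> q" using cj(2) by blast
 show ?thesis
 proof (rule viable_diagram_eqI [OF jb(1) bj(1)])
  show "viable_class Z (hgrade (join_diagram (break_at D r) q))" using hgrade_hdata [OF jb(4)] vb by simp
  show "hdata_of (join_diagram (break_at D r) q) = hdata_of (break_at (join_diagram D q) r)" using jb(4) b(2) bj(2) j(4) by simp
  show "Domain (strands_of (join_diagram (break_at D r) q)) = Domain (strands_of (break_at (join_diagram D q) r))"
   unfolding jb(6) b(4) bj(4) j(6) using rq by blast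
  show "Range (strands_of (join_diagram (break_at D r) q)) = Range (strands_of (break_at (join_diagram D q) r))"
   unfolding jb(7) b(5) bj(5) j(7) using rq by blast
 qed
qed

text \<open>If D is broken at q, the joined diagram is crossed at q, possibly at the twin of q, and
  wherever D is. Breaking it at q returns D, at the twin it gives the moved break, and the remaining
  breaks commute with joining and cancel. If D is not broken at q, only the break at q produces
  something to join, and joining returns D.\<close>

lemma join_homotopy:
 assumes vd: "viable_class Z (fst d)"
 shows "homotopy_on Z d (join_op q) (move_break q)"
 unfolding homotopy_on_def
proof (intro ballI impI conjI)
 fix D assume D: "D \<in> diagrams Z" "hdata_of D = d"
 have vi: "viable_class Z (hgrade D)" using vd D(2) by (auto simp: hdata_of_def)
 have grD: "chain_of Z D \<in> alg_gr Z d (maslov Z D)" using chain_of_gr [OF D(1)] D(2) by simp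
 let ?C = "{p. crossed_place Z D p}"
 have fC: "finite ?C" using finite_crossed [of D "\<lambda>_. True"] by simp
 have ext: "lext Z (join_op q) (diff (chain_of Z D)) = (\<Sum>r\<in>?C. join_op q (break_at D r))"
 proof -
  have b: "break_at D r \<in> diagrams Z" if "r \<in> ?C" for r using break_at_diagram(1) [OF D(1) vi] that by blast
  have "lext Z (join_op q) (\<Sum>r\<in>?C. chain_of Z (break_at D r)) = (\<Sum>r\<in>?C. lext Z (join_op q) (chain_of Z (break_at D r)))"
   using b by (intro lext_sum) simp
  also have "\<dots> = (\<Sum>r\<in>?C. join_op q (break_at D r))" by (rule sum.cong [OF refl], rule lext_chain_of, erule b)
  finally show ?thesis unfolding diff_viable [OF D(1) vi] .
 qed
 show "join_op q D \<in> alg_gr Z d (maslov Z D + 1)"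
 proof (cases "broken D q")
  case True
  note j = join_diagram_props [OF D(1) vi True]
  show ?thesis using chain_of_gr [OF j(1)] j(4,5) D(2) True by (simp add: join_op_def)
 qed (simp add: join_op_def)
 show "move_break q D \<in> alg_gr Z d (maslov Z D)"
 proof (cases "broken D q")
  case True
  note j = join_diagram_props [OF D(1) vi True]
  have vj: "viable_class Z (hgrade (join_diagram D q))" using hgrade_hdata [OF j(4)] vi by simp
  have gb: "chain_of Z (break_at (join_diagram D q) r) \<in> alg_gr Z d (maslov Z D)" if "crossed_place Z (join_diagram D q) r" for r
   using chain_of_gr [OF break_at_diagram(1) [OF j(1) vj that]] break_at_diagram(2,3) [OF j(1) vj that] j(4,5) D(2) by simp
  show ?thesis unfolding move_break_def if_P [OF True] by (rule alg_gr_sum, rule gb) blast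
 qed (simp add: move_break_def grD)
 show "diff (join_op q D) + lext Z (join_op q) (diff (chain_of Z D)) = chain_of Z D + move_break q D"
 proof (cases "broken D q")
  case True
  note j = join_diagram_props [OF D(1) vi True]
  have vj: "viable_class Z (hgrade (join_diagram D q))" using hgrade_hdata [OF j(4)] vi by simp
  let ?J = "join_diagram D q"
  let ?R = "{r. crossed_place Z ?J r \<and> (pair_of Z r = pair_of Z q \<and> r \<noteq> q)}"
  have fR: "finite ?R" by (rule finite_crossed)
  have set: "{p. crossed_place Z ?J p} = ?C \<union> insert q ?R"
   using crossed_join [OF D(1) vi True] j(2) by blast
  have q: "q \<notin> ?R" "?C \<inter> insert q ?R = {}" using crossed_join [OF D(1) vi True] by blast+
  let ?b = "\<lambda>r. chain_of Z (break_at ?J r)"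
  have "diff (join_op q D) = sum ?b ?C + (chain_of Z D + move_break q D)"
   using True fC fR q unfolding join_op_def move_break_def
   by (simp add: diff_viable [OF j(1) vj] set sum.union_disjoint j(3))
  moreover have "(\<Sum>r\<in>?C. join_op q (break_at D r)) = sum ?b ?C"
  proof (rule sum.cong [OF refl])
   fix r assume r: "r \<in> ?C"
   then have r: "crossed_place Z D r" by blast
   have "broken (break_at D r) q" using True unfolding broken_def break_at_diagram(4,5) [OF D(1) vi r] by blast
   then show "join_op q (break_at D r) = ?b r" using join_break [OF D(1) vi True r] by (simp add: join_op_def)
  qed
  ultimately show ?thesis unfolding ext by (simp add: ac_simps chain_cancel)
 next
  case False
  have nb: "broken (break_at D r) q \<longleftrightarrow> r = q" if "r \<in> ?C" for r
  proof -
   have "crossed_place Z D r" using that by blast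
   note b = break_at_diagram(4,5) [OF D(1) vi this]
   have "r \<notin> Domain (strands_of D)" "r \<notin> Range (strands_of D)"
    using \<open>crossed_place Z D r\<close> pair_of_pairs unfolding crossed_place_def all_horiz_def by blast+
   then show ?thesis using False unfolding broken_def b by blast
  qed
  have "(\<Sum>r\<in>?C. join_op q (break_at D r)) = (\<Sum>r\<in>?C. if r = q then join_op q (break_at D q) else 0)"
  proof (rule sum.cong [OF refl])
   fix r assume "r \<in> ?C"
   then show "join_op q (break_at D r) = (if r = q then join_op q (break_at D q) else 0)"
    using nb [of r] by (cases "r = q") (simp_all add: join_op_def)
  qed
  also have "\<dots> = (if q \<in> ?C then join_op q (break_at D q) else 0)" using fC by simp
  also have "\<dots> = (if q \<in> ?C then chain_of Z D else 0)"
  proof (cases "q \<in> ?C")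
   case True
   then have c: "crossed_place Z D q" by blast
   note b = break_at_diagram [OF D(1) vi c]
   have vb: "viable_class Z (hgrade (break_at D q))" using hgrade_hdata [OF b(2)] vi by simp
   have br: "broken (break_at D q) q" using nb [OF True] by simp
   note jb = join_diagram_props [OF b(1) vb br]
   have n: "q \<notin> Domain (strands_of D)" "q \<notin> Range (strands_of D)"
    using c pair_of_pairs unfolding crossed_place_def all_horiz_def by blast+
   have "join_diagram (break_at D q) q = D"
   proof (rule viable_diagram_eqI [OF jb(1) D(1)])
    show "viable_class Z (hgrade (join_diagram (break_at D q) q))" using hgrade_hdata [OF jb(4)] vb by simp
    show "hdata_of (join_diagram (break_at D q) q) = hdata_of D" using jb(4) b(2) by simp
    show "Domain (strands_of (join_diagram (break_at D q) q)) = Domain (strands_of D)" unfolding jb(6) b(4) using n(1) by blast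
    show "Range (strands_of (join_diagram (break_at D q) q)) = Range (strands_of D)" unfolding jb(7) b(5) using n(2) by blast
   qed
   then show ?thesis using br True by (simp add: join_op_def)
  qed simp
  finally have s: "(\<Sum>r\<in>?C. join_op q (break_at D r)) = (if q \<in> ?C then chain_of Z D else 0)" .
  have "join_op q D = 0" using False by (simp add: join_op_def)
  then show ?thesis unfolding ext s using False by (simp add: move_break_def chain_double)
 qed
qed

end

section \<open>Occupied pairs and the choice of homotopies\<close>

lemma over_not_end:
 assumes s: "slim (strands_of D)" and o: "over D r"
 shows "r \<notin> Domain (strands_of D)" "r \<notin> Range (strands_of D)"
proof -
 obtain a x where ax: "(a, x) \<in> strands_of D" "point_less a r" "point_less r x" using o unfolding over_def by blast
 have le: "point_le a r" "point_le r r" using ax(2) by (simp_all add: point_le_iff)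
 show "r \<notin> Domain (strands_of D)"
 proof
  assume "r \<in> Domain (strands_of D)"
  then obtain y where "(r, y) \<in> strands_of D" by blast
  then have "a = r" using slim_eq [OF s ax(1) _ le(1) ax(3)] by blast
  then show False using ax(2) by simp
 qed
 show "r \<notin> Range (strands_of D)"
 proof
  assume "r \<in> Range (strands_of D)"
  then obtain b where b: "(b, r) \<in> strands_of D" by blast
  have br: "point_less b r" by (rule slim_less [OF s b])
  have "point_le a b \<or> point_le b a" using br ax(2) by (auto simp: point_le_def point_less_def)
  then have "x = r"
  proof
   assume "point_le a b"
   then show "x = r" using slim_eq [OF s ax(1) b _ points.less_trans [OF br ax(3)]] by blast
  next
   assume "point_le b a"
   then show "x = r" using slim_eq [OF s b ax(1) _ ax(2)] by blast
  qed
  then show False using ax(3) by simp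
 qed
qed

context arc
begin

lemma diagram_strands:
 assumes "D \<in> diagrams Z"
 shows "strand_diagram Z (strands_of D)" "hgrade D = hgr (strands_of D)"
proof -
 obtain phi where phi: "valid Z phi" "D = diagram_of Z phi" using assms unfolding diagrams_eq by blast
 show "strand_diagram Z (strands_of D)" using strand_diagram_core [of Z phi] phi by simp
 show "hgrade D = hgr (strands_of D)" using hgrade_diagram_of [OF phi(1)] hgr_core [of Z phi] phi by simp
qed

lemma covers_iff:
 assumes D: "D \<in> diagrams Z"
 shows "covers (hgrade D) \<sigma> \<longleftrightarrow> (\<exists>a x. (a, x) \<in> strands_of D \<and> fst \<sigma> = fst a \<and> snd a \<le> snd \<sigma> \<and> snd \<sigma> < snd x)"
proof -
 have fin: "finite (strands_of D)" by (rule strand_diagram_finite [OF diagram_strands(1) [OF D]])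
 then have "finite (covering (strands_of D) \<sigma>)" by (simp add: covering_def)
 then have "covers (hgrade D) \<sigma> \<longleftrightarrow> covering (strands_of D) \<sigma> \<noteq> {}"
  unfolding covers_def diagram_strands(2) [OF D] lookup_hgr_card [OF fin] by simp
 also have "\<dots> \<longleftrightarrow> (\<exists>c\<in>strands_of D. fst \<sigma> = fst (fst c) \<and> snd (fst c) \<le> snd \<sigma> \<and> snd \<sigma> < snd (snd c))"
  unfolding covering_def by blast
 finally show ?thesis by (metis fst_conv snd_conv surj_pair)
qed

lemma covers_step:
 assumes D: "D \<in> diagrams Z" and r: "r \<in> places Z"
 shows "covers (hgrade D) (step_before r) \<longleftrightarrow> (\<exists>a x. (a, x) \<in> strands_of D \<and> point_less a r \<and> point_le r x)"
  "covers (hgrade D) (step_after r) \<longleftrightarrow> (\<exists>a x. (a, x) \<in> strands_of D \<and> point_le a r \<and> point_less r x)"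
proof -
 have f: "fst a = fst x" if "(a, x) \<in> strands_of D" for a x
  using strand_diagramD(3) [OF diagram_strands(1) [OF D] that] by (simp add: point_le_def)
 have r0: "snd r \<noteq> 0" using r by (cases r) (simp add: places_def)
 have "(fst r = fst a \<and> snd a \<le> snd r - 1 \<and> snd r - 1 < snd x) \<longleftrightarrow> point_less a r \<and> point_le r x" if "(a, x) \<in> strands_of D" for a x
  using f [OF that] r0 unfolding point_less_def point_le_def by linarith
 then show "covers (hgrade D) (step_before r) \<longleftrightarrow> (\<exists>a x. (a, x) \<in> strands_of D \<and> point_less a r \<and> point_le r x)"
  unfolding covers_iff [OF D] step_before_def fst_conv snd_conv by blast
 have "(fst r = fst a \<and> snd a \<le> snd r \<and> snd r < snd x) \<longleftrightarrow> point_le a r \<and> point_less r x" if "(a, x) \<in> strands_of D" for a x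
  using f [OF that] unfolding point_less_def point_le_def by linarith
 then show "covers (hgrade D) (step_after r) \<longleftrightarrow> (\<exists>a x. (a, x) \<in> strands_of D \<and> point_le a r \<and> point_less r x)"
  unfolding covers_iff [OF D] step_after_def by blast
qed

definition passed :: "hclass => point => bool" where
 "passed h r \<longleftrightarrow> covers h (step_before r) \<and> covers h (step_after r)"

text \<open>The strands on the two steps at r either meet at r, or one of them runs past r.\<close>

lemma passed_cases:
 assumes D: "D \<in> diagrams Z" and r: "r \<in> places Z" and p: "passed (hgrade D) r"
 shows "broken D r \<or> over D r"
proof -
 obtain a x where a: "(a, x) \<in> strands_of D" "point_less a r" "point_le r x"
  using p covers_step(1) [OF D r] unfolding passed_def by blast
 obtain b y where b: "(b, y) \<in> strands_of D" "point_le b r" "point_less r y"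
  using p covers_step(2) [OF D r] unfolding passed_def by blast
 show ?thesis
 proof (cases "x = r \<and> b = r")
  case True
  then show ?thesis using a(1) b(1) unfolding broken_def by blast
 next
  case False
  then show ?thesis using a b unfolding over_def point_le_iff by blast
 qed
qed

lemma over_passed: "D \<in> diagrams Z ==> r \<in> places Z ==> over D r ==> passed (hgrade D) r"
 unfolding over_def passed_def using covers_step point_le_iff by metis

lemma not_end_covers:
 assumes D: "D \<in> diagrams Z" and r: "r \<in> places Z" "r \<notin> Domain (strands_of D)" "r \<notin> Range (strands_of D)"
  and c: "covers (hgrade D) (step_before r) \<or> covers (hgrade D) (step_after r)"
 shows "over D r"
proof -
 have "\<exists>a x. (a, x) \<in> strands_of D \<and> (point_less a r \<and> point_le r x \<or> point_le a r \<and> point_less r x)"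
  using c covers_step [OF D r(1)] by blast
 then show ?thesis using r(2,3) unfolding over_def point_le_iff by blast
qed

lemma end_covers:
 assumes D: "D \<in> diagrams Z" "viable_class Z (hgrade D)" and r: "r \<in> places Z"
 shows "r \<in> Domain (strands_of D) ==> covers (hgrade D) (step_after r)"
  "r \<in> Range (strands_of D) ==> covers (hgrade D) (step_before r)"
 using slim_less [OF diagram_slim [OF D]] covers_step [OF D(1) r] unfolding point_le_iff by blast+

lemma end_pair:
 assumes D: "D \<in> diagrams Z" and r: "r \<in> places Z"
 shows "r \<in> Domain (strands_of D) ==> pair_of Z r \<in> source D"
  "r \<in> Range (strands_of D) ==> pair_of Z r \<in> target D"
  "r \<in> Domain (strands_of D) ==> r' \<in> Domain (strands_of D) ==> r' \<in> pair_places Z (pair_of Z r) ==> r' = r"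
  "r \<in> Range (strands_of D) ==> r' \<in> Range (strands_of D) ==> r' \<in> pair_places Z (pair_of Z r) ==> r' = r"
proof -
 obtain phi where phi: "valid Z phi" "D = diagram_of Z phi" using D unfolding diagrams_eq by blast
 let ?P = "pair_of Z r"
 have P: "?P \<in> pairs Z" "r \<in> pair_places Z ?P" using pair_of_pairs [OF r] by auto
 have fin: "finite (Domain phi \<inter> pair_places Z ?P)" "finite (Range phi \<inter> pair_places Z ?P)"
  using strand_diagram_finite [OF valid_strand_diagram [OF phi(1)]] by (simp_all add: finite_Domain finite_Range)
 have le: "card (Domain phi \<inter> pair_places Z ?P) \<le> 1" "card (Range phi \<inter> pair_places Z ?P) \<le> 1"
  using phi(1) P(1) unfolding valid_def by blast+
 have sub: "Domain (strands_of D) \<subseteq> Domain phi" "Range (strands_of D) \<subseteq> Range phi" unfolding phi(2) diagram_of_simps core_def by blast+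
 have d: "Domain phi \<inter> pair_places Z ?P = {r}" if "r \<in> Domain (strands_of D)"
  by (rule card_le_1_eq [OF fin(1) le(1)]) (use that sub(1) P(2) in blast)
 have e: "Range phi \<inter> pair_places Z ?P = {r}" if "r \<in> Range (strands_of D)"
  by (rule card_le_1_eq [OF fin(2) le(2)]) (use that sub(2) P(2) in blast)
 show "r \<in> Domain (strands_of D) ==> pair_of Z r \<in> source D" using d P(1) unfolding phi(2) diagram_of_simps occ_def by simp
 show "r \<in> Range (strands_of D) ==> pair_of Z r \<in> target D" using e P(1) unfolding phi(2) diagram_of_simps occ_def by simp
 show "r \<in> Domain (strands_of D) ==> r' \<in> Domain (strands_of D) ==> r' \<in> pair_places Z (pair_of Z r) ==> r' = r"
  using d sub(1) by (metis IntI singletonD subsetD)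
 show "r \<in> Range (strands_of D) ==> r' \<in> Range (strands_of D) ==> r' \<in> pair_places Z (pair_of Z r) ==> r' = r"
  using e sub(2) by (metis IntI singletonD subsetD)
qed

lemma broken_place:
 assumes D: "D \<in> diagrams Z" "viable_class Z (hgrade D)" and b: "broken D r"
 shows "r \<in> places Z" "pair_of Z r \<in> source D \<inter> target D" "passed (hgrade D) r" "r' \<in> pair_places Z (pair_of Z r) ==> broken D r' ==> r' = r"
proof -
 note sd = diagram_strands(1) [OF D(1)]
 obtain a x where ax: "(a, r) \<in> strands_of D" "(r, x) \<in> strands_of D" using b unfolding broken_def by blast
 have l: "point_less a r" "point_less r x" using slim_less [OF diagram_slim [OF D]] ax by blast+
 show r: "r \<in> places Z" using between_place [OF _ _ l] strand_diagramD [OF sd ax(1)] strand_diagramD [OF sd ax(2)] by blast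
 have e: "r \<in> Domain (strands_of D)" "r \<in> Range (strands_of D)" using b unfolding broken_def by blast+
 show "pair_of Z r \<in> source D \<inter> target D" using end_pair(1,2) [OF D(1) r] e by blast
 show "passed (hgrade D) r" using end_covers [OF D r] e unfolding passed_def by blast
 show "r' \<in> pair_places Z (pair_of Z r) ==> broken D r' ==> r' = r"
  using end_pair(3) [OF D(1) r e(1)] unfolding broken_def by blast
qed

lemma crossing_at_iff:
 assumes D: "D \<in> diagrams Z" "viable_class Z (hgrade D)"
 shows "crossing_at Z D P \<longleftrightarrow> (\<exists>r\<in>pair_places Z P. crossed_place Z D r)" "has_crossing Z D \<longleftrightarrow> (\<exists>r. crossed_place Z D r)"
proof -
 have t: "terms_of Z D = {phi. valid Z phi \<and> diagram_of Z phi = D}" unfolding terms_of_def by (rule keys_chain_of [OF D(1)])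
 have f: "\<exists>p. crossed_place Z D p \<and> (\<forall>q. fst c = (q, q) \<or> snd c = (q, q) --> q = p)" if c: "\<nu> \<in> terms_of Z D" "c \<in> crossings \<nu>" for \<nu> c
 proof -
  have "(\<nu>, c) \<in> Sigma {phi. valid Z phi \<and> diagram_of Z phi = D} crossings" using c unfolding t by blast
  then obtain phi a x p where phi: "(\<nu>, c) = (phi, ((a, x), (p, p)))" "valid Z phi" "diagram_of Z phi = D" "viable_class Z (hgr phi)"
   "(a, x) \<in> core phi" "(p, p) \<in> phi" "point_less a p" "point_less p x" by (rule crossing_decompose [OF D])
  have "crossed_place Z D p" using break_resolve(3) [OF phi(2,4-8)] phi(3) by simp
  moreover have "q = p" if "fst c = (q, q) \<or> snd c = (q, q)" for q using phi(1,5) that by (auto simp: core_def)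
  ultimately show ?thesis by blast
 qed
 have g: "\<exists>\<nu>\<in>terms_of Z D. \<exists>a. (a, (r, r)) \<in> crossings \<nu>" if c: "crossed_place Z D r" for r
 proof -
  obtain phi a x where phi: "valid Z phi" "diagram_of Z phi = D" "viable_class Z (hgr phi)" "(a, x) \<in> core phi" "(r, r) \<in> phi"
   "point_less a r" "point_less r x" by (rule break_term [OF D c])
  have "((a, x), (r, r)) \<in> crossings phi" using phi by (simp add: crossings_def core_def)
  moreover have "phi \<in> terms_of Z D" unfolding t using phi(1,2) by blast
  ultimately show ?thesis by blast
 qed
 show "crossing_at Z D P \<longleftrightarrow> (\<exists>r\<in>pair_places Z P. crossed_place Z D r)"
 proof
  assume "crossing_at Z D P"
  then obtain \<nu> c p where c: "\<nu> \<in> terms_of Z D" "c \<in> crossings \<nu>" "p \<in> pair_places Z P" "fst c = (p, p) \<or> snd c = (p, p)"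
   unfolding crossing_at_def by fastforce
  then show "\<exists>r\<in>pair_places Z P. crossed_place Z D r" using f [OF c(1,2)] by blast
 next
  assume "\<exists>r\<in>pair_places Z P. crossed_place Z D r"
  then obtain r where r: "r \<in> pair_places Z P" "crossed_place Z D r" by blast
  then obtain \<nu> a where "\<nu> \<in> terms_of Z D" "(a, (r, r)) \<in> crossings \<nu>" using g by blast
  then show "crossing_at Z D P" unfolding crossing_at_def using r(1) by blast
 qed
 show "has_crossing Z D \<longleftrightarrow> (\<exists>r. crossed_place Z D r)"
  unfolding has_crossing_def using f g by blast
qed

text \<open>Only q is covered in this pair, so no moving strand has an end at the twin. If a strand
  runs past q, none has an end at q either, hence the pair is dotted and q is crossed.\<close>

lemma once_occupied_cases:
 assumes D: "D \<in> diagrams Z" "viable_class Z (hgrade D)" and P: "P \<in> source D \<inter> target D" and o: "once_occupied_at Z (hgrade D) P q"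
 shows "broken D q \<or> crossed_place Z D q" "crossed_place Z D r ==> r \<in> pair_places Z P ==> r = q"
proof -
 have q: "q \<in> places Z" "pair_of Z q = P" "passed (hgrade D) q" using o by (auto simp: once_occupied_at_def pair_places_iff passed_def)
 have n: "\<not> covers (hgrade D) (step_before r)" "\<not> covers (hgrade D) (step_after r)" if "r \<in> pair_places Z P" "r \<noteq> q" for r
  using o that unfolding once_occupied_at_def by blast+
 have "crossed_place Z D q" if ov: "over D q"
 proof -
  have "r \<notin> Domain (strands_of D) \<and> r \<notin> Range (strands_of D)" if r: "r \<in> pair_places Z P" for r
  proof (cases "r = q")
   case True
   then show ?thesis using over_not_end [OF diagram_slim [OF D] ov] by simp
  next
   case False
   have "r \<in> places Z" using r by (simp add: pair_places_iff)
   then show ?thesis using end_covers [OF D] n [OF r False] by blast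
  qed
  then show ?thesis unfolding crossed_place_def all_horiz_def q(2) using P q(1) ov by blast
 qed
 then show "broken D q \<or> crossed_place Z D q" using passed_cases [OF D(1) q(1,3)] by blast
 assume r: "crossed_place Z D r" "r \<in> pair_places Z P"
 have "passed (hgrade D) r" using over_passed [OF D(1)] r(1) unfolding crossed_place_def by blast
 then show "r = q" using n [OF r(2)] unfolding passed_def by blast
qed

lemma viable_hdata: "hdata_of D = d ==> viable_class Z (fst d) ==> viable_class Z (hgrade D)"
 by (auto simp: hdata_of_def)

text \<open>A break at q has nowhere to move, because no strand runs past the twin of q.\<close>

lemma once_homotopy:
 assumes vi: "viable_class Z h" and P: "P \<in> s \<inter> t" and o: "once_occupied_at Z h P q"
 shows "homotopy_on Z (h, s, t) (join_op q) (\<lambda>D. 0)"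
proof -
 have "move_break q D = 0" if D: "D \<in> diagrams Z" "hdata_of D = (h, s, t)" for D
 proof -
  have d: "hgrade D = h" "source D = s" "target D = t" using D(2) by (simp_all add: hdata_of_def)
  have v: "viable_class Z (hgrade D)" using vi d by simp
  have P': "P \<in> source D \<inter> target D" using P d by simp
  have o': "once_occupied_at Z (hgrade D) P q" using o d by simp
  have q: "pair_of Z q = P" using o by (auto simp: once_occupied_at_def pair_places_iff)
  show ?thesis
  proof (cases "broken D q")
   case True
   note j = join_diagram_props [OF D(1) v True]
   have e: "hgrade (join_diagram D q) = hgrade D" "source (join_diagram D q) = source D" "target (join_diagram D q) = target D"
    using hgrade_hdata [OF j(4)] by auto
   have "r = q" if "crossed_place Z (join_diagram D q) r" "pair_of Z r = pair_of Z q" for r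
   proof (rule once_occupied_cases(2) [OF j(1) _ _ _ that(1)])
    show "viable_class Z (hgrade (join_diagram D q))" "P \<in> source (join_diagram D q) \<inter> target (join_diagram D q)"
     "once_occupied_at Z (hgrade (join_diagram D q)) P q" using v P' o' e by simp_all
    show "r \<in> pair_places Z P" using that q by (simp add: crossed_place_def pair_places_iff)
   qed
   then have none: "{r. crossed_place Z (join_diagram D q) r \<and> pair_of Z r = pair_of Z q \<and> r \<noteq> q} = {}" by blast
   show ?thesis unfolding move_break_def if_P [OF True] none by simp
  next
   case False
   then have "crossed_place Z D q" using once_occupied_cases(1) [OF D(1) v P' o'] by blast
   then show ?thesis using False by (simp add: move_break_def)
  qed
 qed
 then show ?thesis using join_homotopy [of "(h, s, t)" q] vi unfolding homotopy_on_def by simp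
qed

definition no_once :: "hdata => bool" where
 "no_once d \<longleftrightarrow> (\<forall>P\<in>fst (snd d) \<inter> snd (snd d). \<forall>q. \<not> once_occupied_at Z (fst d) P q)"

text \<open>Between once and doubly occupied lies only the case of a twin with one covered step.
  There a moving strand would begin or end, which \<open>e\<close> excludes.\<close>

lemma doubly_occupied_if:
 assumes D: "D \<in> diagrams Z" and n: "no_once (hdata_of D)" and r: "r \<in> places Z" "pair_of Z r \<in> source D \<inter> target D" "passed (hgrade D) r"
  and e: "\<And>r'. r' \<in> pair_places Z (pair_of Z r) ==> r' \<noteq> r ==> r' \<notin> Domain (strands_of D) \<and> r' \<notin> Range (strands_of D)"
 shows "doubly_occupied Z (hgrade D) (pair_of Z r)"
proof -
 let ?P = "pair_of Z r"
 have P: "?P \<in> pairs Z" "r \<in> pair_places Z ?P" using pair_of_pairs [OF r(1)] by auto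
 have "\<forall>P\<in>source D \<inter> target D. \<forall>q. \<not> once_occupied_at Z (hgrade D) P q"
  using n unfolding no_once_def hdata_of_def fst_conv snd_conv .
 then have "\<not> once_occupied_at Z (hgrade D) ?P r" using r(2) by blast
 then obtain q where q: "q \<in> pair_places Z ?P" "q \<noteq> r" "covers (hgrade D) (step_before q) \<or> covers (hgrade D) (step_after q)"
  using P(2) r(3) unfolding once_occupied_at_def passed_def by blast
 have qp: "q \<in> places Z" using q(1) by (simp add: pair_places_iff)
 have "over D q" by (rule not_end_covers [OF D qp _ _ q(3)]) (use e [OF q(1,2)] in blast)+
 then have "passed (hgrade D) q" by (rule over_passed [OF D qp])
 moreover have "pair_places Z ?P = {r, q}"
 proof -
  have c: "card (pair_places Z ?P) = 2" using Z P(1) by (simp add: arc_diagram_def)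
  then have "finite (pair_places Z ?P)" by (metis card.infinite zero_neq_numeral)
  moreover have "{r, q} \<subseteq> pair_places Z ?P" "card {r, q} = 2" using P(2) q(1,2) by auto
  ultimately show ?thesis using c card_subset_eq by metis
 qed
 ultimately show ?thesis using P(1) r(3) unfolding doubly_occupied_def passed_def by simp
qed

lemma crossed_doubly_occupied:
 assumes D: "D \<in> diagrams Z" "no_once (hdata_of D)" and c: "crossed_place Z D r"
 shows "doubly_occupied Z (hgrade D) (pair_of Z r)"
proof (rule doubly_occupied_if [OF D])
 show r: "r \<in> places Z" using c by (simp add: crossed_place_def)
 show "pair_of Z r \<in> source D \<inter> target D" using c by (simp add: crossed_place_def all_horiz_def)
 show "passed (hgrade D) r" using over_passed [OF D(1) r] c by (simp add: crossed_place_def)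
 show "r' \<notin> Domain (strands_of D) \<and> r' \<notin> Range (strands_of D)" if "r' \<in> pair_places Z (pair_of Z r)" "r' \<noteq> r" for r'
  using c that(1) by (simp add: crossed_place_def all_horiz_def)
qed

text \<open>A break at q moves to p, and a crossing at q gives zero. Otherwise a strand runs past q
  and the pair is not dotted, so some strand has an end at p, and since both steps at p are covered,
  D is broken at p. No new crossings arise, which later protects uncrossed diagrams from being sent
  to zero.\<close>

lemma double_move:
 assumes D: "D \<in> diagrams Z" "hdata_of D = d" "viable_class Z (hgrade D)" and P: "P \<in> source D \<inter> target D" "doubly_occupied Z (hgrade D) P"
  and pq: "pair_places Z P = {p, q}" "p \<noteq> q"
 shows "move_break q D = 0 \<and> crossed_place Z D q \<or>
  (\<exists>E\<in>diagrams Z. move_break q D = chain_of Z E \<and> hdata_of E = d \<and> broken E p \<and>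
   (\<forall>r. pair_of Z r \<noteq> P --> broken E r = broken D r) \<and> (\<forall>r. crossed_place Z E r --> crossed_place Z D r))"
  and "broken D p ==> move_break q D = chain_of Z D"
proof -
 have pl: "p \<in> places Z" "pair_of Z p = P" "q \<in> places Z" "pair_of Z q = P"
  using pq(1) pair_places_iff [of p P] pair_places_iff [of q P] by auto
 have ps: "passed (hgrade D) p" "passed (hgrade D) q" using P(2) pq(1) unfolding doubly_occupied_def passed_def by auto
 show "move_break q D = 0 \<and> crossed_place Z D q \<or>
  (\<exists>E\<in>diagrams Z. move_break q D = chain_of Z E \<and> hdata_of E = d \<and> broken E p \<and>
   (\<forall>r. pair_of Z r \<noteq> P --> broken E r = broken D r) \<and> (\<forall>r. crossed_place Z E r --> crossed_place Z D r))"
 proof (cases "broken D q")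
  case True
  let ?J = "join_diagram D q"
  note j = join_diagram_props [OF D(1,3) True]
  have e: "hgrade ?J = hgrade D" using hgrade_hdata [OF j(4)] by simp
  have vj: "viable_class Z (hgrade ?J)" using e D(3) by simp
  have ah: "all_horiz Z ?J P" using j(2) pl(4) by (simp add: crossed_place_def)
  have "\<not> broken ?J p" using broken_not_crossed [OF _ ah] pq(1) by blast
  then have "over ?J p" using passed_cases [OF j(1) pl(1)] ps(1) e by simp
  then have cp: "crossed_place Z ?J p" using ah pl by (simp add: crossed_place_def)
  have only: "r = p" if "crossed_place Z ?J r" "pair_of Z r = pair_of Z q" "r \<noteq> q" for r
  proof -
   have "r \<in> pair_places Z P" using that pl(4) by (simp add: pair_places_iff crossed_place_def)
   then show ?thesis using pq(1) that(3) by simp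
  qed
  have pq': "pair_of Z p = pair_of Z q" using pl by simp
  have one: "{r. crossed_place Z ?J r \<and> pair_of Z r = pair_of Z q \<and> r \<noteq> q} = {p}"
   by (rule Set.set_eqI, unfold mem_Collect_eq singleton_iff) (metis only cp pq' pq(2))
  have m: "move_break q D = chain_of Z (break_at ?J p)" unfolding move_break_def if_P [OF True] one by simp
  note b = break_at_diagram [OF j(1) vj cp]
  have "broken (break_at ?J p) r = broken D r" if "pair_of Z r \<noteq> P" for r
  proof -
   have "r \<noteq> p" "r \<noteq> q" using that pl by blast+
   then show ?thesis unfolding broken_def b(4,5) j(6,7) by blast
  qed
  moreover have "broken (break_at ?J p) p" unfolding broken_def b(4,5) by blast
  moreover have "crossed_place Z D r" if "crossed_place Z (break_at ?J p) r" for r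
   using that crossed_place_break [OF j(1) vj cp] crossed_join [OF D(1,3) True] pl by simp
  moreover have "hdata_of (break_at ?J p) = d" using b(2) j(4) D(2) by simp
  ultimately show ?thesis using m b(1) by blast
 next
  case F: False
  show ?thesis
  proof (cases "crossed_place Z D q")
   case True
   then show ?thesis using F by (simp add: move_break_def)
  next
   case False
   have oq: "over D q" using passed_cases [OF D(1) pl(3) ps(2)] F by blast
   have nq: "q \<notin> Domain (strands_of D)" "q \<notin> Range (strands_of D)" using over_not_end [OF diagram_slim [OF D(1,3)] oq] by blast+
   have "\<not> all_horiz Z D P" using False oq pl by (simp add: crossed_place_def)
   then have "p \<in> Domain (strands_of D) \<or> p \<in> Range (strands_of D)" using P(1) nq pq(1) unfolding all_horiz_def by auto
   then have "\<not> over D p" using over_not_end [OF diagram_slim [OF D(1,3)]] by blast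
   then have "broken D p" using passed_cases [OF D(1) pl(1) ps(1)] by blast
   moreover have "move_break q D = chain_of Z D" using F False by (simp add: move_break_def)
   ultimately show ?thesis using D(1,2) by blast
  qed
 qed
 assume bp: "broken D p"
 have "\<not> broken D q" using broken_place(4) [OF D(1,3) bp, of q] pl(2) pq by auto
 moreover have "\<not> crossed_place Z D q" using broken_not_crossed [OF bp, of P] pl(4) pq(1) unfolding crossed_place_def by auto
 ultimately show "move_break q D = chain_of Z D" by (simp add: move_break_def)
qed

end

section \<open>Moving all breaks to the smaller places\<close>

definition good :: "arc_data => pair_order => hdata => diagram => bool" where
 "good Z ord d E \<longleftrightarrow> E \<in> diagrams Z \<and> hdata_of E = d \<and>
  (\<forall>P\<in>source E \<inter> target E. doubly_occupied Z (hgrade E) P --> (\<forall>p. smaller_place Z ord P p --> broken E p))"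

locale ordered_arc = arc +
 fixes ord :: pair_order
 assumes ord: "pair_ordering Z ord"
begin

lemma smaller_place_pair:
 assumes P: "P \<in> pairs Z"
 obtains p q where "pair_places Z P = {p, q}" "p \<noteq> q" "\<And>r. smaller_place Z ord P r \<longleftrightarrow> r = p"
proof -
 let ?R = "place_le ord P"
 have lo: "linear_order_on (pair_places Z P) ?R" using ord P by (simp add: pair_ordering_def)
 then have refl: "\<And>x. x \<in> pair_places Z P ==> (x, x) \<in> ?R" and anti: "antisym ?R" and tot: "total_on (pair_places Z P) ?R"
  by (auto simp: linear_order_on_def partial_order_on_def preorder_on_def refl_on_def)
 have "card (pair_places Z P) = 2" using Z P by (simp add: arc_diagram_def)
 then obtain x y where xy: "pair_places Z P = {x, y}" "x \<noteq> y" by (metis card_2_iff)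
 note th = that
 have g: thesis if pq: "pair_places Z P = {p, q}" "p \<noteq> q" "(p, q) \<in> ?R" for p q
 proof (rule th [OF pq(1,2)])
  have n: "(q, p) \<notin> ?R" using anti pq(2,3) by (metis antisymD)
  have r: "(p, p) \<in> ?R" by (rule refl) (simp add: pq(1))
  show "smaller_place Z ord P r \<longleftrightarrow> r = p" for r
   unfolding smaller_place_def pq(1) using n r pq(2,3) by (cases "r = p") auto
 qed
 have "(x, y) \<in> ?R \<or> (y, x) \<in> ?R" using tot xy by (auto simp: total_on_def)
 then show thesis using g [of x y] g [of y x] xy by (metis insert_commute)
qed

text \<open>The clauses on crossings carry through the iteration that an uncrossed diagram is never
  sent to zero; this is how nonzero homology classes are detected. The last clause makes the final
  projection the identity on the selected diagrams.\<close>

definition collects :: "nat set => hdata => (diagram => chain) => bool" where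
 "collects Q d \<pi> \<longleftrightarrow> (\<forall>D\<in>diagrams Z. hdata_of D = d -->
  (\<pi> D = 0 \<and> (\<exists>r. crossed_place Z D r) \<or>
   (\<exists>E\<in>diagrams Z. \<pi> D = chain_of Z E \<and> hdata_of E = d \<and>
    (\<forall>P\<in>Q. \<forall>p. smaller_place Z ord P p --> broken E p) \<and> ((\<exists>r. crossed_place Z E r) --> (\<exists>r. crossed_place Z D r)))) \<and>
  ((\<forall>P\<in>Q. \<forall>p. smaller_place Z ord P p --> broken D p) --> \<pi> D = chain_of Z D))"

lemma collectsD:
 assumes "collects Q d \<pi>" "D \<in> diagrams Z" "hdata_of D = d"
 shows "\<pi> D = 0 \<and> (\<exists>r. crossed_place Z D r) \<or>
   (\<exists>E\<in>diagrams Z. \<pi> D = chain_of Z E \<and> hdata_of E = d \<and>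
    (\<forall>P\<in>Q. \<forall>p. smaller_place Z ord P p --> broken E p) \<and> ((\<exists>r. crossed_place Z E r) --> (\<exists>r. crossed_place Z D r)))"
  "(\<forall>P\<in>Q. \<forall>p. smaller_place Z ord P p --> broken D p) ==> \<pi> D = chain_of Z D"
 using assms unfolding collects_def by simp_all

text \<open>One pair is treated at a time by \<open>double_move\<close>; moving its break leaves the
  breaks of the other pairs in place, so the pairs already treated stay collected.\<close>

lemma iterated_move:
 assumes vi: "viable_class Z h" and fin: "finite Q" and Q: "Q \<subseteq> {P \<in> s \<inter> t. doubly_occupied Z h P}"
 shows "\<exists>k \<pi>. homotopy_on Z (h, s, t) k \<pi> \<and> collects Q (h, s, t) \<pi>"
 using fin Q
proof (induction Q)
 case empty
 have "homotopy_on Z (h, s, t) (\<lambda>D. 0) (chain_of Z)"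
  unfolding homotopy_on_def
 proof (intro ballI impI conjI)
  fix D assume D: "D \<in> diagrams Z" "hdata_of D = (h, s, t)"
  show "chain_of Z D \<in> alg_gr Z (h, s, t) (maslov Z D)" using chain_of_gr [OF D(1)] D(2) by simp
 qed (simp_all add: lext_def)
 moreover have "collects {} (h, s, t) (chain_of Z)" unfolding collects_def by blast
 ultimately show ?case by blast
next
 case (insert P Q)
 let ?d = "(h, s, t)"
 have sub: "Q \<subseteq> {P \<in> s \<inter> t. doubly_occupied Z h P}" using insert.prems by blast
 obtain k1 \<pi>1 where IH: "homotopy_on Z ?d k1 \<pi>1" and c1: "collects Q ?d \<pi>1" using insert.IH [OF sub] by blast
 have P: "P \<in> s \<inter> t" "doubly_occupied Z h P" "P \<in> pairs Z" using insert.prems by (auto simp: doubly_occupied_def)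
 obtain p q where pq: "pair_places Z P = {p, q}" "p \<noteq> q" "\<And>r. smaller_place Z ord P r \<longleftrightarrow> r = p"
  by (rule smaller_place_pair [OF P(3)]) blast
 have H2: "homotopy_on Z ?d (join_op q) (move_break q)" by (rule join_homotopy) (simp add: vi)
 have dd: "hgrade D = h" "source D = s" "target D = t" if "hdata_of D = ?d" for D using that by (simp_all add: hdata_of_def)
 have V: "viable_class Z (hgrade D)" "P \<in> source D \<inter> target D" "doubly_occupied Z (hgrade D) P" if "hdata_of D = ?d" for D
  using dd [OF that] vi P by simp_all
 let ?k = "\<lambda>D. k1 D + lext Z (join_op q) (\<pi>1 D)" and ?\<pi> = "\<lambda>D. lext Z (move_break q) (\<pi>1 D)"
 have H: "homotopy_on Z ?d ?k ?\<pi>" by (rule homotopy_on_compose [OF IH H2])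
 have A: "?\<pi> D = 0 \<and> (\<exists>r. crossed_place Z D r) \<or>
   (\<exists>E\<in>diagrams Z. ?\<pi> D = chain_of Z E \<and> hdata_of E = ?d \<and>
    (\<forall>P\<in>insert P Q. \<forall>p. smaller_place Z ord P p --> broken E p) \<and> ((\<exists>r. crossed_place Z E r) --> (\<exists>r. crossed_place Z D r)))"
  if D: "D \<in> diagrams Z" "hdata_of D = ?d" for D
  using collectsD(1) [OF c1 D]
 proof
  assume "\<pi>1 D = 0 \<and> (\<exists>r. crossed_place Z D r)"
  then show ?thesis by simp
 next
  assume "\<exists>E\<in>diagrams Z. \<pi>1 D = chain_of Z E \<and> hdata_of E = ?d \<and>
    (\<forall>P\<in>Q. \<forall>p. smaller_place Z ord P p --> broken E p) \<and> ((\<exists>r. crossed_place Z E r) --> (\<exists>r. crossed_place Z D r))"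
  then obtain E where E: "E \<in> diagrams Z" "\<pi>1 D = chain_of Z E" "hdata_of E = ?d"
   "\<forall>P\<in>Q. \<forall>p. smaller_place Z ord P p --> broken E p" "(\<exists>r. crossed_place Z E r) --> (\<exists>r. crossed_place Z D r)" by blast
  have e: "?\<pi> D = move_break q E" using E(1,2) by simp
  from double_move(1) [OF E(1,3) V [OF E(3)] pq(1,2)] show ?thesis
  proof
   assume "move_break q E = 0 \<and> crossed_place Z E q"
   then have "?\<pi> D = 0" "\<exists>r. crossed_place Z D r" using e E(5) by (simp, blast)
   then show ?thesis by blast
  next
   assume "\<exists>F\<in>diagrams Z. move_break q E = chain_of Z F \<and> hdata_of F = ?d \<and> broken F p \<and>
    (\<forall>r. pair_of Z r \<noteq> P --> broken F r = broken E r) \<and> (\<forall>r. crossed_place Z F r --> crossed_place Z E r)"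
   then obtain F where F: "F \<in> diagrams Z" "move_break q E = chain_of Z F" "hdata_of F = ?d" "broken F p"
    "\<And>r. pair_of Z r \<noteq> P ==> broken F r = broken E r" "\<And>r. crossed_place Z F r ==> crossed_place Z E r" by blast
   have "broken F r" if "P' \<in> insert P Q" "smaller_place Z ord P' r" for P' r
   proof (cases "P' = P")
    case True
    then show ?thesis using that(2) pq(3) F(4) by simp
   next
    case False
    moreover have "pair_of Z r = P'" using that(2) by (simp add: smaller_place_def pair_places_iff)
    ultimately show ?thesis using F(5) E(4) that by blast
   qed
   then show ?thesis using F(1,2,3,6) E(5) e by metis
  qed
 qed
 have B: "?\<pi> D = chain_of Z D" if D: "D \<in> diagrams Z" "hdata_of D = ?d" and b: "\<forall>P\<in>insert P Q. \<forall>p. smaller_place Z ord P p --> broken D p" for D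
 proof -
  have "\<pi>1 D = chain_of Z D" using collectsD(2) [OF c1 D] b by blast
  moreover have "broken D p" using b pq(3) by blast
  ultimately show ?thesis using double_move(2) [OF D V [OF D(2)] pq(1,2)] D(1) by simp
 qed
 show ?case
 proof (rule exI [of _ ?k], rule exI [of _ ?\<pi>], rule conjI [OF H])
  show "collects (insert P Q) ?d ?\<pi>" unfolding collects_def using A B by blast
 qed
qed

lemma goodD: "good Z ord d E ==> P \<in> source E \<inter> target E ==> doubly_occupied Z (hgrade E) P ==>
  smaller_place Z ord P p ==> broken E p"
 unfolding good_def by blast

text \<open>Without once occupied 11 pairs a strand can be broken only at doubly occupied 11 pairs,
  where goodness fixes the place. All other ends are read off from the boundary of the class, and
  the ends determine a viable diagram.\<close>

lemma good_unique:
 assumes vi: "viable_class Z (fst d)" and n: "no_once d" and D: "good Z ord d D" and E: "good Z ord d E"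
 shows "D = E"
proof -
 have sub: "Domain (strands_of D) \<subseteq> Domain (strands_of E)" "Range (strands_of D) \<subseteq> Range (strands_of E)"
  if D: "good Z ord d D" and E: "good Z ord d E" for D E
 proof -
  have D': "D \<in> diagrams Z" "hdata_of D = d" and E': "E \<in> diagrams Z" "hdata_of E = d" using D E by (simp_all add: good_def)
  have v: "viable_class Z (hgrade D)" using viable_hdata D'(2) vi by blast
  have h: "hgrade D = hgrade E" "source D = source E" "target D = target E" using hgrade_hdata [of D E] D'(2) E'(2) by simp_all
  have bd: "of_bool (r \<in> Range (strands_of D)) - of_bool (r \<in> Domain (strands_of D)) =
    (of_bool (r \<in> Range (strands_of E)) - of_bool (r \<in> Domain (strands_of E)) :: int)" for r
   using lookup_bdry_hgr [OF diagram_strands(1) [OF D'(1)], of r] lookup_bdry_hgr [OF diagram_strands(1) [OF E'(1)], of r]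
    diagram_strands(2) [OF D'(1)] diagram_strands(2) [OF E'(1)] h(1) by simp
  have br: "broken E r" if b: "broken D r" for r
  proof -
   note bp = broken_place [OF D'(1) v b]
   have e: "r \<in> Domain (strands_of D)" "r \<in> Range (strands_of D)" using b unfolding broken_def by blast+
   have dbl: "doubly_occupied Z (hgrade D) (pair_of Z r)"
   proof (rule doubly_occupied_if [OF D'(1) _ bp(1,2,3)])
    show "no_once (hdata_of D)" using n D'(2) by simp
    show "r' \<notin> Domain (strands_of D) \<and> r' \<notin> Range (strands_of D)" if "r' \<in> pair_places Z (pair_of Z r)" "r' \<noteq> r" for r'
     using end_pair(3,4) [OF D'(1) bp(1)] e that by blast
   qed
   have P: "pair_of Z r \<in> pairs Z" using pair_of_pairs [OF bp(1)] by blast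
   obtain p where p: "\<And>r'. smaller_place Z ord (pair_of Z r) r' \<longleftrightarrow> r' = p" by (rule smaller_place_pair [OF P]) blast
   have sp: "smaller_place Z ord (pair_of Z r) p" using p by blast
   have "broken D p" by (rule goodD [OF D bp(2) dbl sp])
   have "broken E p" by (rule goodD [OF E _ _ sp]) (use bp(2) dbl h in simp_all)
   have "p \<in> pair_places Z (pair_of Z r)" using sp by (simp add: smaller_place_def)
   then have "p = r" using bp(4) \<open>broken D p\<close> by blast
   then show ?thesis using \<open>broken E p\<close> by simp
  qed
  show "Domain (strands_of D) \<subseteq> Domain (strands_of E)"
  proof
   fix r assume r: "r \<in> Domain (strands_of D)"
   show "r \<in> Domain (strands_of E)"
   proof (cases "r \<in> Range (strands_of D)")
    case True
    then show ?thesis using br [of r] r unfolding broken_def by blast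
   next
    case False
    then show ?thesis using bd [of r] r by (auto simp: of_bool_def split: if_splits)
   qed
  qed
  show "Range (strands_of D) \<subseteq> Range (strands_of E)"
  proof
   fix r assume r: "r \<in> Range (strands_of D)"
   show "r \<in> Range (strands_of E)"
   proof (cases "r \<in> Domain (strands_of D)")
    case True
    then show ?thesis using br [of r] r unfolding broken_def by blast
   next
    case False
    then show ?thesis using bd [of r] r by (auto simp: of_bool_def split: if_splits)
   qed
  qed
 qed
 have D': "D \<in> diagrams Z" "hdata_of D = d" and E': "E \<in> diagrams Z" "hdata_of E = d" using D E by (simp_all add: good_def)
 have "viable_class Z (hgrade D)" using viable_hdata D'(2) vi by blast
 then show ?thesis
  using viable_diagram_eqI [OF D'(1) E'(1)] sub [OF D E] sub [OF E D] D'(2) E'(2) by (metis subset_antisym)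
qed

text \<open>A crossing would lie at a doubly occupied 11 pair, but goodness makes such a pair broken
  and hence not dotted.\<close>

lemma good_uncrossed:
 assumes vi: "viable_class Z (fst d)" and n: "no_once d" and E: "good Z ord d E"
 shows "\<not> crossed_place Z E r"
proof
 assume c: "crossed_place Z E r"
 have E': "E \<in> diagrams Z" "hdata_of E = d" using E by (simp_all add: good_def)
 have dbl: "doubly_occupied Z (hgrade E) (pair_of Z r)" using crossed_doubly_occupied [OF E'(1) _ c] n E'(2) by simp
 have ah: "all_horiz Z E (pair_of Z r)" using c by (simp add: crossed_place_def)
 have P: "pair_of Z r \<in> pairs Z" using dbl by (simp add: doubly_occupied_def)
 obtain p where p: "\<And>r'. smaller_place Z ord (pair_of Z r) r' \<longleftrightarrow> r' = p" by (rule smaller_place_pair [OF P]) blast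
 have sp: "smaller_place Z ord (pair_of Z r) p" using p by blast
 have "pair_of Z r \<in> source E \<inter> target E" using ah by (simp add: all_horiz_def)
 then have "broken E p" using E dbl sp unfolding good_def by blast
 then show False using broken_not_crossed [OF _ ah] sp by (simp add: smaller_place_def)
qed

text \<open>The pair and the place in \<open>A_star_diagram\<close> depend on the H-data alone, so a
  single q serves the whole summand. At that pair, not being crossed means being broken at q, which
  matches the case distinction of \<open>join_op\<close>.\<close>

lemma A_star_diagram_join:
 assumes o: "\<not> no_once (h, s, t)" and vi: "viable_class Z h" and D0: "D0 \<in> diagrams Z" "hdata_of D0 = (h, s, t)"
 shows "\<exists>P q. P \<in> s \<inter> t \<and> once_occupied_at Z h P q \<and> (\<forall>D\<in>diagrams Z. hdata_of D = (h, s, t) --> A_star_diagram Z ord D = join_op q D)"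
proof -
 let ?C = "{P \<in> s \<inter> t. \<exists>p. once_occupied_at Z h P p}" and ?R = "pair_le ord"
 have lo: "linear_order_on (pairs Z) ?R" using ord by (simp add: pair_ordering_def)
 then have refl: "\<And>x. x \<in> pairs Z ==> (x, x) \<in> ?R" and anti: "antisym ?R" and tr: "trans ?R" and tot: "total_on (pairs Z) ?R"
  by (auto simp: linear_order_on_def partial_order_on_def preorder_on_def refl_on_def)
 have s: "s \<subseteq> pairs Z" using D0 unfolding diagrams_eq by (auto simp: hdata_of_def occ_def)
 have ne: "?C \<noteq> {}" using o unfolding no_once_def by auto
 have least: "\<exists>P\<in>A. \<forall>Q\<in>A. (P, Q) \<in> ?R" if "finite A" "A \<noteq> {}" "A \<subseteq> pairs Z" for A
  using that
 proof (induction A rule: finite_ne_induct)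
  case (singleton x)
  then show ?case using refl by simp
 next
  case (insert x A)
  then obtain P where P: "P \<in> A" "\<forall>Q\<in>A. (P, Q) \<in> ?R" by blast
  have m: "x \<in> pairs Z" "P \<in> pairs Z" using insert.prems P(1) by blast+
  have "(x, P) \<in> ?R \<or> (P, x) \<in> ?R"
   by (cases "x = P") (use refl [OF m(1)] tot [unfolded total_on_def, rule_format, OF m] in simp_all)
  then show ?case
  proof
   assume xP: "(x, P) \<in> ?R"
   have "(x, Q) \<in> ?R" if "Q \<in> A" for Q by (rule transD [OF tr xP]) (use P(2) that in blast)
   then have "\<forall>Q\<in>insert x A. (x, Q) \<in> ?R" using refl [OF m(1)] by simp
   then show ?case by blast
  next
   assume "(P, x) \<in> ?R"
   then show ?case using P by blast
  qed
 qed
 have fC: "finite ?C" by (rule finite_subset [of _ "pairs Z"]) (use s in \<open>auto simp: pairs_def\<close>)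
 have sC: "?C \<subseteq> pairs Z" using s by blast
 obtain P where P: "P \<in> ?C" "\<forall>Q\<in>?C. (P, Q) \<in> ?R" by (rule bexE [OF least [OF fC ne sC]])
 have tP: "(THE P. P \<in> ?C \<and> (\<forall>Q\<in>?C. (P, Q) \<in> ?R)) = P"
 proof (rule the_equality)
  show "P \<in> ?C \<and> (\<forall>Q\<in>?C. (P, Q) \<in> ?R)" by (rule conjI [OF P])
  fix P' assume m: "P' \<in> ?C \<and> (\<forall>Q\<in>?C. (P', Q) \<in> ?R)"
  show "P' = P" by (rule antisymD [OF anti bspec [OF conjunct2 [OF m] P(1)] bspec [OF P(2) conjunct1 [OF m]]])
 qed
 have PC: "P \<in> s \<inter> t" "\<exists>p. once_occupied_at Z h P p" using P(1) by simp_all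
 obtain q where q: "once_occupied_at Z h P q" using PC(2) ..
 have tq: "(THE p. once_occupied_at Z h P p) = q"
 proof (rule the_equality)
  show "once_occupied_at Z h P q" by (rule q)
  fix r assume "once_occupied_at Z h P r"
  then show "r = q" using q unfolding once_occupied_at_def by blast
 qed
 note PD = PC(1)
 have "A_star_diagram Z ord D = join_op q D" if D: "D \<in> diagrams Z" "hdata_of D = (h, s, t)" for D
 proof -
  have d: "hgrade D = h" "source D = s" "target D = t" using D(2) by (simp_all add: hdata_of_def)
  obtain \<mu> where De: "D = (s, \<mu>, t)" using d(2,3) by (cases D) (auto simp: source_def target_def)
  have hg: "hgrade (s, \<mu>, t) = h" using d(1) De by simp
  have v: "viable_class Z (hgrade D)" using vi d by simp
  have P': "P \<in> source D \<inter> target D" using PD d by simp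
  have o': "once_occupied_at Z (hgrade D) P q" using q d by simp
  have qP: "q \<in> pair_places Z P" using q by (simp add: once_occupied_at_def)
  have cr: "crossing_at Z D P \<longleftrightarrow> crossed_place Z D q"
   unfolding crossing_at_iff [OF D(1) v] using once_occupied_cases(2) [OF D(1) v P' o'] qP by blast
  have nb: "crossed_place Z D q \<longleftrightarrow> \<not> broken D q"
  proof
   assume c: "crossed_place Z D q"
   then have "all_horiz Z D P" using qP by (simp add: crossed_place_def pair_places_iff)
   then show "\<not> broken D q" using broken_not_crossed qP by blast
  qed (use once_occupied_cases(1) [OF D(1) v P' o'] in blast)
  have "A_star_diagram Z ord (s, \<mu>, t) = (if crossing_at Z (s, \<mu>, t) P then 0 else chain_of Z (s, join_at \<mu> q, t))"
   by (simp only: A_star_diagram_def prod.case Let_def hg tP tq)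
  then have "A_star_diagram Z ord D = (if crossing_at Z D P then 0 else chain_of Z (s, join_at (strands_of D) q, t))"
   by (simp add: De)
  then show ?thesis by (simp add: cr nb join_op_def join_diagram_def d)
 qed
 then show ?thesis using PD q by blast
qed

definition summand_contraction :: "hdata => (diagram => chain) => (diagram => chain) => bool" where
 "summand_contraction d k \<pi> \<longleftrightarrow> homotopy_on Z d k \<pi> \<and>
  (\<forall>D\<in>diagrams Z. hdata_of D = d -->
    (\<pi> D = 0 \<or> viable_class Z (fst d) \<and> no_once d \<and> (\<exists>E. good Z ord d E \<and> \<pi> D = chain_of Z E)) \<and>
    (viable_class Z (fst d) --> no_once d --> good Z ord d D --> \<pi> D = chain_of Z D) \<and>
    (viable_class Z (fst d) --> no_once d --> \<not> has_crossing Z D --> \<pi> D \<noteq> 0) \<and>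
    (viable_class Z (fst d) --> \<not> no_once d --> k D = A_star_diagram Z ord D))"

lemma summand_homotopy: "\<exists>k \<pi>. summand_contraction d k \<pi>"
proof -
 obtain h s t where d: "d = (h, s, t)" by (cases d)
 consider "\<not> viable_class Z h" | "viable_class Z h" "\<not> no_once d" | "viable_class Z h" "no_once d" by blast
 then show ?thesis
 proof cases
  case 1
  obtain k where "homotopy_on Z d k (\<lambda>D. 0)" using nonviable_homotopy [OF 1] unfolding d by blast
  then show ?thesis using 1 unfolding summand_contraction_def d by (intro exI [of _ k] exI [of _ "\<lambda>D. 0"]) simp
 next
  case 2
  show ?thesis
  proof (cases "\<exists>D\<in>diagrams Z. hdata_of D = d")
   case True
   then obtain D0 where D0: "D0 \<in> diagrams Z" "hdata_of D0 = (h, s, t)" unfolding d by blast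
   obtain P q where q: "P \<in> s \<inter> t" "once_occupied_at Z h P q"
    "\<forall>D\<in>diagrams Z. hdata_of D = (h, s, t) --> A_star_diagram Z ord D = join_op q D"
    using A_star_diagram_join [OF 2(2) [unfolded d] 2(1) D0] by blast
   have "homotopy_on Z d (join_op q) (\<lambda>D. 0)" unfolding d by (rule once_homotopy [OF 2(1) q(1,2)])
   then show ?thesis using 2 q(3) unfolding summand_contraction_def d by (intro exI [of _ "join_op q"] exI [of _ "\<lambda>D. 0"]) simp
  next
   case False
   then show ?thesis unfolding summand_contraction_def homotopy_on_def by blast
  qed
 next
  case 3
  let ?Q = "{P \<in> s \<inter> t. doubly_occupied Z h P}"
  have "finite ?Q" by (rule finite_subset [of _ "pairs Z"]) (auto simp: doubly_occupied_def pairs_def)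
  from iterated_move [OF 3(1) this subset_refl]
  obtain k \<pi> where H: "homotopy_on Z d k \<pi>" and c: "collects ?Q d \<pi>" unfolding d by blast
  note A = collectsD(1) [OF c] and B = collectsD(2) [OF c]
  have gd: "good Z ord d E \<longleftrightarrow> E \<in> diagrams Z \<and> hdata_of E = d \<and> (\<forall>P\<in>?Q. \<forall>p. smaller_place Z ord P p --> broken E p)" for E
   unfolding good_def d by (auto simp: hdata_of_def)
  have "\<pi> D \<noteq> 0" if D: "D \<in> diagrams Z" "hdata_of D = d" "\<not> has_crossing Z D" for D
  proof -
   have v: "viable_class Z (hgrade D)" using viable_hdata [OF D(2)] 3(1) d by simp
   obtain E where "E \<in> diagrams Z" "\<pi> D = chain_of Z E" using A [OF D(1,2)] D(3) crossing_at_iff(2) [OF D(1) v] by blast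
   then show ?thesis by (simp add: diagrams_def split: prod.splits)
  qed
  moreover have "\<pi> D = 0 \<or> (\<exists>E. good Z ord d E \<and> \<pi> D = chain_of Z E)" if D: "D \<in> diagrams Z" "hdata_of D = d" for D
   using A [OF D] unfolding gd by blast
  moreover have "\<pi> D = chain_of Z D" if "good Z ord d D" for D using B that unfolding gd by blast
  ultimately show ?thesis using H 3 unfolding summand_contraction_def d fst_conv by blast
 qed
qed

end

section \<open>The contraction onto the selected diagrams\<close>

definition core_diagram :: "arc_data => pair_order => diagram => bool" where
 "core_diagram Z ord D \<longleftrightarrow> viable_class Z (hgrade D) \<and> arc.no_once Z (hdata_of D) \<and> good Z ord (hdata_of D) D"

text \<open>Collects what the transfer uses of the homotopies chosen on the summands.
  \<open>nonzero_P\<close> serves to show that twisted H-data has a once occupied 11 pair, which is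
  where \<open>star_K\<close> applies.\<close>

locale contraction = ordered_arc +
 fixes K Pr :: "diagram => chain"
 assumes homotopy_KP: "homotopy_on Z d K Pr"
  and range_P: "D \<in> diagrams Z ==> Pr D = 0 \<or> (\<exists>E. core_diagram Z ord E \<and> hdata_of E = hdata_of D \<and> Pr D = chain_of Z E)"
  and fix_P: "core_diagram Z ord D ==> Pr D = chain_of Z D"
  and nonzero_P: "D \<in> diagrams Z ==> viable_class Z (hgrade D) ==> no_once (hdata_of D) ==> \<not> has_crossing Z D ==> Pr D \<noteq> 0"
  and star_K: "D \<in> diagrams Z ==> viable_class Z (hgrade D) ==> \<not> no_once (hdata_of D) ==> K D = A_star_diagram Z ord D"

text \<open>One homotopy is chosen for each H-data. The differential preserves H-data, so the pieces
  fit together into a single homotopy.\<close>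

lemma (in ordered_arc) contraction_exists: "\<exists>K Pr. contraction Z ord K Pr"
proof -
 have "\<exists>c. summand_contraction d (fst c) (snd c)" for d
 proof -
  obtain k \<pi> where "summand_contraction d k \<pi>" using summand_homotopy [of d] by blast
  then show ?thesis by (intro exI [of _ "(k, \<pi>)"]) simp
 qed
 then have "\<forall>d. \<exists>c. summand_contraction d (fst c) (snd c)" by blast
 from choice [OF this] obtain c where c: "\<forall>d. summand_contraction d (fst (c d)) (snd (c d))" ..
 define k \<pi> where "k d = fst (c d)" and "\<pi> d = snd (c d)" for d
 note S = c [rule_format, folded k_def \<pi>_def, unfolded summand_contraction_def]
 note H = conjunct1 [OF S]
 define K where "K D = k (hdata_of D) D" for D
 define P where "P D = \<pi> (hdata_of D) D" for D
 have fd: "fst (hdata_of D) = hgrade D" for D by (simp add: hdata_of_def)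
 have R': "(P D = 0 \<or> viable_class Z (hgrade D) \<and> no_once (hdata_of D) \<and> (\<exists>E. good Z ord (hdata_of D) E \<and> P D = chain_of Z E)) \<and>
   (viable_class Z (hgrade D) --> no_once (hdata_of D) --> good Z ord (hdata_of D) D --> P D = chain_of Z D) \<and>
   (viable_class Z (hgrade D) --> no_once (hdata_of D) --> \<not> has_crossing Z D --> P D \<noteq> 0) \<and>
   (viable_class Z (hgrade D) --> \<not> no_once (hdata_of D) --> K D = A_star_diagram Z ord D)" if "D \<in> diagrams Z" for D
  using conjunct2 [OF S [of "hdata_of D"]] that unfolding fd K_def P_def by blast
 have "contraction Z ord K P"
 proof (unfold_locales)
  show "homotopy_on Z d K P" for d
   unfolding homotopy_on_def
  proof (intro ballI impI)
   fix D assume D: "D \<in> diagrams Z" "hdata_of D = d"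
   have dx: "diff (chain_of Z D) \<in> alg_gr Z d (maslov Z D - 1)" using diff_graded [OF chain_of_gr [OF D(1)]] D(2) by simp
   have "lext Z K (diff (chain_of Z D)) = lext Z (k d) (diff (chain_of Z D))"
    unfolding lext_def by (rule sum.cong [OF refl]) (simp add: K_def supp_gr(1) [OF dx])
   then show "K D \<in> alg_gr Z d (maslov Z D + 1) \<and> P D \<in> alg_gr Z d (maslov Z D) \<and>
     diff (K D) + lext Z K (diff (chain_of Z D)) = chain_of Z D + P D"
    using homotopy_onD [OF H D] D(2) by (simp add: K_def P_def)
  qed
  show "P D = 0 \<or> (\<exists>E. core_diagram Z ord E \<and> hdata_of E = hdata_of D \<and> P D = chain_of Z E)" if D: "D \<in> diagrams Z" for D
  proof (cases "P D = 0")
   case False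
   then obtain E where E: "viable_class Z (hgrade D)" "no_once (hdata_of D)" "good Z ord (hdata_of D) E" "P D = chain_of Z E"
    using R' [OF D] by blast
   have e: "hdata_of E = hdata_of D" using E(3) by (simp add: good_def)
   then have "core_diagram Z ord E" using E hgrade_hdata [OF e] by (simp add: core_diagram_def)
   then show ?thesis using e E(4) by blast
  qed simp
  show "P D = chain_of Z D" if "core_diagram Z ord D" for D
  proof -
   have "D \<in> diagrams Z" using that by (simp add: core_diagram_def good_def)
   then show ?thesis using R' that unfolding core_diagram_def by blast
  qed
  show "P D \<noteq> 0" if "D \<in> diagrams Z" "viable_class Z (hgrade D)" "no_once (hdata_of D)" "\<not> has_crossing Z D" for D
   using R' that by blast
  show "K D = A_star_diagram Z ord D" if "D \<in> diagrams Z" "viable_class Z (hgrade D)" "\<not> no_once (hdata_of D)" for D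
   using R' that by blast
 qed
 then show ?thesis by blast
qed

context contraction
begin

definition hmap :: "chain => chain" where "hmap = lext Z K"
definition pmap :: "chain => chain" where "pmap = lext Z Pr"
definition selected_chains :: "chain set" where "selected_chains = invariant_chains Z (core_diagram Z ord)"

lemma KP_gr: "D \<in> diagrams Z ==> K D \<in> alg_gr Z (hdata_of D) (maslov Z D + 1)" "D \<in> diagrams Z ==> Pr D \<in> alg_gr Z (hdata_of D) (maslov Z D)"
 using homotopy_onD [OF homotopy_KP] by blast+

lemma hmap_gr: "x \<in> alg_gr Z d g ==> hmap x \<in> alg_gr Z d (g + 1)" and pmap_gr: "x \<in> alg_gr Z d g ==> pmap x \<in> alg_gr Z d g"
 unfolding hmap_def pmap_def using homotopy_on_chain [OF homotopy_KP] by blast+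

lemma hmap_alg: "hmap x \<in> alg Z"
 unfolding hmap_def lext_def by (rule invariant_chains_sum, rule alg_gr_alg, rule KP_gr(1), rule supp_diagrams)

lemma hmap_add: "x \<in> alg Z ==> y \<in> alg Z ==> hmap (x + y) = hmap x + hmap y"
 and pmap_add: "x \<in> alg Z ==> y \<in> alg Z ==> pmap (x + y) = pmap x + pmap y"
 unfolding hmap_def pmap_def by (rule lext_add; assumption)+

lemma hmap_zero [simp]: "hmap 0 = 0" and pmap_zero [simp]: "pmap 0 = 0"
 by (simp_all add: hmap_def pmap_def)

lemma homotopy_chain:
 assumes xa: "x \<in> alg Z"
 shows "diff (hmap x) + hmap (diff x) = x + pmap x"
 unfolding hmap_def pmap_def
 by (rule homotopy_expand [OF xa], rule homotopy_onD(3) [OF homotopy_KP], erule supp_diagrams, rule refl)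

section \<open>Recognising tight, twisted and selected diagrams\<close>

lemma core_diagramD:
 assumes "core_diagram Z ord D"
 shows "D \<in> diagrams Z" "viable_class Z (hgrade D)" "no_once (hdata_of D)" "good Z ord (hdata_of D) D" "\<not> crossed_place Z D r"
proof -
 show c: "D \<in> diagrams Z" "viable_class Z (hgrade D)" "no_once (hdata_of D)" "good Z ord (hdata_of D) D"
  using assms by (simp_all add: core_diagram_def good_def)
 show "\<not> crossed_place Z D r" by (rule good_uncrossed [OF _ c(3,4)]) (use c(2) in \<open>simp add: hdata_of_def\<close>)
qed

lemma core_diagram_diff: "core_diagram Z ord D ==> diff (chain_of Z D) = 0"
 using diff_viable core_diagramD by simp

lemma selected_alg: "x \<in> selected_chains ==> x \<in> alg Z"
 unfolding selected_chains_def using invariant_chains_alg [of x Z "core_diagram Z ord"] by blast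

lemma selected_supp:
 assumes "x \<in> selected_chains" "D \<in> supp Z x"
 shows "core_diagram Z ord D"
proof -
 note x = assms(1) [unfolded selected_chains_def]
 obtain phi where "phi \<in> keys x" "D = diagram_of Z phi" using assms(2) unfolding invariant_supp [OF x] by blast
 then show ?thesis using invariant_chainsD(2) [OF x] by blast
qed

lemma selected_zero: "0 \<in> selected_chains" and selected_add: "x \<in> selected_chains ==> y \<in> selected_chains ==> x + y \<in> selected_chains"
 unfolding selected_chains_def by (simp_all add: invariant_chains_add)

lemma selected_chain_of: "core_diagram Z ord D ==> chain_of Z D \<in> selected_chains"
 unfolding selected_chains_def by (rule chain_of_invariant) (simp_all add: core_diagramD)

lemma selected_P: "D \<in> diagrams Z ==> Pr D \<in> selected_chains"
 using range_P [of D] selected_zero selected_chain_of by metis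

lemma pmap_selected: "pmap x \<in> selected_chains"
proof -
 have "(\<Sum>D\<in>supp Z x. Pr D) \<in> selected_chains"
  unfolding selected_chains_def
  by (rule invariant_chains_sum, fold selected_chains_def, rule selected_P, rule supp_diagrams)
 then show ?thesis by (simp add: pmap_def lext_def)
qed

lemma pmap_id:
 assumes "x \<in> selected_chains"
 shows "pmap x = x"
proof -
 have "pmap x = (\<Sum>D\<in>supp Z x. chain_of Z D)"
  unfolding pmap_def lext_def by (rule sum.cong [OF refl], rule fix_P, rule selected_supp [OF assms])
 then show ?thesis using alg_expand [OF selected_alg [OF assms]] by simp
qed

lemma diff_selected:
 assumes "x \<in> selected_chains"
 shows "diff x = 0"
proof -
 have e: "x = (\<Sum>D\<in>supp Z x. chain_of Z D)" by (rule alg_expand [OF selected_alg [OF assms]])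
 have "diff x = diff (\<Sum>D\<in>supp Z x. chain_of Z D)" by (rule arg_cong [OF e])
 also have "\<dots> = (\<Sum>D\<in>supp Z x. diff (chain_of Z D))" by (rule diff_sum)
 also have "\<dots> = 0" by (rule sum.neutral) (use core_diagram_diff selected_supp [OF assms] in blast)
 finally show ?thesis .
qed

lemma selected_cycles: "x \<in> selected_chains ==> x \<in> cycles Z"
 by (simp add: cycles_eq selected_alg diff_selected)

text \<open>The homotopy identity makes the projection commute with the differential, and the
  differential vanishes on selected chains.\<close>

lemma pmap_boundary:
 assumes "x \<in> boundaries Z"
 shows "pmap x = 0"
proof -
 obtain y where y: "y \<in> alg Z" "x = diff y" using assms unfolding boundaries_eq by blast
 have "diff (diff (hmap y) + hmap (diff y)) = diff (y + pmap y)" using homotopy_chain [OF y(1)] by simp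
 then have "diff (hmap (diff y)) = diff y" by (simp add: diff_add alg_diff_diff [OF hmap_alg] diff_selected [OF pmap_selected])
 moreover have "diff (hmap (diff y)) + hmap (diff (diff y)) = diff y + pmap (diff y)" by (rule homotopy_chain [OF diff_alg [OF y(1)]])
 ultimately show ?thesis unfolding y(2) by (simp add: alg_diff_diff [OF y(1)])
qed

lemma cls_pmap:
 assumes "x \<in> cycles Z"
 shows "cls Z (pmap x) = cls Z x"
proof -
 have x: "x \<in> alg Z" "diff x = 0" using assms by (simp_all add: cycles_eq)
 have "x + pmap x = diff (hmap x)" using homotopy_chain [OF x(1)] x(2) by simp
 then have "pmap x + x \<in> boundaries Z" using hmap_alg unfolding boundaries_eq by (simp add: add.commute)
 then show ?thesis using cls_eq_iff [OF Z selected_cycles [OF pmap_selected] assms] by blast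
qed

lemma chain_of_nonzero: "D \<in> diagrams Z ==> chain_of Z D \<noteq> 0"
 by (simp add: diagrams_def split: prod.splits)

text \<open>The projection fixes selected diagrams and kills boundaries.\<close>

lemma core_tight:
 assumes "core_diagram Z ord D"
 shows "tight_diagram Z D"
proof -
 note c = core_diagramD [OF assms]
 have cy: "chain_of Z D \<in> cycles Z" by (rule selected_cycles [OF selected_chain_of [OF assms]])
 have "pmap (chain_of Z D) \<noteq> 0" using pmap_id [OF selected_chain_of [OF assms]] chain_of_nonzero [OF c(1)] by simp
 then have "chain_of Z D \<notin> boundaries Z" using pmap_boundary by blast
 then show ?thesis using c cls_eq_zero [OF Z cy] crossing_at_iff(2) [OF c(1,2)] unfolding tight_diagram_def by blast
qed

lemma uncrossed_cycle:
 assumes "D \<in> diagrams Z" "viable_class Z (hgrade D)" "\<not> has_crossing Z D"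
 shows "chain_of Z D \<in> cycles Z"
proof -
 have none: "{p. crossed_place Z D p} = {}" using crossing_at_iff(2) [OF assms(1,2)] assms(3) by blast
 have "diff (chain_of Z D) = 0" unfolding diff_viable [OF assms(1,2)] none by simp
 then show ?thesis using assms(1) by (simp add: cycles_eq)
qed

text \<open>The projection preserves homology classes and vanishes on summands with a once occupied
  11 pair.\<close>

lemma tight_no_once:
 assumes "tight_diagram Z D"
 shows "no_once (hdata_of D)"
proof (rule ccontr)
 assume n: "\<not> no_once (hdata_of D)"
 have D: "D \<in> diagrams Z" "viable_class Z (hgrade D)" "\<not> has_crossing Z D" "cls Z (chain_of Z D) \<noteq> \<zero>\<^bsub>homology Z\<^esub>"
  using assms by (simp_all add: tight_diagram_def)
 have cy: "chain_of Z D \<in> cycles Z" by (rule uncrossed_cycle [OF D(1-3)])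
 have "Pr D = 0"
 proof (rule ccontr)
  assume "Pr D \<noteq> 0"
  then obtain E where E: "core_diagram Z ord E" "hdata_of E = hdata_of D" using range_P [OF D(1)] by blast
  have "no_once (hdata_of E)" by (rule core_diagramD(3) [OF E(1)])
  then show False using n E(2) by simp
 qed
 then have "pmap (chain_of Z D) = 0" using D(1) by (simp add: pmap_def)
 then have "cls Z (chain_of Z D) = cls Z 0" using cls_pmap [OF cy] by simp
 then show False using D(4) cls_zero [OF Z] by simp
qed

text \<open>A twisted diagram is a boundary, hence killed by the projection, but uncrossed viable
  diagrams without once occupied 11 pairs are not killed.\<close>

lemma twisted_once:
 assumes "twisted_diagram Z D"
 shows "\<not> no_once (hdata_of D)"
proof
 assume n: "no_once (hdata_of D)"
 have D: "D \<in> diagrams Z" "viable_class Z (hgrade D)" "\<not> has_crossing Z D" "cls Z (chain_of Z D) = \<zero>\<^bsub>homology Z\<^esub>"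
  using assms by (simp_all add: twisted_diagram_def)
 have "chain_of Z D \<in> boundaries Z" using D(4) cls_eq_zero [OF Z uncrossed_cycle [OF D(1-3)]] by blast
 then have "pmap (chain_of Z D) = 0" by (rule pmap_boundary)
 then show False using nonzero_P [OF D(1,2) n D(3)] D(1) by (simp add: pmap_def)
qed

text \<open>Selected diagrams are defined through homology, \<open>core_diagram\<close> through
  occupation and breaks. \<open>tight_no_once\<close> and \<open>core_tight\<close> translate
  between the two.\<close>

lemma selected_iff: "selected_diagram Z ord d E \<longleftrightarrow> core_diagram Z ord E \<and> hdata_of E = d"
proof
 assume s: "selected_diagram Z ord d E"
 then have t: "tight_diagram Z E" "hdata_of E = d" by (simp_all add: selected_diagram_def)
 have "E \<in> diagrams Z" "viable_class Z (hgrade E)" using t(1) by (simp_all add: tight_diagram_def)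
 moreover have "broken E p" if "P \<in> source E \<inter> target E" "doubly_occupied Z (hgrade E) P" "smaller_place Z ord P p" for P p
  using s that unfolding selected_diagram_def broken_def by blast
 ultimately show "core_diagram Z ord E \<and> hdata_of E = d"
  using tight_no_once [OF t(1)] t(2) unfolding core_diagram_def good_def by blast
next
 assume c: "core_diagram Z ord E \<and> hdata_of E = d"
 then show "selected_diagram Z ord d E"
  using core_tight [of E] core_diagramD(4) [of E] unfolding selected_diagram_def good_def broken_def by blast
qed

lemma core_unique:
 assumes D: "core_diagram Z ord D" and E: "core_diagram Z ord E" and "hdata_of D = hdata_of E"
 shows "D = E"
proof (rule good_unique [of "hdata_of D"])
 show "viable_class Z (fst (hdata_of D))" using core_diagramD(2) [OF D] by (simp add: hdata_of_def)
 show "no_once (hdata_of D)" "good Z ord (hdata_of D) D" using core_diagramD [OF D] by blast+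
 show "good Z ord (hdata_of D) E" using core_diagramD(4) [OF E] assms(3) by simp
qed

text \<open>Twisted H-data has a once occupied 11 pair, and on such summands the homotopy is
  \<open>A_star_diagram\<close>.\<close>

lemma hmap_A_star:
 assumes z: "z \<in> alg_gr Z d g" and tw: "twisted_hdata Z d"
 shows "hmap z = A_star Z ord z"
proof -
 obtain D0 where D0: "twisted_diagram Z D0" "hdata_of D0 = d" using tw unfolding twisted_hdata_def by blast
 have n: "\<not> no_once d" using twisted_once [OF D0(1)] D0(2) by simp
 have v: "viable_class Z (fst d)" using D0 by (auto simp: twisted_diagram_def hdata_of_def)
 have s: "{D \<in> diagrams Z. twisted_hdata Z (hdata_of D) \<and> terms_of Z D \<subseteq> keys z} = supp Z z"
  using supp_gr(1) [OF z] tw unfolding supp_def by blast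
 show ?thesis
  unfolding hmap_def lext_def A_star_def s
 proof (rule sum.cong [OF refl])
  fix D assume D: "D \<in> supp Z z"
  have h: "hdata_of D = d" by (rule supp_gr(1) [OF z D])
  show "K D = A_star_diagram Z ord D"
   by (rule star_K [OF supp_diagrams [OF D] viable_hdata [OF h v]]) (simp add: h n)
 qed
qed

end

section \<open>Sums over splittings of a list\<close>

text \<open>Sum over the deconcatenations of a word. The recursive form turns coassociativity into a
  short induction and keeps indices out of the structure relations.\<close>

fun splits :: "('a list => 'a list => 'b::comm_monoid_add) => 'a list => 'b" where
 "splits G [] = G [] []"
| "splits G (x # xs) = G [] (x # xs) + splits (\<lambda>a b. G (x # a) b) xs"

lemma splits_sum: "splits G xs = (\<Sum>i\<le>length xs. G (take i xs) (drop i xs))"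
 by (induction G xs rule: splits.induct) (simp_all add: sum.atMost_Suc_shift del: sum.atMost_Suc)

lemma splits_cong: "(\<And>a b. a @ b = xs ==> G a b = H a b) ==> splits G xs = splits H xs"
 by (simp add: splits_sum)

lemma splits_add: "splits (\<lambda>a b. G a b + H a b) xs = splits G xs + splits H xs"
 by (simp add: splits_sum sum.distrib)

lemma splits_zero [simp]: "splits (\<lambda>a b. 0) xs = 0"
 by (simp add: splits_sum)

lemma splits_swap: "splits (\<lambda>a b. splits (\<lambda>c e. G a b c e) ys) xs = splits (\<lambda>c e. splits (\<lambda>a b. G a b c e) xs) ys"
 unfolding splits_sum by (rule sum.swap)

lemma splits_assoc: "splits (\<lambda>a r. splits (\<lambda>b c. G a b c) r) xs = splits (\<lambda>l c. splits (\<lambda>a b. G a b c) l) xs"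
proof (induction xs arbitrary: G)
 case (Cons x xs)
 show ?case using Cons [of "\<lambda>a. G (x # a)"] by (simp add: splits_add ac_simps)
qed simp

lemma splits_letter: 
 "splits G (u @ x # w) = splits (\<lambda>a b. G a (b @ x # w)) u + splits (\<lambda>a b. G (u @ x # a) b) w"
 by (induction u arbitrary: G) (simp_all add: add.assoc)

lemma splits_last: "splits G xs = splits (\<lambda>a b. if b = [] then 0 else G a b) xs + G xs []"
proof (induction xs arbitrary: G)
 case (Cons x xs)
 show ?case using Cons.IH [of "\<lambda>a. G (x # a)"] by (simp add: add.assoc)
qed simp

lemma splits_additive:
 assumes "\<And>x y. x \<in> C ==> y \<in> C ==> x + y \<in> C \<and> phi (x + y) = phi x + phi y"
  and "\<And>a b. a @ b = xs ==> G a b \<in> C"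
 shows "splits G xs \<in> C \<and> phi (splits G xs) = splits (\<lambda>a b. phi (G a b)) xs"
 using assms(2)
proof (induction xs arbitrary: G)
 case (Cons x xs)
 have "splits (\<lambda>a b. G (x # a) b) xs \<in> C \<and> phi (splits (\<lambda>a b. G (x # a) b) xs) = splits (\<lambda>a b. phi (G (x # a) b)) xs"
  by (rule Cons.IH) (use Cons.prems in auto)
 then show ?case using assms(1) Cons.prems [of "[]" "x # xs"] by simp
qed simp

definition splits3 :: "('a list => 'a list => 'a list => 'b::comm_monoid_add) => 'a list => 'b" where
 "splits3 G xs = splits (\<lambda>a r. splits (\<lambda>b c. G a b c) r) xs"

lemma splits3_cong: "(\<And>a b c. a @ b @ c = xs ==> G a b c = H a b c) ==> splits3 G xs = splits3 H xs"
 unfolding splits3_def by (rule splits_cong, rule splits_cong) simp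

lemma splits3_add: "splits3 (\<lambda>a b c. G a b c + H a b c) xs = splits3 G xs + splits3 H xs"
 by (simp add: splits3_def splits_add)

lemma splits3_zero [simp]: "splits3 (\<lambda>a b c. 0) xs = 0"
 by (simp add: splits3_def)

lemma splits3_additive:
 assumes "\<And>x y. x \<in> C ==> y \<in> C ==> x + y \<in> C \<and> phi (x + y) = phi x + phi y"
  and "\<And>a b c. a @ b @ c = xs ==> G a b c \<in> C"
 shows "splits3 G xs \<in> C \<and> phi (splits3 G xs) = splits3 (\<lambda>a b c. phi (G a b c)) xs"
proof -
 have i: "splits (\<lambda>b c. G a b c) r \<in> C \<and> phi (splits (\<lambda>b c. G a b c) r) = splits (\<lambda>b c. phi (G a b c)) r"
  if "a @ r = xs" for a r
  by (rule splits_additive [OF assms(1)]) (use that assms(2) in auto)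
 have "splits3 G xs \<in> C \<and> phi (splits3 G xs) = splits (\<lambda>a r. phi (splits (\<lambda>b c. G a b c) r)) xs"
  unfolding splits3_def by (rule splits_additive [OF assms(1)]) (use i in auto)
 moreover have "splits (\<lambda>a r. phi (splits (\<lambda>b c. G a b c) r)) xs = splits3 (\<lambda>a b c. phi (G a b c)) xs"
  unfolding splits3_def by (rule splits_cong) (use i in auto)
 ultimately show ?thesis by simp
qed

text \<open>The middle block lies after the letter x, before it, or contains it.\<close>

lemma splits3_letter:
 "splits3 G (u @ x # w) = splits3 (\<lambda>r b c. G (u @ x # r) b c) w + splits3 (\<lambda>a b r. G a b (r @ x # w)) u +
  splits (\<lambda>a r. splits (\<lambda>t c. G a (r @ x # t) c) w) u"
 by (simp add: splits3_def splits_letter splits_add ac_simps)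

text \<open>The block equal to the whole word is split off, since induction on length reaches only
  the shorter blocks.\<close>

lemma splits3_whole:
 "splits3 G xs = splits3 (\<lambda>a b c. if length b < length xs then G a b c else 0) xs + G [] xs []"
proof (cases xs)
 case (Cons x ys)
 have 1: "splits (\<lambda>b c. G [] b c) (x # ys) = splits (\<lambda>b c. if length b < length (x # ys) then G [] b c else 0) (x # ys) + G [] (x # ys) []"
 proof (subst splits_last, rule arg_cong2 [of _ _ _ _ "(+)"], rule splits_cong)
  fix b c assume "b @ c = x # ys"
  then have "length b + length c = Suc (length ys)" by (metis length_append length_Cons)
  then show "(if c = [] then 0 else G [] b c) = (if length b < length (x # ys) then G [] b c else 0)"
   by (cases c) auto
 qed simp
 have 2: "splits (\<lambda>a r. splits (\<lambda>b c. G (x # a) b c) r) ys = 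
   splits (\<lambda>a r. splits (\<lambda>b c. if length b < length (x # ys) then G (x # a) b c else 0) r) ys"
  by (rule splits_cong, rule splits_cong) auto
 show ?thesis unfolding Cons splits3_def splits.simps(2) [of _ x ys]
  using 1 2 by (simp add: ac_simps)
qed (simp add: splits3_def)

lemma splits_left3: "splits3 (\<lambda>u v w. splits (\<lambda>a b. H a b v w) u) xs = splits (\<lambda>a r. splits3 (H a) r) xs"
proof -
 have "splits3 (\<lambda>u v w. splits (\<lambda>a b. H a b v w) u) xs = splits (\<lambda>u r. splits (\<lambda>a b. splits (\<lambda>v w. H a b v w) r) u) xs"
  unfolding splits3_def by (rule splits_cong, rule splits_swap)
 also have "\<dots> = splits (\<lambda>a r. splits3 (H a) r) xs"
  unfolding splits3_def by (rule splits_assoc [symmetric])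
 finally show ?thesis .
qed

lemma splits_right3: "splits3 (\<lambda>u v w. splits (\<lambda>a b. H u v a b) w) xs = splits (\<lambda>r b. splits3 (\<lambda>u v a. H u v a b) r) xs"
 unfolding splits3_def splits_assoc [of "\<lambda>v a b. H u v a b" for u] by (rule splits_assoc)

text \<open>Both sides choose two disjoint blocks, one side starting with the left block and the
  other with the right one. Mod 2 this cancels the two orders of inserting operations.\<close>

lemma splits3_comm: 
 "splits3 (\<lambda>u v w. splits3 (\<lambda>r b c. H u v r b c) w) xs = splits3 (\<lambda>u v w. splits3 (\<lambda>a b r. H a b r v w) u) xs"
proof -
 have "splits3 (\<lambda>u v w. splits3 (\<lambda>a b r. H a b r v w) u) xs
   = splits3 (\<lambda>u v w. splits (\<lambda>a s. splits (\<lambda>b r. H a b r v w) s) u) xs"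
  by (simp add: splits3_def)
 also have "\<dots> = splits (\<lambda>a r. splits3 (\<lambda>s v w. splits (\<lambda>b r. H a b r v w) s) r) xs"
  by (rule splits_left3)
 also have "\<dots> = splits (\<lambda>a r. splits (\<lambda>b r'. splits3 (\<lambda>r v w. H a b r v w) r') r) xs"
  by (simp add: splits_left3)
 also have "\<dots> = splits3 (\<lambda>u v w. splits3 (\<lambda>r b c. H u v r b c) w) xs"
  by (simp add: splits3_def)
 finally show ?thesis by simp
qed

text \<open>A block within a larger block, chosen from the inside or from the outside.\<close>

lemma splits3_nested:
 "splits3 (\<lambda>u v w. splits (\<lambda>a r. splits (\<lambda>t c. H a r v t c) w) u) xs = splits3 (\<lambda>a l c. splits3 (\<lambda>r v t. H a r v t c) l) xs"
proof -
 have "splits3 (\<lambda>u v w. splits (\<lambda>a r. splits (\<lambda>t c. H a r v t c) w) u) xs =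
   splits (\<lambda>a s. splits3 (\<lambda>r v w. splits (\<lambda>t c. H a r v t c) w) s) xs"
  by (rule splits_left3)
 also have "\<dots> = splits (\<lambda>a s. splits (\<lambda>l c. splits3 (\<lambda>r v t. H a r v t c) l) s) xs"
  by (simp add: splits_right3)
 finally show ?thesis by (simp add: splits3_def)
qed

section \<open>Homotopy transfer of an algebra with linear homotopy\<close>

text \<open>C stands for homology, realised inside A by the selected cycles, so the cycle selection
  map becomes the inclusion and is not written. Signs are absent because of
  \<open>double\<close>.\<close>

locale transfer =
 fixes A C :: "'a::ab_group_add set" and mul :: "'a => 'a => 'a" and d h p :: "'a => 'a"
 assumes double: "x + x = (0::'a)"
  and A_add: "x \<in> A ==> y \<in> A ==> x + y \<in> A"
  and A_mul: "x \<in> A ==> y \<in> A ==> mul x y \<in> A"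
  and mul_left: "mul (x + y) z = mul x z + mul y z"
  and mul_right: "mul z (x + y) = mul z x + mul z y"
  and mul_assoc: "x \<in> A ==> y \<in> A ==> z \<in> A ==> mul (mul x y) z = mul x (mul y z)"
  and d_add: "d (x + y) = d x + d y"
  and leib: "x \<in> A ==> y \<in> A ==> d (mul x y) = mul (d x) y + mul x (d y)"
  and d_A: "x \<in> A ==> d x \<in> A"
  and d_d: "x \<in> A ==> d (d x) = 0"
  and C_A: "x \<in> C ==> x \<in> A"
  and C_zero: "0 \<in> C"
  and C_add: "x \<in> C ==> y \<in> C ==> x + y \<in> C"
  and d_C: "x \<in> C ==> d x = 0"
  and p_C: "x \<in> A ==> p x \<in> C"
  and p_id: "x \<in> C ==> p x = x"
  and p_add: "x \<in> A ==> y \<in> A ==> p (x + y) = p x + p y"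
  and h_A: "x \<in> A ==> h x \<in> A"
  and h_add: "x \<in> A ==> y \<in> A ==> h (x + y) = h x + h y"
  and homotopy: "x \<in> A ==> d (h x) + h (d x) = x + p x"
begin

text \<open>The operations take an unknown u in place of U, so that their mutual recursion becomes a
  fixed point equation for U alone.\<close>

definition F_of :: "('a list => 'a) => 'a list => 'a" where
 "F_of u xs = (if xs = [] then 0 else if length xs = 1 then hd xs else h (p (u xs) + u xs))"

definition X_of :: "('a list => 'a) => 'a list => 'a" where
 "X_of u xs = (if length xs \<le> 1 then 0 else p (u xs))"

definition U_step :: "('a list => 'a) => 'a list => 'a" where
 "U_step u xs = splits (\<lambda>a b. if a = [] \<or> b = [] then 0 else mul (F_of u a) (F_of u b)) xs +
  splits3 (\<lambda>a b c. if 2 \<le> length b \<and> length b < length xs then F_of u (a @ X_of u b # c) else 0) xs"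

text \<open>The recursion runs on the length of the list, which serves as fuel.\<close>

primrec U_fuel :: "nat => 'a list => 'a" where
 "U_fuel 0 = (\<lambda>xs. 0)"
| "U_fuel (Suc n) = U_step (U_fuel n)"

definition U :: "'a list => 'a" where "U xs = U_fuel (length xs) xs"
definition F :: "'a list => 'a" where "F = F_of U"
definition X :: "'a list => 'a" where "X = X_of U"

lemma U_step_cong:
 assumes "\<And>ys. length ys < length xs ==> u ys = v ys"
 shows "U_step u xs = U_step v xs"
proof -
 have F: "F_of u ys = F_of v ys" "X_of u ys = X_of v ys" if "length ys < length xs" for ys
  using assms that by (simp_all add: F_of_def X_of_def)
 show ?thesis
  unfolding U_step_def
 proof (rule arg_cong2 [of _ _ _ _ "(+)"])
  show "splits (\<lambda>a b. if a = [] \<or> b = [] then 0 else mul (F_of u a) (F_of u b)) xs =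
   splits (\<lambda>a b. if a = [] \<or> b = [] then 0 else mul (F_of v a) (F_of v b)) xs"
   by (rule splits_cong) (auto simp: F)
  show "splits3 (\<lambda>a b c. if 2 \<le> length b \<and> length b < length xs then F_of u (a @ X_of u b # c) else 0) xs =
   splits3 (\<lambda>a b c. if 2 \<le> length b \<and> length b < length xs then F_of v (a @ X_of v b # c) else 0) xs"
   by (rule splits3_cong) (auto simp: F)
 qed
qed

lemma U_fuel_eq: "length xs \<le> n ==> length xs \<le> m ==> U_fuel n xs = U_fuel m xs"
proof (induction n arbitrary: m xs)
 case 0
 then show ?case by (cases m) (simp_all add: U_step_def splits3_def)
next
 case (Suc n)
 show ?case
 proof (cases m)
  case 0
  then show ?thesis using Suc.prems by (simp add: U_step_def splits3_def)
 next
  case (Suc m')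
  then show ?thesis using Suc.prems Suc.IH by (auto intro!: U_step_cong)
 qed
qed

lemma U_rec: "U xs = splits (\<lambda>a b. if a = [] \<or> b = [] then 0 else mul (F a) (F b)) xs +
  splits3 (\<lambda>a b c. if 2 \<le> length b \<and> length b < length xs then F (a @ X b # c) else 0) xs"
proof -
 have "U xs = U_step (U_fuel (length xs)) xs"
  using U_fuel_eq [of xs "length xs" "Suc (length xs)"] by (simp add: U_def)
 also have "\<dots> = U_step U xs"
  by (rule U_step_cong) (use U_fuel_eq in \<open>auto simp: U_def\<close>)
 finally show ?thesis by (simp only: U_step_def F_def X_def)
qed

lemma zeros: "0 \<in> A" "mul 0 x = 0" "mul x 0 = 0" "d 0 = 0" "h 0 = 0" "p 0 = 0"
proof -
 show A: "0 \<in> A" by (rule C_A [OF C_zero])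
 have z: "y = 0" if "y = y + y" for y :: 'a using that by simp
 show "mul 0 x = 0" "mul x 0 = 0" "d 0 = 0" "h 0 = 0" "p 0 = 0"
  using mul_left [of 0 0 x] mul_right [of x 0 0] d_add [of 0 0] h_add [OF A A] p_add [OF A A] by (simp_all add: z)
qed

lemma F_simps [simp]: "F [] = 0" "F [x] = x" "X [] = 0" "X [x] = 0"
 by (simp_all add: F_def X_def F_of_def X_of_def)

lemma F_long: "2 \<le> length xs ==> F xs = h (X xs + U xs)"
 by (auto simp: F_def X_def F_of_def X_of_def)

lemma X_long: "2 \<le> length xs ==> X xs = p (U xs)"
 by (auto simp: X_def X_of_def)

lemma splits_A: "(\<And>a b. a @ b = xs ==> G a b \<in> A) ==> splits G xs \<in> A"
 using splits_additive [of A "\<lambda>x. x" xs G] A_add by auto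

lemma splits3_A: "(\<And>a b c. a @ b @ c = xs ==> G a b c \<in> A) ==> splits3 G xs \<in> A"
 using splits3_additive [of A "\<lambda>x. x" xs G] A_add by auto

lemma closed: "set xs \<subseteq> C ==> U xs \<in> A \<and> F xs \<in> A \<and> X xs \<in> C"
proof (induction "length xs" arbitrary: xs rule: less_induct)
 case less
 have IH: "F ys \<in> A" "X ys \<in> C" if "length ys < length xs" "set ys \<subseteq> C" for ys
  using less.hyps that by auto
 have "U xs \<in> A"
  unfolding U_rec
 proof (intro A_add splits_A splits3_A)
  fix a b assume "a @ b = xs"
  then show "(if a = [] \<or> b = [] then 0 else mul (F a) (F b)) \<in> A"
   using less.prems by (auto intro!: A_mul IH zeros)
 next
  fix a b c assume e: "a @ b @ c = xs"
  show "(if 2 \<le> length b \<and> length b < length xs then F (a @ X b # c) else 0) \<in> A"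
  proof (cases "2 \<le> length b \<and> length b < length xs")
   case True
   then have "X b \<in> C" using e less.prems by (intro IH) auto
   then show ?thesis using True e less.prems by (auto intro!: IH)
  qed (auto simp: zeros)
 qed
 moreover have "X xs \<in> C" using \<open>U xs \<in> A\<close> C_zero p_C by (simp add: X_def X_of_def)
 moreover have "F xs \<in> A"
 proof (cases "2 \<le> length xs")
  case True
  then show ?thesis unfolding F_long [OF True] using calculation C_A by (intro h_A A_add) auto
 next
  case False
  then consider "xs = []" | x where "xs = [x]" by (cases xs) (auto simp: Suc_le_eq)
  then show ?thesis using less.prems C_A zeros(1) by cases auto
 qed
 ultimately show ?case by blast
qed

lemma closed_U: "set xs \<subseteq> C ==> U xs \<in> A" and closed_F: "set xs \<subseteq> C ==> F xs \<in> A" and closed_X: "set xs \<subseteq> C ==> X xs \<in> C"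
 using closed by blast+

text \<open>Induction on the number of other letters. If the marked letter lies in an inner block,
  additivity of X on this block is used first and then additivity of F in the slot of the block,
  both with fewer other letters.\<close>

lemma additive:
 assumes "set u \<subseteq> C" "set w \<subseteq> C" "x \<in> C" "y \<in> C"
 shows "U (u @ (x + y) # w) = U (u @ x # w) + U (u @ y # w) \<and> F (u @ (x + y) # w) = F (u @ x # w) + F (u @ y # w) \<and>
  X (u @ (x + y) # w) = X (u @ x # w) + X (u @ y # w)"
 using assms
proof (induction "length u + length w" arbitrary: u w x y rule: less_induct)
 case less
 have IHF: "F (a @ (x + y) # b) = F (a @ x # b) + F (a @ y # b)" and IHX: "X (a @ (x + y) # b) = X (a @ x # b) + X (a @ y # b)"
  if "length a + length b < length u + length w" "set a \<subseteq> C" "set b \<subseteq> C" "x \<in> C" "y \<in> C" for a b x y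
  using less.hyps that by auto
 have xy: "x \<in> C" "y \<in> C" "x + y \<in> C" and uw: "set u \<subseteq> C" "set w \<subseteq> C" using less.prems C_add by auto
 have U: "U (u @ (x + y) # w) = U (u @ x # w) + U (u @ y # w)"
 proof -
  let ?m = "\<lambda>a b. if a = [] \<or> b = [] then 0 else mul (F a) (F b)"
  have 1: "splits ?m (u @ (x + y) # w) = splits ?m (u @ x # w) + splits ?m (u @ y # w)"
  proof -
   have "splits (\<lambda>a b. ?m a (b @ (x + y) # w)) u = splits (\<lambda>a b. ?m a (b @ x # w) + ?m a (b @ y # w)) u"
    by (rule splits_cong) (use less.prems in \<open>auto simp: IHF mul_right\<close>)
   moreover have "splits (\<lambda>a b. ?m (u @ (x + y) # a) b) w = splits (\<lambda>a b. ?m (u @ x # a) b + ?m (u @ y # a) b) w"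
    by (rule splits_cong) (use less.prems in \<open>auto simp: IHF mul_left\<close>)
   ultimately show ?thesis unfolding splits_letter splits_add by (simp add: ac_simps)
  qed
  let ?n = "length u + length w + 1"
  let ?G = "\<lambda>a b c. if 2 \<le> length b \<and> length b < ?n then F (a @ X b # c) else 0"
  have 2: "splits3 ?G (u @ (x + y) # w) = splits3 ?G (u @ x # w) + splits3 ?G (u @ y # w)"
  proof -
   have "splits3 (\<lambda>r b c. ?G (u @ (x + y) # r) b c) w = splits3 (\<lambda>r b c. ?G (u @ x # r) b c + ?G (u @ y # r) b c) w"
   proof (rule splits3_cong)
    fix r b c assume e: "r @ b @ c = w"
    show "?G (u @ (x + y) # r) b c = ?G (u @ x # r) b c + ?G (u @ y # r) b c"
     using IHF [of u "r @ X b # c" x y] closed_X [of b] e uw xy by auto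
   qed
   moreover have "splits3 (\<lambda>a b r. ?G a b (r @ (x + y) # w)) u = splits3 (\<lambda>a b r. ?G a b (r @ x # w) + ?G a b (r @ y # w)) u"
   proof (rule splits3_cong)
    fix a b r assume e: "a @ b @ r = u"
    show "?G a b (r @ (x + y) # w) = ?G a b (r @ x # w) + ?G a b (r @ y # w)"
     using IHF [of "a @ X b # r" w x y] closed_X [of b] e uw xy by auto
   qed
   moreover have "splits (\<lambda>a r. splits (\<lambda>t c. ?G a (r @ (x + y) # t) c) w) u = 
    splits (\<lambda>a r. splits (\<lambda>t c. ?G a (r @ x # t) c + ?G a (r @ y # t) c) w) u"
   proof (rule splits_cong, rule splits_cong)
    fix a r t c assume e: "a @ r = u" "t @ c = w"
    show "?G a (r @ (x + y) # t) c = ?G a (r @ x # t) c + ?G a (r @ y # t) c"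
    proof (cases "2 \<le> length (r @ x # t) \<and> length (r @ x # t) < ?n")
     case True
     have "X (r @ x # t) \<in> C" "X (r @ y # t) \<in> C" using e uw xy by (auto intro!: closed_X)
     then have "F (a @ (X (r @ x # t) + X (r @ y # t)) # c) = F (a @ X (r @ x # t) # c) + F (a @ X (r @ y # t) # c)"
      using True e uw by (intro IHF) auto
     moreover have "X (r @ (x + y) # t) = X (r @ x # t) + X (r @ y # t)"
      using True e uw xy by (intro IHX) auto
     ultimately show ?thesis using True by simp
    qed auto
   qed
   ultimately show ?thesis unfolding splits3_letter splits_add splits3_add by (simp add: ac_simps)
  qed
  show ?thesis using 1 2 unfolding U_rec by (simp add: ac_simps)
 qed
 have mem: "U (u @ x # w) \<in> A" "U (u @ y # w) \<in> A" "U (u @ (x + y) # w) \<in> A" using uw xy by (auto intro!: closed_U)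
 have X: "X (u @ (x + y) # w) = X (u @ x # w) + X (u @ y # w)"
  using U p_add mem by (auto simp: X_def X_of_def)
 have memX: "X (u @ x # w) \<in> A" "X (u @ y # w) \<in> A" using uw xy by (auto intro!: closed_X C_A)
 have "F (u @ (x + y) # w) = F (u @ x # w) + F (u @ y # w)"
 proof (cases "2 \<le> length (u @ x # w)")
  case True
  then have l: "2 \<le> length (u @ z # w)" for z by simp
  have "F (u @ (x + y) # w) = h ((X (u @ x # w) + U (u @ x # w)) + (X (u @ y # w) + U (u @ y # w)))"
   unfolding F_long [OF l] U X by (simp add: ac_simps)
  also have "\<dots> = h (X (u @ x # w) + U (u @ x # w)) + h (X (u @ y # w) + U (u @ y # w))"
   by (rule h_add) (use mem memX A_add in auto)
  finally show ?thesis unfolding F_long [OF l] .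
 next
  case False
  then have "u = []" "w = []" by (cases u; cases w; auto)+
  then show ?thesis by simp
 qed
 then show ?case using U X by blast
qed

lemma zero_slot: 
 assumes "set u \<subseteq> C" "set w \<subseteq> C"
 shows "F (u @ 0 # w) = 0" "X (u @ 0 # w) = 0"
 using additive [OF assms C_zero C_zero] by simp_all

section \<open>The structure relations\<close>

definition Q :: "'a list => 'a" where "Q xs = splits (\<lambda>a b. mul (F a) (F b)) xs"
definition T :: "'a list => 'a" where "T xs = splits3 (\<lambda>a b c. F (a @ X b # c)) xs"
definition E :: "'a list => 'a" where "E xs = splits3 (\<lambda>a b c. X (a @ X b # c)) xs"

lemma short_X: "length b < 2 ==> X b = 0"
 by (simp add: X_def X_of_def)

lemma Q_guard: "splits (\<lambda>a b. if a = [] \<or> b = [] then 0 else mul (F a) (F b)) xs = Q xs"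
 unfolding Q_def by (rule splits_cong) (auto simp: zeros)

lemma T_guard:
 assumes "set xs \<subseteq> C"
 shows "splits3 (\<lambda>a b c. if 2 \<le> length b \<and> length b < length xs then F (a @ X b # c) else 0) xs = T xs + X xs"
proof -
 have "splits3 (\<lambda>a b c. if 2 \<le> length b \<and> length b < length xs then F (a @ X b # c) else 0) xs =
   splits3 (\<lambda>a b c. if length b < length xs then F (a @ X b # c) else 0) xs"
 proof (rule splits3_cong)
  fix a b c assume e: "a @ b @ c = xs"
  then have "set a \<subseteq> C" "set c \<subseteq> C" using assms by auto
  then show "(if 2 \<le> length b \<and> length b < length xs then F (a @ X b # c) else 0) =
   (if length b < length xs then F (a @ X b # c) else 0)"
   using short_X [of b] zero_slot [of a c] by auto
 qed
 moreover have "T xs = splits3 (\<lambda>a b c. if length b < length xs then F (a @ X b # c) else 0) xs + X xs"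
  unfolding T_def by (subst splits3_whole) simp
 ultimately show ?thesis by (simp add: double add.assoc)
qed

lemma U_eq: "set xs \<subseteq> C ==> U xs = Q xs + (T xs + X xs)"
 by (simp only: U_rec Q_guard T_guard)

lemma Q_zero_slot: "set u \<subseteq> C ==> set w \<subseteq> C ==> Q (u @ 0 # w) = 0"
proof -
 assume uw: "set u \<subseteq> C" "set w \<subseteq> C"
 have "splits (\<lambda>a b. mul (F a) (F (b @ 0 # w))) u = splits (\<lambda>a b. 0) u"
  by (rule splits_cong) (use uw zero_slot zeros in auto)
 moreover have "splits (\<lambda>a b. mul (F (u @ 0 # a)) (F b)) w = splits (\<lambda>a b. 0) w"
  by (rule splits_cong) (use uw zero_slot zeros in auto)
 ultimately show ?thesis by (simp add: Q_def splits_letter)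
qed

lemma T_zero_slot: "set u \<subseteq> C ==> set w \<subseteq> C ==> T (u @ 0 # w) = 0"
proof -
 assume uw: "set u \<subseteq> C" "set w \<subseteq> C"
 have "splits3 (\<lambda>r b c. F ((u @ 0 # r) @ X b # c)) w = splits3 (\<lambda>r b c. 0) w"
 proof (rule splits3_cong)
  fix r b c assume e: "r @ b @ c = w"
  then show "F ((u @ 0 # r) @ X b # c) = 0"
   using zero_slot [of u "r @ X b # c"] closed_X [of b] uw by auto
 qed
 moreover have "splits3 (\<lambda>a b r. F (a @ X b # (r @ 0 # w))) u = splits3 (\<lambda>a b r. 0) u"
 proof (rule splits3_cong)
  fix a b r assume e: "a @ b @ r = u"
  then show "F (a @ X b # (r @ 0 # w)) = 0"
   using zero_slot [of "a @ X b # r" w] closed_X [of b] uw by auto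
 qed
 moreover have "splits (\<lambda>a r. splits (\<lambda>t c. F (a @ X (r @ 0 # t) # c)) w) u = splits (\<lambda>a r. splits (\<lambda>t c. 0) w) u"
  by (rule splits_cong, rule splits_cong) (use uw zero_slot in auto)
 ultimately show ?thesis by (simp add: T_def splits3_letter)
qed

lemma d_splits: "d (splits G xs) = splits (\<lambda>a b. d (G a b)) xs"
 using splits_additive [of UNIV d xs G] d_add by simp

lemma d_splits3: "d (splits3 G xs) = splits3 (\<lambda>a b c. d (G a b c)) xs"
 using splits3_additive [of UNIV d xs G] d_add by simp

lemma mul_splits: "mul (splits G xs) y = splits (\<lambda>a b. mul (G a b) y) xs" "mul y (splits G xs) = splits (\<lambda>a b. mul y (G a b)) xs"
 using splits_additive [of UNIV "\<lambda>x. mul x y" xs G] splits_additive [of UNIV "mul y" xs G] mul_left mul_right by simp_all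

lemma mul_splits3: "mul (splits3 G xs) y = splits3 (\<lambda>a b c. mul (G a b c) y) xs" "mul y (splits3 G xs) = splits3 (\<lambda>a b c. mul y (G a b c)) xs"
 using splits3_additive [of UNIV "\<lambda>x. mul x y" xs G] splits3_additive [of UNIV "mul y" xs G] mul_left mul_right by simp_all

text \<open>By the Leibniz rule and the morphism relation for shorter words. The terms with three
  factors appear in both bracketings and cancel; in the others an operation is inserted in one of
  the two factors, which is the sum of Q over all inserted blocks.\<close>

lemma d_Q:
 assumes C: "set xs \<subseteq> C" and R: "\<And>ys. length ys < length xs ==> set ys \<subseteq> C ==> d (F ys) = T ys + Q ys"
 shows "d (Q xs) = splits3 (\<lambda>u v w. Q (u @ X v # w)) xs"
proof -
 have "d (Q xs) = splits (\<lambda>a b. d (mul (F a) (F b))) xs"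
  unfolding Q_def by (rule d_splits)
 also have "\<dots> = splits (\<lambda>a b. (mul (T a) (F b) + mul (F a) (T b)) + (mul (Q a) (F b) + mul (F a) (Q b))) xs"
 proof (rule splits_cong)
  fix a b assume e: "a @ b = xs"
  have ab: "set a \<subseteq> C" "set b \<subseteq> C" using e C by auto
  have "mul (d (F a)) (F b) = mul (T a + Q a) (F b)"
   using R [of a] e ab by (cases "b = []") (auto simp: zeros)
  moreover have "mul (F a) (d (F b)) = mul (F a) (T b + Q b)"
   using R [of b] e ab by (cases "a = []") (auto simp: zeros)
  ultimately show "d (mul (F a) (F b)) = (mul (T a) (F b) + mul (F a) (T b)) + (mul (Q a) (F b) + mul (F a) (Q b))"
   by (simp add: leib [OF closed_F [OF ab(1)] closed_F [OF ab(2)]] mul_left mul_right ac_simps)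
 qed
 also have "\<dots> = splits (\<lambda>a b. mul (T a) (F b) + mul (F a) (T b)) xs + 
   (splits (\<lambda>a b. mul (Q a) (F b)) xs + splits (\<lambda>a b. mul (F a) (Q b)) xs)"
  by (simp add: splits_add)
 also have "splits (\<lambda>a b. mul (Q a) (F b)) xs = splits (\<lambda>a b. mul (F a) (Q b)) xs"
 proof -
  have "splits (\<lambda>a b. mul (Q a) (F b)) xs = splits (\<lambda>l c. splits (\<lambda>a b. mul (mul (F a) (F b)) (F c)) l) xs"
   by (simp add: Q_def mul_splits)
  also have "\<dots> = splits (\<lambda>a r. splits (\<lambda>b c. mul (mul (F a) (F b)) (F c)) r) xs"
   by (rule splits_assoc [symmetric])
  also have "\<dots> = splits (\<lambda>a r. splits (\<lambda>b c. mul (F a) (mul (F b) (F c))) r) xs"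
   by (rule splits_cong, rule splits_cong) (use C in \<open>auto intro!: mul_assoc closed_F\<close>)
  finally show ?thesis by (simp add: Q_def mul_splits)
 qed
 also have "splits (\<lambda>a b. mul (T a) (F b) + mul (F a) (T b)) xs = splits3 (\<lambda>u v w. Q (u @ X v # w)) xs"
 proof -
  have "splits3 (\<lambda>u v w. Q (u @ X v # w)) xs = 
    splits3 (\<lambda>u v w. splits (\<lambda>a b. mul (F a) (F (b @ X v # w))) u) xs +
    splits3 (\<lambda>u v w. splits (\<lambda>a b. mul (F (u @ X v # a)) (F b)) w) xs"
   by (simp add: Q_def splits_letter splits3_add)
  also have "\<dots> = splits (\<lambda>a r. splits3 (\<lambda>b v w. mul (F a) (F (b @ X v # w))) r) xs +
    splits (\<lambda>r b. splits3 (\<lambda>u v a. mul (F (u @ X v # a)) (F b)) r) xs"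
   by (simp add: splits_left3 splits_right3)
  finally show ?thesis by (simp add: T_def mul_splits3 splits_add add.commute)
 qed
 finally show ?thesis by (simp add: double)
qed

text \<open>Two blocks are inserted. Disjoint ones occur in both orders and cancel; nested ones sum
  to F with E of the outer block inserted, and by induction only the whole word survives as outer
  block.\<close>

lemma splits3_T:
 assumes C: "set xs \<subseteq> C" and E: "\<And>ys. length ys < length xs ==> set ys \<subseteq> C ==> E ys = 0"
 shows "splits3 (\<lambda>u v w. T (u @ X v # w)) xs = E xs"
proof -
 have "splits3 (\<lambda>u v w. T (u @ X v # w)) xs = 
   splits3 (\<lambda>u v w. splits3 (\<lambda>r b c. F (u @ X v # r @ X b # c)) w) xs +
   splits3 (\<lambda>u v w. splits3 (\<lambda>a b r. F (a @ X b # r @ X v # w)) u) xs +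
   splits3 (\<lambda>u v w. splits (\<lambda>a r. splits (\<lambda>t c. F (a @ X (r @ X v # t) # c)) w) u) xs"
  by (simp add: T_def splits3_letter splits3_add)
 also have "splits3 (\<lambda>u v w. splits3 (\<lambda>r b c. F (u @ X v # r @ X b # c)) w) xs =
   splits3 (\<lambda>u v w. splits3 (\<lambda>a b r. F (a @ X b # r @ X v # w)) u) xs"
  by (rule splits3_comm)
 also have "splits3 (\<lambda>u v w. splits (\<lambda>a r. splits (\<lambda>t c. F (a @ X (r @ X v # t) # c)) w) u) xs =
   splits3 (\<lambda>a l c. splits3 (\<lambda>r v t. F (a @ X (r @ X v # t) # c)) l) xs"
  by (rule splits3_nested)
 also have "\<dots> = splits3 (\<lambda>a l c. F (a @ E l # c)) xs"
 proof (rule splits3_cong)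
  fix a l c assume e: "a @ l @ c = xs"
  have "E l \<in> C \<and> F (a @ E l # c) = splits3 (\<lambda>r v t. F (a @ X (r @ X v # t) # c)) l"
   unfolding E_def
  proof (rule splits3_additive)
   fix x y assume "x \<in> C" "y \<in> C"
   then show "x + y \<in> C \<and> F (a @ (x + y) # c) = F (a @ x # c) + F (a @ y # c)"
    using additive [of a c x y] C_add e C by auto
  next
   fix r v t assume "r @ v @ t = l"
   then have s: "set r \<subseteq> C" "set v \<subseteq> C" "set t \<subseteq> C" using e C by auto
   then show "X (r @ X v # t) \<in> C" using closed_X [of v] by (intro closed_X) auto
  qed
  then show "splits3 (\<lambda>r v t. F (a @ X (r @ X v # t) # c)) l = F (a @ E l # c)" by simp
 qed
 also have "\<dots> = splits3 (\<lambda>a l c. if length l < length xs then F (a @ E l # c) else 0) xs + E xs"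
  by (subst splits3_whole) simp
 also have "splits3 (\<lambda>a l c. if length l < length xs then F (a @ E l # c) else 0) xs = splits3 (\<lambda>a l c. 0) xs"
  by (rule splits3_cong) (use E C zero_slot in auto)
 finally show ?thesis by (simp add: double)
qed

text \<open>The differential of U uses the morphism relation for shorter words and the cancellation
  of blocks uses \<open>E = 0\<close> for shorter words, so all claims share one induction on
  length.\<close>

theorem relations:
 "set xs \<subseteq> C ==> d (F xs) = T xs + Q xs \<and> d (U xs) = 0 \<and> E xs = 0"
proof (induction "length xs" arbitrary: xs rule: less_induct)
 case less
 have R: "d (F ys) = T ys + Q ys" and E0: "E ys = 0" if "length ys < length xs" "set ys \<subseteq> C" for ys
  using less.hyps that by auto
 note C = less.prems
 show ?case
 proof (cases "length xs < 2")
  case True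
  then consider "xs = []" | x where "xs = [x]" by (cases xs) (auto simp: Suc_le_eq)
  then have "T xs = 0 \<and> Q xs = 0 \<and> d (F xs) = 0 \<and> E xs = 0"
  proof cases
   case 1
   then show ?thesis by (simp add: T_def Q_def E_def splits3_def zeros)
  next
   case 2
   then have "x \<in> C" using C by simp
   then show ?thesis using 2 zero_slot [of "[]" "[x]"] zero_slot [of "[x]" "[]"]
    by (simp add: T_def Q_def E_def splits3_def zeros d_C)
  qed
  moreover have "X xs = 0" using True by (rule short_X)
  ultimately show ?thesis using U_eq [OF C] by (simp add: zeros)
 next
  case False
  have dT: "d (T xs) = splits3 (\<lambda>u v w. T (u @ X v # w) + Q (u @ X v # w)) xs"
   unfolding T_def [of xs] d_splits3
  proof (rule splits3_cong)
   fix u v w assume e: "u @ v @ w = xs"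
   then have s: "set u \<subseteq> C" "set v \<subseteq> C" "set w \<subseteq> C" using C by auto
   show "d (F (u @ X v # w)) = T (u @ X v # w) + Q (u @ X v # w)"
   proof (cases "length v < 2")
    case True
    then show ?thesis using s by (simp add: short_X zero_slot T_zero_slot Q_zero_slot zeros)
   next
    case False
    then show ?thesis using e s closed_X [OF s(2)] by (intro R) auto
   qed
  qed
  have "d (T xs) = E xs + d (Q xs)"
   unfolding dT splits3_add using splits3_T [OF C E0] d_Q [OF C R] by simp
  then have "d (T xs) + d (Q xs) = E xs" by (simp add: add.assoc double)
  moreover have dX: "d (X xs) = 0" using closed_X [OF C] d_C by blast
  ultimately have dU: "d (U xs) = E xs" using U_eq [OF C] by (simp add: d_add ac_simps)
  have UA: "U xs \<in> A" by (rule closed_U [OF C])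
  have EC: "E xs \<in> C"
  proof -
   have "E xs \<in> C \<and> id (E xs) = splits3 (\<lambda>a b c. id (X (a @ X b # c))) xs"
    unfolding E_def
   proof (rule splits3_additive)
    fix r v t assume "r @ v @ t = xs"
    then have s: "set r \<subseteq> C" "set v \<subseteq> C" "set t \<subseteq> C" using C by auto
    then show "X (r @ X v # t) \<in> C" using closed_X [of v] by (intro closed_X) auto
   qed (simp add: C_add)
   then show ?thesis ..
  qed
  \<comment> \<open>On a boundary the homotopy identity reads d a + p (d a) = d (h (d a)), and
    expanding h (d a) by the identity at a turns the right side into d a.\<close>
  have pd: "p (d a) = 0" if "a \<in> A" for a
  proof -
   have "d a + p (d a) = d (h (d a)) + h (d (d a))" using homotopy [OF d_A [OF that]] by simp
   also have "\<dots> = d (h (d a))" using d_d [OF that] by (simp add: zeros)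
   also have "h (d a) = a + p a + d (h a)" 
    using homotopy [OF that] double [of "d (h a)"] by (metis add.assoc add.commute add_0)
   also have "d (a + p a + d (h a)) = d a"
    using that by (simp add: d_add d_C p_C d_d h_A)
   finally show ?thesis by simp
  qed
  have "E xs = 0" using p_id [OF EC] pd [OF UA] dU by simp
  have dU0: "d (U xs) = 0" using dU \<open>E xs = 0\<close> by simp
  have l: "2 \<le> length xs" using False by simp
  have XA: "X xs \<in> A" using closed_X [OF C] C_A by blast
  have "d (F xs) = d (h (X xs + U xs)) + h (d (X xs + U xs))"
   using F_long [OF l] dX dU0 by (simp add: d_add zeros)
  also have "\<dots> = X xs + U xs + p (X xs + U xs)" using XA UA by (simp add: homotopy A_add)
  \<comment> \<open>\<open>X xs\<close> is the projection of \<open>U xs\<close> and is fixed by p,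
    so it occurs twice. This is why F applies h to the sum of X and U: nothing is left of the
    projection.\<close>
  also have "p (X xs + U xs) = 0"
   using p_add [OF XA UA] p_id [OF closed_X [OF C]] X_long [OF l] by (simp add: double)
  also have "X xs + U xs + 0 = T xs + Q xs"
   unfolding U_eq [OF C] using double [of "X xs"] by (simp add: ac_simps)
  finally show ?thesis using \<open>E xs = 0\<close> dU0 by blast
 qed
qed

end

section \<open>Gradings of the transferred operations\<close>

text \<open>A grading is absent for tensors with an idempotent mismatch, on which all operations vanish.\<close>

type_synonym grade = "(hclass \<times> nat set \<times> nat set \<times> rat) option"

definition graded_part :: "arc_data => grade => chain set" where
 "graded_part Z a = (case a of None => {0} | Some (h, s, t, g) => alg_gr Z (h, s, t) g)"

fun grade_mult :: "arc_data => grade => grade => grade" where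
 "grade_mult Z (Some (h, s, t, g)) (Some (h', s', t', g')) =
  (if t = s' then Some (h + h', s, t', g + g' + mlt Z h' (bdry h)) else None)"
| "grade_mult Z _ _ = None"

fun grade_shift :: "rat => grade => grade" where
 "grade_shift k (Some (h, s, t, g)) = Some (h, s, t, g + k)"
| "grade_shift k None = None"

text \<open>\<open>None\<close> on the empty list is a default value; only nonempty tensors are
  graded.\<close>

fun total_grade :: "arc_data => grade list => grade" where
 "total_grade Z [] = None"
| "total_grade Z [a] = a"
| "total_grade Z (a # b # as) = grade_mult Z a (total_grade Z (b # as))"

lemma mlt_add: "mlt Z (h + k) c = mlt Z h c + mlt Z k c"
 and mlt_add_chain: "mlt Z h (c + c') = mlt Z h c + mlt Z h c'"
 by (simp_all add: mlt_def avg_mult_add lookup_add algebra_simps sum.distrib)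

lemma bdry_add: "bdry (h + k) = bdry h + bdry k"
 by (rule poly_mapping_eqI) (simp add: lookup_bdry lookup_add)

lemma mlt_zero: "mlt Z 0 c = 0"
 by (simp add: mlt_def avg_mult_def)

lemma grade_cases:
 obtains "a = None" | h s t g where "a = Some (h, s, t, g)"
 by (cases a) auto

lemma grade_mult_None [simp]: "grade_mult Z a None = None"
 by (cases a rule: grade_cases) simp_all

text \<open>The correction m(h', \<partial> h) is additive in both classes, so both bracketings
  collect the same three corrections.\<close>

lemma grade_mult_assoc: "grade_mult Z (grade_mult Z a b) c = grade_mult Z a (grade_mult Z b c)"
 by (cases a rule: grade_cases; cases b rule: grade_cases; cases c rule: grade_cases)
  (simp_all add: mlt_add mlt_add_chain bdry_add)

lemma grade_shift_0 [simp]: "grade_shift 0 a = a"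
 by (cases a rule: grade_cases) simp_all

lemma grade_shift_shift [simp]: "grade_shift k (grade_shift l a) = grade_shift (l + k) a"
 by (cases a rule: grade_cases) simp_all

lemma grade_mult_shift: "grade_mult Z (grade_shift k a) (grade_shift l b) = grade_shift (k + l) (grade_mult Z a b)"
 by (cases a rule: grade_cases; cases b rule: grade_cases) simp_all

lemma total_grade_append: "as \<noteq> [] ==> bs \<noteq> [] ==> total_grade Z (as @ bs) = grade_mult Z (total_grade Z as) (total_grade Z bs)"
proof (induction as)
 case (Cons a as)
 obtain b bs' where b: "bs = b # bs'" using Cons.prems by (cases bs) auto
 show ?case
 proof (cases as)
  case Nil
  then show ?thesis by (simp add: b)
 next
  case (Cons c cs)
  have "total_grade Z ((a # as) @ bs) = grade_mult Z a (total_grade Z (as @ bs))" by (simp add: Cons)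
  also have "\<dots> = grade_mult Z (grade_mult Z a (total_grade Z as)) (total_grade Z bs)"
   using Cons.IH Cons.prems Cons by (simp add: grade_mult_assoc)
  finally show ?thesis by (simp add: Cons)
 qed
qed simp

lemma total_grade_shift: "total_grade Z (as @ grade_shift k b # cs) = grade_shift k (total_grade Z (as @ b # cs))"
proof -
 have c: "total_grade Z (grade_shift k b # cs) = grade_shift k (total_grade Z (b # cs))"
  using grade_mult_shift [of Z k b 0] by (cases cs) simp_all
 then show ?thesis
 proof (cases "as = []")
  case False
  then show ?thesis
   using grade_mult_shift [of Z 0 "total_grade Z as" k "total_grade Z (b # cs)"] c by (simp add: total_grade_append)
 qed simp
qed

lemma total_grade_nested:
 assumes "bs \<noteq> []"
 shows "total_grade Z (as @ total_grade Z bs # cs) = total_grade Z (as @ bs @ cs)"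
proof -
 have c: "total_grade Z (total_grade Z bs # cs) = total_grade Z (bs @ cs)"
  using assms total_grade_append [of bs cs Z] by (cases cs) simp_all
 then show ?thesis
  using assms by (cases "as = []") (simp_all add: total_grade_append)
qed

lemma graded_part_zero [simp]: "0 \<in> graded_part Z a"
 by (cases a rule: grade_cases) (simp_all add: graded_part_def)

lemma graded_part_add: "x \<in> graded_part Z a ==> y \<in> graded_part Z a ==> x + y \<in> graded_part Z a"
 by (cases a rule: grade_cases) (simp_all add: graded_part_def alg_gr_add)

lemma graded_part_sum: "(\<And>i. i \<in> I ==> x i \<in> graded_part Z a) ==> (\<Sum>i\<in>I. x i) \<in> graded_part Z a"
 by (induction I rule: infinite_finite_induct) (simp_all add: graded_part_add)

lemma graded_part_mult:
 "arc_diagram Z ==> x \<in> graded_part Z a ==> y \<in> graded_part Z b ==> chain_mult x y \<in> graded_part Z (grade_mult Z a b)"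
 by (cases a rule: grade_cases; cases b rule: grade_cases) (auto simp: graded_part_def mult_graded mult_mismatch)

lemma splits_graded: "(\<And>u v. u @ v = xs ==> G u v \<in> graded_part Z a) ==> splits G xs \<in> graded_part Z a"
 unfolding splits_sum by (rule graded_part_sum) simp

lemma splits3_graded: "(\<And>u v w. u @ v @ w = xs ==> G u v w \<in> graded_part Z a) ==> splits3 G xs \<in> graded_part Z a"
 unfolding splits3_def by (rule splits_graded, rule splits_graded) simp

context contraction
begin

sublocale tr: transfer "alg Z" selected_chains chain_mult diff hmap pmap
proof
 fix x y z :: chain
 show "x + x = 0" by simp
 show "chain_mult (x + y) z = chain_mult x z + chain_mult y z" by (rule chain_mult_add_left)
 show "chain_mult z (x + y) = chain_mult z x + chain_mult z y" by (rule chain_mult_add_right)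
 show "diff (x + y) = diff x + diff y" by (rule diff_add)
 show "x \<in> selected_chains ==> x \<in> alg Z" by (rule selected_alg)
 show "0 \<in> selected_chains" by (rule selected_zero)
 show "x \<in> selected_chains ==> y \<in> selected_chains ==> x + y \<in> selected_chains" by (rule selected_add)
 show "x \<in> selected_chains ==> diff x = 0" by (rule diff_selected)
 show "x \<in> selected_chains ==> pmap x = x" by (rule pmap_id)
 assume x: "x \<in> alg Z"
 show "diff x \<in> alg Z" by (rule diff_alg [OF x])
 show "diff (diff x) = 0" by (rule alg_diff_diff [OF x])
 show "pmap x \<in> selected_chains" by (rule pmap_selected)
 show "hmap x \<in> alg Z" by (rule hmap_alg)
 show "diff (hmap x) + hmap (diff x) = x + pmap x" by (rule homotopy_chain [OF x])
 assume y: "y \<in> alg Z"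
 show "x + y \<in> alg Z" by (rule alg_add [OF x y])
 show "chain_mult x y \<in> alg Z" by (rule chain_mult_alg [OF Z x y])
 show "diff (chain_mult x y) = chain_mult (diff x) y + chain_mult x (diff y)" by (rule alg_leibniz [OF x y])
 show "pmap (x + y) = pmap x + pmap y" by (rule pmap_add [OF x y])
 show "hmap (x + y) = hmap x + hmap y" by (rule hmap_add [OF x y])
 assume z: "z \<in> alg Z"
 show "chain_mult (chain_mult x y) z = chain_mult x (chain_mult y z)" by (rule alg_mult_assoc [OF x y z])
qed

lemma hmap_graded: "x \<in> graded_part Z a ==> hmap x \<in> graded_part Z (grade_shift 1 a)"
 and pmap_graded: "x \<in> graded_part Z a ==> pmap x \<in> graded_part Z a"
 by (cases a rule: grade_cases; simp add: graded_part_def hmap_gr pmap_gr)+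

text \<open>With n letters, a product of operations on i and n - i letters has degree (i - 1) + (n -
  i - 1) = n - 2, an inner operation on j letters gives (j - 2) + (n - j) = n - 2, and the homotopy
  adds one.\<close>

lemma operations_graded:
 assumes "list_all2 (\<lambda>y a. y \<in> selected_chains \<and> y \<in> graded_part Z a) ys as" "ys \<noteq> []"
 shows "(2 \<le> length ys --> tr.U ys \<in> graded_part Z (grade_shift (of_nat (length ys) - 2) (total_grade Z as)) \<and>
   tr.X ys \<in> graded_part Z (grade_shift (of_nat (length ys) - 2) (total_grade Z as))) \<and>
  tr.F ys \<in> graded_part Z (grade_shift (of_nat (length ys) - 1) (total_grade Z as))"
 using assms
proof (induction "length ys" arbitrary: ys as rule: less_induct)
 case less
 let ?L = "list_all2 (\<lambda>y a. y \<in> selected_chains \<and> y \<in> graded_part Z a)"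
 let ?g = "grade_shift (of_nat (length ys) - 2) (total_grade Z as)"
 have sel: "set u \<subseteq> selected_chains" if "?L u a" for u a
  using that by (auto simp: list_all2_conv_all_nth in_set_conv_nth)
 show ?case
 proof (cases "2 \<le> length ys")
  case False
  then obtain y where y: "ys = [y]" using less.prems(2) by (cases ys; cases "tl ys") auto
  then obtain a where "as = [a]" "y \<in> graded_part Z a" using less.prems(1) by (auto simp: list_all2_Cons1)
  then show ?thesis by (simp add: y)
 next
  case True
  have FF: "(if u = [] \<or> v = [] then 0 else chain_mult (tr.F u) (tr.F v)) \<in> graded_part Z ?g" if uv: "u @ v = ys" for u v
  proof (cases "u = [] \<or> v = []")
   case False
   have "?L (u @ v) as" using less.prems(1) uv by simp
   then obtain a b where ab: "as = a @ b" "?L u a" "?L v b" by (auto simp: list_all2_append1)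
   have ne: "a \<noteq> []" "b \<noteq> []" using False ab(2,3) by auto
   have l: "length u < length ys" "length v < length ys" using uv False by auto
   have "tr.F u \<in> graded_part Z (grade_shift (of_nat (length u) - 1) (total_grade Z a))"
    "tr.F v \<in> graded_part Z (grade_shift (of_nat (length v) - 1) (total_grade Z b))"
    using less.hyps [OF l(1) ab(2)] less.hyps [OF l(2) ab(3)] False by blast+
   note m = graded_part_mult [OF Z this, unfolded grade_mult_shift total_grade_append [OF ne, symmetric]]
   have "of_nat (length u) - 1 + (of_nat (length v) - 1) = (of_nat (length ys) - 2 :: rat)" using uv by auto
   then show ?thesis using m False ab(1) by simp
  qed simp
  have FX: "(if 2 \<le> length v \<and> length v < length ys then tr.F (u @ tr.X v # w) else 0) \<in> graded_part Z ?g" if uvw: "u @ v @ w = ys" for u v w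
  proof (cases "2 \<le> length v \<and> length v < length ys")
   case True
   have "?L (u @ v @ w) as" using less.prems(1) uvw by simp
   then obtain a b c where abc: "as = a @ b @ c" "?L u a" "?L v b" "?L w c" by (auto simp: list_all2_append1)
   have ne: "v \<noteq> []" "b \<noteq> []" using True abc(3) by auto
   let ?b = "grade_shift (of_nat (length v) - 2) (total_grade Z b)"
   have "tr.X v \<in> graded_part Z ?b" using less.hyps [OF _ abc(3) ne(1)] True by blast
   moreover have "tr.X v \<in> selected_chains" by (rule tr.closed_X [OF sel [OF abc(3)]])
   ultimately have L: "?L (u @ tr.X v # w) (a @ ?b # c)" using abc by (intro list_all2_appendI) simp_all
   have l: "length (u @ tr.X v # w) < length ys" using uvw True by auto
   have "tr.F (u @ tr.X v # w) \<in> graded_part Z (grade_shift (of_nat (length (u @ tr.X v # w)) - 1) (total_grade Z (a @ ?b # c)))"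
    using less.hyps [OF l L] by simp
   moreover have "grade_shift (of_nat (length (u @ tr.X v # w)) - 1) (total_grade Z (a @ ?b # c)) = ?g"
   proof -
    have "of_nat (length v) - 2 + (of_nat (length (u @ tr.X v # w)) - 1) = (of_nat (length ys) - 2 :: rat)" using uvw by auto
    then show ?thesis by (simp only: total_grade_shift total_grade_nested [OF ne(2)] grade_shift_shift abc(1))
   qed
   ultimately show ?thesis using True by simp
  qed (simp only: if_False graded_part_zero)
  have U: "tr.U ys \<in> graded_part Z ?g"
   unfolding tr.U_rec [of ys] by (rule graded_part_add, rule splits_graded, erule FF, rule splits3_graded, erule FX)
  have X: "tr.X ys \<in> graded_part Z ?g" unfolding tr.X_long [OF True] by (rule pmap_graded [OF U])
  have "tr.F ys \<in> graded_part Z (grade_shift 1 ?g)" unfolding tr.F_long [OF True] by (rule hmap_graded [OF graded_part_add [OF X U]])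
  moreover have "grade_shift 1 ?g = grade_shift (of_nat (length ys) - 1) (total_grade Z as)" by simp
  ultimately show ?thesis using U X by simp
 qed
qed

end

section \<open>Grades of tensor products of diagrams\<close>

definition diagram_grade :: "arc_data => diagram => grade" where
 "diagram_grade Z D = Some (hgrade D, source D, target D, maslov Z D)"

lemma idem_mismatch_Cons: "idem_mismatch (D # E # Ds) \<longleftrightarrow> target D \<noteq> source E \<or> idem_mismatch (E # Ds)"
proof
 assume "idem_mismatch (D # E # Ds)"
 then obtain i where i: "Suc i < length (D # E # Ds)" "target ((D # E # Ds) ! i) \<noteq> source ((D # E # Ds) ! Suc i)"
  unfolding idem_mismatch_def by blast
 then show "target D \<noteq> source E \<or> idem_mismatch (E # Ds)"
  by (cases i) (auto simp: idem_mismatch_def)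
next
 assume "target D \<noteq> source E \<or> idem_mismatch (E # Ds)"
 then show "idem_mismatch (D # E # Ds)"
 proof
  assume "target D \<noteq> source E"
  then show ?thesis unfolding idem_mismatch_def by (intro exI [of _ 0]) simp
 next
  assume "idem_mismatch (E # Ds)"
  then obtain i where "Suc i < length (E # Ds)" "target ((E # Ds) ! i) \<noteq> source ((E # Ds) ! Suc i)"
   unfolding idem_mismatch_def by blast
  then show ?thesis unfolding idem_mismatch_def by (intro exI [of _ "Suc i"]) simp
 qed
qed

text \<open>Pairs of positions either contain the new first position, and are gathered into one term
  by additivity of m, or are shifted old pairs.\<close>

lemma tensor_maslov_Cons: "tensor_maslov Z (D # Ds) = maslov Z D + tensor_maslov Z Ds + mlt Z (\<Sum>E\<leftarrow>Ds. hgrade E) (bdry (hgrade D))"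
proof -
 let ?n = "length Ds" and ?f = "\<lambda>Ds (j, k). mlt Z (hgrade (Ds ! k)) (bdry (hgrade (Ds ! j)))"
 let ?A = "{(j, k). j < k \<and> k < length (D # Ds)}" and ?B = "{(j, k). j < k \<and> k < ?n}"
 have fB: "finite ?B" by (rule finite_subset [of _ "{..<?n} \<times> {..<?n}"]) auto
 have A: "?A = (\<lambda>k. (0, Suc k)) ` {..<?n} \<union> map_prod Suc Suc ` ?B"
 proof (rule Set.set_eqI)
  fix c :: "nat \<times> nat"
  obtain j k where c: "c = (j, k)" by (cases c)
  show "c \<in> ?A \<longleftrightarrow> c \<in> (\<lambda>k. (0, Suc k)) ` {..<?n} \<union> map_prod Suc Suc ` ?B"
   unfolding c by (cases j; cases k) (auto simp: image_iff map_prod_def)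
 qed
 have i: "inj_on (\<lambda>k. (0::nat, Suc k)) {..<?n}" "inj_on (map_prod Suc Suc) ?B" by (auto simp: inj_on_def)
 have "(\<Sum>c\<in>?A. ?f (D # Ds) c) = (\<Sum>c\<in>(\<lambda>k. (0, Suc k)) ` {..<?n}. ?f (D # Ds) c) + (\<Sum>c\<in>map_prod Suc Suc ` ?B. ?f (D # Ds) c)"
  unfolding A by (rule sum.union_disjoint) (use fB in auto)
 also have "(\<Sum>c\<in>(\<lambda>k. (0, Suc k)) ` {..<?n}. ?f (D # Ds) c) = (\<Sum>k<?n. mlt Z (hgrade (Ds ! k)) (bdry (hgrade D)))"
  unfolding sum.reindex [OF i(1)] by simp
 also have "(\<Sum>c\<in>map_prod Suc Suc ` ?B. ?f (D # Ds) c) = (\<Sum>c\<in>?B. ?f Ds c)"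
  unfolding sum.reindex [OF i(2)] by (rule sum.cong) auto
 also have "(\<Sum>k<?n. mlt Z (hgrade (Ds ! k)) (bdry (hgrade D))) = (\<Sum>E\<leftarrow>Ds. mlt Z (hgrade E) (bdry (hgrade D)))"
  by (simp add: sum_list_sum_nth atLeast0LessThan)
 also have "\<dots> = mlt Z (\<Sum>E\<leftarrow>Ds. hgrade E) (bdry (hgrade D))"
  by (induction Ds) (simp_all add: mlt_zero mlt_add)
 finally show ?thesis by (simp add: tensor_maslov_def case_prod_unfold)
qed

lemma total_diagram_grade:
 "Ds \<noteq> [] ==> total_grade Z (map (diagram_grade Z) Ds) =
  (if idem_mismatch Ds then None else Some (fst (tensor_hdata Ds), fst (snd (tensor_hdata Ds)), snd (snd (tensor_hdata Ds)), tensor_maslov Z Ds))"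
proof (induction Ds)
 case (Cons D Ds)
 show ?case
 proof (cases Ds)
  case Nil
  have e: "{(j, k). j < k \<and> k < length [D]} = {}" by auto
  have "tensor_maslov Z [D] = maslov Z D" unfolding tensor_maslov_def e by simp
  then show ?thesis using Nil by (simp add: diagram_grade_def idem_mismatch_def tensor_hdata_def)
 next
  case Ds: (Cons E Es)
  have ih: "total_grade Z (map (diagram_grade Z) Ds) = (if idem_mismatch Ds then None
    else Some (fst (tensor_hdata Ds), fst (snd (tensor_hdata Ds)), snd (snd (tensor_hdata Ds)), tensor_maslov Z Ds))"
   by (rule Cons.IH) (simp add: Ds)
  have "total_grade Z (map (diagram_grade Z) (D # Ds)) = grade_mult Z (diagram_grade Z D) (total_grade Z (map (diagram_grade Z) Ds))"
   by (simp add: Ds)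
  also have "\<dots> = (if idem_mismatch (D # Ds) then None else Some (fst (tensor_hdata (D # Ds)), fst (snd (tensor_hdata (D # Ds))), snd (snd (tensor_hdata (D # Ds))), tensor_maslov Z (D # Ds)))"
   unfolding ih diagram_grade_def tensor_maslov_Cons [of Z D Ds] by (simp add: tensor_hdata_def Ds idem_mismatch_Cons)
  finally show ?thesis .
 qed
qed simp

section \<open>The transferred structure\<close>

lemma splits3_index:
 "splits3 G xs = (\<Sum>(i, j)\<in>{(i, j). i + j \<le> length xs}. G (take i xs) (take j (drop i xs)) (drop (i + j) xs))"
proof -
 have "splits3 G xs = (\<Sum>i\<le>length xs. \<Sum>j\<le>length xs - i. G (take i xs) (take j (drop i xs)) (drop (i + j) xs))"
  by (simp add: splits3_def splits_sum add.commute)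
 also have "\<dots> = (\<Sum>(i, j)\<in>Sigma {..length xs} (\<lambda>i. {..length xs - i}). G (take i xs) (take j (drop i xs)) (drop (i + j) xs))"
  by (rule sum.Sigma) simp_all
 also have "Sigma {..length xs} (\<lambda>i. {..length xs - i}) = {(i, j). i + j \<le> length xs}" by auto
 finally show ?thesis .
qed

lemma splits_proper:
 "splits (\<lambda>a b. if a = [] \<or> b = [] then 0 else G a b) xs = (\<Sum>i\<in>{1..<length xs}. G (take i xs) (drop i xs))"
 unfolding splits_sum by (rule sum.mono_neutral_cong_right) auto

lemma finite_splittings: "finite {(i, j). i + j \<le> (n::nat)}"
 by (rule finite_subset [of _ "{..n} \<times> {..n}"]) auto

lemma invariant_chains_mono: "x \<in> invariant_chains Z Q ==> (\<And>D. Q D ==> R D) ==> x \<in> invariant_chains Z R"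
 unfolding invariant_chains_def by blast

lemma sum_zero_or: "(\<And>i. i \<in> I ==> f i \<in> {0, e}) ==> (\<Sum>i\<in>I. f i) \<in> {0, e :: chain}"
proof (induction I rule: infinite_finite_induct)
 case (insert i I)
 then have "f i \<in> {0, e}" "sum f I \<in> {0, e}" by simp_all
 then show ?case using insert.hyps by auto
qed simp_all

section \<open>Passing from selected chains to homology\<close>

context contraction
begin

text \<open>Any cycle of the class is projected; \<open>pmap\<close> kills boundaries, so the value
  depends on the class only. This is the map \<open>f_1\<close>.\<close>

definition rep :: "chain set => chain" where
 "rep c = pmap (SOME z. z \<in> cycles Z \<and> cls Z z = c)"

lemma rep_cls:
 assumes "z \<in> cycles Z"
 shows "rep (cls Z z) = pmap z"
proof -
 let ?w = "SOME w. w \<in> cycles Z \<and> cls Z w = cls Z z"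
 have w: "?w \<in> cycles Z" "cls Z ?w = cls Z z"
  using someI [of "\<lambda>w. w \<in> cycles Z \<and> cls Z w = cls Z z" z] assms by auto
 then have "?w + z \<in> boundaries Z" using cls_eq_iff [OF Z w(1) assms] by blast
 then have "pmap (?w + z) = 0" by (rule pmap_boundary)
 then have "pmap ?w + pmap z = 0" using pmap_add cycles_alg w(1) assms by simp
 then show ?thesis unfolding rep_def by (simp add: chain_add_eq_0)
qed

lemma rep_carrier:
 assumes "c \<in> carrier (homology Z)"
 shows "rep c \<in> selected_chains" "cls Z (rep c) = c"
proof -
 obtain z where z: "z \<in> cycles Z" "c = cls Z z" using assms unfolding carrier_homology [OF Z] by blast
 show "rep c \<in> selected_chains" unfolding z(2) rep_cls [OF z(1)] by (rule pmap_selected)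
 show "cls Z (rep c) = c" unfolding z(2) rep_cls [OF z(1)] by (rule cls_pmap [OF z(1)])
qed

lemma rep_cls_selected: "x \<in> selected_chains ==> rep (cls Z x) = x"
 using rep_cls selected_cycles pmap_id by simp

lemma rep_add:
 assumes "x \<in> carrier (homology Z)" "y \<in> carrier (homology Z)"
 shows "rep (x \<oplus>\<^bsub>homology Z\<^esub> y) = rep x + rep y"
proof -
 note r = rep_carrier [OF assms(1)] rep_carrier [OF assms(2)]
 have "x \<oplus>\<^bsub>homology Z\<^esub> y = cls Z (rep x + rep y)"
  using cls_add [OF Z selected_cycles [OF r(1)] selected_cycles [OF r(3)]] r(2,4) by simp
 then show ?thesis using rep_cls_selected [OF selected_add [OF r(1,3)]] by simp
qed

lemma map_rep_selected: "set xs \<subseteq> carrier (homology Z) ==> set (map rep xs) \<subseteq> selected_chains"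
 using rep_carrier(1) by auto

definition Xh :: "chain set list => chain set" where "Xh xs = cls Z (tr.X (map rep xs))"
definition fh :: "chain set list => chain" where "fh xs = tr.F (map rep xs)"

lemma Xh_closed: "set xs \<subseteq> carrier (homology Z) ==> Xh xs \<in> carrier (homology Z)"
 and rep_Xh: "set xs \<subseteq> carrier (homology Z) ==> rep (Xh xs) = tr.X (map rep xs)"
proof -
 assume "set xs \<subseteq> carrier (homology Z)"
 then have X: "tr.X (map rep xs) \<in> selected_chains" by (intro tr.closed_X map_rep_selected)
 show "Xh xs \<in> carrier (homology Z)" unfolding Xh_def by (rule cls_closed [OF Z selected_cycles [OF X]])
 show "rep (Xh xs) = tr.X (map rep xs)" unfolding Xh_def by (rule rep_cls_selected [OF X])
qed

text \<open>An inner operation returns a class whose selected representative is the transferred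
  operation itself, so passing to classes and back changes nothing.\<close>

lemma apply_inner_eq:
 assumes "set xs \<subseteq> carrier (homology Z)"
 shows "apply_inner fh Xh i j xs =
   tr.F (take i (map rep xs) @ tr.X (take j (drop i (map rep xs))) # drop (i + j) (map rep xs))"
  "apply_inner Xh Xh i j xs =
   cls Z (tr.X (take i (map rep xs) @ tr.X (take j (drop i (map rep xs))) # drop (i + j) (map rep xs)))"
proof -
 have "set (take j (drop i xs)) \<subseteq> carrier (homology Z)"
  using assms set_take_subset [of j "drop i xs"] set_drop_subset [of i xs] by blast
 note r = rep_Xh [OF this]
 show "apply_inner fh Xh i j xs =
   tr.F (take i (map rep xs) @ tr.X (take j (drop i (map rep xs))) # drop (i + j) (map rep xs))"
  unfolding apply_inner_def fh_def by (simp add: r take_map drop_map)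
 show "apply_inner Xh Xh i j xs =
   cls Z (tr.X (take i (map rep xs) @ tr.X (take j (drop i (map rep xs))) # drop (i + j) (map rep xs)))"
  unfolding apply_inner_def Xh_def [of "take i xs @ [Xh (take j (drop i xs))] @ drop (i + j) xs"]
  by (simp add: r take_map drop_map)
qed

lemma zero_inner:
 assumes "set ys \<subseteq> selected_chains"
 shows "tr.F (take i ys @ tr.X (take 0 (drop i ys)) # drop (i + 0) ys) = 0"
  "tr.X (take i ys @ tr.X (take 0 (drop i ys)) # drop (i + 0) ys) = 0"
proof -
 have "set (take i ys) \<subseteq> selected_chains" "set (drop (i + 0) ys) \<subseteq> selected_chains"
  using assms set_take_subset [of i ys] set_drop_subset [of "i + 0" ys] by blast+
 from tr.zero_slot [OF this]
 show "tr.F (take i ys @ tr.X (take 0 (drop i ys)) # drop (i + 0) ys) = 0"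
  "tr.X (take i ys @ tr.X (take 0 (drop i ys)) # drop (i + 0) ys) = 0" by simp_all
qed

lemma T_index:
 assumes "set ys \<subseteq> selected_chains"
 shows "tr.T ys = (\<Sum>(i, j)\<in>{(i, j). 1 \<le> j \<and> i + j \<le> length ys}. tr.F (take i ys @ tr.X (take j (drop i ys)) # drop (i + j) ys))"
  "tr.E ys = (\<Sum>(i, j)\<in>{(i, j). 1 \<le> j \<and> i + j \<le> length ys}. tr.X (take i ys @ tr.X (take j (drop i ys)) # drop (i + j) ys))"
proof -
 have z: "snd c = 0" if "c \<in> {(i, j). i + j \<le> length ys} - {(i, j). 1 \<le> j \<and> i + j \<le> length ys}" for c :: "nat \<times> nat"
  using that by auto
 show "tr.T ys = (\<Sum>(i, j)\<in>{(i, j). 1 \<le> j \<and> i + j \<le> length ys}. tr.F (take i ys @ tr.X (take j (drop i ys)) # drop (i + j) ys))"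
  unfolding tr.T_def splits3_index
 proof (rule sum.mono_neutral_right [OF finite_splittings], blast, rule ballI)
  fix c assume c: "c \<in> {(i, j). i + j \<le> length ys} - {(i, j). 1 \<le> j \<and> i + j \<le> length ys}"
  show "(case c of (i, j) => tr.F (take i ys @ tr.X (take j (drop i ys)) # drop (i + j) ys)) = 0"
   unfolding case_prod_unfold z [OF c] by (rule zero_inner(1) [OF assms])
 qed
 show "tr.E ys = (\<Sum>(i, j)\<in>{(i, j). 1 \<le> j \<and> i + j \<le> length ys}. tr.X (take i ys @ tr.X (take j (drop i ys)) # drop (i + j) ys))"
  unfolding tr.E_def splits3_index
 proof (rule sum.mono_neutral_right [OF finite_splittings], blast, rule ballI)
  fix c assume c: "c \<in> {(i, j). i + j \<le> length ys} - {(i, j). 1 \<le> j \<and> i + j \<le> length ys}"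
  show "(case c of (i, j) => tr.X (take i ys @ tr.X (take j (drop i ys)) # drop (i + j) ys)) = 0"
   unfolding case_prod_unfold z [OF c] by (rule zero_inner(2) [OF assms])
 qed
qed

lemma products_eq:
 "(\<Sum>i\<in>{1..<length xs}. chain_mult (fh (take i xs)) (fh (drop i xs))) = tr.Q (map rep xs)"
 unfolding tr.Q_guard [symmetric] splits_proper by (simp add: fh_def take_map drop_map)

lemma U_op_eq:
 assumes xs: "set xs \<subseteq> carrier (homology Z)"
 shows "U_op Xh fh xs = tr.U (map rep xs)"
proof -
 let ?ys = "map rep xs" and ?n = "length xs"
 let ?H = "\<lambda>i j. tr.F (take i ?ys @ tr.X (take j (drop i ?ys)) # drop (i + j) ?ys)"
 have "(\<Sum>(j, k)\<in>{(j, k). 2 \<le> j \<and> j < ?n \<and> j + k \<le> ?n}. apply_inner fh Xh k j xs) =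
   (\<Sum>(j, k)\<in>{(j, k). 2 \<le> j \<and> j < ?n \<and> j + k \<le> ?n}. ?H k j)"
  by (simp only: apply_inner_eq(1) [OF xs])
 also have "\<dots> = (\<Sum>(i, j)\<in>{(i, j). i + j \<le> ?n \<and> 2 \<le> j \<and> j < ?n}. ?H i j)"
  by (rule sum.reindex_bij_witness [of _ prod.swap prod.swap]) auto
 also have "\<dots> = splits3 (\<lambda>a b c. if 2 \<le> length b \<and> length b < length ?ys then tr.F (a @ tr.X b # c) else 0) ?ys"
  unfolding splits3_index
 proof (rule sum.mono_neutral_cong_left)
  show "finite {(i, j). i + j \<le> length ?ys}" by (rule finite_splittings)
 qed (auto split: if_splits)
 finally show ?thesis
  unfolding U_op_def products_eq tr.U_rec [of ?ys] tr.Q_guard by simp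
qed

lemma relations_map:
 assumes "set xs \<subseteq> carrier (homology Z)"
 shows "diff (fh xs) = tr.T (map rep xs) + tr.Q (map rep xs)" "diff (tr.U (map rep xs)) = 0" "tr.E (map rep xs) = 0"
 using tr.relations [OF map_rep_selected [OF assms]] unfolding fh_def by blast+

lemma additive_map:
 assumes "set xs \<subseteq> carrier (homology Z)" "set ys \<subseteq> carrier (homology Z)" "x \<in> carrier (homology Z)" "y \<in> carrier (homology Z)"
 shows "fh (xs @ [x \<oplus>\<^bsub>homology Z\<^esub> y] @ ys) = fh (xs @ [x] @ ys) + fh (xs @ [y] @ ys)"
  "Xh (xs @ [x \<oplus>\<^bsub>homology Z\<^esub> y] @ ys) = Xh (xs @ [x] @ ys) \<oplus>\<^bsub>homology Z\<^esub> Xh (xs @ [y] @ ys)"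
proof -
 let ?u = "map rep xs" and ?w = "map rep ys"
 have s: "set ?u \<subseteq> selected_chains" "set ?w \<subseteq> selected_chains" "rep x \<in> selected_chains" "rep y \<in> selected_chains"
  using assms map_rep_selected rep_carrier(1) by blast+
 note a = tr.additive [OF s]
 show "fh (xs @ [x \<oplus>\<^bsub>homology Z\<^esub> y] @ ys) = fh (xs @ [x] @ ys) + fh (xs @ [y] @ ys)"
  using a by (simp add: fh_def rep_add [OF assms(3,4)])
 have c: "tr.X (?u @ rep x # ?w) \<in> cycles Z" "tr.X (?u @ rep y # ?w) \<in> cycles Z"
  using s by (intro selected_cycles tr.closed_X; simp)+
 show "Xh (xs @ [x \<oplus>\<^bsub>homology Z\<^esub> y] @ ys) = Xh (xs @ [x] @ ys) \<oplus>\<^bsub>homology Z\<^esub> Xh (xs @ [y] @ ys)"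
  using a cls_add [OF Z c] by (simp add: Xh_def rep_add [OF assms(3,4)])
qed

lemma ainf_structure_Xh: "ainf_structure (homology Z) Xh"
 unfolding ainf_structure_def multilinear_def
proof (intro conjI allI impI)
 fix xs :: "chain set list"
 assume xs: "xs \<noteq> [] \<and> set xs \<subseteq> carrier (homology Z)"
 show "Xh xs \<in> carrier (homology Z)" using Xh_closed xs by blast
 let ?ys = "map rep xs" and ?I = "{(i, j). 1 \<le> j \<and> i + j \<le> length xs}"
 let ?g = "\<lambda>c. tr.X (take (fst c) ?ys @ tr.X (take (snd c) (drop (fst c) ?ys)) # drop (fst c + snd c) ?ys)"
 have s: "set ?ys \<subseteq> selected_chains" using xs map_rep_selected by blast
 have sc: "?g c \<in> selected_chains" for c
 proof (rule tr.closed_X)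
  have sub: "set (take i ?ys) \<subseteq> selected_chains" "set (drop i ?ys) \<subseteq> selected_chains" for i
   using s set_take_subset [of i ?ys] set_drop_subset [of i ?ys] by blast+
  have "tr.X (take (snd c) (drop (fst c) ?ys)) \<in> selected_chains"
   by (rule tr.closed_X) (use sub(2) [of "fst c"] set_take_subset [of "snd c" "drop (fst c) ?ys"] in blast)
  then show "set (take (fst c) ?ys @ tr.X (take (snd c) (drop (fst c) ?ys)) # drop (fst c + snd c) ?ys) \<subseteq> selected_chains"
   using sub by simp
 qed
 have fin: "finite ?I" by (rule finite_subset [OF _ finite_splittings [of "length xs"]]) auto
 have "(\<Oplus>\<^bsub>homology Z\<^esub>c\<in>?I. apply_inner Xh Xh (fst c) (snd c) xs) = (\<Oplus>\<^bsub>homology Z\<^esub>c\<in>?I. cls Z (?g c))"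
  using xs by (simp only: apply_inner_eq(2))
 also have "\<dots> = cls Z (\<Sum>c\<in>?I. ?g c)"
  by (rule cls_sum [OF Z fin, symmetric]) (rule selected_cycles [OF sc])
 also have "(\<Sum>c\<in>?I. ?g c) = tr.E ?ys"
  unfolding T_index(2) [OF s] by (simp add: case_prod_unfold)
 also have "\<dots> = 0" using relations_map(3) xs by blast
 finally show "(\<Oplus>\<^bsub>homology Z\<^esub>c\<in>?I. apply_inner Xh Xh (fst c) (snd c) xs) = \<zero>\<^bsub>homology Z\<^esub>"
  by (simp add: cls_zero [OF Z])
next
 fix xs ys :: "chain set list" and x y
 assume "set xs \<subseteq> carrier (homology Z) \<and> set ys \<subseteq> carrier (homology Z) \<and> x \<in> carrier (homology Z) \<and> y \<in> carrier (homology Z)"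
 then show "Xh (xs @ [x \<oplus>\<^bsub>homology Z\<^esub> y] @ ys) = Xh (xs @ [x] @ ys) \<oplus>\<^bsub>homology Z\<^esub> Xh (xs @ [y] @ ys)"
  using additive_map(2) by blast
qed

lemma ainf_morphism_fh: "ainf_morphism Z Xh fh"
 unfolding ainf_morphism_def multilinear_def
proof (intro conjI allI impI)
 fix xs :: "chain set list"
 assume xs: "xs \<noteq> [] \<and> set xs \<subseteq> carrier (homology Z)"
 have s: "set (map rep xs) \<subseteq> selected_chains" using xs map_rep_selected by blast
 show "fh xs \<in> carrier (strand_algebra Z)" unfolding fh_def using tr.closed_F [OF s] by simp
 have "(\<Sum>(i, j)\<in>{(i, j). 1 \<le> j \<and> i + j \<le> length xs}. apply_inner fh Xh i j xs) = tr.T (map rep xs)"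
  unfolding T_index(1) [OF s] using xs by (simp only: apply_inner_eq(1) length_map)
 moreover have "diff (fh xs) + tr.Q (map rep xs) = tr.T (map rep xs)"
  using relations_map(1) xs by (simp add: add.assoc)
 ultimately show "(\<Sum>(i, j)\<in>{(i, j). 1 \<le> j \<and> i + j \<le> length xs}. apply_inner fh Xh i j xs) =
   diff (fh xs) + (\<Sum>i\<in>{1..<length xs}. chain_mult (fh (take i xs)) (fh (drop i xs)))"
  unfolding products_eq by simp
next
 fix xs ys :: "chain set list" and x y
 assume "set xs \<subseteq> carrier (homology Z) \<and> set ys \<subseteq> carrier (homology Z) \<and> x \<in> carrier (homology Z) \<and> y \<in> carrier (homology Z)"
 then show "fh (xs @ [x \<oplus>\<^bsub>homology Z\<^esub> y] @ ys) = fh (xs @ [x] @ ys) \<oplus>\<^bsub>strand_algebra Z\<^esub> fh (xs @ [y] @ ys)"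
  using additive_map(1) by (simp add: strand_algebra_simps)
qed

lemma unary: "x \<in> carrier (homology Z) ==> Xh [x] = \<zero>\<^bsub>homology Z\<^esub>" "fh [x] = rep x"
 by (simp_all add: Xh_def fh_def cls_zero [OF Z])

lemma higher:
 assumes xs: "2 \<le> length xs" "set xs \<subseteq> carrier (homology Z)"
 shows "U_op Xh fh xs \<in> cycles Z" "Xh xs = cls Z (U_op Xh fh xs)"
proof -
 have s: "set (map rep xs) \<subseteq> selected_chains" using xs map_rep_selected by blast
 show c: "U_op Xh fh xs \<in> cycles Z"
  unfolding U_op_eq [OF xs(2)] using tr.closed_U [OF s] relations_map(2) [OF xs(2)] by (simp add: cycles_eq)
 show "Xh xs = cls Z (U_op Xh fh xs)"
  using cls_pmap [OF c] tr.X_long [of "map rep xs"] xs(1) unfolding Xh_def U_op_eq [OF xs(2)] by simp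
qed

lemma binary:
 assumes "x \<in> carrier (homology Z)" "y \<in> carrier (homology Z)"
 shows "Xh [x, y] = x \<otimes>\<^bsub>homology Z\<^esub> y"
proof -
 have e: "{(j, k). 2 \<le> j \<and> j < (2::nat) \<and> j + k \<le> 2} = {}" by auto
 have "{1..<2::nat} = {1}" by auto
 then have "U_op Xh fh [x, y] = chain_mult (rep x) (rep y)" by (simp add: U_op_def unary(2) e numeral_2_eq_2 [symmetric])
 then show ?thesis
  using higher(2) [of "[x, y]"] assms cls_mult [OF Z selected_cycles selected_cycles] rep_carrier by simp
qed

text \<open>At most one selected diagram E has the given H-data, so the projection of a cycle there
  is 0 or E, and it is not 0 because it represents the same nonzero class.\<close>

lemma selection: "cycle_selection Z ord (\<lambda>x. fh [x])"
 unfolding cycle_selection_def unary(2)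
proof (intro conjI ballI allI impI)
 fix x y assume "x \<in> carrier (homology Z)" "y \<in> carrier (homology Z)"
 then show "rep (x \<oplus>\<^bsub>homology Z\<^esub> y) = rep x + rep y" by (rule rep_add)
next
 fix d c assume "tight_hdata Z d" and c: "c \<in> hom_hdata Z d" "c \<noteq> \<zero>\<^bsub>homology Z\<^esub>"
 obtain z where z: "z \<in> cycles Z" "z \<in> alg_hdata Z d" "c = cls Z z" using c(1) unfolding hom_hdata_def by blast
 have pz: "rep c = pmap z" unfolding z(3) by (rule rep_cls [OF z(1)])
 have nz: "pmap z \<noteq> 0" using c(2) cls_pmap [OF z(1)] cls_zero [OF Z] z(3) by auto
 have hd: "hdata_of D = d" if Dz: "D \<in> supp Z z" for D
 proof -
  note z' = z(2) [unfolded alg_hdata_eq]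
  obtain phi where "phi \<in> keys z" "D = diagram_of Z phi" using Dz unfolding invariant_supp [OF z'] by blast
  then show ?thesis using invariant_chainsD(2) [OF z'] by blast
 qed
 have "\<exists>D\<in>supp Z z. Pr D \<noteq> 0"
 proof (rule ccontr)
  assume "\<not> (\<exists>D\<in>supp Z z. Pr D \<noteq> 0)"
  then have "pmap z = 0" unfolding pmap_def lext_def by (intro sum.neutral) blast
  then show False using nz by blast
 qed
 then obtain D E where DE: "D \<in> supp Z z" "core_diagram Z ord E" "hdata_of E = hdata_of D"
  using range_P [OF supp_diagrams] by blast
 have E: "core_diagram Z ord E" "hdata_of E = d" using DE hd by simp_all
 have un: "F = E" if "core_diagram Z ord F" "hdata_of F = d" for F
  by (rule core_unique [OF that(1) E(1)]) (simp add: that(2) E(2))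
 have "Pr F \<in> {0, chain_of Z E}" if F: "F \<in> supp Z z" for F
  using range_P [OF supp_diagrams [OF F]] un hd [OF F] by auto
 then have "pmap z \<in> {0, chain_of Z E}" unfolding pmap_def lext_def by (rule sum_zero_or)
 then have "pmap z = chain_of Z E" using nz by blast
 moreover have "(THE D. selected_diagram Z ord d D) = E"
  by (rule the_equality) (use E un selected_iff in blast)+
 ultimately show "rep c = chain_of Z (THE D. selected_diagram Z ord d D)" using pz by simp
qed

section \<open>The clauses on tensor products of homology classes\<close>

lemma tensor_operations:
 assumes ne: "Ds \<noteq> []" and Ds: "\<forall>D\<in>set Ds. represents_class Z D" and M: "M = map (\<lambda>D. cls Z (chain_of Z D)) Ds"
 shows "set M \<subseteq> carrier (homology Z)"
  "fh M \<in> alg_gr Z (tensor_hdata Ds) (tensor_maslov Z Ds + of_nat (length Ds) - 1)"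
  "tr.X (map rep M) \<in> alg_gr Z (tensor_hdata Ds) (tensor_maslov Z Ds + of_nat (length Ds) - 2)"
  "2 \<le> length Ds ==> tr.U (map rep M) \<in> alg_gr Z (tensor_hdata Ds) (tensor_maslov Z Ds + of_nat (length Ds) - 2)"
  "idem_mismatch Ds ==> fh M = 0" "idem_mismatch Ds ==> tr.X (map rep M) = 0"
proof -
 have cy: "D \<in> diagrams Z" "chain_of Z D \<in> cycles Z" if "D \<in> set Ds" for D
  using Ds that by (auto simp: represents_class_def cycles_eq)
 show "set M \<subseteq> carrier (homology Z)" unfolding M using cls_closed [OF Z] cy(2) by auto
 let ?ys = "map rep M" and ?n = "length Ds"
 have ys: "?ys = map Pr Ds" unfolding M using rep_cls cy by (simp add: pmap_def)
 have "list_all2 (\<lambda>y a. y \<in> selected_chains \<and> y \<in> graded_part Z a) ?ys (map (diagram_grade Z) Ds)"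
  unfolding ys list.rel_map
 proof (rule list.rel_refl_strong)
  fix D assume "D \<in> set Ds"
  then have D: "D \<in> diagrams Z" by (rule cy(1))
  show "Pr D \<in> selected_chains \<and> Pr D \<in> graded_part Z (diagram_grade Z D)"
   using selected_P [OF D] KP_gr(2) [OF D] by (simp add: graded_part_def diagram_grade_def hdata_of_def)
 qed
 note gr = operations_graded [OF this, unfolded total_diagram_grade [OF ne]]
 have len: "length ?ys = ?n" "?ys \<noteq> []" using ne by (simp_all add: ys)
 let ?t = "if idem_mismatch Ds then None else Some (fst (tensor_hdata Ds), fst (snd (tensor_hdata Ds)), snd (snd (tensor_hdata Ds)), tensor_maslov Z Ds)"
 have g: "x \<in> alg_gr Z (tensor_hdata Ds) (tensor_maslov Z Ds + of_nat ?n - k)" "idem_mismatch Ds ==> x = 0"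
  if "x \<in> graded_part Z (grade_shift (of_nat ?n - k) ?t)" for x k
  using that by (auto simp: graded_part_def add_diff_eq split: if_splits)
 have F: "fh M \<in> graded_part Z (grade_shift (of_nat ?n - 1) ?t)" unfolding fh_def using gr len by simp
 show "fh M \<in> alg_gr Z (tensor_hdata Ds) (tensor_maslov Z Ds + of_nat ?n - 1)" "idem_mismatch Ds ==> fh M = 0" using g [OF F] by blast+
 have X: "tr.X ?ys \<in> graded_part Z (grade_shift (of_nat ?n - 2) ?t)"
 proof (cases "2 \<le> ?n")
  case True
  then show ?thesis using gr len by simp
 next
  case False
  \<comment> \<open>On a single letter X vanishes, and zero has every grade.\<close>
  then have "tr.X ?ys = 0" by (intro tr.short_X) (simp add: M)
  then show ?thesis by (simp only: graded_part_zero)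
 qed
 show "tr.X ?ys \<in> alg_gr Z (tensor_hdata Ds) (tensor_maslov Z Ds + of_nat ?n - 2)" "idem_mismatch Ds ==> tr.X ?ys = 0" using g [OF X] by blast+
 show "2 \<le> ?n ==> tr.U ?ys \<in> alg_gr Z (tensor_hdata Ds) (tensor_maslov Z Ds + of_nat ?n - 2)"
  by (rule g(1)) (use gr len in simp)
qed

text \<open>Selected diagrams are viable, so none of them has non-viable H-data.\<close>

lemma selected_nonviable:
 assumes "x \<in> selected_chains" "x \<in> alg_gr Z d g" "\<not> viable_class Z (fst d)"
 shows "x = 0"
proof -
 have "supp Z x = {}"
 proof (rule equals0I)
  fix D assume D: "D \<in> supp Z x"
  have "hdata_of D = d" by (rule supp_gr(1) [OF assms(2) D])
  then show False using core_diagramD(2) [OF selected_supp [OF assms(1) D]] assms(3) by (auto simp: hdata_of_def)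
 qed
 then show ?thesis using alg_expand [OF selected_alg [OF assms(1)]] by simp
qed

lemma nonviable_ideal:
 assumes "x \<in> alg_gr Z d g" "\<not> viable_class Z (fst d)"
 shows "x \<in> ideal_F Z"
 unfolding ideal_F_eq
 by (rule invariant_chains_mono [OF assms(1) [unfolded alg_gr_def]]) (use assms(2) in \<open>auto simp: hdata_of_def\<close>)

text \<open>On a tensor whose total class is not viable, the X operations vanish because their
  values are selected chains, whereas f only inherits the grading and lands in the ideal. The last
  two clauses hold because f is by construction the homotopy applied to the sum of X and U.\<close>

lemma tensor_properties:
 assumes ne: "Ds \<noteq> []" and Ds: "\<forall>D\<in>set Ds. represents_class Z D" and M: "M = map (\<lambda>D. cls Z (chain_of Z D)) Ds"
 shows "\<not> tensor_viable Z Ds ==> fh M \<in> ideal_F Z \<and> Xh M = \<zero>\<^bsub>homology Z\<^esub>"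
  "idem_mismatch Ds ==> fh M = 0"
  "Xh M \<in> hom_hdata Z (tensor_hdata Ds)"
  "fh M \<in> alg_hdata Z (tensor_hdata Ds)"
  "Xh M \<in> hom_maslov Z (tensor_maslov Z Ds + of_nat (length Ds) - 2)"
  "fh M \<in> alg_maslov Z (tensor_maslov Z Ds + of_nat (length Ds) - 1)"
  "2 \<le> length Ds ==> fh [Xh M] - U_op Xh fh M = 0 ==> fh M = 0"
  "2 \<le> length Ds ==> twisted_hdata Z (tensor_hdata Ds) ==> fh M = A_star Z ord (fh [Xh M] - U_op Xh fh M)"
proof -
 note t = tensor_operations [OF assms]
 have Xs: "tr.X (map rep M) \<in> selected_chains" by (rule tr.closed_X [OF map_rep_selected [OF t(1)]])
 have fd: "fst (tensor_hdata Ds) = (\<Sum>D\<leftarrow>Ds. hgrade D)" by (simp add: tensor_hdata_def)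
 have zero_ideal: "0 \<in> ideal_F Z" unfolding ideal_F_eq by simp
 show "fh M \<in> ideal_F Z \<and> Xh M = \<zero>\<^bsub>homology Z\<^esub>" if "\<not> tensor_viable Z Ds"
 proof (cases "idem_mismatch Ds")
  case True
  then show ?thesis using t(5,6) zero_ideal by (simp add: Xh_def cls_zero [OF Z])
 next
  case False
  then have nv: "\<not> viable_class Z (fst (tensor_hdata Ds))" using that fd by (simp add: tensor_viable_def)
  have "tr.X (map rep M) = 0" by (rule selected_nonviable [OF Xs t(3) nv])
  then show ?thesis using nonviable_ideal [OF t(2) nv] by (simp add: Xh_def cls_zero [OF Z])
 qed
 show "idem_mismatch Ds ==> fh M = 0" by (rule t(5))
 show "Xh M \<in> hom_hdata Z (tensor_hdata Ds)" "Xh M \<in> hom_maslov Z (tensor_maslov Z Ds + of_nat (length Ds) - 2)"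
  unfolding Xh_def hom_hdata_def hom_maslov_def
  using selected_cycles [OF Xs] alg_gr_hdata [OF t(3)] alg_gr_maslov [OF t(3)] by blast+
 show "fh M \<in> alg_hdata Z (tensor_hdata Ds)" by (rule alg_gr_hdata [OF t(2)])
 show "fh M \<in> alg_maslov Z (tensor_maslov Z Ds + of_nat (length Ds) - 1)" by (rule alg_gr_maslov [OF t(2)])
 let ?z = "fh [Xh M] - U_op Xh fh M"
 have z: "?z = tr.X (map rep M) + tr.U (map rep M)"
  unfolding unary(2) rep_Xh [OF t(1)] U_op_eq [OF t(1)] by (rule chain_minus)
 have F: "fh M = hmap ?z" if "2 \<le> length Ds"
  unfolding z unfolding fh_def by (rule tr.F_long) (simp add: M that)
 show "fh M = 0" if "2 \<le> length Ds" "?z = 0" using F that by simp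
 show "fh M = A_star Z ord ?z" if "2 \<le> length Ds" "twisted_hdata Z (tensor_hdata Ds)"
  unfolding F [OF that(1)]
 proof (rule hmap_A_star [OF _ that(2)])
  show "?z \<in> alg_gr Z (tensor_hdata Ds) (tensor_maslov Z Ds + of_nat (length Ds) - 2)"
   unfolding z by (rule alg_gr_add [OF t(3) t(4) [OF that(1)]])
 qed
qed

lemma tensor_summary:
 assumes "Ds \<noteq> []" "\<forall>D\<in>set Ds. represents_class Z D" "M = map (\<lambda>D. cls Z (chain_of Z D)) Ds"
 shows "(\<not> tensor_viable Z Ds --> fh M \<in> ideal_F Z \<and> Xh M = \<zero>\<^bsub>homology Z\<^esub>) \<and>
   (idem_mismatch Ds --> fh M = 0) \<and>
   Xh M \<in> hom_hdata Z (tensor_hdata Ds) \<and>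
   fh M \<in> alg_hdata Z (tensor_hdata Ds) \<and>
   Xh M \<in> hom_maslov Z (tensor_maslov Z Ds + of_nat (length Ds) - 2) \<and>
   fh M \<in> alg_maslov Z (tensor_maslov Z Ds + of_nat (length Ds) - 1) \<and>
   (2 \<le> length Ds \<and> fh [Xh M] - U_op Xh fh M = 0 --> fh M = 0) \<and>
   (2 \<le> length Ds \<and> tensor_viable Z Ds \<and> twisted_hdata Z (tensor_hdata Ds) -->
     fh M = A_star Z ord (fh [Xh M] - U_op Xh fh M))"
 by (intro conjI impI) (use tensor_properties [OF assms] in blast)+

end

theorem theorem1p1:
  fixes Z :: arc_data and ord :: pair_order
  assumes "arc_diagram Z" and "pair_ordering Z ord"
  shows "\<exists>X f.
    ainf_structure (homology Z) X \<and>
    (\<forall>x\<in>carrier (homology Z). X [x] = \<zero>\<^bsub>homology Z\<^esub>) \<and>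
    (\<forall>x\<in>carrier (homology Z). \<forall>y\<in>carrier (homology Z). X [x, y] = x \<otimes>\<^bsub>homology Z\<^esub> y) \<and>
    ainf_morphism Z X f \<and>
    cycle_selection Z ord (\<lambda>x. f [x]) \<and>
    (\<forall>xs. 2 \<le> length xs \<and> set xs \<subseteq> carrier (homology Z) \<longrightarrow>
       U_op X f xs \<in> cycles Z \<and> X xs = cls Z (U_op X f xs)) \<and>
    (\<forall>Ds M. Ds \<noteq> [] \<and> (\<forall>D\<in>set Ds. represents_class Z D) \<and>
         M = map (\<lambda>D. cls Z (chain_of Z D)) Ds \<longrightarrow>
       (\<not> tensor_viable Z Ds \<longrightarrow> f M \<in> ideal_F Z \<and> X M = \<zero>\<^bsub>homology Z\<^esub>) \<and>
       (idem_mismatch Ds \<longrightarrow> f M = 0) \<and>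
       X M \<in> hom_hdata Z (tensor_hdata Ds) \<and>
       f M \<in> alg_hdata Z (tensor_hdata Ds) \<and>
       X M \<in> hom_maslov Z (tensor_maslov Z Ds + of_nat (length Ds) - 2) \<and>
       f M \<in> alg_maslov Z (tensor_maslov Z Ds + of_nat (length Ds) - 1) \<and>
       (2 \<le> length Ds \<and> f [X M] - U_op X f M = 0 \<longrightarrow> f M = 0) \<and>
       (2 \<le> length Ds \<and> tensor_viable Z Ds \<and> twisted_hdata Z (tensor_hdata Ds) \<longrightarrow>
          f M = A_star Z ord (f [X M] - U_op X f M)))"
proof -
 interpret ordered_arc Z ord by unfold_locales (use assms in auto)
 obtain K Pr where "contraction Z ord K Pr" using contraction_exists by blast
 then interpret contraction Z ord K Pr .
 show ?thesis
 proof (rule exI [of _ Xh], rule exI [of _ fh], intro conjI)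
  show "ainf_structure (homology Z) Xh" by (rule ainf_structure_Xh)
  show "\<forall>x\<in>carrier (homology Z). Xh [x] = \<zero>\<^bsub>homology Z\<^esub>" using unary(1) by blast
  show "\<forall>x\<in>carrier (homology Z). \<forall>y\<in>carrier (homology Z). Xh [x, y] = x \<otimes>\<^bsub>homology Z\<^esub> y" using binary by blast
  show "ainf_morphism Z Xh fh" by (rule ainf_morphism_fh)
  show "cycle_selection Z ord (\<lambda>x. fh [x])" by (rule selection)
  show "\<forall>xs. 2 \<le> length xs \<and> set xs \<subseteq> carrier (homology Z) --> U_op Xh fh xs \<in> cycles Z \<and> Xh xs = cls Z (U_op Xh fh xs)"
   using higher by blast
 qed (intro allI impI, elim conjE, rule tensor_summary)
qed

end
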